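(* Let $\nu\in\mathbb{R}$, let $a=-\sigma$ with $0<\sigma<1$, and put $$\kappa=1-\sigma,\quad h=\sigma^\sigma,\quad \vartheta=-\nu-\tfrac32,\quad A_0=\sqrt{2\pi}\,(\kappa/\sigma)^{\nu+1},\quad x=\tfrac14z^2,\quad X=\kappa(hx)^{1/\kappa},\quad k_s=\tfrac1\sigma(k-\nu-\tfrac12).$$ Let $\mathbf{L}_\nu(z;-\sigma)$ be the generalised Struve function defined in the context, and define the formal expansions $$\hat H_{2,1}(x)=\frac1\pi\sum_{k=0}^\infty\frac{(-x)^{-k-1}\,\Gamma(k+\frac12)}{\Gamma(\nu+\frac32+\sigma(k+1))}+\frac1\sigma\sum_{k=0}^\infty\frac{x^{-k_s}}{k!\,\Gamma(\frac32-k_s)},$$ $$\hat E_{2,1}(x)=\frac{A_0}{\pi}X^{\vartheta}e^{X\cos(\pi\sigma/\kappa)}\sum_{j=0}^\infty(-1)^{j-1}c_jX^{-j}\sin\Bigl[X\sin\frac{\pi\sigma}{\kappa}+\frac{\pi}{\kappa}(\vartheta-j)\Bigr],$$ with coefficients $c_j=c_j(-\sigma,\nu)$ as defined in the context. Then, as $z\to+\infty$, $$(\tfrac12z)^{-\nu-1}\,\mathbf{L}_\nu(z;-\sigma)\sim\begin{cases}\hat E_{2,1}(x)+\hat H_{2,1}(x) & (0<\sigma<\tfrac12),\\[1mm] \hat H_{2,1}(x) & (\tfrac12<\sigma<1).\end{cases}$$ The first few coefficients are $c_0=1$ and the values at $a=-\sigma$ of $$c_1(a,\nu)=-\frac{1}{24a}\{11+24\nu+12\nu^2-a(25+24\nu)+11a^2\},$$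 $$c_2(a,\nu)=\frac{1}{1152a^2}\{265+1056\nu+1416\nu^2+768\nu^3+144\nu^4-2a(791+2040\nu+1596\nu^2+384\nu^3)+3a^2(905+1360\nu+472\nu^2)-2a^3(791+528\nu)+265a^4\},$$ $$\begin{aligned}c_3(a,\nu)=-\frac{1}{414720a^3}\{&48703+286200\nu+617940\nu^2+636480\nu^3+334800\nu^4+86400\nu^5+8640\nu^6\\&-3a(189797+791400\nu+1179240\nu^2+797760\nu^3+248400\nu^4+28800\nu^5)\\&+6a^2(355459+1019700\nu+996570\nu^2+398880\nu^3+55800\nu^4)\\&-a^3(3254507+6118200\nu+3537720\nu^2+636480\nu^3)\\&+6a^4(355459+395700\nu+102990\nu^2)-3a^5(189797+95400\nu)+48703a^6\}.\end{aligned}$$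
   Context: **Generalised Struve function.** For real $\nu$ and real $a>-1$, $$\mathbf{L}_\nu(z;a)=(\tfrac12 z)^{\nu+1}\sum_{n=0}^\infty\frac{(\frac12 z)^{2n}}{\Gamma(n+\frac32)\,\Gamma(an+\nu+\frac32)},$$ with $1/\Gamma$ equal to $0$ at the poles of $\Gamma$ (the same convention applies to reciprocal gamma functions in the expansions). **Coefficients.** With $\vartheta'=1-\vartheta=\nu+\frac52$ and $\kappa,h,A_0$ as in the claim, the coefficients $c_j=c_j(-\sigma,\nu)$, with $c_0=1$, do not depend on $s$ and are determined by the inverse factorial expansion: for each positive integer $M$, $$\frac{\Gamma(\sigma s-\nu-\frac12)}{\Gamma(s+\frac32)}=\kappa A_0(h\kappa^\kappa)^s\Bigl\{\sum_{j=0}^{M-1}\frac{c_j}{\Gamma(\kappa s+\vartheta'+j)}+\frac{\rho_M(s)}{\Gamma(\kappa s+\vartheta'+M)}\Bigr\},$$ with $\rho_M(s)=O(1)$ as $|s|\to\infty$ in $|\arg s|<\pi$ (uniformly in closed subsectors). **Meaning of $\sim$.** The relation is a compound asymptotic expansion in the Poincaré sense: for all positive integers $M,K,K'$, if the exponential series (when present) is truncated to $j<M$ and the two algebraic series of $\hat H_{2,1}$ to $k<K$ and $k<K'$ respectively, then the difference of the two sides is, as $z\to+\infty$, bounded by a constant times the sum of $X^{\vartheta-M}e^{X\cos(\pi\sigma/\kappa)}$ (only when $\hat E_{2,1}$ is present), $x^{-K-1}$, and $x^{-(K'-\nu-\frac12)/\sigma}$. *)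

theory Defs
  imports "HOL-Analysis.Analysis"
begin

text \<open>
  Throughout, \<open>rGamma\<close> is the reciprocal gamma function, which is entire and vanishes at the
  poles of \<open>Gamma\<close>.
\<close>

definition gen_struve :: "real \<Rightarrow> real \<Rightarrow> real \<Rightarrow> real" where
  "gen_struve \<nu> a z = (z / 2) powr (\<nu> + 1) *
     (\<Sum>n. (z / 2) ^ (2 * n) * rGamma (real n + 3 / 2) * rGamma (a * real n + \<nu> + 3 / 2))"

definition struve_kappa :: "real \<Rightarrow> real" where
  "struve_kappa \<sigma> = 1 - \<sigma>"

definition struve_h :: "real \<Rightarrow> real" where
  "struve_h \<sigma> = \<sigma> powr \<sigma>"

definition struve_theta :: "real \<Rightarrow> real" where
  "struve_theta \<nu> = - \<nu> - 3 / 2"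

definition struve_A0 :: "real \<Rightarrow> real \<Rightarrow> real" where
  "struve_A0 \<sigma> \<nu> = sqrt (2 * pi) * (struve_kappa \<sigma> / \<sigma>) powr (\<nu> + 1)"

definition struve_X :: "real \<Rightarrow> real \<Rightarrow> real" where
  "struve_X \<sigma> x = struve_kappa \<sigma> * (struve_h \<sigma> * x) powr (1 / struve_kappa \<sigma>)"

definition struve_k :: "real \<Rightarrow> real \<Rightarrow> nat \<Rightarrow> real" where
  "struve_k \<sigma> \<nu> k = (real k - \<nu> - 1 / 2) / \<sigma>"


text \<open>
  \<open>sector_at_infinity \<delta>\<close> describes \<open>|s| \<rightarrow> \<infinity>\<close> within the closed subsector
  \<open>|arg s| \<le> \<pi> - \<delta>\<close> of \<open>|arg s| < \<pi>\<close>.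
\<close>

definition sector_at_infinity :: "real \<Rightarrow> complex filter" where
  "sector_at_infinity \<delta> = inf at_infinity (principal {s. \<bar>Arg s\<bar> \<le> pi - \<delta>})"

text \<open>
  The defining property of the coefficients. The expansion is an identity of meromorphic functions
  that determines the remainder \<open>\<rho>\<close> away from poles and zeros of the gamma factors; in every
  closed subsector these are avoided once \<open>|s|\<close> is large, which is where the identity is demanded.
\<close>

definition inverse_factorial_coeffs :: "real \<Rightarrow> real \<Rightarrow> (nat \<Rightarrow> real) \<Rightarrow> bool" where
  "inverse_factorial_coeffs \<sigma> \<nu> c \<longleftrightarrow>
     c 0 = 1 \<and>
     (\<forall>M\<ge>1. \<exists>\<rho> :: complex \<Rightarrow> complex. \<forall>\<delta>>0.
        (\<forall>\<^sub>F s in sector_at_infinity \<delta>.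
           Gamma (of_real \<sigma> * s - of_real \<nu> - 1 / 2) * rGamma (s + 3 / 2) =
           of_real (struve_kappa \<sigma> * struve_A0 \<sigma> \<nu>) *
           of_real (struve_h \<sigma> * struve_kappa \<sigma> powr struve_kappa \<sigma>) powr s *
           ((\<Sum>j<M. of_real (c j) *
                rGamma (of_real (struve_kappa \<sigma>) * s + of_real (1 - struve_theta \<nu>) + of_nat j))
            + \<rho> s *
                rGamma (of_real (struve_kappa \<sigma>) * s + of_real (1 - struve_theta \<nu>) + of_nat M)))
        \<and> \<rho> \<in> O[sector_at_infinity \<delta>](\<lambda>_. 1))"

definition struve_coeff :: "real \<Rightarrow> real \<Rightarrow> nat \<Rightarrow> real" where
  "struve_coeff \<sigma> \<nu> = (THE c. inverse_factorial_coeffs \<sigma> \<nu> c)"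


text \<open>The formal expansions are given by their truncations.\<close>

definition struve_H_trunc :: "real \<Rightarrow> real \<Rightarrow> nat \<Rightarrow> nat \<Rightarrow> real \<Rightarrow> real" where
  "struve_H_trunc \<sigma> \<nu> K K' x =
     1 / pi * (\<Sum>k<K. (- x) powi (- int k - 1) * Gamma (real k + 1 / 2) *
                       rGamma (\<nu> + 3 / 2 + \<sigma> * (real k + 1)))
     + 1 / \<sigma> * (\<Sum>k<K'. x powr (- struve_k \<sigma> \<nu> k) / fact k * rGamma (3 / 2 - struve_k \<sigma> \<nu> k))"

text \<open>The sign \<open>(-1)^(j-1)\<close> is an integer power: it equals \<open>-1\<close> for \<open>j = 0\<close>.\<close>

definition struve_E_trunc :: "real \<Rightarrow> real \<Rightarrow> nat \<Rightarrow> real \<Rightarrow> real" where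
  "struve_E_trunc \<sigma> \<nu> M x =
     (let X = struve_X \<sigma> x; \<kappa> = struve_kappa \<sigma>; \<theta> = struve_theta \<nu> in
      struve_A0 \<sigma> \<nu> / pi * X powr \<theta> * exp (X * cos (pi * \<sigma> / \<kappa>)) *
      (\<Sum>j<M. (- 1) powi (int j - 1) * struve_coeff \<sigma> \<nu> j * X powi (- int j) *
               sin (X * sin (pi * \<sigma> / \<kappa>) + pi / \<kappa> * (\<theta> - real j))))"


definition struve_c1 :: "real \<Rightarrow> real \<Rightarrow> real" where
  "struve_c1 a \<nu> = - 1 / (24 * a) *
     (11 + 24 * \<nu> + 12 * \<nu>^2 - a * (25 + 24 * \<nu>) + 11 * a^2)"

definition struve_c2 :: "real \<Rightarrow> real \<Rightarrow> real" where
  "struve_c2 a \<nu> = 1 / (1152 * a^2) *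
     (265 + 1056 * \<nu> + 1416 * \<nu>^2 + 768 * \<nu>^3 + 144 * \<nu>^4
      - 2 * a * (791 + 2040 * \<nu> + 1596 * \<nu>^2 + 384 * \<nu>^3)
      + 3 * a^2 * (905 + 1360 * \<nu> + 472 * \<nu>^2)
      - 2 * a^3 * (791 + 528 * \<nu>)
      + 265 * a^4)"

definition struve_c3 :: "real \<Rightarrow> real \<Rightarrow> real" where
  "struve_c3 a \<nu> = - 1 / (414720 * a^3) *
     (48703 + 286200 * \<nu> + 617940 * \<nu>^2 + 636480 * \<nu>^3 + 334800 * \<nu>^4 + 86400 * \<nu>^5 + 8640 * \<nu>^6
      - 3 * a * (189797 + 791400 * \<nu> + 1179240 * \<nu>^2 + 797760 * \<nu>^3 + 248400 * \<nu>^4 + 28800 * \<nu>^5)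
      + 6 * a^2 * (355459 + 1019700 * \<nu> + 996570 * \<nu>^2 + 398880 * \<nu>^3 + 55800 * \<nu>^4)
      - a^3 * (3254507 + 6118200 * \<nu> + 3537720 * \<nu>^2 + 636480 * \<nu>^3)
      + 6 * a^4 * (355459 + 395700 * \<nu> + 102990 * \<nu>^2)
      - 3 * a^5 * (189797 + 95400 * \<nu>)
      + 48703 * a^6)"

end

theory Submission
  imports Defs "HOL-Complex_Analysis.Complex_Analysis" "HOL-Real_Asymp.Real_Asymp"
begin

text \<open>
  Put \<open>\<phi>(s) = \<pi>(\<sigma>s - \<nu> - 1/2)\<close>. By reflection the \<open>n\<close>-th term of the series is
  \<open>sin \<phi>(n)/\<pi> \<cdot> x\<^sup>n \<Gamma>(\<sigma>n - \<nu> - 1/2)/\<Gamma>(n + 3/2)\<close>, and Stirling's formula expands the quotient of Gamma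
  functions in inverse factorials \<open>c\<^sub>j/\<Gamma>(\<kappa>s + \<vartheta>' + j)\<close>. The sum over \<open>n\<close> of the \<open>j\<close>-th term of this
  expansion is a Mittag-Leffler series in \<open>u = X e\<^bsup>i\<pi>\<sigma>/\<kappa>\<^esup>\<close>, and its growth \<open>u\<^bsup>\<vartheta>-j\<^esup> e\<^sup>u\<close> yields the exponential expansion.

  For \<open>\<sigma> < 1/3\<close> the remainder is summed by the Abel--Plana formula and the resulting integral is turned onto
  the ray through the saddle point \<open>u\<close>, where it has the size \<open>X\<^bsup>\<vartheta>-M\<^esup> e\<^bsup>X cos(\<pi>\<sigma>/\<kappa>)\<^esup>\<close> of the error; this beats every
  power of \<open>x\<close>, so the algebraic expansion is negligible. For \<open>\<sigma> \<ge> 1/3\<close> the remainder \<open>R\<close> times \<open>e\<^bsup>-\<pi>\<sigma>|Im s|\<^esup>\<close> is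
  integrable along vertical lines. The function \<open>x\<^sup>s R(s) (sin \<phi>(s) cot \<pi>s - cos \<phi>(s))\<close> is then integrated around a half
  plane \<open>Re s > a\<close> with \<open>a\<close> far to the left: the integers contribute the series together with the terms \<open>n < 0\<close>,
  which form the first algebraic series, and the poles \<open>-k\<^sub>s\<close> of \<open>R\<close> contribute the second one. For \<open>\<sigma> > 1/3\<close> no
  term has to be split off to form \<open>R\<close>, so no exponential expansion arises; for \<open>\<sigma> < 1/2\<close> it is exponentially small.
\<close>

section \<open>Stirling's formula in sectors\<close>

text \<open>The threshold 1/3 is the value of \<sigma> at which \<psi> = \<pi>\<sigma>/\<kappa>
  equals \<pi>/2. Three things change there at once: the saddle point u leaves the right half plane,
  the growth exp(\<pi>\<kappa>|Im s|/2) of 1/\<Gamma>(\<kappa>s) becomes weaker than the decay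
  exp(-\<pi>\<sigma>|Im s|) of the kernel, and the exponential expansion passes from dominant to
  recessive. At \<sigma> = 1/3 itself the two rates agree, so only a power of |Im s| can give
  integrability; it is bought by splitting off enough terms of the inverse factorial expansion,
  which are then summed as Mittag-Leffler series. All error bounds are uniform in x: they have the
  form K exp(a ln x), with a the abscissa of a vertical line, and moving a to the left gives the
  algebraic expansion to any order. The lines run half way between integers, where cot(\<pi>s) is
  bounded down to the real axis. \<open>struve_coeff\<close> is a definite description, so existence
  and uniqueness of the inverse factorial expansion have to be settled before anything can be said
  of the coefficients; uniqueness is read off along the positive integers.\<close>

lemma norm_Ln_minus_Taylor_le:
  fixes z :: complex
  assumes "norm z \<le> 1 / 2"
  shows "norm (Ln (1 + z) - (\<Sum>n\<le>N. - ((-z) ^ n) / of_nat n)) \<le> 2 * norm z ^ Suc N"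
proof -
  \<comment> \<open>For n = 0 the term is a division by zero, hence 0, in agreement with the missing
    constant term of the logarithm.\<close>
  let ?f = "\<lambda>n. - ((-z) ^ n) / of_nat n"
  have s: "?f sums Ln (1 + z)"
    using assms by (intro Ln_series') auto
  have "Ln (1 + z) - (\<Sum>n<Suc N. ?f n) = (\<Sum>n. ?f (n + Suc N))"
    using s suminf_split_initial_segment[of ?f "Suc N"] sums_unique[OF s]
    by (simp add: sums_iff algebra_simps)
  moreover have "norm (\<Sum>n. ?f (n + Suc N)) \<le> (\<Sum>n. norm z ^ Suc N * norm z ^ n)"
  proof (rule norm_suminf_le)
    show "norm (?f (n + Suc N)) \<le> norm z ^ Suc N * norm z ^ n" for n
    proof -
      have "norm (?f (n + Suc N)) = norm z ^ (n + Suc N) / real (n + Suc N)"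
        by (simp only: norm_divide norm_minus_cancel norm_power norm_of_nat)
      also have "\<dots> \<le> norm z ^ (n + Suc N) / 1"
        by (intro divide_left_mono) auto
      finally show ?thesis by (simp add: power_add mult_ac)
    qed
    show "summable (\<lambda>n. norm z ^ Suc N * norm z ^ n)"
      using assms by (intro summable_mult summable_geometric) auto
  qed
  moreover have "(\<Sum>n. norm z ^ Suc N * norm z ^ n) = norm z ^ Suc N * (1 / (1 - norm z))"
    using assms suminf_geometric[of "norm z"] suminf_mult[OF summable_geometric[of "norm z"], of "norm z ^ Suc N"]
    by simp
  moreover have "norm z ^ Suc N * (1 / (1 - norm z)) \<le> norm z ^ Suc N * 2"
    using assms by (intro mult_left_mono) (auto simp: field_simps)
  ultimately show ?thesis
    unfolding lessThan_Suc_atMost by (simp add: mult.commute)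
qed

text \<open>Divide by w and induct on k: an analytic D that is O(w^(k + 1)) vanishes at 0,
  \<open>pole_lemma\<close> makes D(w)/w analytic, and the bound loses one power. For k = 0 the
  coefficient is D(0), since the difference quotient converges.\<close>

lemma bigo_leading_coeff:
  fixes D :: "complex \<Rightarrow> complex"
  assumes "D analytic_on {0}" "D \<in> O[at 0](\<lambda>w. w ^ k)"
  shows "\<exists>d. (\<lambda>w. D w - d * w ^ k) \<in> O[at 0](\<lambda>w. w ^ Suc k)"
  using assms
proof (induction k arbitrary: D)
  case (0 D)
  have "D field_differentiable at 0"
    using 0 by (simp add: analytic_on_imp_differentiable_at)
  then obtain d where "(D has_field_derivative d) (at 0)"
    by (auto simp: field_differentiable_def)
  hence "((\<lambda>w. (D w - D 0) / w) \<longlongrightarrow> d) (at 0)"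
    by (simp add: has_field_derivative_iff)
  hence "(\<lambda>w. (D w - D 0) / w) \<in> O[at 0](\<lambda>_. 1)"
    by (intro bigoI_tendsto[where c = d]) (auto simp: )
  hence "(\<lambda>w. (D w - D 0) / w * w) \<in> O[at 0](\<lambda>w. 1 * w)"
    by (intro landau_o.big.mult) auto
  moreover have "eventually (\<lambda>w. (D w - D 0) / w * w = D w - D 0) (at 0)"
    by (auto simp: eventually_at_filter)
  ultimately have "(\<lambda>w. D w - D 0) \<in> O[at 0](\<lambda>w. w)"
    by (simp add: landau_o.big.in_cong)
  thus ?case by (intro exI[of _ "D 0"]) auto
next
  case (Suc k D)
  obtain r where r: "r > 0" "D holomorphic_on ball 0 r"
    using Suc.prems(1) by (auto simp: analytic_on_def)
  define g where "g = (\<lambda>z. if z = 0 then deriv D 0 else (D z - D 0) / (z - 0))"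
  have hg: "g holomorphic_on ball 0 r"
    unfolding g_def by (intro pole_lemma r) (use r in auto)
  hence ag: "g analytic_on {0}"
    using r(1) analytic_on_def by (auto simp: intro!: exI[of _ r])
  have "isCont D 0"
    using Suc.prems(1) analytic_at_imp_isCont by blast
  hence l: "(D \<longlongrightarrow> D 0) (at 0)" by (simp add: isCont_def)
  have "((\<lambda>w::complex. w ^ Suc k) \<longlongrightarrow> 0) (at 0)"
    by (auto intro!: tendsto_eq_intros)
  hence "(D \<longlongrightarrow> 0) (at 0)"
  proof -
    from Suc.prems(2) obtain c where "eventually (\<lambda>w. norm (D w) \<le> c * norm (w ^ Suc k)) (at 0)"
      by (elim landau_o.bigE)
    hence "eventually (\<lambda>w. norm (D w) \<le> norm (w ^ Suc k) * c) (at 0)"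
      by (simp add: mult.commute)
    with \<open>((\<lambda>w::complex. w ^ Suc k) \<longlongrightarrow> 0) (at 0)\<close> show ?thesis by (rule tendsto_0_le)
  qed
  hence D0: "D 0 = 0" using l tendsto_unique trivial_limit_at by blast
  have ev: "eventually (\<lambda>w. D w = w * g w) (at 0)"
    by (auto simp: eventually_at_filter g_def D0)
  have "(\<lambda>w. w * g w) \<in> O[at 0](\<lambda>w. w * w ^ k)"
    using Suc.prems(2) landau_o.big.in_cong[OF ev] by simp
  hence "g \<in> O[at 0](\<lambda>w. w ^ k)"
    by (subst (asm) landau_o.big.mult_cancel_left) (auto simp: eventually_at_filter)
  from Suc.IH[OF ag this] obtain d where "(\<lambda>w. g w - d * w ^ k) \<in> O[at 0](\<lambda>w. w ^ Suc k)" ..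
  hence "(\<lambda>w. w * (g w - d * w ^ k)) \<in> O[at 0](\<lambda>w. w * w ^ Suc k)"
    by (intro landau_o.big.mult) auto
  moreover have "eventually (\<lambda>w. w * (g w - d * w ^ k) = D w - d * w ^ Suc k) (at 0)"
    using ev by eventually_elim (simp add: algebra_simps)
  ultimately have "(\<lambda>w. D w - d * w ^ Suc k) \<in> O[at 0](\<lambda>w. w ^ Suc (Suc k))"
    by (simp add: landau_o.big.in_cong)
  thus ?case ..
qed

text \<open>Law of cosines: after inserting cos(Arg s) \<ge> -cos \<delta>, the square |s + k|^2
  splits into (1 - cos \<delta>)/2 times (|s| + k)^2 and a nonnegative multiple of (|s| - k)^2, and
  the first factor is sin^2(\<delta>/2). Keeping all points s + k away from 0 in this way makes the
  sum of the defects uniform in the sector.\<close>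

lemma norm_add_of_nat_ge:
  fixes s :: complex
  assumes "\<bar>Arg s\<bar> \<le> pi - \<delta>" "\<delta> > 0"
  shows "norm (s + of_nat k) \<ge> sin (\<delta> / 2) * (norm s + real k)"
proof -
  have d: "\<delta> \<le> pi" using assms by linarith
  have "cos \<bar>Arg s\<bar> \<ge> cos (pi - \<delta>)"
    using assms d by (intro cos_monotone_0_pi_le) auto
  hence c: "cos (Arg s) \<ge> - cos \<delta>" by simp
  have s: "Re s = norm s * cos (Arg s)"
    by (metis Re_rcis rcis_cmod_Arg)
  have "(norm (s + of_nat k))\<^sup>2 = (norm s)\<^sup>2 + 2 * real k * Re s + (real k)\<^sup>2"
    unfolding cmod_power2 by (simp add: power2_eq_square algebra_simps)
  also have "\<dots> \<ge> (norm s)\<^sup>2 + 2 * real k * (norm s * (- cos \<delta>)) + (real k)\<^sup>2"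
    unfolding s using c by (intro add_mono mult_left_mono) auto
  also have "(norm s)\<^sup>2 + 2 * real k * (norm s * (- cos \<delta>)) + (real k)\<^sup>2 =
     (1 - cos \<delta>) / 2 * (norm s + real k)\<^sup>2 + (1 + cos \<delta>) / 2 * (norm s - real k)\<^sup>2"
    by (simp add: power2_eq_square field_simps)
  also have "\<dots> \<ge> (1 - cos \<delta>) / 2 * (norm s + real k)\<^sup>2"
  proof -
    have "0 \<le> (1 + cos \<delta>) / 2 * (norm s - real k)\<^sup>2"
    proof (intro mult_nonneg_nonneg zero_le_power2 divide_nonneg_pos)
      show "0 \<le> 1 + cos \<delta>" using cos_ge_minus_one[of \<delta>] by linarith
    qed simp
    thus ?thesis by linarith
  qed
  also have "(1 - cos \<delta>) / 2 = (sin (\<delta> / 2))\<^sup>2"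
    using cos_double_sin[of "\<delta>/2"] by simp
  finally have "(sin (\<delta> / 2) * (norm s + real k))\<^sup>2 \<le> (norm (s + of_nat k))\<^sup>2"
    by (simp add: power_mult_distrib)
  thus ?thesis by (rule power2_le_imp_le) simp
qed

text \<open>Im s and Im(1 + 1/s) have opposite signs, so the two arguments have opposite signs as
  well and their sum stays in (-\<pi>, \<pi>]; no multiple of 2\<pi>i appears in the product rule
  for \<open>Ln\<close>.\<close>

lemma Ln_add_1:
  fixes s :: complex
  assumes "s \<notin> \<real>\<^sub>\<le>\<^sub>0"
  shows "Ln (s + 1) = Ln s + Ln (1 + 1 / s)"
proof -
  have s0: "s \<noteq> 0" using assms by auto
  have ne: "1 + 1 / s \<noteq> 0"
  proof
    assume "1 + 1 / s = 0"
    hence "s = -1" using s0 by (simp add: field_simps add_eq_0_iff)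
    thus False using assms by simp
  qed
  have im: "Im (1 + 1 / s) = - Im s / (norm s)\<^sup>2"
    by (simp add: Im_divide cmod_power2)
  have "- pi < Im (Ln s) + Im (Ln (1 + 1 / s)) \<and> Im (Ln s) + Im (Ln (1 + 1 / s)) \<le> pi"
  proof (cases "Im s = 0")
    case True
    hence "Re s > 0" using assms by (auto simp: complex_nonpos_Reals_iff)
    then have "s = of_real (Re s)" "1 + 1 / s = of_real (1 + 1 / Re s)" "1 + 1 / Re s > 0"
      using True by (auto simp: complex_eq_iff Re_divide Im_divide power2_eq_square add_pos_pos)
    hence "Im (Ln s) = 0" "Im (Ln (1 + 1 / s)) = 0"
      using \<open>Re s > 0\<close> by (metis Ln_of_real Im_complex_of_real)+
    thus ?thesis by simp
  next
    case False
    show ?thesis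
    proof (cases "Im s > 0")
      case True
      have "Im (1 + 1 / s) < 0" unfolding im using True s0 by simp
      hence "Im (Ln (1 + 1 / s)) < 0" "-pi < Im (Ln (1 + 1 / s))"
        using ne Im_Ln_pos_le[OF ne] mpi_less_Im_Ln[OF ne] Im_Ln_le_pi[OF ne] by linarith+
      moreover have "0 < Im (Ln s)" "Im (Ln s) < pi"
        using True s0 Im_Ln_pos_lt by auto
      ultimately show ?thesis by linarith
    next
      case 2: False
      hence neg: "Im s < 0" using False by simp
      have "Im (1 + 1 / s) > 0" unfolding im using neg s0 by (auto intro!: divide_neg_pos)
      hence "0 < Im (Ln (1 + 1 / s))" "Im (Ln (1 + 1 / s)) < pi"
        using Im_Ln_pos_lt[OF ne] by blast+
      moreover have "Im (Ln s) < 0" "-pi < Im (Ln s)"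
        using neg Im_Ln_pos_le[OF s0] mpi_less_Im_Ln[OF s0] Im_Ln_le_pi[OF s0] by linarith+
      ultimately show ?thesis by linarith
    qed
  qed
  hence "Ln (s * (1 + 1 / s)) = Ln s + Ln (1 + 1 / s)"
    using s0 ne by (intro Ln_times_simple) auto
  moreover have "s * (1 + 1 / s) = s + 1" using s0 by (simp add: field_simps)
  ultimately show ?thesis by simp
qed

text \<open>The doubling trick behind Wallis' product: for the sequence u of the hypothesis,
  u(n)^2/u(2n) tends to C, but it is also \<open>Gamma_series (1/2) n\<close> times a factor tending
  to sqrt 2, and that Gauss product tends to \<Gamma>(1/2) = sqrt \<pi>. Convergence itself is
  supplied in \<open>stirling_constant\<close>.\<close>

lemma fact_over_n_power_limit:
  assumes "(\<lambda>n. fact n * exp (real n - (real n + 1 / 2) * ln (real n))) \<longlonglongrightarrow> C" "C \<noteq> 0"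
  shows "C = sqrt (2 * pi)"
proof -
  define u where "u = (\<lambda>n. fact n * exp (real n - (real n + 1 / 2) * ln (real n)))"
  have u: "u \<longlonglongrightarrow> C" using assms by (simp add: u_def)
  have u2: "(\<lambda>n. u (2 * n)) \<longlonglongrightarrow> C"
    using LIMSEQ_subseq_LIMSEQ[OF u, of "\<lambda>n. 2 * n"] by (simp add: o_def strict_mono_def)
  have lim1: "(\<lambda>n. u n ^ 2 / u (2 * n)) \<longlonglongrightarrow> C"
    using tendsto_divide[OF tendsto_power[OF u, of 2] u2 assms(2)] assms(2)
    by (simp add: power2_eq_square)
  have "(\<lambda>n. Gamma_series (1 / 2 :: real) n) \<longlonglongrightarrow> sqrt pi"
    using Gamma_series_LIMSEQ[of "1/2 :: real"] by (simp add: Gamma_one_half_real)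
  \<comment> \<open>The factor 1 + 1/(2n) adjusts \<open>pochhammer\<close> from n to the n + 1
    factors that \<open>Gamma_series\<close> contains.\<close>
  moreover have "(\<lambda>n. 1 + 1 / (2 * real n)) \<longlonglongrightarrow> 1"
    by real_asymp
  hence "(\<lambda>n. (1 + 1 / (2 * real n)) * sqrt 2) \<longlonglongrightarrow> 1 * sqrt 2"
    by (intro tendsto_mult tendsto_const)
  ultimately have lim2: "(\<lambda>n. Gamma_series (1 / 2 :: real) n * ((1 + 1 / (2 * real n)) * sqrt 2)) \<longlonglongrightarrow> sqrt pi * (1 * sqrt 2)"
    by (rule tendsto_mult)
  have "eventually (\<lambda>n. u n ^ 2 / u (2 * n) = Gamma_series (1 / 2 :: real) n * ((1 + 1 / (2 * real n)) * sqrt 2)) sequentially"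
    using eventually_gt_at_top[of 0]
  proof eventually_elim
    case (elim n)
    define l where "l = ln (real n)"
    have e1: "exp (l / 2) = sqrt (real n)"
      using elim unfolding l_def by (simp add: powr_half_sqrt[symmetric] powr_def)
    have l2: "ln (2 * real n) = ln 2 + l"
      using elim unfolding l_def by (intro ln_mult_pos) auto
    have "u n ^ 2 = (fact n)^2 * exp (2 * real n - (2 * real n + 1) * l)"
      by (simp add: u_def power_mult_distrib l_def[symmetric] exp_double[symmetric] algebra_simps)
    moreover have "u (2 * n) = fact (2 * n) * exp (2 * real n - (2 * real n + 1 / 2) * (ln 2 + l))"
      by (simp add: u_def l2)
    moreover have "exp (2 * real n - (2 * real n + 1) * l) / exp (2 * real n - (2 * real n + 1 / 2) * (ln 2 + l))
       = exp (2 * real n * ln 2) * exp (ln 2 / 2) / exp (l / 2)"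
      by (simp add: exp_diff[symmetric] exp_add[symmetric]) (simp add: algebra_simps)
    moreover have "exp (2 * real n * ln 2) = 2 ^ (2 * n)"
      by (simp add: exp_of_nat_mult[symmetric] flip: powr_realpow) (simp add: powr_def)
    moreover have "exp (ln 2 / 2) = sqrt (2::real)"
      by (simp add: powr_half_sqrt[symmetric] powr_def)
    ultimately have "u n ^ 2 / u (2 * n) = (fact n)^2 / fact (2 * n) * (2 ^ (2 * n) * sqrt 2 / sqrt n)"
      using e1 by (simp add: field_simps)
    also have "\<dots> = fact n / pochhammer (1/2) n * sqrt 2 / sqrt n"
      by (simp add: fact_double power2_eq_square)
    also have "\<dots> = Gamma_series (1 / 2 :: real) n * ((1 + 1 / (2 * real n)) * sqrt 2)"
    proof -
      have "pochhammer (1/2) (Suc n) = pochhammer (1/2::real) n * (1/2 + real n)"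
        by (simp add: pochhammer_rec')
      moreover have "exp (1/2 * ln (real n)) = sqrt n" using e1 by (simp add: l_def)
      ultimately have gs: "Gamma_series (1 / 2 :: real) n = fact n * sqrt n / (pochhammer (1/2) n * (1/2 + real n))"
        unfolding Gamma_series_def by simp
      define S P q where "S = sqrt (real n)" and "P = pochhammer (1/2::real) n" and "q = 1/2 + real n"
      have SS: "real n = S * S" by (simp add: S_def)
      have ne: "S \<noteq> 0" "P \<noteq> 0" "q \<noteq> 0"
        using elim pochhammer_pos[of "1/2::real" n] by (auto simp: S_def P_def q_def)
      have e: "1 + 1 / (2 * real n) = q / (S * S)"
        unfolding SS[symmetric] q_def using elim by (simp add: field_simps)
      show ?thesis unfolding gs e S_def[symmetric] P_def[symmetric] q_def[symmetric]
        using ne by (simp add: field_simps)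
    qed
    finally show ?case .
  qed
  from tendsto_cong[OF this] lim2 have "(\<lambda>n. u n ^ 2 / u (2 * n)) \<longlonglongrightarrow> sqrt pi * (1 * sqrt 2)"
    by simp
  from LIMSEQ_unique[OF lim1 this] show ?thesis by (simp add: real_sqrt_mult)
qed


section \<open>Telescoping the functional equation of \<Gamma>\<close>

definition stirling_exponent :: "real \<Rightarrow> complex \<Rightarrow> complex" where
  "stirling_exponent b s = (s + of_real b - 1 / 2) * Ln s - s"

text \<open>For \<open>G(s) = \<Gamma>(s + b) exp (- stirling_exponent b s - p(1/s))\<close> the functional equation of \<open>\<Gamma>\<close> becomes
  \<open>G(s) = G(s + 1) exp (stirling_defect b p (1/s))\<close>, so \<open>G\<close> is recovered from its limit at infinity by
  telescoping, and \<open>p\<close> is chosen to make the defect vanish to high order at \<open>0\<close>.\<close>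

definition stirling_defect :: "real \<Rightarrow> complex poly \<Rightarrow> complex \<Rightarrow> complex" where
  "stirling_defect b p w = (1 / w + of_real b + 1 / 2) * Ln (1 + w) - 1 - Ln (1 + of_real b * w)
     + poly p (w / (1 + w)) - poly p w"

lemma Gamma_stirling_step:
  fixes s :: complex
  assumes "s \<notin> \<real>\<^sub>\<le>\<^sub>0" "s + of_real b \<notin> \<int>\<^sub>\<le>\<^sub>0"
  shows "Gamma (s + of_real b) * exp (- stirling_exponent b s - poly p (1 / s)) =
         Gamma (s + 1 + of_real b) * exp (- stirling_exponent b (s + 1) - poly p (1 / (s + 1)))
           * exp (stirling_defect b p (1 / s))"
proof -
  have s0: "s \<noteq> 0" and s1: "s + 1 \<noteq> 0" and sb: "s + of_real b \<noteq> 0"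
    using assms by (auto simp: add_eq_0_iff2)
  have "1 / s / (1 + 1 / s) = 1 / (s + 1)"
    using s0 s1 by (simp add: field_simps)
  hence "stirling_defect b p (1 / s) = (s + of_real b + 1 / 2) * Ln (1 + 1 / s) - 1
      - Ln (1 + of_real b * (1 / s)) + poly p (1 / (s + 1)) - poly p (1 / s)"
    unfolding stirling_defect_def by simp
  also have "\<dots> = stirling_exponent b (s + 1) - stirling_exponent b s + poly p (1 / (s + 1)) - poly p (1 / s)
      - (Ln s + Ln (1 + of_real b * (1 / s)))"
    unfolding stirling_exponent_def Ln_add_1[OF assms(1)] by (simp add: algebra_simps)
  finally have "- stirling_exponent b (s + 1) - poly p (1 / (s + 1)) + stirling_defect b p (1 / s) =
      (- stirling_exponent b s - poly p (1 / s)) - (Ln s + Ln (1 + of_real b * (1 / s)))"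
    by simp
  hence "exp (- stirling_exponent b (s + 1) - poly p (1 / (s + 1))) * exp (stirling_defect b p (1 / s)) =
      exp (- stirling_exponent b s - poly p (1 / s)) / exp (Ln s + Ln (1 + of_real b * (1 / s)))"
    by (simp only: exp_add[symmetric] exp_diff[symmetric])
  also have "exp (Ln s + Ln (1 + of_real b * (1 / s))) = s + of_real b"
  proof -
    have eq: "s + of_real b = s * (1 + of_real b * (1 / s))" using s0 by (simp add: field_simps)
    hence "1 + of_real b * (1 / s) \<noteq> 0" using sb by auto
    thus ?thesis using s0 eq by (simp add: exp_add)
  qed
  finally have *: "exp (- stirling_exponent b (s + 1) - poly p (1 / (s + 1))) * exp (stirling_defect b p (1 / s)) =
      exp (- stirling_exponent b s - poly p (1 / s)) / (s + of_real b)" .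
  have "Gamma (s + 1 + of_real b) = (s + of_real b) * Gamma (s + of_real b)"
    using Gamma_plus1[OF assms(2)] by (simp add: add_ac)
  thus ?thesis unfolding mult.assoc * using sb by simp
qed

lemma Gamma_stirling_iterate:
  fixes s :: complex
  assumes s: "s \<notin> \<real>\<^sub>\<le>\<^sub>0" and sb: "\<And>k. s + of_nat k + of_real b \<notin> \<int>\<^sub>\<le>\<^sub>0"
  shows "Gamma (s + of_real b) * exp (- stirling_exponent b s - poly p (1 / s)) =
         Gamma (s + of_nat n + of_real b) * exp (- stirling_exponent b (s + of_nat n) - poly p (1 / (s + of_nat n)))
           * exp (\<Sum>k<n. stirling_defect b p (1 / (s + of_nat k)))"
proof (induction n)
  case 0 thus ?case by simp
next
  case (Suc n)
  have "s + of_nat n \<notin> \<real>\<^sub>\<le>\<^sub>0"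
    using s by (auto simp: complex_nonpos_Reals_iff)
  note st = Gamma_stirling_step[OF this sb, of p]
  show ?case unfolding Suc.IH st
    by (simp add: exp_add add_ac mult_ac)
qed

text \<open>\<open>Gamma_series\<close> at z = s + b - 1 contains
  \<open>pochhammer z (n + 1)\<close> = \<Gamma>(s + n + b)/\<Gamma>(z), so Gauss's limit already
  holds the wanted quotient. What is left over is exp(-v n), where v collects the difference between
  Ln(s + n) and ln n; it tends to 0 because n Ln(1 + s/n) tends to s.\<close>

lemma Gamma_div_fact_limit:
  fixes s :: complex
  assumes sb: "s + of_real b - 1 \<notin> \<int>\<^sub>\<le>\<^sub>0"
  shows "(\<lambda>n. Gamma (s + of_nat n + of_real b) * exp (- stirling_exponent b (s + of_nat n))
            / of_real (fact n * exp (real n - (real n + 1 / 2) * ln (real n)))) \<longlonglongrightarrow> 1"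
proof -
  define z where "z = s + of_real b - 1"
  have Gz: "Gamma z \<noteq> 0" using sb by (simp add: z_def Gamma_eq_zero_iff)
  have lim1: "(\<lambda>n. Gamma z / Gamma_series z n) \<longlonglongrightarrow> 1"
    using tendsto_divide[OF tendsto_const Gamma_series_LIMSEQ[of z] Gz, of "Gamma z"] Gz by simp
  define v where "v = (\<lambda>n::nat. (s + of_nat n + of_real b - 1 / 2) * Ln (1 + s / of_nat n) - s)"
  have lim2: "(\<lambda>n. s / of_nat n) \<longlonglongrightarrow> 0"
    by (rule lim_const_over_n)
  have lim3: "(\<lambda>n. Ln (1 + s / of_nat n)) \<longlonglongrightarrow> 0"
    using tendsto_Ln[OF tendsto_add[OF tendsto_const lim2, of 1]] by simp
  have lim4: "(\<lambda>n. of_nat n * Ln (1 + s / of_nat n) - s) \<longlonglongrightarrow> 0"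
  proof (rule Lim_null_comparison)
    have "(\<lambda>n. norm (s / of_nat n)) \<longlonglongrightarrow> 0" using lim2 by (rule tendsto_norm_zero)
    hence "eventually (\<lambda>n. norm (s / of_nat n) < 1 / 2) sequentially"
      by (rule order_tendstoD) simp
    thus "eventually (\<lambda>n. norm (of_nat n * Ln (1 + s / of_nat n) - s) \<le> 2 * norm s * norm (s / of_nat n)) sequentially"
      using eventually_gt_at_top[of 0]
    proof eventually_elim
      case (elim n)
      have "norm (Ln (1 + s / of_nat n) - s / of_nat n) \<le> 2 * norm (s / of_nat n) ^ 2"
        using norm_Ln_minus_Taylor_le[of "s / of_nat n" 1] elim by (simp add: power2_eq_square)
      hence "real n * norm (Ln (1 + s / of_nat n) - s / of_nat n) \<le> real n * (2 * norm (s / of_nat n) ^ 2)"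
        by (intro mult_left_mono) auto
      also have "real n * norm (Ln (1 + s / of_nat n) - s / of_nat n) = norm (of_nat n * (Ln (1 + s / of_nat n) - s / of_nat n))"
        by (simp add: norm_mult)
      also have "of_nat n * (Ln (1 + s / of_nat n) - s / of_nat n) = of_nat n * Ln (1 + s / of_nat n) - s"
        using elim by (simp add: algebra_simps)
      also have "real n * (2 * norm (s / of_nat n) ^ 2) = 2 * norm s * norm (s / of_nat n)"
        using elim by (simp add: norm_divide power2_eq_square)
      finally show ?case .
    qed
    show "(\<lambda>n. 2 * norm s * norm (s / of_nat n)) \<longlonglongrightarrow> 0"
      using tendsto_mult[OF tendsto_const tendsto_norm_zero[OF lim2], of "2 * norm s"] by simp
  qed
  have "v \<longlonglongrightarrow> 0 + (s + of_real b - 1 / 2) * 0"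
    unfolding v_def using tendsto_add[OF lim4 tendsto_mult[OF tendsto_const lim3, of "s + of_real b - 1 / 2"]]
    by (simp add: algebra_simps)
  hence "(\<lambda>n. exp (- v n)) \<longlonglongrightarrow> exp (- 0)"
    by (intro tendsto_intros) simp
  from tendsto_mult[OF lim1 this]
  have lim: "(\<lambda>n. Gamma z / Gamma_series z n * exp (- v n)) \<longlonglongrightarrow> 1" by simp
  have pole: "eventually (\<lambda>n. norm s < real n) sequentially"
    using filterlim_at_top_dense[THEN iffD1, OF filterlim_real_sequentially] by blast
  have "eventually (\<lambda>n. Gamma z / Gamma_series z n * exp (- v n) =
      Gamma (s + of_nat n + of_real b) * exp (- stirling_exponent b (s + of_nat n))
            / of_real (fact n * exp (real n - (real n + 1 / 2) * ln (real n)))) sequentially"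
    using eventually_gt_at_top[of 0] pole
  proof eventually_elim
    case (elim n)
    have ph: "pochhammer z (n + 1) = Gamma (s + of_nat n + of_real b) / Gamma z"
      using pochhammer_Gamma[of z "n + 1"] sb by (simp add: z_def algebra_simps)
    have "1 + s / of_nat n \<noteq> 0"
    proof
      assume "1 + s / of_nat n = 0"
      hence "s = - of_nat n" using elim by (simp add: field_simps add_eq_0_iff)
      thus False using elim by simp
    qed
    hence "Ln (of_real (real n) * (1 + s / of_nat n)) = ln (real n) + Ln (1 + s / of_nat n)"
      using elim Ln_times_of_real[of "real n" "1 + s / of_nat n"] by auto
    moreover have "of_real (real n) * (1 + s / of_nat n) = s + of_nat n"
      using elim by (simp add: field_simps)
    ultimately have Lnn: "Ln (s + of_nat n) = of_real (ln (real n)) + Ln (1 + s / of_nat n)" by simp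
    have ve: "v n = stirling_exponent b (s + of_nat n) - z * of_real (ln (real n))
            + of_real (real n - (real n + 1 / 2) * ln (real n))"
      unfolding v_def stirling_exponent_def Lnn z_def by (simp add: algebra_simps add_divide_distrib diff_divide_distrib)
    have "Gamma z / Gamma_series z n = Gamma (s + of_nat n + of_real b) / (fact n * exp (z * of_real (ln (real n))))"
      unfolding Gamma_series_def ph using Gz by simp
    moreover have "exp (- v n) = exp (- stirling_exponent b (s + of_nat n)) * exp (z * of_real (ln (real n)))
        / exp (of_real (real n - (real n + 1 / 2) * ln (real n)))"
      unfolding ve exp_diff[symmetric] exp_add[symmetric] by (rule arg_cong[where f = exp]) simp
    moreover have "complex_of_real (fact n * exp (real n - (real n + 1 / 2) * ln (real n))) =
        fact n * exp (of_real (real n - (real n + 1 / 2) * ln (real n)))"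
      by (simp only: of_real_mult of_real_fact exp_of_real)
    ultimately show ?case by (simp only:) simp
  qed
  from tendsto_cong[OF this] lim show ?thesis by simp
qed

lemma sums_inverse_squares_shift:
  fixes a :: real
  assumes "a \<ge> 2"
  shows "(\<lambda>k. 1 / ((a + real k - 1) * (a + real k))) sums (1 / (a - 1))"
proof -
  have "(\<lambda>k. 1 / (a + real k - 1)) \<longlonglongrightarrow> 0" by real_asymp
  from telescope_sums'[OF this]
  have "(\<lambda>k. 1 / (a + real k - 1) - 1 / (a + real (Suc k) - 1)) sums (1 / (a - 1))" by simp
  moreover have "1 / (a + real k - 1) - 1 / (a + real (Suc k) - 1) = 1 / ((a + real k - 1) * (a + real k))" for k
    using assms by (simp add: field_simps)
  ultimately show ?thesis by simp
qed

text \<open>In the sector |s + k| \<ge> t(|s| + k) with t = sin(\<delta>/2). Of the m + 2 powers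
  gained from the defect, m are weakened to |s|^m and the last two to (|s| + k - 1)(|s| + k), whose
  reciprocal telescopes in k.\<close>

lemma norm_stirling_defect_le:
  fixes s :: complex
  assumes bnd: "\<And>w. 0 < norm w \<Longrightarrow> norm w \<le> r \<Longrightarrow> norm (stirling_defect b p w) \<le> C * norm w ^ (m + 2)"
    and r: "r > 0" and s: "\<bar>Arg s\<bar> \<le> pi - \<delta>" "\<delta> > 0"
    and s2: "norm s \<ge> 2" "sin (\<delta> / 2) * norm s \<ge> 1 / r"
  shows "norm (stirling_defect b p (1 / (s + of_nat k)))
      \<le> C / sin (\<delta> / 2) ^ (m + 2) / norm s ^ m * (1 / ((norm s + real k - 1) * (norm s + real k)))"
proof -
  define t where "t = sin (\<delta> / 2)"
  have "\<delta> \<le> pi" using s by linarith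
  hence t0: "t > 0" unfolding t_def using s(2) by (intro sin_gt_zero) auto
  have C0: "C \<ge> 0"
  proof -
    have "norm (stirling_defect b p (of_real r)) \<le> C * norm (of_real r :: complex) ^ (m + 2)"
      by (intro bnd) (use r in auto)
    hence "0 \<le> C * norm (of_real r :: complex) ^ (m + 2)"
      using norm_ge_zero order.trans by blast
    moreover have "norm (of_real r :: complex) ^ (m + 2) > 0"
      using r by (intro zero_less_power) simp
    ultimately show ?thesis by (metis mult_neg_pos not_le)
  qed
  have n: "norm (s + of_nat k) \<ge> t * (norm s + real k)"
    unfolding t_def by (rule norm_add_of_nat_ge[OF s])
  have pos: "t * (norm s + real k) > 0" using t0 s2 by (intro mult_pos_pos) auto
  have "1 / r \<le> t * (norm s + real k)"
    using s2(2) t0 by (simp add: t_def[symmetric] distrib_left add_increasing2)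
  hence "norm (s + of_nat k) \<ge> 1 / r" using n by linarith
  hence "norm (1 / (s + of_nat k)) \<le> r"
  proof -
    have "norm (s + of_nat k) > 0" using pos n by linarith
    thus ?thesis using \<open>1 / r \<le> norm (s + of_nat k)\<close> r by (simp add: norm_divide field_simps)
  qed
  hence "norm (stirling_defect b p (1 / (s + of_nat k))) \<le> C * norm (1 / (s + of_nat k)) ^ (m + 2)"
    using pos n by (intro bnd) auto
  also have "\<dots> \<le> C * (1 / (t * (norm s + real k))) ^ (m + 2)"
    using n pos C0 by (intro mult_left_mono power_mono) (auto simp: norm_divide intro!: divide_left_mono mult_pos_pos)
  also have "\<dots> = C / t ^ (m + 2) * (1 / ((norm s + real k) ^ m * ((norm s + real k) * (norm s + real k))))"
    by (simp add: power_mult_distrib power_divide power_add power2_eq_square)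
  also have "\<dots> \<le> C / t ^ (m + 2) * (1 / (norm s ^ m * ((norm s + real k - 1) * (norm s + real k))))"
  proof -
    have "norm s > 0" using s2 by linarith
    thus ?thesis
      using s2 C0 t0 by (intro mult_left_mono divide_left_mono mult_mono power_mono mult_pos_pos zero_less_power)
        (auto intro!: mult_nonneg_nonneg)
  qed
  finally show ?thesis unfolding t_def by simp
qed

text \<open>Of the m + 1 powers of 1/|s|, m come from the single terms and one from the telescoped
  sum 1/(|s| - 1), which is at most 2/|s| for |s| \<ge> 2.\<close>

lemma suminf_stirling_defect_le:
  assumes bnd: "\<And>w. 0 < norm w \<Longrightarrow> norm w \<le> r \<Longrightarrow> norm (stirling_defect b p w) \<le> C * norm w ^ (m + 2)"
    and r: "r > 0" and \<delta>: "\<delta> > 0" "\<delta> \<le> pi"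
  obtains R B where "R > 0" "\<And>s. \<bar>Arg s\<bar> \<le> pi - \<delta> \<Longrightarrow> norm s \<ge> R \<Longrightarrow>
      summable (\<lambda>k. stirling_defect b p (1 / (s + of_nat k))) \<and>
      norm (\<Sum>k. stirling_defect b p (1 / (s + of_nat k))) \<le> B / norm s ^ (m + 1)"
proof -
  define t where "t = sin (\<delta> / 2)"
  have t0: "t > 0" unfolding t_def using \<delta> by (intro sin_gt_zero) auto
  define K where "K = C / t ^ (m + 2)"
  have *: "summable (\<lambda>k. stirling_defect b p (1 / (s + of_nat k))) \<and>
      norm (\<Sum>k. stirling_defect b p (1 / (s + of_nat k))) \<le> 2 * K / norm s ^ (m + 1)"
    if s: "\<bar>Arg s\<bar> \<le> pi - \<delta>" "norm s \<ge> max 2 (1 / (r * t))" for s :: complex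
  proof -
    have s2: "norm s \<ge> 2" and "norm s \<ge> 1 / (r * t)" using s by auto
    hence s3: "t * norm s \<ge> 1 / r" using t0 r by (simp add: field_simps)
    note le = norm_stirling_defect_le[OF bnd r s(1) \<delta>(1) s2 s3[unfolded t_def], folded t_def, folded K_def]
    have sums: "(\<lambda>k. K / norm s ^ m * (1 / ((norm s + real k - 1) * (norm s + real k)))) sums
            (K / norm s ^ m * (1 / (norm s - 1)))"
      by (intro sums_mult sums_inverse_squares_shift s2)
    have summ: "summable (\<lambda>k. stirling_defect b p (1 / (s + of_nat k)))"
      by (rule summable_comparison_test'[OF sums_summable[OF sums], of 0]) (rule le)
    have "norm (\<Sum>k. stirling_defect b p (1 / (s + of_nat k))) \<le> K / norm s ^ m * (1 / (norm s - 1))"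
      using norm_suminf_le[OF le sums_summable[OF sums]] sums_unique[OF sums] by simp
    also have "\<dots> \<le> K / norm s ^ m * (2 / norm s)"
    proof (intro mult_left_mono)
      have "0 \<le> K / norm s ^ m * (1 / ((norm s + real 0 - 1) * (norm s + real 0)))"
        using le[of 0] norm_ge_zero order.trans by blast
      moreover have "1 / ((norm s + real 0 - 1) * (norm s + real 0)) > 0"
        by (intro divide_pos_pos mult_pos_pos) (use s2 in auto)
      ultimately show "0 \<le> K / norm s ^ m" by (simp only: zero_le_mult_iff) linarith
      have "2 / (2 * norm s - 2) \<le> 2 / norm s"
        using s2 by (intro divide_left_mono mult_pos_pos) auto
      moreover have "1 / (norm s - 1) = 2 / (2 * norm s - 2)"
        using s2 by (simp add: field_simps)
      ultimately show "1 / (norm s - 1) \<le> 2 / norm s" by simp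
    qed
    finally show ?thesis using summ by (simp add: mult_ac)
  qed
  show ?thesis by (rule that[of "max 2 (1 / (r * t))" "2 * K"]) (use * in auto)
qed

section \<open>Choosing the correction polynomial p by expansion at w = 0\<close>

lemma isCont_bigo_1:
  fixes f :: "complex \<Rightarrow> complex"
  assumes "isCont f 0"
  shows "f \<in> O[at 0](\<lambda>_. 1)"
  using assms by (intro bigoI_tendsto[where c = "f 0"]) (auto simp: isCont_def)

lemma Ln_Taylor_bigo:
  fixes a :: complex
  shows "(\<lambda>w. Ln (1 + a * w) - (\<Sum>n\<le>N. - ((-(a * w)) ^ n) / of_nat n)) \<in> O[at 0](\<lambda>w. w ^ Suc N)"
proof (rule bigoI)
  have "((\<lambda>w. norm (a * w)) \<longlongrightarrow> 0) (at 0)"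
    by (auto intro!: tendsto_eq_intros)
  hence "eventually (\<lambda>w. norm (a * w) < 1 / 2) (at 0)"
    by (rule order_tendstoD) simp
  thus "eventually (\<lambda>w. norm (Ln (1 + a * w) - (\<Sum>n\<le>N. - ((-(a * w)) ^ n) / of_nat n)) \<le> (2 * norm a ^ Suc N) * norm (w ^ Suc N)) (at 0)"
  proof eventually_elim
    case (elim w)
    thus ?case using norm_Ln_minus_Taylor_le[of "a * w" N]
      by (simp add: norm_mult norm_power power_mult_distrib mult_ac)
  qed
qed

lemma defect_bound_of_bigo:
  assumes "(\<lambda>w. w * stirling_defect b p w) \<in> O[at 0](\<lambda>w. w ^ (m + 3))"
  obtains r C where "r > 0" "\<And>w. 0 < norm w \<Longrightarrow> norm w \<le> r \<Longrightarrow> norm (stirling_defect b p w) \<le> C * norm w ^ (m + 2)"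
proof -
  from assms obtain c where "eventually (\<lambda>w. norm (w * stirling_defect b p w) \<le> c * norm (w ^ (m + 3))) (at 0)"
    by (elim landau_o.bigE)
  then obtain d where d: "d > 0" "\<And>w. w \<noteq> 0 \<Longrightarrow> dist w 0 < d \<Longrightarrow> norm (w * stirling_defect b p w) \<le> c * norm (w ^ (m + 3))"
    unfolding eventually_at by blast
  show ?thesis
  proof (rule that[of "d / 2" c])
    fix w :: complex assume w: "0 < norm w" "norm w \<le> d / 2"
    hence "norm w * norm (stirling_defect b p w) \<le> norm w * (c * norm w ^ (m + 2))"
      using d(2)[of w] d(1) by (simp add: norm_mult norm_power mult_ac eval_nat_numeral)
    thus "norm (stirling_defect b p w) \<le> c * norm w ^ (m + 2)"
      using w(1) by (simp only: mult_le_cancel_left_pos)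
  qed (use d in auto)
qed

text \<open>Multiplying the defect by w removes the 1/w in front of Ln(1 + w); the result is
  analytic at 0, so Taylor arguments apply.\<close>

definition stirling_analytic :: "real \<Rightarrow> complex poly \<Rightarrow> complex \<Rightarrow> complex" where
  "stirling_analytic b p w = (1 + (of_real b + 1 / 2) * w) * Ln (1 + w) - w - w * Ln (1 + of_real b * w)
     + w * (poly p (w / (1 + w)) - poly p w)"

lemma stirling_analytic_eq:
  "w \<noteq> 0 \<Longrightarrow> w * stirling_defect b p w = stirling_analytic b p w"
  unfolding stirling_analytic_def stirling_defect_def by (simp add: algebra_simps)

lemma stirling_defect_bigo_iff:
  "(\<lambda>w. w * stirling_defect b p w) \<in> O[at 0](g) \<longleftrightarrow> stirling_analytic b p \<in> O[at 0](g)"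
proof -
  have "eventually (\<lambda>w. w * stirling_defect b p w = stirling_analytic b p w) (at 0)"
    by (auto simp: eventually_at_filter stirling_analytic_eq)
  thus ?thesis by (rule landau_o.big.in_cong)
qed

lemma analytic_on_poly_comp:
  fixes p :: "complex poly"
  assumes "f analytic_on A"
  shows "(\<lambda>w. poly p (f w)) analytic_on A"
  by (induction p rule: pCons_induct) (auto intro!: analytic_intros assms)

lemma analytic_stirling_analytic: "stirling_analytic b p analytic_on {0}"
  unfolding stirling_analytic_def
  by (intro analytic_intros analytic_on_poly_comp) auto

text \<open>The starting point without correction: the linear and quadratic terms of (1 + (b +
  1/2)w) Ln(1 + w) - w - w Ln(1 + b w) cancel, which is the purpose of the 1/2 in
  \<open>stirling_exponent\<close>.\<close>

lemma stirling_analytic_0: "stirling_analytic b 0 \<in> O[at 0](\<lambda>w. w ^ 3)"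
proof -
  define E1 where "E1 = (\<lambda>w::complex. Ln (1 + 1 * w) - (\<Sum>n\<le>2. - ((-(1 * w)) ^ n) / of_nat n))"
  define E2 where "E2 = (\<lambda>w::complex. Ln (1 + of_real b * w) - (\<Sum>n\<le>1. - ((-(of_real b * w)) ^ n) / of_nat n))"
  have E1: "E1 \<in> O[at 0](\<lambda>w. w ^ 3)" using Ln_Taylor_bigo[of 1 2] by (simp add: E1_def numeral_3_eq_3)
  have E2: "E2 \<in> O[at 0](\<lambda>w. w ^ 2)" using Ln_Taylor_bigo[of "of_real b" 1] by (simp add: E2_def numeral_2_eq_2)
  have L1: "Ln (1 + w) = w - w\<^sup>2 / 2 + E1 w" for w
    by (simp add: E1_def numeral_2_eq_2 atMost_Suc)
  have L2: "Ln (1 + of_real b * w) = of_real b * w + E2 w" for w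
    by (simp add: E2_def atMost_Suc)
  have "stirling_analytic b 0 = (\<lambda>w. (1 + (of_real b + 1 / 2) * w) * E1 w - w * E2 w + (- ((of_real b + 1 / 2) / 2)) * w ^ 3)"
  proof (rule ext)
    fix w :: complex
    show "stirling_analytic b 0 w = (1 + (of_real b + 1 / 2) * w) * E1 w - w * E2 w + (- ((of_real b + 1 / 2) / 2)) * w ^ 3"
      unfolding stirling_analytic_def L1[of w] L2[of w] by (simp add: field_simps power2_eq_square power3_eq_cube)
  qed
  also have "\<dots> \<in> O[at 0](\<lambda>w. w ^ 3)"
  proof (intro sum_in_bigo)
    have "(\<lambda>w. (1 + (of_real b + 1 / 2) * w) * E1 w) \<in> O[at 0](\<lambda>w. 1 * w ^ 3)"
      by (intro landau_o.big.mult isCont_bigo_1 E1) auto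
    thus "(\<lambda>w. (1 + (of_real b + 1 / 2) * w) * E1 w) \<in> O[at 0](\<lambda>w. w ^ 3)" by simp
    have "(\<lambda>w. w * E2 w) \<in> O[at 0](\<lambda>w. w * w ^ 2)"
      by (intro landau_o.big.mult E2) auto
    thus "(\<lambda>w. w * E2 w) \<in> O[at 0](\<lambda>w. w ^ 3)" by (simp add: power2_eq_square power3_eq_cube mult.assoc)
  qed auto
  finally show ?thesis .
qed

lemma one_plus_power_expand:
  "\<exists>q :: complex poly. \<forall>w. (1 + w) ^ n = 1 + of_nat n * w + w\<^sup>2 * poly q w"
proof (induction n)
  case 0 show ?case by (rule exI[of _ 0]) simp
next
  case (Suc n)
  then obtain q :: "complex poly" where q: "\<And>w. (1 + w) ^ n = 1 + of_nat n * w + w\<^sup>2 * poly q w" by blast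
  show ?case
  proof (rule exI[of _ "[:of_nat n:] + q + [:0, 1:] * q"], rule allI)
    fix w :: complex
    have "(1 + w) ^ Suc n = (1 + w) * (1 + of_nat n * w + w\<^sup>2 * poly q w)" by (simp add: q)
    thus "(1 + w) ^ Suc n = 1 + of_nat (Suc n) * w + w\<^sup>2 * poly ([:of_nat n:] + q + [:0, 1:] * q) w"
      by (simp add: algebra_simps power2_eq_square)
  qed
qed

text \<open>Adding a w^n to p changes \<open>stirling_analytic\<close> by a w^(n + 1) ((1 + w)^(-n)
  - 1), whose leading term is -a n w^(n + 2). With n = m + 1 and a = d/n this cancels the leading
  term d w^(m + 3), so every order can be reached.\<close>

lemma stirling_poly_exists:
  "\<exists>p. poly p 0 = 0 \<and> stirling_analytic b p \<in> O[at 0](\<lambda>w. w ^ (m + 3))"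
proof (induction m)
  case 0 show ?case using stirling_analytic_0[of b] by (intro exI[of _ 0]) simp
next
  case (Suc m)
  then obtain p where p: "poly p 0 = 0" "stirling_analytic b p \<in> O[at 0](\<lambda>w. w ^ (m + 3))" by blast
  from bigo_leading_coeff[OF analytic_stirling_analytic p(2)] obtain d
    where d: "(\<lambda>w. stirling_analytic b p w - d * w ^ (m + 3)) \<in> O[at 0](\<lambda>w. w ^ (m + 4))"
    by (auto simp: eval_nat_numeral)
  define n where "n = Suc m"
  define a where "a = d / of_nat n"
  \<comment> \<open>q isolates the part of (1 + w)^n from w^2 on, so that the remainder after the
    cancellation carries the factor w^(m + 4) explicitly.\<close>
  obtain q :: "complex poly" where q: "\<And>w. (1 + w) ^ n = 1 + of_nat n * w + w\<^sup>2 * poly q w"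
    using one_plus_power_expand by blast
  have ev: "eventually (\<lambda>w::complex. norm w < 1) (at 0)"
    using eventually_at_ball[of 1 "0::complex" UNIV] by simp
  have "eventually (\<lambda>w. (stirling_analytic b p w - d * w ^ (m + 3))
      + a * w ^ (m + 4) * ((of_nat n ^ 2 - poly q w * (1 - of_nat n * w)) / (1 + w) ^ n)
      = stirling_analytic b (p + monom a n) w) (at 0)"
    using ev
  proof eventually_elim
    case (elim w)
    have w1: "1 + w \<noteq> 0"
    proof
      assume "1 + w = 0"
      hence "w = -1" by (simp add: eq_neg_iff_add_eq_0 add.commute)
      thus False using elim by simp
    qed
    have *: "(of_nat n ^ 2 - poly q w * (1 - of_nat n * w)) * w^2 = 1 - (1 - of_nat n * w) * (1 + w) ^ n"
      unfolding q by (simp add: algebra_simps power2_eq_square)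
    define Y where "Y = 1 / (1 + w) ^ n"
    define q' where "q' = (of_nat n ^ 2 - poly q w * (1 - of_nat n * w)) / (1 + w) ^ n"
    have q': "q' * w^2 = Y - (1 - of_nat n * w)"
      using * w1 by (simp add: q'_def Y_def field_simps)
    have "a * w ^ (m + 4) * q' = a * w ^ (m + 2) * (q' * w^2)"
      by (simp add: eval_nat_numeral)
    also have "\<dots> = a * w ^ (m + 2) * (Y - 1) + (a * of_nat n) * w ^ (m + 3)"
      unfolding q' by (simp add: algebra_simps eval_nat_numeral)
    also have "a * of_nat n = d" by (simp add: a_def n_def del: of_nat_Suc)
    finally have "a * w ^ (m + 4) * q' = a * w ^ (m + 2) * (Y - 1) + d * w ^ (m + 3)" .
    moreover have "stirling_analytic b (p + monom a n) w = stirling_analytic b p w + a * w ^ (m + 2) * (Y - 1)"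
    proof -
      have "(w / (1 + w)) ^ n = w ^ n * Y" by (simp add: power_divide Y_def)
      moreover have "w ^ (m + 2) = w * w ^ n" by (simp add: n_def)
      ultimately show ?thesis
        unfolding stirling_analytic_def poly_add poly_monom by (simp only:) (simp add: algebra_simps)
    qed
    ultimately show ?case unfolding q'_def by simp
  qed
  moreover have "(\<lambda>w. (stirling_analytic b p w - d * w ^ (m + 3))
      + a * w ^ (m + 4) * ((of_nat n ^ 2 - poly q w * (1 - of_nat n * w)) / (1 + w) ^ n)) \<in> O[at 0](\<lambda>w. w ^ (m + 4))"
  proof (rule sum_in_bigo(1)[OF d])
    have "(\<lambda>w. a * w ^ (m + 4) * ((of_nat n ^ 2 - poly q w * (1 - of_nat n * w)) / (1 + w) ^ n)) \<in> O[at 0](\<lambda>w. w ^ (m + 4) * 1)"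
      by (intro landau_o.big.mult isCont_bigo_1) (auto intro!: continuous_intros)
    thus "(\<lambda>w. a * w ^ (m + 4) * ((of_nat n ^ 2 - poly q w * (1 - of_nat n * w)) / (1 + w) ^ n)) \<in> O[at 0](\<lambda>w. w ^ (m + 4))"
      by simp
  qed
  ultimately have "stirling_analytic b (p + monom a n) \<in> O[at 0](\<lambda>w. w ^ (m + 4))"
    by (simp add: landau_o.big.in_cong)
  moreover have "poly (p + monom a n) 0 = 0" by (simp add: p poly_monom n_def)
  ultimately show ?case by (intro exI[of _ "p + monom a n"]) (simp add: eval_nat_numeral)
qed

text \<open>The coefficients are \<open>(-1)\<^bsup>k+1\<^esup> B\<^bsub>k+1\<^esub>(b) / (k (k + 1))\<close> with the Bernoulli polynomials \<open>B\<^bsub>k\<^esub>\<close>.\<close>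

definition stirling_poly3 :: "real \<Rightarrow> complex poly" where
  "stirling_poly3 b = [:0, of_real ((b^2 - b + 1/6) / 2), of_real (- (b^3 - 3/2 * b^2 + b/2) / 6),
      of_real ((b^4 - 2 * b^3 + b^2 - 1/30) / 12):]"

text \<open>Order 6 is m + 3 with m = 3, exactly the precision that c_1, c_2, c_3 require.\<close>

lemma stirling_poly3_defect:
  "stirling_analytic b (stirling_poly3 b) \<in> O[at 0](\<lambda>w. w ^ 6)"
proof -
  define B where "B = complex_of_real b"
  define E1 where "E1 = (\<lambda>w::complex. Ln (1 + 1 * w) - (\<Sum>n\<le>5. - ((-(1 * w)) ^ n) / of_nat n))"
  define E2 where "E2 = (\<lambda>w::complex. Ln (1 + B * w) - (\<Sum>n\<le>4. - ((-(B * w)) ^ n) / of_nat n))"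
  \<comment> \<open>\<open>N\<close> is what remains, after multiplication by (1 + w)^3, once all
    terms of order below 6 have cancelled; with it the claim becomes a polynomial identity.\<close>
  define N where "N = (\<lambda>w. (1/6 + B/30 - B^3/3 + B^4/2) + (4/9 + 11/60*B - B^2/12 - B^3/6 + 2/3*B^4) * w
     + (3/8 + 7/20*B + B^4/4) * w^2 + (1/10 + B/5) * w^3)"
  have E1: "E1 \<in> O[at 0](\<lambda>w. w ^ 6)" using Ln_Taylor_bigo[of 1 5] by (simp add: E1_def)
  have E2: "E2 \<in> O[at 0](\<lambda>w. w ^ 5)" using Ln_Taylor_bigo[of B 4] by (simp add: E2_def)
  have L1: "Ln (1 + w) = w - w\<^sup>2 / 2 + w^3 / 3 - w^4 / 4 + w^5 / 5 + E1 w" for w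
    by (simp add: E1_def eval_nat_numeral atMost_Suc)
  have L2: "Ln (1 + B * w) = B * w - (B * w)^2 / 2 + (B * w)^3 / 3 - (B * w)^4 / 4 + E2 w" for w
    by (simp add: E2_def eval_nat_numeral atMost_Suc)
  have ev: "eventually (\<lambda>w::complex. norm w < 1) (at 0)"
    using eventually_at_ball[of 1 "0::complex" UNIV] by simp
  have "eventually (\<lambda>w. (1 + (B + 1 / 2) * w) * E1 w - w * E2 w + w ^ 6 * (N w / (1 + w) ^ 3)
           = stirling_analytic b (stirling_poly3 b) w) (at 0)"
    using ev
  proof eventually_elim
    case (elim w)
    have w1: "1 + w \<noteq> 0"
    proof
      assume "1 + w = 0"
      hence "w = -1" by (simp add: eq_neg_iff_add_eq_0 add.commute)
      thus False using elim by simp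
    qed
    define v where "v = w / (1 + w)"
    have v: "w = v * (1 + w)" using w1 by (simp add: v_def)
    define a1 a2 a3 where "a1 = (B^2 - B + 1/6) / 2" and "a2 = - (B^3 - 3/2 * B^2 + B/2) / 6" and "a3 = (B^4 - 2 * B^3 + B^2 - 1/30) / 12"
    have p: "poly (stirling_poly3 b) x = a1 * x + a2 * x^2 + a3 * x^3" for x
      by (simp add: stirling_poly3_def a1_def a2_def a3_def B_def algebra_simps power2_eq_square power3_eq_cube)
    have pv: "poly (stirling_poly3 b) v = (a1 * w * (1 + w)^2 + a2 * w^2 * (1 + w) + a3 * w^3) / (1 + w) ^ 3"
    proof -
      have "a1 * (w / D) + a2 * (w / D)^2 + a3 * (w / D)^3 = (a1 * w * D^2 + a2 * w^2 * D + a3 * w^3) / D ^ 3"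
        if "D \<noteq> 0" for D
        using that by (simp add: field_simps power2_eq_square power3_eq_cube)
      from this[OF w1] show ?thesis unfolding p v_def .
    qed
    have "(1 + w)^3 * ((1 + (B + 1 / 2) * w) * (w - w\<^sup>2 / 2 + w^3 / 3 - w^4 / 4 + w^5 / 5) - w
       - w * (B * w - (B * w)^2 / 2 + (B * w)^3 / 3 - (B * w)^4 / 4))
       + w * ((a1 * w * (1 + w)^2 + a2 * w^2 * (1 + w) + a3 * w^3) - (1 + w)^3 * (a1 * w + a2 * w^2 + a3 * w^3)) = w ^ 6 * N w"
      unfolding N_def a1_def a2_def a3_def by (simp add: field_simps) algebra
    hence "w ^ 6 * (N w / (1 + w) ^ 3) = (1 + (B + 1 / 2) * w) * (w - w\<^sup>2 / 2 + w^3 / 3 - w^4 / 4 + w^5 / 5) - w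
       - w * (B * w - (B * w)^2 / 2 + (B * w)^3 / 3 - (B * w)^4 / 4)
       + w * ((a1 * w * (1 + w)^2 + a2 * w^2 * (1 + w) + a3 * w^3) / (1 + w)^3 - (a1 * w + a2 * w^2 + a3 * w^3))"
      using w1 by (simp add: divide_simps) (simp add: mult_ac)
    thus ?case
      unfolding stirling_analytic_def B_def[symmetric] L1[of w] L2[of w] v_def[symmetric] pv p[of w]
      by (simp add: algebra_simps)
  qed
  moreover have "(\<lambda>w. (1 + (B + 1 / 2) * w) * E1 w - w * E2 w + w ^ 6 * (N w / (1 + w) ^ 3)) \<in> O[at 0](\<lambda>w. w ^ 6)"
  proof (intro sum_in_bigo)
    have "(\<lambda>w. (1 + (B + 1 / 2) * w) * E1 w) \<in> O[at 0](\<lambda>w. 1 * w ^ 6)"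
      by (intro landau_o.big.mult isCont_bigo_1 E1) auto
    thus "(\<lambda>w. (1 + (B + 1 / 2) * w) * E1 w) \<in> O[at 0](\<lambda>w. w ^ 6)" by simp
    have "(\<lambda>w. w * E2 w) \<in> O[at 0](\<lambda>w. w * w ^ 5)"
      by (intro landau_o.big.mult E2) auto
    thus "(\<lambda>w. w * E2 w) \<in> O[at 0](\<lambda>w. w ^ 6)" by (simp add: eval_nat_numeral)
    have "(\<lambda>w. w ^ 6 * (N w / (1 + w) ^ 3)) \<in> O[at 0](\<lambda>w. w ^ 6 * 1)"
      unfolding N_def by (intro landau_o.big.mult isCont_bigo_1) (auto intro!: continuous_intros)
    thus "(\<lambda>w. w ^ 6 * (N w / (1 + w) ^ 3)) \<in> O[at 0](\<lambda>w. w ^ 6)" by simp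
  qed
  ultimately show ?thesis by (simp add: landau_o.big.in_cong)
qed

lemma stirling_exponent_of_nat:
  "Gamma (of_nat n + of_real 1) * exp (- stirling_exponent 1 (of_nat n)) =
     of_real (fact n * exp (real n - (real n + 1 / 2) * ln (real n)))" if "n > 0"
proof -
  have "Ln (of_nat n :: complex) = of_real (ln (real n))"
    using that Ln_of_real[of "real n"] by simp
  moreover have "Gamma (of_nat n + of_real 1 :: complex) = fact n"
    using Gamma_fact[of n, where 'a = complex] by (simp add: add.commute)
  ultimately show ?thesis
    by (simp add: stirling_exponent_def exp_of_real[symmetric] algebra_simps)
qed

text \<open>Telescoping with b = 1 and p = 0 from a fixed integer K shows that the sequence
  converges, to u(K)/exp(e) with e the sum of the defects. The limit is therefore nonzero, and
  \<open>fact_over_n_power_limit\<close> identifies it.\<close>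

lemma stirling_constant:
  "(\<lambda>n. fact n * exp (real n - (real n + 1 / 2) * ln (real n))) \<longlonglongrightarrow> sqrt (2 * pi)"
proof -
  define u where "u = (\<lambda>n. fact n * exp (real n - (real n + 1 / 2) * ln (real n)))"
  have "stirling_analytic 1 0 \<in> O[at 0](\<lambda>w. w ^ (0 + 3))"
    using stirling_analytic_0[of 1] by simp
  then obtain r C where rC: "r > 0" "\<And>w. 0 < norm w \<Longrightarrow> norm w \<le> r \<Longrightarrow> norm (stirling_defect 1 0 w) \<le> C * norm w ^ (0 + 2)"
    using defect_bound_of_bigo[of 1 0 0] unfolding stirling_defect_bigo_iff by blast
  \<comment> \<open>With \<delta> = \<pi> the sector shrinks to the nonnegative real axis, on which
    the integers used here lie.\<close>
  obtain R B where RB: "R > 0" "\<And>s. \<bar>Arg s\<bar> \<le> pi - pi \<Longrightarrow> norm s \<ge> R \<Longrightarrow>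
      summable (\<lambda>k. stirling_defect 1 0 (1 / (s + of_nat k))) \<and>
      norm (\<Sum>k. stirling_defect 1 0 (1 / (s + of_nat k))) \<le> B / norm s ^ (0 + 1)"
    using suminf_stirling_defect_le[OF rC(2,1), of pi] by (metis pi_gt_zero order_refl)
  define K where "K = nat \<lceil>R\<rceil> + 1"
  define s where "s = complex_of_real (real K)"
  have K: "real K \<ge> R" "K > 0" by (auto simp: K_def) linarith
  have summ: "summable (\<lambda>k. stirling_defect 1 0 (1 / (s + of_nat k)))"
  proof -
    have "Arg s = 0" unfolding s_def using K by (subst Arg_of_real) auto
    moreover have "norm s = real K" by (simp add: s_def)
    ultimately show ?thesis using RB(2)[of s] K(1) by simp
  qed
  define e where "e = (\<Sum>k. stirling_defect 1 0 (1 / (s + of_nat k)))"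
  have "(\<lambda>n. exp (\<Sum>k<n. stirling_defect 1 0 (1 / (s + of_nat k)))) \<longlonglongrightarrow> exp e"
    unfolding e_def by (intro tendsto_exp summable_LIMSEQ summ)
  hence "(\<lambda>n. of_real (u K) / exp (\<Sum>k<n. stirling_defect 1 0 (1 / (s + of_nat k)))) \<longlonglongrightarrow> of_real (u K) / exp e"
    by (intro tendsto_divide tendsto_const) auto
  moreover have "of_real (u K) / exp (\<Sum>k<n. stirling_defect 1 0 (1 / (s + of_nat k))) = complex_of_real (u (n + K))" for n
  proof -
    have "s \<notin> \<real>\<^sub>\<le>\<^sub>0" using K by (simp add: s_def)
    moreover have "s + of_nat k + of_real 1 \<notin> \<int>\<^sub>\<le>\<^sub>0" for k
    proof -
      have "s + of_nat k + of_real 1 = of_nat (Suc (K + k))" by (simp add: s_def)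
      thus ?thesis by (metis of_nat_in_nonpos_Ints_iff nat.distinct(1))
    qed
    ultimately have "Gamma (s + of_real 1) * exp (- stirling_exponent 1 s - poly 0 (1 / s)) =
         Gamma (s + of_nat n + of_real 1) * exp (- stirling_exponent 1 (s + of_nat n) - poly 0 (1 / (s + of_nat n)))
           * exp (\<Sum>k<n. stirling_defect 1 0 (1 / (s + of_nat k)))"
      by (rule Gamma_stirling_iterate)
    moreover have "Gamma (s + of_real 1) * exp (- stirling_exponent 1 s) = of_real (u K)"
      using stirling_exponent_of_nat[of K] K by (simp add: u_def s_def)
    moreover have "Gamma (s + of_nat n + of_real 1) * exp (- stirling_exponent 1 (s + of_nat n)) = of_real (u (n + K))"
      using stirling_exponent_of_nat[of "n + K"] K by (simp add: u_def s_def add_ac)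
    ultimately have "of_real (u K) = complex_of_real (u (n + K)) * exp (\<Sum>k<n. stirling_defect 1 0 (1 / (s + of_nat k)))"
      by (simp only: poly_0 diff_zero)
    thus ?thesis by (simp add: field_simps)
  qed
  ultimately have "(\<lambda>n. complex_of_real (u (n + K))) \<longlonglongrightarrow> of_real (u K) / exp e" by simp
  hence lim: "(\<lambda>n. complex_of_real (u n)) \<longlonglongrightarrow> of_real (u K) / exp e" by (rule LIMSEQ_offset)
  define c where "c = complex_of_real (u K) / exp e"
  have "c \<noteq> 0" using K by (simp add: c_def u_def)
  have "c \<in> \<real>" using lim unfolding c_def[symmetric]
    by (rule closed_sequentially[OF closed_complex_Reals, rotated]) auto
  then obtain c' where c': "c = of_real c'" by (auto elim: Reals_cases)
  have "u \<longlonglongrightarrow> c'" using lim unfolding c_def[symmetric] c' tendsto_of_real_iff .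
  moreover have "c' \<noteq> 0" using \<open>c \<noteq> 0\<close> c' by simp
  ultimately show ?thesis using fact_over_n_power_limit[of c'] unfolding u_def by simp
qed

text \<open>Iterating the functional equation n times and letting n grow produces the constant of
  \<open>stirling_constant\<close> and the factor exp(e), where e is the sum of all defects and
  serves as \<epsilon>. The error is kept in the exponent so that products and quotients of Gamma
  functions combine additively.\<close>

theorem Gamma_stirling:
  assumes bnd: "stirling_analytic b p \<in> O[at 0](\<lambda>w. w ^ (m + 3))"
    and \<delta>: "\<delta> > 0" and p0: "poly p 0 = 0"
  shows "\<exists>R>0. \<exists>B. \<forall>s. \<bar>Arg s\<bar> \<le> pi - \<delta> \<and> norm s \<ge> R \<longrightarrow>
           (\<exists>\<epsilon>. norm \<epsilon> \<le> B / norm s ^ (m + 1) \<and>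
             Gamma (s + of_real b) = of_real (sqrt (2 * pi)) * exp (stirling_exponent b s + poly p (1 / s) + \<epsilon>))"
proof (cases "\<delta> \<le> pi")
  case False
  have False if "\<bar>Arg s\<bar> \<le> pi - \<delta>" for s :: complex
    using that False by linarith
  thus ?thesis by (intro exI[of _ 1]) auto
next
  case True
  obtain r C where rC: "r > 0" "\<And>w. 0 < norm w \<Longrightarrow> norm w \<le> r \<Longrightarrow> norm (stirling_defect b p w) \<le> C * norm w ^ (m + 2)"
    using defect_bound_of_bigo bnd unfolding stirling_defect_bigo_iff by blast
  obtain R B where RB: "R > 0" "\<And>s. \<bar>Arg s\<bar> \<le> pi - \<delta> \<Longrightarrow> norm s \<ge> R \<Longrightarrow>
      summable (\<lambda>k. stirling_defect b p (1 / (s + of_nat k))) \<and>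
      norm (\<Sum>k. stirling_defect b p (1 / (s + of_nat k))) \<le> B / norm s ^ (m + 1)"
    using suminf_stirling_defect_le[OF rC(2,1) \<delta> True] by metis
  define R' where "R' = max R (\<bar>b\<bar> + 2)"
  have "\<exists>\<epsilon>. norm \<epsilon> \<le> B / norm s ^ (m + 1) \<and>
             Gamma (s + of_real b) = of_real (sqrt (2 * pi)) * exp (stirling_exponent b s + poly p (1 / s) + \<epsilon>)"
    if s: "\<bar>Arg s\<bar> \<le> pi - \<delta>" "norm s \<ge> R'" for s :: complex
  proof -
    define e where "e = (\<Sum>k. stirling_defect b p (1 / (s + of_nat k)))"
    have summ: "summable (\<lambda>k. stirling_defect b p (1 / (s + of_nat k)))"
      and e: "norm e \<le> B / norm s ^ (m + 1)"
      using RB(2)[of s] s by (auto simp: R'_def e_def)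
    have nr: "s \<notin> \<real>\<^sub>\<le>\<^sub>0"
    proof
      assume "s \<in> \<real>\<^sub>\<le>\<^sub>0"
      moreover have "s \<noteq> 0" using s(2) by (auto simp: R'_def)
      ultimately have "Arg s = pi" by (subst Arg_eq_pi) (auto simp: complex_nonpos_Reals_iff complex_eq_iff)
      thus False using s(1) \<delta> by simp
    qed
    \<comment> \<open>Both shifts are excluded: b for the iterated functional equation, b - 1 for
      Gauss's limit at s + b - 1.\<close>
    have ni: "s + of_nat k + of_real x \<notin> \<int>\<^sub>\<le>\<^sub>0" if "x \<in> {b - 1, b}" for k x
    proof
      assume "s + of_nat k + of_real x \<in> \<int>\<^sub>\<le>\<^sub>0"
      then obtain n where n: "s + of_nat k + of_real x = - of_nat n" by (auto elim: nonpos_Ints_cases')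
      hence "s = of_real (- real n - real k - x)" by (simp add: algebra_simps complex_eq_iff)
      then obtain y where y: "s = of_real y" "y = - real n - real k - x" by blast
      have "y > 0" using nr unfolding y(1) by simp
      hence "norm s = y" unfolding y(1) norm_of_real by simp
      thus False using s(2) y that by (auto simp: R'_def)
    qed
    have lim1: "(\<lambda>n. Gamma (s + of_nat n + of_real b) * exp (- stirling_exponent b (s + of_nat n))
            / of_real (fact n * exp (real n - (real n + 1 / 2) * ln (real n)))) \<longlonglongrightarrow> 1"
      using ni[of "b - 1" 0] by (intro Gamma_div_fact_limit) (auto simp: algebra_simps)
    have lim2: "(\<lambda>n. complex_of_real (fact n * exp (real n - (real n + 1 / 2) * ln (real n)))) \<longlonglongrightarrow> of_real (sqrt (2 * pi))"
      by (intro tendsto_of_real stirling_constant)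
    have lim3: "(\<lambda>n. exp (- poly p (1 / (s + of_nat n)))) \<longlonglongrightarrow> 1"
    proof -
      have "filterlim (\<lambda>n. s + of_nat n) at_infinity sequentially"
        using tendsto_add_filterlim_at_infinity[OF tendsto_const tendsto_of_nat] .
      hence "(\<lambda>n. 1 / (s + of_nat n)) \<longlonglongrightarrow> 0"
        using filterlim_compose[OF tendsto_inverse_0] by (simp add: divide_inverse)
      hence "(\<lambda>n. exp (- poly p (1 / (s + of_nat n)))) \<longlonglongrightarrow> exp (- poly p 0)"
        by (intro tendsto_intros)
      thus ?thesis by (simp add: p0)
    qed
    have lim4: "(\<lambda>n. exp (\<Sum>k<n. stirling_defect b p (1 / (s + of_nat k)))) \<longlonglongrightarrow> exp e"
      unfolding e_def by (intro tendsto_exp summable_LIMSEQ summ)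
    note lim = tendsto_mult[OF tendsto_mult[OF tendsto_mult[OF lim1 lim2] lim3] lim4]
    \<comment> \<open>By the iterated functional equation this product does not depend on n, so its
      limit is its value.\<close>
    have eq: "Gamma (s + of_nat n + of_real b) * exp (- stirling_exponent b (s + of_nat n))
            / of_real (fact n * exp (real n - (real n + 1 / 2) * ln (real n))) *
          complex_of_real (fact n * exp (real n - (real n + 1 / 2) * ln (real n))) *
          exp (- poly p (1 / (s + of_nat n))) * exp (\<Sum>k<n. stirling_defect b p (1 / (s + of_nat k)))
        = Gamma (s + of_real b) * exp (- stirling_exponent b s - poly p (1 / s))" for n
    proof -
      have ne: "fact n * exp (real n - (real n + 1 / 2) * ln (real n)) \<noteq> 0" by simp
      define W where "W = complex_of_real (fact n * exp (real n - (real n + 1 / 2) * ln (real n)))"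
      have "W \<noteq> 0" using ne unfolding W_def of_real_eq_0_iff .
      moreover have "Gamma (s + of_real b) * exp (- stirling_exponent b s - poly p (1 / s)) =
         Gamma (s + of_nat n + of_real b) * exp (- stirling_exponent b (s + of_nat n) - poly p (1 / (s + of_nat n)))
           * exp (\<Sum>k<n. stirling_defect b p (1 / (s + of_nat k)))"
        by (rule Gamma_stirling_iterate[OF nr ni]) simp
      ultimately show ?thesis unfolding W_def[symmetric]
        by (simp add: exp_diff exp_minus divide_inverse)
    qed
    from lim have "Gamma (s + of_real b) * exp (- stirling_exponent b s - poly p (1 / s)) = of_real (sqrt (2 * pi)) * exp e"
      unfolding eq by (simp add: LIMSEQ_const_iff)
    hence "Gamma (s + of_real b) = of_real (sqrt (2 * pi)) * exp (stirling_exponent b s + poly p (1 / s) + e)"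
      by (simp add: exp_diff exp_minus exp_add field_simps)
    thus ?thesis using e by blast
  qed
  moreover have "R' > 0" using RB(1) by (simp add: R'_def)
  ultimately show ?thesis by (intro exI[of _ R'] conjI exI[of _ B]) auto
qed

section \<open>Inverse factorial expansions\<close>

lemma bernoulli_combination_1: fixes s v :: real
  shows "24 * ((1 - s) * (((-v-1/2)^2 - (-v-1/2) + 1/6) / 2) + s * (((v+5/2)^2 - (v+5/2) + 1/6) / 2 - (1 - s) * (((3/2)^2 - (3/2) + 1/6) / 2)))
    = 11 + 24 * v + 12 * v^2 + s * (25 + 24 * v) + 11 * s^2"
  by (simp add: field_simps power2_eq_square)
lemma bernoulli_combination_2: fixes s v :: real
  shows "24 * ((1 - s)^2 * (- ((-v-1/2)^3 - 3/2 * (-v-1/2)^2 + (-v-1/2)/2) / 6) + s^2 * ((- ((v+5/2)^3 - 3/2 * (v+5/2)^2 + (v+5/2)/2) / 6) - (1 - s)^2 * (- ((3/2)^3 - 3/2 * (3/2)^2 + (3/2)/2) / 6)))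
   = 3 + 11 * v + 12 * v^2 + 4 * v^3 - s * (6 + 22 * v + 24 * v^2 + 8 * v^3) - s^2 * (24 + 36 * v + 12 * v^2) - 6 * s^3 + 3 * s^4"
  by (simp add: field_simps eval_nat_numeral)
lemma bernoulli_combination_3: fixes s v :: real
  shows "2880 * ((1 - s)^3 * (((-v-1/2)^4 - 2 * (-v-1/2)^3 + (-v-1/2)^2 - 1/30) / 12) + s^3 * (((v+5/2)^4 - 2 * (v+5/2)^3 + (v+5/2)^2 - 1/30) / 12 - (1 - s)^3 * (((3/2)^4 - 2 * (3/2)^3 + (3/2)^2 - 1/30) / 12)))
   = 127 + 720 * v + 1320 * v^2 + 960 * v^3 + 240 * v^4 - s * (381 + 2160 * v + 3960 * v^2 + 2880 * v^3 + 720 * v^4)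
     + s^2 * (381 + 2160 * v + 3960 * v^2 + 2880 * v^3 + 720 * v^4) + s^3 * (3113 + 6480 * v + 4320 * v^2 + 960 * v^3)
     + 381 * s^4 - 381 * s^5 + 127 * s^6"
  by (simp add: field_simps eval_nat_numeral)
text \<open>With l1, l2, l3 the coefficients in the logarithm of the normalised quotient,
  \<open>N1\<close>, \<open>N2\<close>, \<open>N3\<close> are the numerators of k l1, k^2 l2, k^3 l3
  over 24 s, 24 s^2, 2880 s^3. The combination on the left is c_3 over the common denominator 414720
  s^3.\<close>

lemma struve_c3_numerator: fixes s v :: real
  defines "N1 \<equiv> 11 + 24 * v + 12 * v^2 + s * (25 + 24 * v) + 11 * s^2"
  defines "N2 \<equiv> 3 + 11 * v + 12 * v^2 + 4 * v^3 - s * (6 + 22 * v + 24 * v^2 + 8 * v^3) - s^2 * (24 + 36 * v + 12 * v^2) - 6 * s^3 + 3 * s^4"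
  defines "N3 \<equiv> 127 + 720 * v + 1320 * v^2 + 960 * v^3 + 240 * v^4 - s * (381 + 2160 * v + 3960 * v^2 + 2880 * v^3 + 720 * v^4)
     + s^2 * (381 + 2160 * v + 3960 * v^2 + 2880 * v^3 + 720 * v^4) + s^3 * (3113 + 6480 * v + 4320 * v^2 + 960 * v^3)
     + 381 * s^4 - 381 * s^5 + 127 * s^6"
  shows "144 * N3 + 720 * N1 * N2 + 5 * N1^3 - 4320 * N1 * s^2 * (2 * v+5)^2 + (17280 * N2 * s + 360 * N1^2 * s + 8640 * N1 * s^2 * (2 * v+5)) * (2 * v+6) =
     (48703 + 286200 * v + 617940 * v^2 + 636480 * v^3 + 334800 * v^4 + 86400 * v^5 + 8640 * v^6
      - 3 * (-s) * (189797 + 791400 * v + 1179240 * v^2 + 797760 * v^3 + 248400 * v^4 + 28800 * v^5)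
      + 6 * (-s)^2 * (355459 + 1019700 * v + 996570 * v^2 + 398880 * v^3 + 55800 * v^4)
      - (-s)^3 * (3254507 + 6118200 * v + 3537720 * v^2 + 636480 * v^3)
      + 6 * (-s)^4 * (355459 + 395700 * v + 102990 * v^2)
      - 3 * (-s)^5 * (189797 + 95400 * v)
      + 48703 * (-s)^6)"
  unfolding N1_def N2_def N3_def by algebra



lemma struve_c2_numerator: fixes s v :: real
  defines "N1 \<equiv> 11 + 24 * v + 12 * v^2 + s * (25 + 24 * v) + 11 * s^2"
  defines "N2 \<equiv> 3 + 11 * v + 12 * v^2 + 4 * v^3 - s * (6 + 22 * v + 24 * v^2 + 8 * v^3) - s^2 * (24 + 36 * v + 12 * v^2) - 6 * s^3 + 3 * s^4"
  shows "48 * N2 + N1^2 + 24 * N1 * s * (2 * v+5) =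
     265 + 1056 * v + 1416 * v^2 + 768 * v^3 + 144 * v^4
      - 2 * (-s) * (791 + 2040 * v + 1596 * v^2 + 384 * v^3)
      + 3 * (-s)^2 * (905 + 1360 * v + 472 * v^2)
      - 2 * (-s)^3 * (791 + 528 * v)
      + 265 * (-s)^4"
  unfolding N1_def N2_def by algebra

text \<open>The recipe for c1, c2, c3 is the re-expansion of \<open>exp_cubic_in_ifac_hat\<close>,
  with Bernoulli polynomials at the three shifts of \<Gamma> as input. The equations are hypotheses
  so that the lemma can be instantiated with locally defined constants.\<close>

lemma struve_coeff_formulas: fixes s v k l1 l2 l3 c1 c2 c3 :: real
  assumes s: "0 < s" "s < 1"
  assumes k_def: "k = (1 - s)"
  assumes a1_def: "a1 = (\<lambda>b::real. (b^2 - b + 1/6) / 2)"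
  assumes a2_def: "a2 = (\<lambda>b::real. - (b^3 - 3/2 * b^2 + b/2) / 6)"
  assumes a3_def: "a3 = (\<lambda>b::real. (b^4 - 2 * b^3 + b^2 - 1/30) / 12)"
  assumes l1_def: "l1 = (a1 (-v-1/2) / s + a1 (v+5/2) / k - a1 (3/2))"
  assumes l2_def: "l2 = (a2 (-v-1/2) / s^2 + a2 (v+5/2) / k^2 - a2 (3/2))"
  assumes l3_def: "l3 = (a3 (-v-1/2) / s^3 + a3 (v+5/2) / k^3 - a3 (3/2))"
  assumes c1_def: "c1 = (k * l1)"
  assumes c2_def: "c2 = (k^2 * (l2 + l1^2 / 2) + c1 * (v+5/2))"
  assumes c3_def: "c3 = (k^3 * (l3 + l1 * l2 + l1^3 / 6) - c1 * (v+5/2)^2 + c2 * (2 * (v+5/2) + 1))"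
  shows "c1 = struve_c1 (-s) v" "c2 = struve_c2 (-s) v" "c3 = struve_c3 (-s) v"
proof -
  define N1 N2 N3 where "N1 = 11 + 24 * v + 12 * v^2 + s * (25 + 24 * v) + 11 * s^2"
   and "N2 = 3 + 11 * v + 12 * v^2 + 4 * v^3 - s * (6 + 22 * v + 24 * v^2 + 8 * v^3) - s^2 * (24 + 36 * v + 12 * v^2) - 6 * s^3 + 3 * s^4"
   and "N3 = 127 + 720 * v + 1320 * v^2 + 960 * v^3 + 240 * v^4 - s * (381 + 2160 * v + 3960 * v^2 + 2880 * v^3 + 720 * v^4)
     + s^2 * (381 + 2160 * v + 3960 * v^2 + 2880 * v^3 + 720 * v^4) + s^3 * (3113 + 6480 * v + 4320 * v^2 + 960 * v^3)
     + 381 * s^4 - 381 * s^5 + 127 * s^6"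
  have ne: "s \<noteq> 0" "k \<noteq> 0" using s by (auto simp: k_def)
  have U: "24 * (k * a1 (-v-1/2) + s * (a1 (v+5/2) - k * a1 (3/2))) = N1"
    "24 * (k^2 * a2 (-v-1/2) + s^2 * (a2 (v+5/2) - k^2 * a2 (3/2))) = N2"
    "2880 * (k^3 * a3 (-v-1/2) + s^3 * (a3 (v+5/2) - k^3 * a3 (3/2))) = N3"
    using bernoulli_combination_1[of s v] bernoulli_combination_2[of s v] bernoulli_combination_3[of s v]
    unfolding k_def a1_def a2_def a3_def N1_def N2_def N3_def by blast+
  have L: "k^n * (x / s^n + y / k^n - w) = (k^n * x + s^n * (y - k^n * w)) / s^n" for n x y w
    using ne by (simp add: field_simps)
  have L1: "k * l1 = N1 / (24 * s)"
    using L[of 1 "a1 (-v-1/2)" "a1 (v+5/2)" "a1 (3/2)"]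
    unfolding power_one_right l1_def[symmetric] U(1)[symmetric] by (subst mult_divide_mult_cancel_left) simp_all
  have L2: "k^2 * l2 = N2 / (24 * s^2)"
    using L[of 2 "a2 (-v-1/2)" "a2 (v+5/2)" "a2 (3/2)"]
    unfolding power_one_right l2_def[symmetric] U(2)[symmetric] by (subst mult_divide_mult_cancel_left) simp_all
  have L3: "k^3 * l3 = N3 / (2880 * s^3)"
    using L[of 3 "a3 (-v-1/2)" "a3 (v+5/2)" "a3 (3/2)"]
    unfolding power_one_right l3_def[symmetric] U(3)[symmetric] by (subst mult_divide_mult_cancel_left) simp_all
  show c1: "c1 = struve_c1 (-s) v"
    unfolding c1_def L1 struve_c1_def N1_def using ne by (simp add: field_simps)
  have "c2 = k^2 * l2 + (k * l1)^2 / 2 + (k * l1) * (v + 5/2)"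
    unfolding c2_def c1_def by (simp add: algebra_simps power2_eq_square)
  also have "\<dots> = (48 * N2 + N1^2 + 24 * N1 * s * (2 * v+5)) / (1152 * s^2)"
    unfolding L1 L2 using ne by (simp add: field_simps power2_eq_square)
  finally have c2': "c2 = (48 * N2 + N1^2 + 24 * N1 * s * (2 * v+5)) / (1152 * s^2)" .
  show c2: "c2 = struve_c2 (-s) v"
    unfolding c2' struve_c2_def N1_def N2_def struve_c2_numerator by simp
  have "c3 = k^3 * l3 + (k * l1) * (k^2 * l2) + (k * l1)^3 / 6 - (k * l1) * (v+5/2)^2 + c2 * (2 * (v+5/2) + 1)"
    unfolding c3_def c1_def by (simp add: algebra_simps power2_eq_square power3_eq_cube)
  also have "\<dots> = (144 * N3 + 720 * N1 * N2 + 5 * N1^3 - 4320 * N1 * s^2 * (2 * v+5)^2 + (17280 * N2 * s + 360 * N1^2 * s + 8640 * N1 * s^2 * (2 * v+5)) * (2 * v+6)) / (414720 * s^3)"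
    unfolding L1 L2 L3 c2' using ne by (simp add: field_simps power2_eq_square power3_eq_cube)
  finally show "c3 = struve_c3 (-s) v"
    unfolding struve_c3_def N1_def N2_def N3_def struve_c3_numerator by simp
qed

section \<open>Inverse factorials as functions of 1/s\<close>

definition ifac_basis :: "real \<Rightarrow> real \<Rightarrow> nat \<Rightarrow> complex \<Rightarrow> complex" where
  "ifac_basis \<kappa> \<beta> j s = inverse (pochhammer (of_real \<kappa> * s + of_real \<beta>) j)"

text \<open>The quotient \<Gamma>(z)/\<Gamma>(z + j) at z = \<kappa>s + \<beta>, i.e.
  \<open>ifac_basis\<close>, in the variable w = 1/s, in which it is analytic at 0 with leading term
  w^j/\<kappa>^j.\<close>

definition ifac_hat :: "real \<Rightarrow> real \<Rightarrow> nat \<Rightarrow> complex \<Rightarrow> complex" where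
  "ifac_hat \<kappa> \<beta> j w = w ^ j / (\<Prod>i<j. of_real \<kappa> + (of_real \<beta> + of_nat i) * w)"

lemma ifac_hat_eq:
  assumes "s \<noteq> 0"
  shows "ifac_hat \<kappa> \<beta> j (1 / s) = ifac_basis \<kappa> \<beta> j s"
proof -
  have "pochhammer (of_real \<kappa> * s + of_real \<beta>) j = s ^ j * (\<Prod>i<j. of_real \<kappa> + (of_real \<beta> + of_nat i) * (1 / s))"
  proof (induction j)
    case (Suc j)
    have "of_real \<kappa> * s + of_real \<beta> + of_nat j = s * (of_real \<kappa> + (of_real \<beta> + of_nat j) * (1 / s))"
      using assms by (simp add: field_simps)
    thus ?case unfolding pochhammer_Suc Suc.IH by simp
  qed auto
  thus ?thesis unfolding ifac_hat_def ifac_basis_def using assms by (simp add: field_simps)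
qed

lemma ifac_hat_analytic:
  assumes "\<kappa> \<noteq> 0"
  shows "ifac_hat \<kappa> \<beta> j analytic_on {0}"
  unfolding ifac_hat_def using assms by (intro analytic_intros) auto

lemma analytic_minus_value_bigo:
  fixes D :: "complex \<Rightarrow> complex"
  assumes "D analytic_on {0}"
  shows "(\<lambda>w. D w - D 0) \<in> O[at 0](\<lambda>w. w)"
proof -
  have "D field_differentiable at 0"
    using assms by (simp add: analytic_on_imp_differentiable_at)
  then obtain d where "(D has_field_derivative d) (at 0)"
    by (auto simp: field_differentiable_def)
  hence "((\<lambda>w. (D w - D 0) / w) \<longlongrightarrow> d) (at 0)"
    by (simp add: has_field_derivative_iff)
  hence "(\<lambda>w. (D w - D 0) / w) \<in> O[at 0](\<lambda>_. 1)"
    by (intro bigoI_tendsto[where c = d]) (auto simp: )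
  hence "(\<lambda>w. (D w - D 0) / w * w) \<in> O[at 0](\<lambda>w. 1 * w)"
    by (intro landau_o.big.mult) auto
  moreover have "eventually (\<lambda>w. (D w - D 0) / w * w = D w - D 0) (at 0)"
    by (auto simp: eventually_at_filter)
  ultimately show ?thesis by (simp add: landau_o.big.in_cong)
qed

lemma ifac_hat_leading:
  assumes "\<kappa> \<noteq> 0"
  shows "(\<lambda>w. w ^ k - of_real \<kappa> ^ k * ifac_hat \<kappa> \<beta> k w) \<in> O[at 0](\<lambda>w. w ^ Suc k)"
proof -
  define g where "g = (\<lambda>w::complex. 1 - of_real \<kappa> ^ k / (\<Prod>i<k. of_real \<kappa> + (of_real \<beta> + of_nat i) * w))"
  have "g analytic_on {0}" unfolding g_def using assms by (intro analytic_intros) auto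
  from analytic_minus_value_bigo[OF this] have "g \<in> O[at 0](\<lambda>w. w)"
    using assms by (simp add: g_def)
  hence "(\<lambda>w. w ^ k * g w) \<in> O[at 0](\<lambda>w. w ^ k * w)"
    by (intro landau_o.big.mult) auto
  thus ?thesis by (simp add: g_def ifac_hat_def algebra_simps)
qed

text \<open>Triangular elimination: the k-th function starts with w^k/\<kappa>^k, so d w^k can be
  replaced by d \<kappa>^k times this function at the cost of O(w^(k + 1)).\<close>

lemma expand_in_ifac_hat:
  assumes \<kappa>: "\<kappa> \<noteq> 0" and B: "B analytic_on {0}"
  shows "\<exists>c. (\<lambda>w. B w - (\<Sum>j<k. c j * ifac_hat \<kappa> \<beta> j w)) \<in> O[at 0](\<lambda>w. w ^ k)"
proof (induction k)
  case 0
  have "isCont B 0" using B analytic_at_imp_isCont by blast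
  thus ?case using isCont_bigo_1[of B] by simp
next
  case (Suc k)
  then obtain c where c: "(\<lambda>w. B w - (\<Sum>j<k. c j * ifac_hat \<kappa> \<beta> j w)) \<in> O[at 0](\<lambda>w. w ^ k)" ..
  have "(\<lambda>w. B w - (\<Sum>j<k. c j * ifac_hat \<kappa> \<beta> j w)) analytic_on {0}"
    by (intro analytic_intros B ifac_hat_analytic \<kappa>)
  from bigo_leading_coeff[OF this c] obtain d
    where d: "(\<lambda>w. B w - (\<Sum>j<k. c j * ifac_hat \<kappa> \<beta> j w) - d * w ^ k) \<in> O[at 0](\<lambda>w. w ^ Suc k)" ..
  have "(\<lambda>w. d * (w ^ k - of_real \<kappa> ^ k * ifac_hat \<kappa> \<beta> k w)) \<in> O[at 0](\<lambda>w. 1 * w ^ Suc k)"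
    by (intro landau_o.big.mult ifac_hat_leading \<kappa>) auto
  hence "(\<lambda>w. d * (w ^ k - of_real \<kappa> ^ k * ifac_hat \<kappa> \<beta> k w)) \<in> O[at 0](\<lambda>w. w ^ Suc k)"
    by simp
  from sum_in_bigo(1)[OF d this]
  show ?case
    by (intro exI[of _ "c(k := d * of_real \<kappa> ^ k)"]) (simp add: algebra_simps)
qed

text \<open>The functions have distinct orders, so dividing by w^j and letting w tend to 0 isolates
  the lowest remaining coefficient. The filter F is left free in order to cover w = 1/n along the
  positive integers.\<close>

lemma ifac_hat_unique:
  assumes \<kappa>: "\<kappa> \<noteq> 0" and F: "F \<le> at 0" "F \<noteq> bot"
    and O: "(\<lambda>w. \<Sum>j<M. d j * ifac_hat \<kappa> \<beta> j w) \<in> O[F](\<lambda>w. w ^ M)" and "j < M"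
  shows "d j = 0"
  using \<open>j < M\<close>
proof (induction j rule: less_induct)
  case (less j)
  define r where "r = (\<lambda>i (w::complex). w ^ (i - j) / (\<Prod>l<i. of_real \<kappa> + (of_real \<beta> + of_nat l) * w))"
  define G where "G = (\<lambda>w. \<Sum>i\<in>{j..<M}. d i * r i w)"
  have "(\<Sum>i<M. d i * ifac_hat \<kappa> \<beta> i w) = w ^ j * G w" for w
  proof -
    have "(\<Sum>i<M. d i * ifac_hat \<kappa> \<beta> i w) = (\<Sum>i\<in>{j..<M}. d i * ifac_hat \<kappa> \<beta> i w)"
      using less by (intro sum.mono_neutral_right) auto
    also have "\<dots> = (\<Sum>i\<in>{j..<M}. w ^ j * (d i * r i w))"
    proof (intro sum.cong refl)
      fix i assume "i \<in> {j..<M}"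
      hence "w ^ i = w ^ j * w ^ (i - j)" by (simp flip: power_add)
      thus "d i * ifac_hat \<kappa> \<beta> i w = w ^ j * (d i * r i w)"
        by (simp add: ifac_hat_def r_def)
    qed
    finally show ?thesis by (simp add: G_def sum_distrib_left)
  qed
  moreover have "w ^ M = w ^ j * w ^ (M - j)" for w :: complex
    using less.prems by (simp flip: power_add)
  ultimately have "(\<lambda>w. w ^ j * G w) \<in> O[F](\<lambda>w. w ^ j * w ^ (M - j))"
    using O by simp
  moreover have ev: "eventually (\<lambda>w. w \<noteq> 0) F"
    using F(1) by (rule filter_leD) (auto simp: eventually_at_filter)
  have ev': "eventually (\<lambda>w. w ^ j \<noteq> 0) F"
    using ev by eventually_elim simp
  ultimately have "G \<in> O[F](\<lambda>w. w ^ (M - j))"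
    using landau_o.big.mult_cancel_left[OF bigtheta_refl ev'] by simp
  then obtain K where "eventually (\<lambda>w. norm (G w) \<le> K * norm (w ^ (M - j))) F"
    by (elim landau_o.bigE)
  hence "eventually (\<lambda>w. norm (G w) \<le> norm (w ^ (M - j)) * K) F" by (simp add: mult.commute)
  moreover have "((\<lambda>w::complex. w ^ (M - j)) \<longlongrightarrow> 0 ^ (M - j)) (at 0)"
    by (intro tendsto_intros)
  hence "((\<lambda>w::complex. w ^ (M - j)) \<longlongrightarrow> 0) F"
    using less.prems by (intro tendsto_mono[OF F(1)]) (simp add: power_0_left)
  ultimately have 1: "(G \<longlongrightarrow> 0) F" by (rule tendsto_0_le[rotated])
  have "isCont G 0" unfolding G_def r_def using \<kappa> by (intro continuous_intros) auto
  hence 2: "(G \<longlongrightarrow> G 0) F" using tendsto_mono[OF F(1)] by (simp add: isCont_def)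
  have "G 0 = 0" using tendsto_unique[OF F(2) 2 1] .
  moreover have "G 0 = d j / of_real \<kappa> ^ j"
  proof -
    have "G 0 = (\<Sum>i\<in>{j}. d i * r i 0)"
      unfolding G_def using less.prems by (intro sum.mono_neutral_right) (auto simp: r_def)
    thus ?thesis by (simp add: r_def)
  qed
  ultimately show ?case using \<kappa> by simp
qed

lemma filterlim_inverse_sector: "filterlim (\<lambda>s. 1 / s) (at 0) (sector_at_infinity \<delta>)"
proof -
  have "filterlim inverse (at (0::complex)) at_infinity"
    by (simp add: at_to_infinity filterlim_def)
  thus ?thesis
    unfolding sector_at_infinity_def inverse_eq_divide by (rule filterlim_mono) auto
qed

lemma eventually_sector_iff:
  "eventually P (sector_at_infinity \<delta>) \<longleftrightarrow> (\<exists>R. \<forall>s. norm s \<ge> R \<and> \<bar>Arg s\<bar> \<le> pi - \<delta> \<longrightarrow> P s)"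
  unfolding sector_at_infinity_def eventually_inf_principal eventually_at_infinity by auto

lemma filterlim_of_nat_sector:
  assumes "\<delta> \<le> pi"
  shows "filterlim of_nat (sector_at_infinity \<delta>) sequentially"
  unfolding sector_at_infinity_def
proof (subst filterlim_inf, intro conjI)
  show "filterlim (of_nat :: nat \<Rightarrow> complex) at_infinity sequentially"
    by (rule tendsto_of_nat)
  have "Arg (of_nat n) = 0" for n
    using Arg_of_real[of "real n"] by (cases "n = 0") (auto simp: Arg_zero)
  thus "filterlim of_nat (principal {s::complex. \<bar>Arg s\<bar> \<le> pi - \<delta>}) sequentially"
    using assms by (simp add: filterlim_principal)
qed

text \<open>A positive factor a leaves Arg s unchanged, so the sector bound applies at a s; the
  scaling enters through Ln(a s) = ln a + Ln s.\<close>

lemma Gamma_stirling_scaled: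
  assumes bnd: "stirling_analytic b p \<in> O[at 0](\<lambda>w. w ^ (m + 3))"
    and \<delta>: "\<delta> > 0" and p0: "poly p 0 = 0" and a: "a > 0"
  shows "\<exists>R B. \<forall>s. \<bar>Arg s\<bar> \<le> pi - \<delta> \<and> norm s \<ge> R \<longrightarrow>
           (\<exists>\<epsilon>. norm \<epsilon> \<le> B / norm s ^ (m + 1) \<and>
             Gamma (of_real a * s + of_real b) = of_real (sqrt (2 * pi)) *
               exp ((of_real a * s + of_real b - 1 / 2) * (of_real (ln a) + Ln s) - of_real a * s + poly p (1 / s / of_real a) + \<epsilon>))"
proof -
  obtain R B where R: "R > 0" and RB: "\<And>s. \<bar>Arg s\<bar> \<le> pi - \<delta> \<Longrightarrow> norm s \<ge> R \<Longrightarrow>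
           (\<exists>\<epsilon>. norm \<epsilon> \<le> B / norm s ^ (m + 1) \<and>
             Gamma (s + of_real b) = of_real (sqrt (2 * pi)) * exp (stirling_exponent b s + poly p (1 / s) + \<epsilon>))"
    using Gamma_stirling[OF bnd \<delta> p0] by blast
  have "\<exists>\<epsilon>. norm \<epsilon> \<le> (B / a ^ (m + 1)) / norm s ^ (m + 1) \<and>
             Gamma (of_real a * s + of_real b) = of_real (sqrt (2 * pi)) *
               exp ((of_real a * s + of_real b - 1 / 2) * (of_real (ln a) + Ln s) - of_real a * s + poly p (1 / s / of_real a) + \<epsilon>)"
    if s: "\<bar>Arg s\<bar> \<le> pi - \<delta>" "norm s \<ge> R / a" for s
  proof -
    have s0: "s \<noteq> 0" using s(2) R a by (auto simp: divide_le_0_iff)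
    have "Arg (of_real a * s) = Arg s" using a by (simp add: Arg_times_of_real)
    moreover have ns: "norm (of_real a * s) = a * norm s" using a by (simp add: norm_mult)
    moreover have "a * norm s \<ge> R" using s(2) a by (simp add: field_simps)
    ultimately obtain e where e: "norm e \<le> B / norm (of_real a * s) ^ (m + 1)"
       "Gamma (of_real a * s + of_real b) = of_real (sqrt (2 * pi)) * exp (stirling_exponent b (of_real a * s) + poly p (1 / (of_real a * s)) + e)"
      using RB[of "of_real a * s"] s(1) by auto
    have "Ln (of_real a * s) = of_real (ln a) + Ln s"
      using Ln_times_of_real[OF a s0] Ln_of_real[OF a] by simp
    moreover have "1 / (of_real a * s) = 1 / s / of_real a" by simp
    moreover have "B / norm (of_real a * s) ^ (m + 1) = (B / a ^ (m + 1)) / norm s ^ (m + 1)"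
      unfolding ns by (simp add: power_mult_distrib)
    ultimately show ?thesis
      using e unfolding stirling_exponent_def by (intro exI[of _ e] conjI) (simp_all only:)
  qed
  thus ?thesis by blast
qed

lemma norm_exp_minus_1_le: "norm (exp z - 1) \<le> exp (norm z) * norm z" for z :: complex
proof -
  have "norm (exp z - (\<Sum>i\<le>0. z ^ i / fact i)) \<le> exp \<bar>Re z\<bar> * norm z ^ Suc 0 / fact 0"
    by (rule Taylor_exp)
  also have "\<dots> \<le> exp (norm z) * norm z"
    using abs_Re_le_cmod[of z] by (simp add: mult_right_mono)
  finally show ?thesis by simp
qed

section \<open>Asymptotics of the normalised quotient of Gamma functions\<close>

definition struve_prefactor :: "real \<Rightarrow> real \<Rightarrow> complex \<Rightarrow> complex" where
  "struve_prefactor \<sigma> \<nu> s = of_real (struve_kappa \<sigma> * struve_A0 \<sigma> \<nu>) *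
           of_real (struve_h \<sigma> * struve_kappa \<sigma> powr struve_kappa \<sigma>) powr s"

definition struve_ratio :: "real \<Rightarrow> real \<Rightarrow> complex \<Rightarrow> complex" where
  "struve_ratio \<sigma> \<nu> s = Gamma (of_real \<sigma> * s - of_real \<nu> - 1 / 2) * rGamma (s + 3 / 2)"

text \<open>The quotient divided by its leading behaviour, so that it tends to 1. The identity
  defining the coefficients is then the expansion of this function in
  \<open>ifac_basis\<close>.\<close>

definition struve_Q :: "real \<Rightarrow> real \<Rightarrow> complex \<Rightarrow> complex" where
  "struve_Q \<sigma> \<nu> s = struve_ratio \<sigma> \<nu> s * Gamma (of_real (struve_kappa \<sigma>) * s + of_real (1 - struve_theta \<nu>)) /
     struve_prefactor \<sigma> \<nu> s"

text \<open>Everything is put into one exponential, using ln(h \<kappa>^\<kappa>) = \<sigma> ln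
  \<sigma> + \<kappa> ln \<kappa>, so that it can be subtracted from the Stirling exponents.\<close>

lemma struve_prefactor_eq:
  assumes "0 < \<sigma>" "\<sigma> < 1"
  shows "struve_prefactor \<sigma> \<nu> s = of_real (sqrt (2 * pi)) *
     exp (of_real ((- \<nu> - 1) * ln \<sigma> + (\<nu> + 2) * ln (1 - \<sigma>)) + s * of_real (\<sigma> * ln \<sigma> + (1 - \<sigma>) * ln (1 - \<sigma>)))"
proof -
  have pos: "struve_h \<sigma> * struve_kappa \<sigma> powr struve_kappa \<sigma> > 0"
    using assms by (simp add: struve_h_def struve_kappa_def)
  have "ln (struve_h \<sigma> * struve_kappa \<sigma> powr struve_kappa \<sigma>) = \<sigma> * ln \<sigma> + (1 - \<sigma>) * ln (1 - \<sigma>)"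
    using assms by (simp add: struve_h_def struve_kappa_def ln_mult_pos ln_powr)
  hence "of_real (struve_h \<sigma> * struve_kappa \<sigma> powr struve_kappa \<sigma>) powr s =
      exp (s * of_real (\<sigma> * ln \<sigma> + (1 - \<sigma>) * ln (1 - \<sigma>)))"
  proof -
    define c where "c = struve_h \<sigma> * struve_kappa \<sigma> powr struve_kappa \<sigma>"
    have "complex_of_real c powr s = exp (s * Ln (of_real c))"
      using pos unfolding c_def[symmetric] by (simp add: powr_def)
    also have "Ln (complex_of_real c) = of_real (ln c)"
      using pos by (intro Ln_of_real) (simp add: c_def)
    finally show ?thesis
      using \<open>ln (struve_h \<sigma> * struve_kappa \<sigma> powr struve_kappa \<sigma>) = _\<close> unfolding c_def by simp
  qed
  moreover have "struve_kappa \<sigma> * struve_A0 \<sigma> \<nu> = sqrt (2 * pi) * exp ((- \<nu> - 1) * ln \<sigma> + (\<nu> + 2) * ln (1 - \<sigma>))"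
  proof -
    have "((1 - \<sigma>) / \<sigma>) powr (\<nu> + 1) = exp ((\<nu> + 1) * (ln (1 - \<sigma>) - ln \<sigma>))"
      using assms by (simp add: powr_def ln_div)
    moreover have "exp (ln (1 - \<sigma>)) = 1 - \<sigma>" using assms by simp
    ultimately have "struve_kappa \<sigma> * struve_A0 \<sigma> \<nu> = sqrt (2 * pi) * (exp (ln (1 - \<sigma>)) * exp ((\<nu> + 1) * (ln (1 - \<sigma>) - ln \<sigma>)))"
      unfolding struve_kappa_def struve_A0_def by simp
    also have "exp (ln (1 - \<sigma>)) * exp ((\<nu> + 1) * (ln (1 - \<sigma>) - ln \<sigma>)) = exp ((- \<nu> - 1) * ln \<sigma> + (\<nu> + 2) * ln (1 - \<sigma>))"
      unfolding exp_add[symmetric] by (rule arg_cong[where f = exp]) (simp add: algebra_simps)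
    finally show ?thesis .
  qed
  hence "complex_of_real (struve_kappa \<sigma> * struve_A0 \<sigma> \<nu>) =
      of_real (sqrt (2 * pi)) * exp (of_real ((- \<nu> - 1) * ln \<sigma> + (\<nu> + 2) * ln (1 - \<sigma>)))"
    by (simp only: of_real_mult exp_of_real)
  ultimately show ?thesis
    unfolding struve_prefactor_def exp_add by (simp only: mult.assoc)
qed

text \<open>The three Stirling exponents and the exponent of the prefactor add up. Since \<sigma> +
  \<kappa> = 1 and the shifts satisfy (-\<nu> - 1/2) + (\<nu> + 5/2) - 3/2 = 1/2, all terms with s,
  Ln s and s Ln s cancel exactly, and only the correction polynomials and the errors
  survive.\<close>

lemma struve_Q_asymp:
  assumes \<sigma>: "0 < \<sigma>" "\<sigma> < 1" and \<delta>: "\<delta> > 0"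
    and p1: "stirling_analytic (- \<nu> - 1 / 2) p1 \<in> O[at 0](\<lambda>w. w ^ (m + 3))" "poly p1 0 = 0"
    and p2: "stirling_analytic (\<nu> + 5 / 2) p2 \<in> O[at 0](\<lambda>w. w ^ (m + 3))" "poly p2 0 = 0"
    and p3: "stirling_analytic (3 / 2) p3 \<in> O[at 0](\<lambda>w. w ^ (m + 3))" "poly p3 0 = 0"
  defines "A \<equiv> \<lambda>w. poly p1 (w / of_real \<sigma>) + poly p2 (w / of_real (1 - \<sigma>)) - poly p3 w"
  shows "(\<lambda>s. struve_Q \<sigma> \<nu> s - exp (A (1 / s))) \<in> O[sector_at_infinity \<delta>](\<lambda>s. (1 / s) ^ (m + 1))"
proof -
  have k: "1 - \<sigma> > 0" using \<sigma> by simp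
  obtain R1 B1 where 1: "\<And>s. \<bar>Arg s\<bar> \<le> pi - \<delta> \<Longrightarrow> norm s \<ge> R1 \<Longrightarrow>
           (\<exists>\<epsilon>. norm \<epsilon> \<le> B1 / norm s ^ (m + 1) \<and>
             Gamma (of_real \<sigma> * s + of_real (- \<nu> - 1 / 2)) = of_real (sqrt (2 * pi)) *
               exp ((of_real \<sigma> * s + of_real (- \<nu> - 1 / 2) - 1 / 2) * (of_real (ln \<sigma>) + Ln s) - of_real \<sigma> * s + poly p1 (1 / s / of_real \<sigma>) + \<epsilon>))"
    using Gamma_stirling_scaled[OF p1(1) \<delta> p1(2) \<sigma>(1)] by blast
  obtain R2 B2 where 2: "\<And>s. \<bar>Arg s\<bar> \<le> pi - \<delta> \<Longrightarrow> norm s \<ge> R2 \<Longrightarrow>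
           (\<exists>\<epsilon>. norm \<epsilon> \<le> B2 / norm s ^ (m + 1) \<and>
             Gamma (of_real (1 - \<sigma>) * s + of_real (\<nu> + 5 / 2)) = of_real (sqrt (2 * pi)) *
               exp ((of_real (1 - \<sigma>) * s + of_real (\<nu> + 5 / 2) - 1 / 2) * (of_real (ln (1 - \<sigma>)) + Ln s) - of_real (1 - \<sigma>) * s + poly p2 (1 / s / of_real (1 - \<sigma>)) + \<epsilon>))"
    using Gamma_stirling_scaled[OF p2(1) \<delta> p2(2) k] by blast
  obtain R3 B3 where 3: "\<And>s. \<bar>Arg s\<bar> \<le> pi - \<delta> \<Longrightarrow> norm s \<ge> R3 \<Longrightarrow>
           (\<exists>\<epsilon>. norm \<epsilon> \<le> B3 / norm s ^ (m + 1) \<and>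
             Gamma (of_real 1 * s + of_real (3 / 2)) = of_real (sqrt (2 * pi)) *
               exp ((of_real 1 * s + of_real (3 / 2) - 1 / 2) * (of_real (ln 1) + Ln s) - of_real 1 * s + poly p3 (1 / s / of_real 1) + \<epsilon>))"
    using Gamma_stirling_scaled[OF p3(1) \<delta> p3(2) zero_less_one] by blast
  define R where "R = max (max R1 R2) (max R3 1)"
  have "\<exists>e. norm e \<le> (B1 + B2 + B3) * norm ((1 / s) ^ (m + 1)) \<and> struve_Q \<sigma> \<nu> s = exp (A (1 / s)) * exp e"
    if s: "norm s \<ge> R \<and> \<bar>Arg s\<bar> \<le> pi - \<delta>" for s
  proof -
    obtain e1 where e1: "norm e1 \<le> B1 / norm s ^ (m + 1)" "Gamma (of_real \<sigma> * s + of_real (- \<nu> - 1 / 2)) = of_real (sqrt (2 * pi)) *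
               exp ((of_real \<sigma> * s + of_real (- \<nu> - 1 / 2) - 1 / 2) * (of_real (ln \<sigma>) + Ln s) - of_real \<sigma> * s + poly p1 (1 / s / of_real \<sigma>) + e1)"
      using 1[of s] s by (auto simp: R_def)
    obtain e2 where e2: "norm e2 \<le> B2 / norm s ^ (m + 1)" "Gamma (of_real (1 - \<sigma>) * s + of_real (\<nu> + 5 / 2)) = of_real (sqrt (2 * pi)) *
               exp ((of_real (1 - \<sigma>) * s + of_real (\<nu> + 5 / 2) - 1 / 2) * (of_real (ln (1 - \<sigma>)) + Ln s) - of_real (1 - \<sigma>) * s + poly p2 (1 / s / of_real (1 - \<sigma>)) + e2)"
      using 2[of s] s by (auto simp: R_def)
    obtain e3 where e3: "norm e3 \<le> B3 / norm s ^ (m + 1)" "Gamma (of_real 1 * s + of_real (3 / 2)) = of_real (sqrt (2 * pi)) *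
               exp ((of_real 1 * s + of_real (3 / 2) - 1 / 2) * (of_real (ln 1) + Ln s) - of_real 1 * s + poly p3 (1 / s / of_real 1) + e3)"
      using 3[of s] s by (auto simp: R_def)
    define S where "S = complex_of_real (sqrt (2 * pi))"
    have S0: "S \<noteq> 0" by (simp add: S_def)
    define L where "L = Ln s"
    define x1 x2 x3 x4 where "x1 = (of_real \<sigma> * s + of_real (- \<nu> - 1 / 2) - 1 / 2) * (of_real (ln \<sigma>) + L) - of_real \<sigma> * s + poly p1 (1 / s / of_real \<sigma>) + e1"
      and "x2 = (of_real (1 - \<sigma>) * s + of_real (\<nu> + 5 / 2) - 1 / 2) * (of_real (ln (1 - \<sigma>)) + L) - of_real (1 - \<sigma>) * s + poly p2 (1 / s / of_real (1 - \<sigma>)) + e2"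
      and "x3 = (of_real 1 * s + of_real (3 / 2) - 1 / 2) * (of_real (ln 1) + L) - of_real 1 * s + poly p3 (1 / s / of_real 1) + e3"
      and "x4 = of_real ((- \<nu> - 1) * ln \<sigma> + (\<nu> + 2) * ln (1 - \<sigma>)) + s * of_real (\<sigma> * ln \<sigma> + (1 - \<sigma>) * ln (1 - \<sigma>))"
    have "Gamma (of_real \<sigma> * s - of_real \<nu> - 1 / 2) = S * exp x1"
      using e1(2) unfolding x1_def S_def L_def by (simp add: algebra_simps)
    moreover have "Gamma (of_real (struve_kappa \<sigma>) * s + of_real (1 - struve_theta \<nu>)) = S * exp x2"
    proof -
      have "1 - struve_theta \<nu> = \<nu> + 5 / 2" by (simp add: struve_theta_def)
      thus ?thesis using e2(2) unfolding x2_def S_def L_def struve_kappa_def by simp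
    qed
    moreover have "Gamma (s + 3 / 2) = S * exp x3"
      using e3(2) unfolding x3_def S_def L_def by simp
    moreover have "struve_prefactor \<sigma> \<nu> s = S * exp x4"
      unfolding struve_prefactor_eq[OF \<sigma>] x4_def S_def ..
    ultimately have "struve_Q \<sigma> \<nu> s = exp (x1 + x2 - x3 - x4)"
    proof -
      have "S * E1 * inverse (S * E3) * (S * E2) / (S * E4) = E1 * E2 / E3 / E4" for E1 E2 E3 E4
        using S0 by (simp add: field_simps)
      thus ?thesis unfolding struve_Q_def struve_ratio_def rGamma_inverse_Gamma exp_diff exp_add
        using \<open>Gamma (of_real \<sigma> * s - of_real \<nu> - 1 / 2) = S * exp x1\<close> \<open>Gamma (s + 3 / 2) = S * exp x3\<close>
          \<open>Gamma (of_real (struve_kappa \<sigma>) * s + of_real (1 - struve_theta \<nu>)) = S * exp x2\<close>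
          \<open>struve_prefactor \<sigma> \<nu> s = S * exp x4\<close> by (simp only:)
    qed
    also have "x1 + x2 - x3 - x4 = A (1 / s) + (e1 + e2 - e3)"
    proof -
      have "(a * s + (- n - 1/2) - 1/2) * (l + L) - a * s + y1 + e1 + ((1 - a) * s + (n + 5/2) - 1/2) * (k + L) - (1 - a) * s + y2 + e2
          - ((1 * s + 3/2 - 1/2) * (0 + L) - 1 * s + y3 + e3) - ((- n - 1) * l + (n + 2) * k + s * (a * l + (1 - a) * k)) = y1 + y2 - y3 + (e1 + e2 - e3)"
        for a n l k y1 y2 y3 :: complex
        by (simp add: algebra_simps)
      from this[of "of_real \<sigma>" "of_real \<nu>" "of_real (ln \<sigma>)" _ "of_real (ln (1 - \<sigma>))"]
      show ?thesis unfolding x1_def x2_def x3_def x4_def A_def by simp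
    qed
    finally have "struve_Q \<sigma> \<nu> s = exp (A (1 / s)) * exp (e1 + e2 - e3)" by (simp add: exp_add)
    moreover have "norm (e1 + e2 - e3) \<le> norm e1 + norm e2 + norm e3"
      using norm_triangle_ineq4[of "e1 + e2" e3] norm_triangle_ineq[of e1 e2] by linarith
    hence "norm (e1 + e2 - e3) \<le> (B1 + B2 + B3) * norm ((1 / s) ^ (m + 1))"
    proof -
      define X where "X = norm s ^ (m + 1)"
      have n1: "norm ((1 / s) ^ (m + 1)) = 1 / X" by (simp add: X_def norm_power norm_divide power_divide norm_mult)
      have n2: "(B1 + B2 + B3) * (1 / X) = B1 / X + B2 / X + B3 / X" by (simp add: add_divide_distrib)
      show ?thesis unfolding n1 n2
        using e1(1) e2(1) e3(1) \<open>norm (e1 + e2 - e3) \<le> _\<close> unfolding X_def[symmetric] by linarith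
    qed
    ultimately show ?thesis by blast
  qed
  hence "\<forall>s. \<exists>e. norm s \<ge> R \<and> \<bar>Arg s\<bar> \<le> pi - \<delta> \<longrightarrow>
      norm e \<le> (B1 + B2 + B3) * norm ((1 / s) ^ (m + 1)) \<and> struve_Q \<sigma> \<nu> s = exp (A (1 / s)) * exp e"
    by blast
  from choice[OF this] obtain e where e: "\<And>s. norm s \<ge> R \<and> \<bar>Arg s\<bar> \<le> pi - \<delta> \<Longrightarrow> norm (e s) \<le> (B1 + B2 + B3) * norm ((1 / s) ^ (m + 1)) \<and> struve_Q \<sigma> \<nu> s = exp (A (1 / s)) * exp (e s)"
    by blast
  let ?F = "sector_at_infinity \<delta>"
  have e_O: "e \<in> O[?F](\<lambda>s. (1 / s) ^ (m + 1))"
    by (rule bigoI[where c = "B1 + B2 + B3"]) (use e in \<open>auto simp: eventually_sector_iff\<close>)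
  have w0: "((\<lambda>s. 1 / s) \<longlongrightarrow> 0) ?F"
    using filterlim_inverse_sector[of \<delta>] by (simp add: filterlim_at)
  have "((\<lambda>s::complex. (1 / s) ^ (m + 1)) \<longlongrightarrow> 0 ^ (m + 1)) ?F"
    by (intro tendsto_power w0)
  moreover obtain K where "eventually (\<lambda>s. norm (e s) \<le> K * norm ((1 / s) ^ (m + 1))) ?F"
    using e_O by (elim landau_o.bigE)
  hence "eventually (\<lambda>s. norm (e s) \<le> norm ((1 / s) ^ (m + 1)) * K) ?F" by (simp add: mult.commute)
  ultimately have "(e \<longlongrightarrow> 0) ?F" using tendsto_0_le by fastforce
  hence "eventually (\<lambda>s. norm (e s) < 1) ?F"
    using order_tendstoD(2)[OF tendsto_norm_zero, of e ?F 1] by simp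
  hence "(\<lambda>s. exp (e s) - 1) \<in> O[?F](e)"
    by (intro bigoI[where c = "exp 1"])
       (erule eventually_mono, rule order.trans[OF norm_exp_minus_1_le], simp add: mult_right_mono)
  hence "(\<lambda>s. exp (e s) - 1) \<in> O[?F](\<lambda>s. (1 / s) ^ (m + 1))"
    using e_O landau_o.big_trans by blast
  moreover have "(\<lambda>s. exp (A (1 / s))) \<in> O[?F](\<lambda>_. 1)"
  proof (rule bigoI_tendsto[where c = "exp (A 0)"])
    have "isCont (\<lambda>w. exp (A w)) 0"
      unfolding A_def using \<sigma> by (intro continuous_intros) auto
    from isCont_tendsto_compose[OF this w0] show "((\<lambda>s. exp (A (1 / s)) / 1) \<longlongrightarrow> exp (A 0)) ?F"
      by simp
  qed auto
  ultimately have "(\<lambda>s. exp (A (1 / s)) * (exp (e s) - 1)) \<in> O[?F](\<lambda>s. 1 * (1 / s) ^ (m + 1))"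
    by (rule landau_o.big.mult[rotated])
  moreover have "eventually (\<lambda>s. exp (A (1 / s)) * (exp (e s) - 1) = struve_Q \<sigma> \<nu> s - exp (A (1 / s))) ?F"
    unfolding eventually_sector_iff using e by (intro exI[of _ R]) (auto simp: algebra_simps)
  ultimately show ?thesis by (simp add: landau_o.big.in_cong)
qed


lemma exp_poly_analytic:
  fixes p1 p2 p3 :: "complex poly"
  assumes "a \<noteq> 0" "b \<noteq> 0"
  shows "(\<lambda>w. exp (poly p1 (w / a) + poly p2 (w / b) - poly p3 w)) analytic_on {0}"
  using assms by (intro analytic_intros analytic_on_poly_comp) auto

lemma bigo_sector_of_bigo_at_0:
  assumes "f \<in> O[at 0](g)"
  shows "(\<lambda>s. f (1 / s)) \<in> O[sector_at_infinity \<delta>](\<lambda>s. g (1 / s))"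
  using landau_o.big.compose[OF assms filterlim_inverse_sector] by simp

lemma eventually_sector_nz: "eventually (\<lambda>s. s \<noteq> 0) (sector_at_infinity \<delta>)"
  unfolding eventually_sector_iff by (intro exI[of _ 1]) auto

lemma struve_Q_expand:
  assumes \<sigma>: "0 < \<sigma>" "\<sigma> < 1"
    and Q: "\<And>\<delta>. \<delta> > 0 \<Longrightarrow> (\<lambda>s. struve_Q \<sigma> \<nu> s - B (1 / s)) \<in> O[sector_at_infinity \<delta>](\<lambda>s. (1 / s) ^ M)"
    and c: "(\<lambda>w. B w - (\<Sum>j<M. c j * ifac_hat (struve_kappa \<sigma>) (1 - struve_theta \<nu>) j w)) \<in> O[at 0](\<lambda>w. w ^ M)"
    and \<delta>: "\<delta> > 0"
  shows "(\<lambda>s. struve_Q \<sigma> \<nu> s - (\<Sum>j<M. c j * ifac_basis (struve_kappa \<sigma>) (1 - struve_theta \<nu>) j s))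
    \<in> O[sector_at_infinity \<delta>](\<lambda>s. (1 / s) ^ M)"
proof -
  have ev: "eventually (\<lambda>s. (struve_Q \<sigma> \<nu> s - B (1 / s)) + (B (1 / s) - (\<Sum>j<M. c j * ifac_hat (struve_kappa \<sigma>) (1 - struve_theta \<nu>) j (1 / s)))
      = struve_Q \<sigma> \<nu> s - (\<Sum>j<M. c j * ifac_basis (struve_kappa \<sigma>) (1 - struve_theta \<nu>) j s)) (sector_at_infinity \<delta>)"
    using eventually_sector_nz by eventually_elim (simp add: ifac_hat_eq)
  show ?thesis
    by (rule iffD1[OF landau_o.big.in_cong[OF ev] sum_in_bigo(1)[OF Q[OF \<delta>] bigo_sector_of_bigo_at_0[OF c]]])
qed

lemma struve_Q_expansion_exists:
  assumes \<sigma>: "0 < \<sigma>" "\<sigma> < 1"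
  shows "\<exists>c. \<forall>\<delta>>0. (\<lambda>s. struve_Q \<sigma> \<nu> s - (\<Sum>j<Suc m. c j * ifac_basis (struve_kappa \<sigma>) (1 - struve_theta \<nu>) j s))
    \<in> O[sector_at_infinity \<delta>](\<lambda>s. (1 / s) ^ Suc m)"
proof -
  obtain p1 where p1: "poly p1 0 = 0" "stirling_analytic (- \<nu> - 1 / 2) p1 \<in> O[at 0](\<lambda>w. w ^ (m + 3))"
    using stirling_poly_exists by blast
  obtain p2 where p2: "poly p2 0 = 0" "stirling_analytic (\<nu> + 5 / 2) p2 \<in> O[at 0](\<lambda>w. w ^ (m + 3))"
    using stirling_poly_exists by blast
  obtain p3 where p3: "poly p3 0 = 0" "stirling_analytic (3 / 2) p3 \<in> O[at 0](\<lambda>w. w ^ (m + 3))"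
    using stirling_poly_exists by blast
  define B where "B = (\<lambda>w. exp (poly p1 (w / of_real \<sigma>) + poly p2 (w / of_real (1 - \<sigma>)) - poly p3 w))"
  have Q: "(\<lambda>s. struve_Q \<sigma> \<nu> s - B (1 / s)) \<in> O[sector_at_infinity \<delta>](\<lambda>s. (1 / s) ^ Suc m)" if "\<delta> > 0" for \<delta>
    using struve_Q_asymp[OF \<sigma> that p1(2,1) p2(2,1) p3(2,1)] unfolding B_def by simp
  have k: "struve_kappa \<sigma> \<noteq> 0" using \<sigma> by (simp add: struve_kappa_def)
  have "complex_of_real \<sigma> \<noteq> 0" "complex_of_real (1 - \<sigma>) \<noteq> 0"
    using \<sigma> unfolding of_real_eq_0_iff by auto
  hence "B analytic_on {0}" unfolding B_def by (intro exp_poly_analytic)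
  from expand_in_ifac_hat[OF k this, where k = "Suc m" and \<beta> = "1 - struve_theta \<nu>"] obtain c where
    c: "(\<lambda>w. B w - (\<Sum>j<Suc m. c j * ifac_hat (struve_kappa \<sigma>) (1 - struve_theta \<nu>) j w)) \<in> O[at 0](\<lambda>w. w ^ Suc m)" ..
  show ?thesis using struve_Q_expand[OF \<sigma> Q c] by blast
qed

text \<open>The difference of the two expansions is a combination of the first M basis functions
  that is O(n^(-M)) along the integers; with w = 1/n this is the situation of
  \<open>ifac_hat_unique\<close> for the image filter F.\<close>

lemma struve_Q_expansion_unique:
  assumes \<sigma>: "0 < \<sigma>" "\<sigma> < 1"
    and c: "(\<lambda>n. struve_Q \<sigma> \<nu> (of_nat n) - (\<Sum>j<M. c j * ifac_basis (struve_kappa \<sigma>) (1 - struve_theta \<nu>) j (of_nat n)))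
       \<in> O(\<lambda>n. (1 / of_nat n) ^ M)"
    and c': "(\<lambda>n. struve_Q \<sigma> \<nu> (of_nat n) - (\<Sum>j<M. c' j * ifac_basis (struve_kappa \<sigma>) (1 - struve_theta \<nu>) j (of_nat n)))
       \<in> O(\<lambda>n. (1 / of_nat n) ^ M)"
    and j: "j < M"
  shows "c j = c' j"
proof -
  let ?b = "ifac_basis (struve_kappa \<sigma>) (1 - struve_theta \<nu>)" and ?h = "ifac_hat (struve_kappa \<sigma>) (1 - struve_theta \<nu>)"
  define F where "F = filtermap (\<lambda>n. 1 / (of_nat n :: complex)) sequentially"
  have "filterlim inverse (at (0::complex)) at_infinity"
    by (simp add: at_to_infinity filterlim_def)
  from filterlim_compose[OF this tendsto_of_nat] have F: "F \<le> at 0"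
    by (simp add: F_def filterlim_def inverse_eq_divide)
  have Fb: "F \<noteq> bot" by (simp add: F_def filtermap_bot_iff)
  have "(\<lambda>n. \<Sum>j<M. (c j - c' j) * ?b j (of_nat n)) \<in> O(\<lambda>n. (1 / of_nat n) ^ M)"
    using sum_in_bigo(2)[OF c' c] by (simp add: algebra_simps sum_subtractf)
  moreover have "eventually (\<lambda>n. (\<Sum>j<M. (c j - c' j) * ?b j (of_nat n)) = (\<Sum>j<M. (c j - c' j) * ?h j (1 / of_nat n))) sequentially"
    using eventually_gt_at_top[of 0] by eventually_elim (simp add: ifac_hat_eq)
  ultimately have "(\<lambda>n. \<Sum>j<M. (c j - c' j) * ?h j (1 / of_nat n)) \<in> O(\<lambda>n. (1 / of_nat n) ^ M)"
    by (simp add: landau_o.big.in_cong)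
  hence "(\<lambda>w. \<Sum>j<M. (c j - c' j) * ?h j w) \<in> O[F](\<lambda>w. w ^ M)"
    unfolding F_def by (simp add: landau_o.big.in_filtermap_iff)
  from ifac_hat_unique[OF _ F Fb this j] \<sigma> show ?thesis by (simp add: struve_kappa_def)
qed

lemma ifac_basis_cnj: "cnj (ifac_basis \<kappa> \<beta> j s) = ifac_basis \<kappa> \<beta> j (cnj s)"
proof -
  have "cnj (pochhammer z j) = pochhammer (cnj z) j" for z by (induction j) (auto simp: pochhammer_Suc)
  thus ?thesis by (simp add: ifac_basis_def)
qed

lemma struve_prefactor_cnj:
  assumes "0 < \<sigma>" "\<sigma> < 1"
  shows "cnj (struve_prefactor \<sigma> \<nu> s) = struve_prefactor \<sigma> \<nu> (cnj s)"
  unfolding struve_prefactor_eq[OF assms] by (simp add: exp_cnj)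

lemma struve_Q_cnj:
  assumes "0 < \<sigma>" "\<sigma> < 1"
  shows "cnj (struve_Q \<sigma> \<nu> s) = struve_Q \<sigma> \<nu> (cnj s)"
  unfolding struve_Q_def struve_ratio_def
  by (simp add: struve_prefactor_cnj[OF assms] cnj_Gamma cnj_rGamma)


lemma power_bigo_power:
  fixes i j :: nat
  assumes "j \<le> i"
  shows "(\<lambda>w::complex. w ^ i) \<in> O[at 0](\<lambda>w. w ^ j)"
proof -
  have "(\<lambda>w::complex. w ^ j * w ^ (i - j)) \<in> O[at 0](\<lambda>w. w ^ j * 1)"
    by (intro landau_o.big.mult isCont_bigo_1 continuous_intros) auto
  thus ?thesis using assms by (simp flip: power_add)
qed

lemma ifac_hat_bigo:
  assumes "\<kappa> \<noteq> 0"
  shows "ifac_hat \<kappa> \<beta> j \<in> O[at 0](\<lambda>w. w ^ j)"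
proof -
  have "(\<lambda>w::complex. w ^ j * (1 / (\<Prod>i<j. of_real \<kappa> + (of_real \<beta> + of_nat i) * w))) \<in> O[at 0](\<lambda>w. w ^ j * 1)"
    using assms by (intro landau_o.big.mult isCont_bigo_1 continuous_intros) auto
  moreover have "ifac_hat \<kappa> \<beta> j = (\<lambda>w. w ^ j * (1 / (\<Prod>i<j. of_real \<kappa> + (of_real \<beta> + of_nat i) * w)))"
    by (simp add: ifac_hat_def fun_eq_iff)
  ultimately show ?thesis by (simp only: mult_1_right)
qed

lemma ifac_basis_bigo:
  assumes "\<kappa> \<noteq> 0"
  shows "ifac_basis \<kappa> \<beta> j \<in> O[sector_at_infinity \<delta>](\<lambda>s. (1 / s) ^ j)"
proof -
  have "eventually (\<lambda>s. ifac_hat \<kappa> \<beta> j (1 / s) = ifac_basis \<kappa> \<beta> j s) (sector_at_infinity \<delta>)"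
    using eventually_sector_nz by eventually_elim (simp add: ifac_hat_eq)
  from landau_o.big.in_cong[OF this] bigo_sector_of_bigo_at_0[OF ifac_hat_bigo[OF assms], of \<beta> j \<delta>]
  show ?thesis by blast
qed

lemma ifac_expansion_truncate:
  assumes f: "(\<lambda>s. f s - (\<Sum>i<M. c i * ifac_basis \<kappa> \<beta> i s)) \<in> O[sector_at_infinity \<delta>](\<lambda>s. (1 / s) ^ M)"
    and j: "j \<le> M" and \<kappa>: "\<kappa> \<noteq> 0"
  shows "(\<lambda>s. f s - (\<Sum>i<j. c i * ifac_basis \<kappa> \<beta> i s)) \<in> O[sector_at_infinity \<delta>](\<lambda>s. (1 / s) ^ j)"
proof -
  have pw: "(\<lambda>s. (1 / s) ^ i) \<in> O[sector_at_infinity \<delta>](\<lambda>s. (1 / s) ^ j)" if "i \<ge> j" for i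
    using bigo_sector_of_bigo_at_0[OF power_bigo_power[OF that]] .
  have "(\<lambda>s. c i * ifac_basis \<kappa> \<beta> i s) \<in> O[sector_at_infinity \<delta>](\<lambda>s. (1 / s) ^ j)" if "i \<ge> j" for i
  proof -
    have "(\<lambda>s. c i * ifac_basis \<kappa> \<beta> i s) \<in> O[sector_at_infinity \<delta>](\<lambda>s. 1 * (1 / s) ^ i)"
      by (intro landau_o.big.mult ifac_basis_bigo \<kappa>) auto
    hence "(\<lambda>s. c i * ifac_basis \<kappa> \<beta> i s) \<in> O[sector_at_infinity \<delta>](\<lambda>s. (1 / s) ^ i)"
      by (simp only: mult_1_left)
    from landau_o.big_trans[OF this pw[OF that]] show ?thesis .
  qed
  hence "(\<lambda>s. \<Sum>i\<in>{j..<M}. c i * ifac_basis \<kappa> \<beta> i s) \<in> O[sector_at_infinity \<delta>](\<lambda>s. (1 / s) ^ j)"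
    by (intro big_sum_in_bigo) auto
  from sum_in_bigo(1)[OF landau_o.big_trans[OF f pw[OF j]] this]
  moreover have "(\<Sum>i<M. g i) = (\<Sum>i<j. g i) + (\<Sum>i\<in>{j..<M}. g i)" for g :: "nat \<Rightarrow> complex"
    using sum.atLeastLessThan_concat[of 0 j M g] j by (simp add: lessThan_atLeast0)
  ultimately show ?thesis by simp
qed

text \<open>The coefficients found for different truncations agree by uniqueness, and they are real because
  the quotient commutes with conjugation.\<close>

lemma struve_Q_coeffs:
  assumes \<sigma>: "0 < \<sigma>" "\<sigma> < 1"
  shows "\<exists>c :: nat \<Rightarrow> real. \<forall>M\<ge>1. \<forall>\<delta>>0.
     (\<lambda>s. struve_Q \<sigma> \<nu> s - (\<Sum>j<M. of_real (c j) * ifac_basis (struve_kappa \<sigma>) (1 - struve_theta \<nu>) j s))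
    \<in> O[sector_at_infinity \<delta>](\<lambda>s. (1 / s) ^ M)"
proof -
  let ?b = "ifac_basis (struve_kappa \<sigma>) (1 - struve_theta \<nu>)"
  have k: "struve_kappa \<sigma> \<noteq> 0" using \<sigma> by (simp add: struve_kappa_def)
  have "\<forall>m. \<exists>c. \<forall>\<delta>>0. (\<lambda>s. struve_Q \<sigma> \<nu> s - (\<Sum>j<Suc m. c j * ?b j s)) \<in> O[sector_at_infinity \<delta>](\<lambda>s. (1 / s) ^ Suc m)"
    using struve_Q_expansion_exists[OF \<sigma>] by blast
  from choice[OF this] obtain C where C: "\<And>m \<delta>. \<delta> > 0 \<Longrightarrow> (\<lambda>s. struve_Q \<sigma> \<nu> s - (\<Sum>j<Suc m. C m j * ?b j s)) \<in> O[sector_at_infinity \<delta>](\<lambda>s. (1 / s) ^ Suc m)"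
    by blast
  have Cn: "(\<lambda>n. struve_Q \<sigma> \<nu> (of_nat n) - (\<Sum>i<Suc j. C m i * ?b i (of_nat n))) \<in> O(\<lambda>n. (1 / of_nat n) ^ Suc j)" if "j \<le> m" for j m
  proof -
    have "Suc j \<le> Suc m" using that by simp
    from landau_o.big.compose[OF ifac_expansion_truncate[OF C[OF pi_gt_zero] this k] filterlim_of_nat_sector[of pi]]
    show ?thesis by simp
  qed
  \<comment> \<open>The diagonal choice: it is shown below that C m j is real and the same for all m
    \<ge> j.\<close>
  define c where "c = (\<lambda>j. Re (C j j))"
  have real: "cnj (C j j) = C j j" for j
  proof (rule struve_Q_expansion_unique[OF \<sigma>, where M = "Suc j" and c = "\<lambda>i. cnj (C j i)" and c' = "C j"])
    from Cn[OF order_refl, of j] obtain K where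
      "eventually (\<lambda>n. norm (struve_Q \<sigma> \<nu> (of_nat n) - (\<Sum>i<Suc j. C j i * ?b i (of_nat n))) \<le> K * norm ((1 / complex_of_nat n) ^ Suc j)) sequentially"
      by (elim landau_o.bigE)
    thus "(\<lambda>n. struve_Q \<sigma> \<nu> (of_nat n) - (\<Sum>i<Suc j. cnj (C j i) * ?b i (of_nat n))) \<in> O(\<lambda>n. (1 / of_nat n) ^ Suc j)"
    proof (intro bigoI[where c = K], elim eventually_mono)
      fix n :: nat
      have "cnj (struve_Q \<sigma> \<nu> (of_nat n) - (\<Sum>i<Suc j. C j i * ?b i (of_nat n))) =
        struve_Q \<sigma> \<nu> (of_nat n) - (\<Sum>i<Suc j. cnj (C j i) * ?b i (of_nat n))"
        by (simp add: struve_Q_cnj[OF \<sigma>] ifac_basis_cnj)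
      hence "norm (struve_Q \<sigma> \<nu> (of_nat n) - (\<Sum>i<Suc j. cnj (C j i) * ?b i (of_nat n))) =
        norm (struve_Q \<sigma> \<nu> (of_nat n) - (\<Sum>i<Suc j. C j i * ?b i (of_nat n)))"
        by (metis complex_mod_cnj)
      moreover assume "norm (struve_Q \<sigma> \<nu> (of_nat n) - (\<Sum>i<Suc j. C j i * ?b i (of_nat n))) \<le> K * norm ((1 / complex_of_nat n) ^ Suc j)"
      ultimately show "norm (struve_Q \<sigma> \<nu> (of_nat n) - (\<Sum>i<Suc j. cnj (C j i) * ?b i (of_nat n))) \<le> K * norm ((1 / complex_of_nat n) ^ Suc j)"
        by (simp only:)
    qed
  qed (use Cn[of j j] in auto)
  have cC: "C m j = of_real (c j)" if "j \<le> m" for j m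
  proof -
    have "C m j = C j j"
      by (rule struve_Q_expansion_unique[OF \<sigma> Cn[OF that] Cn[OF order_refl]]) simp
    also have "C j j = of_real (c j)" using real[of j] by (simp add: c_def complex_eq_iff)
    finally show ?thesis .
  qed
  show ?thesis
  proof (intro exI[of _ c] allI impI)
    fix M :: nat and \<delta> :: real assume M: "M \<ge> 1" "\<delta> > 0"
    then obtain m where m: "M = Suc m" by (cases M) auto
    have "(\<Sum>j<M. of_real (c j) * ?b j s) = (\<Sum>j<Suc m. C m j * ?b j s)" for s
      unfolding m by (intro sum.cong refl) (auto simp: cC)
    thus "(\<lambda>s. struve_Q \<sigma> \<nu> s - (\<Sum>j<M. of_real (c j) * ?b j s)) \<in> O[sector_at_infinity \<delta>](\<lambda>s. (1 / s) ^ M)"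
      using C[OF M(2), of m] unfolding m by simp
  qed
qed


text \<open>The exponential is multiplied out up to w^3 and the powers of w are replaced by basis
  functions. Each basis function also contributes to higher powers: the first has -b w^2/k^2 + b^2
  w^3/k^3, the second -(2 b + 1) w^3/k^3. The summand c1 b of c2 and the summands -c1 b^2 + c2 (2 b
  + 1) of c3 undo these contributions.\<close>

lemma exp_cubic_in_ifac_hat:
  fixes l1 l2 l3 :: complex and \<kappa> \<beta> :: real
  assumes \<kappa>: "\<kappa> \<noteq> 0"
  defines "k \<equiv> complex_of_real \<kappa>" and "b \<equiv> complex_of_real \<beta>"
  defines "c1 \<equiv> k * l1"
  defines "c2 \<equiv> k^2 * (l2 + l1^2 / 2) + c1 * b"
  defines "c3 \<equiv> k^3 * (l3 + l1 * l2 + l1^3 / 6) - c1 * b^2 + c2 * (2 * b + 1)"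
  shows "(\<lambda>w. exp (l1 * w + l2 * w^2 + l3 * w^3) - (\<Sum>j<4. [1, c1, c2, c3] ! j * ifac_hat \<kappa> \<beta> j w)) \<in> O[at 0](\<lambda>w. w ^ 4)"
proof -
  have k0: "k \<noteq> 0" using \<kappa> by (simp add: k_def)
  define A where "A = (\<lambda>w. l1 * w + l2 * w^2 + l3 * w^3)"
  define E where "E = (\<lambda>w. exp (A w) - (1 + A w + A w ^ 2 / 2 + A w ^ 3 / 6))"
  have E: "E \<in> O[at 0](\<lambda>w. w ^ 4)"
  proof -
    have "(A \<longlongrightarrow> A 0) (at 0)" unfolding A_def by (intro tendsto_intros)
    hence "(A \<longlongrightarrow> 0) (at 0)" by (simp add: A_def)
    hence "eventually (\<lambda>w. norm (A w) < 1) (at 0)"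
      using order_tendstoD(2)[OF tendsto_norm_zero, of A "at 0" 1] by simp
    hence "E \<in> O[at 0](\<lambda>w. A w ^ 4)"
    proof (intro bigoI[where c = "exp 1"], elim eventually_mono)
      fix w assume w: "norm (A w) < 1"
      have "norm (E w) = norm (exp (A w) - (\<Sum>k\<le>3. A w ^ k / fact k))"
        by (simp add: E_def atMost_Suc eval_nat_numeral fact_reduce add_ac)
      also have "\<dots> \<le> exp \<bar>Re (A w)\<bar> * norm (A w) ^ Suc 3 / fact 3" by (rule Taylor_exp)
      also have "\<dots> \<le> exp 1 * norm (A w) ^ 4 / 1"
        using w abs_Re_le_cmod[of "A w"] by (intro frac_le mult_mono) auto
      finally show "norm (E w) \<le> exp 1 * norm (A w ^ 4)" by (simp add: norm_power)
    qed
    moreover have "A \<in> O[at 0](\<lambda>w. w)"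
    proof -
      have "A analytic_on {0}" unfolding A_def by (intro analytic_intros)
      from analytic_minus_value_bigo[OF this] show ?thesis by (simp add: A_def)
    qed
    hence "(\<lambda>w. A w ^ 4) \<in> O[at 0](\<lambda>w. w ^ 4)" by (rule landau_o.big_power)
    ultimately show ?thesis by (rule landau_o.big_trans)
  qed
  define z where "z = (\<lambda>w. l2 + l3 * w)"
  \<comment> \<open>\<open>R\<close> gathers everything of order at least 4: the tails of the powers
    of A and the exact tails of the first two basis functions.\<close>
  define R where "R = (\<lambda>w. z w ^ 2 / 2 + l1 * l3 + (3 * l1^2 * z w + 3 * l1 * w * z w ^ 2 + w^2 * z w ^ 3) / 6
     - c1 * (- (b^3) / (k^3 * (k + b * w)))
     - c2 * ((- k * b * (b + 1) + (2 * b + 1)^2 * k + (2 * b + 1) * b * (b + 1) * w) / (k^3 * ((k + b * w) * (k + (b + 1) * w)))))"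
  have "(\<lambda>w. w ^ 4 * R w) \<in> O[at 0](\<lambda>w. w ^ 4 * 1)"
    unfolding R_def z_def using k0 by (intro landau_o.big.mult isCont_bigo_1 continuous_intros) auto
  hence wR: "(\<lambda>w. w ^ 4 * R w) \<in> O[at 0](\<lambda>w. w ^ 4)" by simp
  have "(\<lambda>w. c3 / k^3 * (w ^ 3 - of_real \<kappa> ^ 3 * ifac_hat \<kappa> \<beta> 3 w)) \<in> O[at 0](\<lambda>w. 1 * w ^ Suc 3)"
    by (intro landau_o.big.mult ifac_hat_leading \<kappa>) auto
  hence h3: "(\<lambda>w. c3 / k^3 * (w ^ 3 - k ^ 3 * ifac_hat \<kappa> \<beta> 3 w)) \<in> O[at 0](\<lambda>w. w ^ 4)"
    unfolding k_def by simp
  have cont: "eventually (\<lambda>w. f w \<noteq> 0) (at 0)" if "isCont f 0" "f 0 \<noteq> 0" for f :: "complex \<Rightarrow> complex"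
    using tendsto_imp_eventually_ne[of f "f 0" "at 0" 0] that by (simp add: isCont_def)
  have u: "eventually (\<lambda>w. k + b * w \<noteq> 0) (at 0)" and v: "eventually (\<lambda>w. k + (b + 1) * w \<noteq> 0) (at 0)"
    using k0 by (auto intro!: cont continuous_intros)
  have "eventually (\<lambda>w. E w + w ^ 4 * R w + c3 / k^3 * (w ^ 3 - k ^ 3 * ifac_hat \<kappa> \<beta> 3 w) =
      exp (l1 * w + l2 * w^2 + l3 * w^3) - (\<Sum>j<4. [1, c1, c2, c3] ! j * ifac_hat \<kappa> \<beta> j w)) (at 0)"
    using u v
  proof eventually_elim
    case (elim w)
    have h1: "ifac_hat \<kappa> \<beta> 1 w = w / k - b * w^2 / k^2 + b^2 * w^3 / k^3 + w^4 * (- (b^3) / (k^3 * (k + b * w)))"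
    proof -
      have "w / U = w / k - (U - k) * w / k^2 + (U - k)^2 * w / k^3 + w * (- ((U - k)^3) / (k^3 * U))" if "U \<noteq> 0" for U
        using that k0 by (simp add: field_simps power2_eq_square power3_eq_cube)
      from this[of "k + b * w"] elim show ?thesis
        by (simp add: ifac_hat_def k_def b_def power2_eq_square power3_eq_cube eval_nat_numeral mult_ac)
    qed
    have h2: "ifac_hat \<kappa> \<beta> 2 w = w^2 / k^2 - (2 * b + 1) * w^3 / k^3 +
        w^4 * ((- k * b * (b + 1) + (2 * b + 1)^2 * k + (2 * b + 1) * b * (b + 1) * w) / (k^3 * ((k + b * w) * (k + (b + 1) * w))))"
    proof -
      define W where "W = (k + b * w) * (k + (b + 1) * w)"
      have W0: "W \<noteq> 0" using elim by (simp add: W_def)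
      have "w^2 * (k^3 - k * W + (2 * b + 1) * w * W) = w^4 * (- k * b * (b + 1) + (2 * b + 1)^2 * k + (2 * b + 1) * b * (b + 1) * w)"
        unfolding W_def by algebra
      hence "w^4 * ((- k * b * (b + 1) + (2 * b + 1)^2 * k + (2 * b + 1) * b * (b + 1) * w) / (k^3 * W)) =
        w^2 * (k^3 - k * W + (2 * b + 1) * w * W) / (k^3 * W)" by simp
      also have "\<dots> = w^2 / W - w^2 / k^2 + (2 * b + 1) * w^3 / k^3"
        using W0 k0 by (simp add: field_simps power2_eq_square power3_eq_cube)
      finally have "w^4 * ((- k * b * (b + 1) + (2 * b + 1)^2 * k + (2 * b + 1) * b * (b + 1) * w) / (k^3 * W)) =
         w^2 / W - w^2 / k^2 + (2 * b + 1) * w^3 / k^3" .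
      moreover have "ifac_hat \<kappa> \<beta> 2 w = w^2 / W"
        by (simp add: ifac_hat_def W_def k_def b_def numeral_2_eq_2)
      ultimately show ?thesis unfolding W_def by simp
    qed
    have h0: "ifac_hat \<kappa> \<beta> 0 w = 1" by (simp add: ifac_hat_def)
    have sum4: "(\<Sum>j<4. [1, c1, c2, c3] ! j * ifac_hat \<kappa> \<beta> j w) = 1 + c1 * ifac_hat \<kappa> \<beta> 1 w + c2 * ifac_hat \<kappa> \<beta> 2 w + c3 * ifac_hat \<kappa> \<beta> 3 w"
      by (simp add: eval_nat_numeral h0)
    define q2 q3 where "q2 = l2 + l1^2 / 2" and "q3 = l3 + l1 * l2 + l1^3 / 6"
    have pA: "1 + A w + A w ^ 2 / 2 + A w ^ 3 / 6 = 1 + l1 * w + q2 * w^2 + q3 * w^3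
        + w^4 * (z w ^ 2 / 2 + l1 * l3 + (3 * l1^2 * z w + 3 * l1 * w * z w ^ 2 + w^2 * z w ^ 3) / 6)"
      unfolding A_def z_def q2_def q3_def by (simp add: field_simps) algebra
    have cc: "c1 / k = l1" "c2 / k^2 = q2 + c1 * b / k^2" "c3 / k^3 = q3 - c1 * b^2 / k^3 + c2 * (2 * b + 1) / k^3"
      using k0 unfolding c1_def c2_def c3_def q2_def q3_def by (simp_all add: add_divide_distrib diff_divide_distrib)
    define y1 y2 y3 where "y1 = - (b^3) / (k^3 * (k + b * w))"
      and "y2 = (- k * b * (b + 1) + (2 * b + 1)^2 * k + (2 * b + 1) * b * (b + 1) * w) / (k^3 * ((k + b * w) * (k + (b + 1) * w)))"
      and "y3 = z w ^ 2 / 2 + l1 * l3 + (3 * l1^2 * z w + 3 * l1 * w * z w ^ 2 + w^2 * z w ^ 3) / 6"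
    have "1 + A w + A w ^ 2 / 2 + A w ^ 3 / 6 + (E w + w ^ 4 * R w + c3 / k^3 * (w ^ 3 - k ^ 3 * ifac_hat \<kappa> \<beta> 3 w))
       = exp (A w) + w ^ 4 * R w + c3 / k^3 * (w ^ 3 - k ^ 3 * ifac_hat \<kappa> \<beta> 3 w)"
      by (simp add: E_def)
    also have "\<dots> = exp (A w) + w^4 * (y3 - c1 * y1 - c2 * y2) + c3 / k^3 * w^3 - c3 * ifac_hat \<kappa> \<beta> 3 w"
      using k0 by (simp add: R_def y1_def y2_def y3_def field_simps)
    finally have 1: "E w + w ^ 4 * R w + c3 / k^3 * (w ^ 3 - k ^ 3 * ifac_hat \<kappa> \<beta> 3 w) =
       exp (A w) + w^4 * (y3 - c1 * y1 - c2 * y2) + c3 / k^3 * w^3 - c3 * ifac_hat \<kappa> \<beta> 3 w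
        - (1 + l1 * w + q2 * w^2 + q3 * w^3 + w^4 * y3)"
      unfolding pA y3_def by (simp add: algebra_simps)
    have 2: "c1 * ifac_hat \<kappa> \<beta> 1 w = (c1 / k) * w - (c1 * b / k^2) * w^2 + (c1 * b^2 / k^3) * w^3 + w^4 * (c1 * y1)"
      unfolding h1 y1_def[symmetric] by (simp add: algebra_simps)
    have 3: "c2 * ifac_hat \<kappa> \<beta> 2 w = (c2 / k^2) * w^2 - (c2 * (2 * b + 1) / k^3) * w^3 + w^4 * (c2 * y2)"
      unfolding h2 y2_def[symmetric] by (simp add: algebra_simps)
    show ?case unfolding 1 sum4 2 3 unfolding cc A_def by (simp add: algebra_simps)
  qed
  moreover have "(\<lambda>w. E w + w ^ 4 * R w + c3 / k^3 * (w ^ 3 - k ^ 3 * ifac_hat \<kappa> \<beta> 3 w)) \<in> O[at 0](\<lambda>w. w ^ 4)"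
    by (intro sum_in_bigo(1) E wR h3)
  ultimately show ?thesis using landau_o.big.in_cong[THEN iffD1] by fast
qed


section \<open>Translation into the defining property of the coefficients\<close>

lemma eventually_sector_no_pole:
  assumes k: "\<kappa> > 0" and d: "\<delta> > 0"
  shows "eventually (\<lambda>s. of_real \<kappa> * s + of_real \<beta> \<notin> \<int>\<^sub>\<le>\<^sub>0) (sector_at_infinity \<delta>)"
  unfolding eventually_sector_iff
proof (intro exI[of _ "(\<bar>\<beta>\<bar> + 1) / \<kappa>"] allI impI notI)
  fix s assume s: "(\<bar>\<beta>\<bar> + 1) / \<kappa> \<le> norm s \<and> \<bar>Arg s\<bar> \<le> pi - \<delta>" and "of_real \<kappa> * s + of_real \<beta> \<in> \<int>\<^sub>\<le>\<^sub>0"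
  then obtain n where n: "of_real \<kappa> * s + of_real \<beta> = - of_nat n" by (auto elim: nonpos_Ints_cases')
  define y where "y = (- real n - \<beta>) / \<kappa>"
  have "\<kappa> * y = - real n - \<beta>" using k by (simp add: y_def)
  hence "of_real \<kappa> * of_real y = - of_nat n - complex_of_real \<beta>"
    by (simp only: of_real_mult[symmetric]) simp
  moreover have "of_real \<kappa> * s = - of_nat n - complex_of_real \<beta>"
    using n by (simp only: eq_diff_eq)
  ultimately have "of_real \<kappa> * s = of_real \<kappa> * of_real y" by (simp only:)
  hence y: "s = of_real y" using k by simp
  have pos: "(\<bar>\<beta>\<bar> + 1) / \<kappa> > 0" using k by simp
  have "y > 0"
  proof (rule ccontr)
    assume "\<not> y > 0"
    moreover have "y \<noteq> 0" using s y pos by auto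
    ultimately have "Arg s = pi" unfolding y by (subst Arg_of_real) auto
    thus False using s d by simp
  qed
  hence "norm s = y" unfolding y by simp
  hence "(\<bar>\<beta>\<bar> + 1) / \<kappa> \<le> (- real n - \<beta>) / \<kappa>" using s by (simp add: y_def)
  hence "\<bar>\<beta>\<bar> + 1 \<le> - real n - \<beta>" using k by (simp add: divide_le_cancel)
  thus False by linarith
qed

lemma rGamma_shift:
  fixes z :: complex
  assumes "z \<notin> \<int>\<^sub>\<le>\<^sub>0"
  shows "rGamma (z + of_nat j) = rGamma z * inverse (pochhammer z j)"
proof -
  have "pochhammer z j \<noteq> 0" using pochhammer_eq_0_imp_nonpos_Int[of z j] assms by blast
  thus ?thesis using pochhammer_rGamma[of z j] by (simp add: field_simps)
qed

text \<open>Dividing by the prefactor and by 1/\<Gamma>(\<kappa>s + \<beta>), both nonzero here,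
  turns the defining identity into an expansion of \<open>struve_Q\<close> with the same remainder
  r.\<close>

lemma struve_identity_iff:
  fixes \<sigma> \<nu> :: real
  assumes \<sigma>: "0 < \<sigma>" "\<sigma> < 1"
  defines "\<kappa> \<equiv> struve_kappa \<sigma>" and "\<beta> \<equiv> 1 - struve_theta \<nu>"
  assumes np: "of_real \<kappa> * s + of_real \<beta> \<notin> \<int>\<^sub>\<le>\<^sub>0"
  shows "struve_ratio \<sigma> \<nu> s = struve_prefactor \<sigma> \<nu> s *
       ((\<Sum>j<M. of_real (c j) * rGamma (of_real \<kappa> * s + of_real \<beta> + of_nat j))
          + r * rGamma (of_real \<kappa> * s + of_real \<beta> + of_nat M))
     \<longleftrightarrow> struve_Q \<sigma> \<nu> s - (\<Sum>j<M. of_real (c j) * ifac_basis \<kappa> \<beta> j s) = r * ifac_basis \<kappa> \<beta> M s"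
proof -
  define z where "z = of_real \<kappa> * s + complex_of_real \<beta>"
  define D where "D = struve_prefactor \<sigma> \<nu> s"
  have D0: "D \<noteq> 0" unfolding D_def struve_prefactor_eq[OF \<sigma>] by simp
  have g: "rGamma z \<noteq> 0" using np by (simp add: rGamma_eq_zero_iff z_def)
  have G: "Gamma z = 1 / rGamma z" by (simp add: rGamma_inverse_Gamma divide_inverse)
  have Q: "struve_ratio \<sigma> \<nu> s = D * (struve_Q \<sigma> \<nu> s * rGamma z)"
    unfolding struve_Q_def D_def[symmetric] \<kappa>_def[symmetric] \<beta>_def[symmetric] z_def[symmetric] G
    using D0 g by simp
  have b: "rGamma (z + of_nat j) = rGamma z * ifac_basis \<kappa> \<beta> j s" for j
    using rGamma_shift[of z j] np by (simp add: ifac_basis_def z_def)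
  have "struve_ratio \<sigma> \<nu> s = D * ((\<Sum>j<M. of_real (c j) * rGamma (z + of_nat j)) + r * rGamma (z + of_nat M))
     \<longleftrightarrow> (D * rGamma z) * struve_Q \<sigma> \<nu> s = (D * rGamma z) * ((\<Sum>j<M. of_real (c j) * ifac_basis \<kappa> \<beta> j s) + r * ifac_basis \<kappa> \<beta> M s)"
    unfolding Q b by (simp add: sum_distrib_left sum_distrib_right algebra_simps)
  also have "\<dots> \<longleftrightarrow> struve_Q \<sigma> \<nu> s = (\<Sum>j<M. of_real (c j) * ifac_basis \<kappa> \<beta> j s) + r * ifac_basis \<kappa> \<beta> M s"
    using D0 g by (simp only: mult_cancel_left mult_eq_0_iff) simp
  finally show ?thesis unfolding z_def D_def by (simp add: algebra_simps)
qed

lemma ifac_basis_inverse_bigo: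
  assumes "\<kappa> > 0" "\<delta> > 0"
  shows "(\<lambda>s. 1 / ifac_basis \<kappa> \<beta> M s) \<in> O[sector_at_infinity \<delta>](\<lambda>s. s ^ M)"
proof -
  have "(\<lambda>w::complex. \<Prod>i<M. of_real \<kappa> + (of_real \<beta> + of_nat i) * w) \<in> O[at 0](\<lambda>_. 1)"
    by (intro isCont_bigo_1 continuous_intros)
  from landau_o.big.mult[OF bigo_sector_of_bigo_at_0[OF this, of \<delta>] landau_o.big_refl[of "\<lambda>s. s ^ M"]]
  have 1: "(\<lambda>s. (\<Prod>i<M. of_real \<kappa> + (of_real \<beta> + of_nat i) * (1 / s)) * s ^ M) \<in> O[sector_at_infinity \<delta>](\<lambda>s. 1 * s ^ M)"
    .
  have ev: "eventually (\<lambda>s. (\<Prod>i<M. of_real \<kappa> + (of_real \<beta> + of_nat i) * (1 / s)) * s ^ M = 1 / ifac_basis \<kappa> \<beta> M s) (sector_at_infinity \<delta>)"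
    using eventually_sector_nz
    by eventually_elim (simp add: ifac_hat_eq[symmetric] ifac_hat_def power_one_over)
  show ?thesis using iffD1[OF landau_o.big.in_cong[OF ev] 1] by simp
qed

text \<open>\<open>ifac_basis\<close> of index M has exact order (1/s)^M in every closed subsector,
  so a bounded \<rho> exists precisely when the difference is O((1/s)^M). One \<rho> serves all
  sectors, because it is recovered as the difference divided by the basis function.\<close>

lemma inverse_factorial_coeffs_iff:
  fixes \<sigma> \<nu> :: real
  assumes \<sigma>: "0 < \<sigma>" "\<sigma> < 1"
  defines "\<kappa> \<equiv> struve_kappa \<sigma>" and "\<beta> \<equiv> 1 - struve_theta \<nu>"
  shows "inverse_factorial_coeffs \<sigma> \<nu> c \<longleftrightarrow> c 0 = 1 \<and> (\<forall>M\<ge>1. \<forall>\<delta>>0.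
     (\<lambda>s. struve_Q \<sigma> \<nu> s - (\<Sum>j<M. of_real (c j) * ifac_basis \<kappa> \<beta> j s))
    \<in> O[sector_at_infinity \<delta>](\<lambda>s. (1 / s) ^ M))"
proof -
  have k: "\<kappa> > 0" using \<sigma> by (simp add: \<kappa>_def struve_kappa_def)
  have np: "eventually (\<lambda>s. of_real \<kappa> * s + of_real \<beta> \<notin> \<int>\<^sub>\<le>\<^sub>0) (sector_at_infinity \<delta>)" if "\<delta> > 0" for \<delta>
    using eventually_sector_no_pole[OF k that] .
  have "inverse_factorial_coeffs \<sigma> \<nu> c \<longleftrightarrow> c 0 = 1 \<and> (\<forall>M\<ge>1. \<exists>\<rho>. \<forall>\<delta>>0.
        (\<forall>\<^sub>F s in sector_at_infinity \<delta>. struve_ratio \<sigma> \<nu> s = struve_prefactor \<sigma> \<nu> s *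
       ((\<Sum>j<M. of_real (c j) * rGamma (of_real \<kappa> * s + of_real \<beta> + of_nat j))
          + \<rho> s * rGamma (of_real \<kappa> * s + of_real \<beta> + of_nat M))) \<and> \<rho> \<in> O[sector_at_infinity \<delta>](\<lambda>_. 1))"
    unfolding inverse_factorial_coeffs_def struve_ratio_def struve_prefactor_def \<kappa>_def \<beta>_def by (simp only: mult.assoc)
  also have "\<dots> \<longleftrightarrow> c 0 = 1 \<and> (\<forall>M\<ge>1. \<exists>\<rho>. \<forall>\<delta>>0.
        (\<forall>\<^sub>F s in sector_at_infinity \<delta>. struve_Q \<sigma> \<nu> s - (\<Sum>j<M. of_real (c j) * ifac_basis \<kappa> \<beta> j s) = \<rho> s * ifac_basis \<kappa> \<beta> M s)
         \<and> \<rho> \<in> O[sector_at_infinity \<delta>](\<lambda>_. 1))"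
  proof (intro conj_cong refl all_cong1 imp_cong ex_cong1)
    fix M :: nat and \<rho> :: "complex \<Rightarrow> complex" and \<delta> :: real assume "\<delta> > 0"
    have "eventually (\<lambda>s. (struve_ratio \<sigma> \<nu> s = struve_prefactor \<sigma> \<nu> s *
       ((\<Sum>j<M. of_real (c j) * rGamma (of_real \<kappa> * s + of_real \<beta> + of_nat j))
          + \<rho> s * rGamma (of_real \<kappa> * s + of_real \<beta> + of_nat M))) \<longleftrightarrow>
      (struve_Q \<sigma> \<nu> s - (\<Sum>j<M. of_real (c j) * ifac_basis \<kappa> \<beta> j s) = \<rho> s * ifac_basis \<kappa> \<beta> M s)) (sector_at_infinity \<delta>)"
      using np[OF \<open>\<delta> > 0\<close>]
      by eventually_elim (unfold \<kappa>_def \<beta>_def, rule struve_identity_iff[OF \<sigma>])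
    thus "(\<forall>\<^sub>F s in sector_at_infinity \<delta>. struve_ratio \<sigma> \<nu> s = struve_prefactor \<sigma> \<nu> s *
       ((\<Sum>j<M. of_real (c j) * rGamma (of_real \<kappa> * s + of_real \<beta> + of_nat j))
          + \<rho> s * rGamma (of_real \<kappa> * s + of_real \<beta> + of_nat M))) \<longleftrightarrow>
      (\<forall>\<^sub>F s in sector_at_infinity \<delta>. struve_Q \<sigma> \<nu> s - (\<Sum>j<M. of_real (c j) * ifac_basis \<kappa> \<beta> j s) = \<rho> s * ifac_basis \<kappa> \<beta> M s)"
      by (rule eventually_cong[OF _ iffD1]) auto
  qed
  also have "\<dots> \<longleftrightarrow> c 0 = 1 \<and> (\<forall>M\<ge>1. \<forall>\<delta>>0.
     (\<lambda>s. struve_Q \<sigma> \<nu> s - (\<Sum>j<M. of_real (c j) * ifac_basis \<kappa> \<beta> j s))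
    \<in> O[sector_at_infinity \<delta>](\<lambda>s. (1 / s) ^ M))"
  proof (intro conj_cong refl all_cong1 imp_cong)
    fix M :: nat
    let ?f = "\<lambda>s. struve_Q \<sigma> \<nu> s - (\<Sum>j<M. of_real (c j) * ifac_basis \<kappa> \<beta> j s)"
    show "(\<exists>\<rho>. \<forall>\<delta>>0. (\<forall>\<^sub>F s in sector_at_infinity \<delta>. ?f s = \<rho> s * ifac_basis \<kappa> \<beta> M s)
         \<and> \<rho> \<in> O[sector_at_infinity \<delta>](\<lambda>_. 1)) \<longleftrightarrow> (\<forall>\<delta>>0. ?f \<in> O[sector_at_infinity \<delta>](\<lambda>s. (1 / s) ^ M))"
      (is "?L \<longleftrightarrow> ?R")
    proof
      assume ?L
      then obtain \<rho> where \<rho>: "\<And>\<delta>. \<delta> > 0 \<Longrightarrow> \<forall>\<^sub>F s in sector_at_infinity \<delta>. ?f s = \<rho> s * ifac_basis \<kappa> \<beta> M s"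
        "\<And>\<delta>. \<delta> > 0 \<Longrightarrow> \<rho> \<in> O[sector_at_infinity \<delta>](\<lambda>_. 1)" by blast
      show ?R
      proof (intro allI impI)
        fix \<delta> :: real assume d: "\<delta> > 0"
        have "(\<lambda>s. \<rho> s * ifac_basis \<kappa> \<beta> M s) \<in> O[sector_at_infinity \<delta>](\<lambda>s. 1 * (1 / s) ^ M)"
          using k by (intro landau_o.big.mult \<rho>(2) d ifac_basis_bigo) auto
        from iffD2[OF landau_o.big.in_cong[OF \<rho>(1)[OF d]] this]
        show "?f \<in> O[sector_at_infinity \<delta>](\<lambda>s. (1 / s) ^ M)" by simp
      qed
    next
      assume R: ?R
      show ?L
      proof (intro exI[of _ "\<lambda>s. ?f s * (1 / ifac_basis \<kappa> \<beta> M s)"] allI impI conjI)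
        fix \<delta> :: real assume d: "\<delta> > 0"
        show "\<forall>\<^sub>F s in sector_at_infinity \<delta>. ?f s = ?f s * (1 / ifac_basis \<kappa> \<beta> M s) * ifac_basis \<kappa> \<beta> M s"
          using np[OF d]
        proof eventually_elim
          case (elim s)
          have "ifac_basis \<kappa> \<beta> M s \<noteq> 0"
            using pochhammer_eq_0_imp_nonpos_Int[of "of_real \<kappa> * s + of_real \<beta>" M] elim by (auto simp: ifac_basis_def)
          thus ?case by simp
        qed
        have "(\<lambda>s. ?f s * (1 / ifac_basis \<kappa> \<beta> M s)) \<in> O[sector_at_infinity \<delta>](\<lambda>s. (1 / s) ^ M * s ^ M)"
          using R d k by (intro landau_o.big.mult ifac_basis_inverse_bigo) auto
        also have "(\<lambda>s::complex. (1 / s) ^ M * s ^ M) \<in> O[sector_at_infinity \<delta>](\<lambda>_. 1)"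
          by (rule bigoI[where c = 1], rule eventually_mono[OF eventually_sector_nz]) (simp add: power_one_over)
        finally show "(\<lambda>s. ?f s * (1 / ifac_basis \<kappa> \<beta> M s)) \<in> O[sector_at_infinity \<delta>](\<lambda>_. 1)" .
      qed
    qed
  qed
  finally show ?thesis .
qed

lemma poly_stirling_poly3:
  "poly (stirling_poly3 b) w = of_real ((b^2 - b + 1/6) / 2) * w + of_real (- (b^3 - 3/2 * b^2 + b/2) / 6) * w^2
     + of_real ((b^4 - 2 * b^3 + b^2 - 1/30) / 12) * w^3"
  by (simp add: stirling_poly3_def algebra_simps power2_eq_square power3_eq_cube del: of_real_diff of_real_add of_real_mult of_real_divide of_real_minus)

text \<open>Existence and uniqueness identify the definite description with the sequence found. The
  values of c_1, c_2, c_3 come from a second expansion, with M = 4 and the explicit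
  \<open>stirling_poly3\<close>, which uniqueness matches with the first.\<close>

theorem struve_coeff_spec:
  assumes \<sigma>: "0 < \<sigma>" "\<sigma> < 1"
  shows "inverse_factorial_coeffs \<sigma> \<nu> (struve_coeff \<sigma> \<nu>)"
    and "struve_coeff \<sigma> \<nu> 0 = 1" "struve_coeff \<sigma> \<nu> 1 = struve_c1 (- \<sigma>) \<nu>"
    and "struve_coeff \<sigma> \<nu> 2 = struve_c2 (- \<sigma>) \<nu>" "struve_coeff \<sigma> \<nu> 3 = struve_c3 (- \<sigma>) \<nu>"
proof -
  let ?\<kappa> = "struve_kappa \<sigma>" and ?\<beta> = "1 - struve_theta \<nu>"
  obtain c :: "nat \<Rightarrow> real" where c: "\<And>M \<delta>. M \<ge> 1 \<Longrightarrow> \<delta> > 0 \<Longrightarrow>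
     (\<lambda>s. struve_Q \<sigma> \<nu> s - (\<Sum>j<M. of_real (c j) * ifac_basis ?\<kappa> ?\<beta> j s)) \<in> O[sector_at_infinity \<delta>](\<lambda>s. (1 / s) ^ M)"
    using struve_Q_coeffs[OF \<sigma>] by blast
  have seq: "(\<lambda>n. f (of_nat n)) \<in> O(\<lambda>n. (1 / of_nat n) ^ M)"
    if "f \<in> O[sector_at_infinity pi](\<lambda>s. (1 / s) ^ M)" for f :: "complex \<Rightarrow> complex" and M
    using landau_o.big.compose[OF that filterlim_of_nat_sector[of pi]] by simp
  define a1 a2 a3 where "a1 = (\<lambda>b::real. (b^2 - b + 1/6) / 2)" and "a2 = (\<lambda>b::real. - (b^3 - 3/2 * b^2 + b/2) / 6)"
    and "a3 = (\<lambda>b::real. (b^4 - 2 * b^3 + b^2 - 1/30) / 12)"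
  define k where "k = 1 - \<sigma>"
  have k: "k > 0" "?\<kappa> = k" using \<sigma> by (auto simp: k_def struve_kappa_def)
  have be: "?\<beta> = \<nu> + 5 / 2" by (simp add: struve_theta_def)
  define l1 l2 l3 where "l1 = a1 (-\<nu>-1/2) / \<sigma> + a1 (\<nu>+5/2) / k - a1 (3/2)"
    and "l2 = a2 (-\<nu>-1/2) / \<sigma>^2 + a2 (\<nu>+5/2) / k^2 - a2 (3/2)"
    and "l3 = a3 (-\<nu>-1/2) / \<sigma>^3 + a3 (\<nu>+5/2) / k^3 - a3 (3/2)"
  define c1 where "c1 = k * l1"
  define c2 where "c2 = k^2 * (l2 + l1^2 / 2) + c1 * (\<nu>+5/2)"
  define c3 where "c3 = k^3 * (l3 + l1 * l2 + l1^3 / 6) - c1 * (\<nu>+5/2)^2 + c2 * (2 * (\<nu>+5/2) + 1)"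
  define B where "B = (\<lambda>w::complex. exp (of_real l1 * w + of_real l2 * w^2 + of_real l3 * w^3))"
  have p: "stirling_analytic b (stirling_poly3 b) \<in> O[at 0](\<lambda>w. w ^ (3 + 3))" "poly (stirling_poly3 b) 0 = 0" for b
    using stirling_poly3_defect[of b] by (simp_all add: stirling_poly3_def)
  have QB: "(\<lambda>s. struve_Q \<sigma> \<nu> s - B (1 / s)) \<in> O[sector_at_infinity \<delta>](\<lambda>s. (1 / s) ^ 4)" if "\<delta> > 0" for \<delta>
  proof -
    have "B w = exp (poly (stirling_poly3 (-\<nu>-1/2)) (w / of_real \<sigma>) + poly (stirling_poly3 (\<nu>+5/2)) (w / of_real (1 - \<sigma>)) - poly (stirling_poly3 (3/2)) w)" for w
    proof -
      have P: "poly (stirling_poly3 b) w = of_real (a1 b) * w + of_real (a2 b) * w^2 + of_real (a3 b) * w^3" for b w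
        unfolding a1_def a2_def a3_def by (rule poly_stirling_poly3)
      show ?thesis unfolding P B_def l1_def l2_def l3_def k_def[symmetric]
        by (simp add: power_divide algebra_simps)
    qed
    thus ?thesis using struve_Q_asymp[OF \<sigma> that p(1,2) p(1,2) p(1,2), of \<nu>] by simp
  qed
  have hat: "(\<lambda>w. B w - (\<Sum>j<4. [1, of_real c1, of_real c2, of_real c3] ! j * ifac_hat ?\<kappa> ?\<beta> j w)) \<in> O[at 0](\<lambda>w. w ^ 4)"
    using exp_cubic_in_ifac_hat[of k "of_real l1" "of_real l2" "of_real l3" "\<nu> + 5 / 2"] k(1)
    unfolding B_def k(2) be c3_def c2_def c1_def by simp
  note E4 = seq[OF struve_Q_expand[OF \<sigma> QB hat pi_gt_zero]]
  have uniq4: "c' j = [1, c1, c2, c3] ! j"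
    if "\<And>M \<delta>. M \<ge> 1 \<Longrightarrow> \<delta> > 0 \<Longrightarrow>
     (\<lambda>s. struve_Q \<sigma> \<nu> s - (\<Sum>j<M. of_real (c' j) * ifac_basis ?\<kappa> ?\<beta> j s)) \<in> O[sector_at_infinity \<delta>](\<lambda>s. (1 / s) ^ M)"
      "j < 4" for c' :: "nat \<Rightarrow> real" and j
  proof -
    have "complex_of_real (c' j) = [1, of_real c1, of_real c2, of_real c3] ! j"
      using struve_Q_expansion_unique[OF \<sigma> seq[OF that(1)] E4 that(2)] by simp
    moreover have "j = 0 \<or> j = 1 \<or> j = 2 \<or> j = 3" using that(2) by linarith
    ultimately show ?thesis by (auto simp: numeral_2_eq_2 numeral_3_eq_3)
  qed
  have c0: "c 0 = 1" using uniq4[OF c, of 0] by simp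
  have "inverse_factorial_coeffs \<sigma> \<nu> c"
    unfolding inverse_factorial_coeffs_iff[OF \<sigma>] using c c0 by blast
  moreover have "c' = c" if "inverse_factorial_coeffs \<sigma> \<nu> c'" for c'
  proof (rule ext)
    fix j
    have "complex_of_real (c' j) = of_real (c j)"
    proof (rule struve_Q_expansion_unique[OF \<sigma>])
      have H: "\<forall>M\<ge>1. \<forall>\<delta>>0. (\<lambda>s. struve_Q \<sigma> \<nu> s - (\<Sum>j<M. of_real (c' j) * ifac_basis ?\<kappa> ?\<beta> j s))
          \<in> O[sector_at_infinity \<delta>](\<lambda>s. (1 / s) ^ M)"
        using that unfolding inverse_factorial_coeffs_iff[OF \<sigma>] by blast
      have "(\<lambda>s. struve_Q \<sigma> \<nu> s - (\<Sum>j<Suc j. of_real (c' j) * ifac_basis ?\<kappa> ?\<beta> j s))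
          \<in> O[sector_at_infinity pi](\<lambda>s. (1 / s) ^ Suc j)" by (intro H[rule_format]) auto
      from seq[OF this] show "(\<lambda>n. struve_Q \<sigma> \<nu> (of_nat n) - (\<Sum>j<Suc j. of_real (c' j) * ifac_basis ?\<kappa> ?\<beta> j (of_nat n)))
          \<in> O(\<lambda>n. (1 / of_nat n) ^ Suc j)" .
      show "(\<lambda>n. struve_Q \<sigma> \<nu> (of_nat n) - (\<Sum>j<Suc j. of_real (c j) * ifac_basis ?\<kappa> ?\<beta> j (of_nat n)))
          \<in> O(\<lambda>n. (1 / of_nat n) ^ Suc j)"
        by (rule seq[OF c]) auto
    qed simp
    thus "c' j = c j" by simp
  qed
  ultimately have sc: "struve_coeff \<sigma> \<nu> = c"
    unfolding struve_coeff_def by (rule the_equality)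
  show "inverse_factorial_coeffs \<sigma> \<nu> (struve_coeff \<sigma> \<nu>)"
    unfolding sc by fact
  note f = struve_coeff_formulas[OF \<sigma> k_def a1_def a2_def a3_def l1_def l2_def l3_def c1_def c2_def c3_def]
  have "c 1 = c1" "c 2 = c2" "c 3 = c3"
    using uniq4[OF c, of 1] uniq4[OF c, of 2] uniq4[OF c, of 3] by (simp_all add: numeral_2_eq_2 numeral_3_eq_3)
  with c0 f show "struve_coeff \<sigma> \<nu> 0 = 1" "struve_coeff \<sigma> \<nu> 1 = struve_c1 (- \<sigma>) \<nu>"
    "struve_coeff \<sigma> \<nu> 2 = struve_c2 (- \<sigma>) \<nu>" "struve_coeff \<sigma> \<nu> 3 = struve_c3 (- \<sigma>) \<nu>"
    unfolding sc by (simp_all only:)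
qed

section \<open>Bounds for the reciprocal Gamma function\<close>

text \<open>Factor by factor: for fixed Im z the quotient |z + m|/(Re z + m) decreases in Re z, so
  it is largest at Re z = 1/2. In the limit of the Gauss products this compares 1/\<Gamma> with its
  values on the line Re z = 1/2.\<close>

lemma norm_pochhammer_ratio:
  fixes z :: complex
  assumes "Re z \<ge> 1 / 2"
  shows "norm (pochhammer z m) * pochhammer (1 / 2) m \<le> pochhammer (Re z) m * norm (pochhammer (Complex (1 / 2) (Im z)) m)"
proof (induction m)
  case 0 show ?case by simp
next
  case (Suc m)
  have "norm (z + of_nat m) * (1 / 2 + real m) \<le> (Re z + real m) * norm (Complex (1 / 2) (Im z) + of_nat m)"
  proof (rule power2_le_imp_le)
    have "(Im z)\<^sup>2 * (1 / 2 + real m)\<^sup>2 \<le> (Im z)\<^sup>2 * (Re z + real m)\<^sup>2"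
      using assms by (intro mult_left_mono power_mono) auto
    thus "(norm (z + of_nat m) * (1 / 2 + real m))\<^sup>2 \<le> ((Re z + real m) * norm (Complex (1 / 2) (Im z) + of_nat m))\<^sup>2"
      unfolding power_mult_distrib cmod_power2 by (simp add: algebra_simps)
  qed (use assms in auto)
  hence "(norm (pochhammer z m) * pochhammer (1 / 2) m) * (norm (z + of_nat m) * (1 / 2 + real m)) \<le>
     (pochhammer (Re z) m * norm (pochhammer (Complex (1 / 2) (Im z)) m)) * ((Re z + real m) * norm (Complex (1 / 2) (Im z) + of_nat m))"
    using assms by (intro mult_mono[OF Suc]) (auto intro!: mult_nonneg_nonneg pochhammer_nonneg)
  thus ?case by (simp add: pochhammer_Suc norm_mult mult_ac)
qed

lemma norm_sin_le_exp: "norm (sin z) \<le> exp \<bar>Im z\<bar>" for z :: complex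
proof -
  have "norm (sin z) = norm (exp (\<i> * z) - exp (- (\<i> * z))) / 2"
    by (simp add: sin_exp_eq norm_divide norm_mult)
  also have "norm (exp (\<i> * z) - exp (- (\<i> * z))) \<le> norm (exp (\<i> * z)) + norm (exp (- (\<i> * z)))"
    by (rule norm_triangle_ineq4)
  also have "\<dots> \<le> exp \<bar>Im z\<bar> + exp \<bar>Im z\<bar>"
    by (intro add_mono) (auto simp: norm_exp_eq_Re)
  finally show ?thesis by simp
qed

text \<open>On the line Re h = 1/2 one has 1 - h = \<open>cnj h\<close>, so the reflection formula
  evaluates |1/\<Gamma>(h)|^2 as |sin(\<pi>h)|/\<pi>.\<close>

lemma norm_rGamma_half_le: "norm (rGamma (Complex (1 / 2) y)) * sqrt pi \<le> exp (pi * \<bar>y\<bar> / 2)"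
proof (rule power2_le_imp_le)
  define h where "h = Complex (1 / 2) y"
  have "1 - h = cnj h" by (simp add: h_def complex_eq_iff)
  hence "rGamma h * cnj (rGamma h) = sin (of_real pi * h) / of_real pi"
    using rGamma_reflection_complex[of h] by (simp add: cnj_rGamma)
  hence "norm (rGamma h * cnj (rGamma h)) = norm (sin (of_real pi * h)) / pi"
    by (simp add: norm_divide)
  hence "(norm (rGamma h))\<^sup>2 * pi = norm (sin (of_real pi * h))"
    by (simp add: norm_mult power2_eq_square)
  also have "\<dots> \<le> exp (pi * \<bar>y\<bar>)"
    using norm_sin_le_exp[of "of_real pi * h"] by (simp add: h_def abs_mult)
  also have "\<dots> = (exp (pi * \<bar>y\<bar> / 2))\<^sup>2" by (simp flip: exp_double)
  finally show "(norm (rGamma (Complex (1 / 2) y)) * sqrt pi)\<^sup>2 \<le> (exp (pi * \<bar>y\<bar> / 2))\<^sup>2"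
    by (simp add: h_def power_mult_distrib)
qed auto

text \<open>The quotient \<open>|\<Gamma>(x)/\<Gamma>(x + iy)|\<close> is an infinite product that decreases in \<open>x\<close>, and at
  \<open>x = 1/2\<close> it is given by the reflection formula.\<close>

lemma norm_rGamma_le:
  fixes z :: complex
  assumes "Re z \<ge> 1 / 2"
  shows "norm (rGamma z) \<le> rGamma (Re z) * exp (pi * \<bar>Im z\<bar> / 2)"
proof -
  define h where "h = Complex (1 / 2) (Im z)"
  have le: "norm (rGamma_series z n) * rGamma_series (1 / 2) n \<le> rGamma_series (Re z) n * norm (rGamma_series h n)" for n
  proof -
    have e: "norm (exp (w * of_real (ln (real n)))) = exp (Re w * ln (real n))" for w :: complex
      by (simp add: norm_exp_eq_Re)
    have n: "norm (rGamma_series w n) = norm (pochhammer w (n + 1)) / (fact n * exp (Re w * ln (real n)))" for w :: complex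
      using e[of w] by (simp add: rGamma_series_def norm_divide norm_mult)
    have r: "rGamma_series x n = pochhammer x (n + 1) / (fact n * exp (x * ln (real n)))" for x :: real
      by (simp add: rGamma_series_def)
    define P where "P = fact n * exp (Re z * ln (real n)) * (fact n * exp (1 / 2 * ln (real n)))"
    have "norm (rGamma_series z n) * rGamma_series (1 / 2) n = norm (pochhammer z (n + 1)) * pochhammer (1 / 2) (n + 1) / P"
      unfolding n r P_def by simp
    also have "\<dots> \<le> pochhammer (Re z) (n + 1) * norm (pochhammer h (n + 1)) / P"
      unfolding h_def by (intro divide_right_mono norm_pochhammer_ratio assms) (simp add: P_def)
    also have "\<dots> = rGamma_series (Re z) n * norm (rGamma_series h n)"
      unfolding n r P_def by (simp add: h_def)
    finally show ?thesis .
  qed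
  have "norm (rGamma z) * rGamma (1 / 2) \<le> rGamma (Re z) * norm (rGamma h)"
    by (rule LIMSEQ_le[OF tendsto_mult[OF tendsto_norm[OF rGamma_series_LIMSEQ] rGamma_series_LIMSEQ]
          tendsto_mult[OF rGamma_series_LIMSEQ tendsto_norm[OF rGamma_series_LIMSEQ]]]) (use le in auto)
  moreover have "rGamma (1 / 2 :: real) = 1 / sqrt pi"
    unfolding rGamma_inverse_Gamma Gamma_one_half_real by (rule inverse_eq_divide)
  ultimately have "norm (rGamma z) \<le> rGamma (Re z) * (norm (rGamma h) * sqrt pi)"
    by (simp add: pos_divide_le_eq mult.assoc)
  also have "\<dots> \<le> rGamma (Re z) * exp (pi * \<bar>Im z\<bar> / 2)"
    using assms unfolding h_def
    by (intro mult_left_mono norm_rGamma_half_le) (simp add: rGamma_inverse_Gamma)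
  finally show ?thesis .
qed

text \<open>One step of the functional equation multiplies f(x) = exp(r x)/\<Gamma>(x) by e^r/(x -
  1), which is at most 1 beyond N + 1; up to that point a compact interval supplies the
  constant.\<close>

lemma rGamma_exp_bounded:
  fixes r :: real
  shows "\<exists>C>0. \<forall>x\<ge>1/2. rGamma x \<le> C * exp (- r * x)"
proof -
  define f where "f = (\<lambda>x::real. rGamma x * exp (r * x))"
  define N where "N = exp r + 1"
  have "continuous_on {1/2..N + 1} f" unfolding f_def by (intro continuous_intros)
  from compact_continuous_image[OF this] have "compact (f ` {1/2..N + 1})" by simp
  hence "bdd_above (f ` {1/2..N + 1})" by (rule compact_imp_bounded[THEN bounded_imp_bdd_above])
  then obtain C0 where C0: "\<And>x. x \<in> {1/2..N + 1} \<Longrightarrow> f x \<le> C0" unfolding bdd_above_def by blast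
  have nonneg: "f x \<ge> 0" if "x \<ge> 1 / 2" for x
    using that by (simp add: f_def rGamma_inverse_Gamma)
  have *: "f x \<le> C0" if "x \<in> {1/2..N + 1 + real n}" for n x
    using that
  proof (induction n arbitrary: x)
    case 0 thus ?case using C0 by simp
  next
    case (Suc n)
    show ?case
    proof (cases "x \<le> N + 1")
      case True thus ?thesis using C0 Suc.prems by simp
    next
      case False
      have x1: "x - 1 \<ge> exp r" "x - 1 \<ge> 1 / 2" "x - 1 > 0"
        using False exp_gt_zero[of r] unfolding N_def by linarith+
      have "rGamma (x - 1) = (x - 1) * rGamma x" using rGamma_plus1[of "x - 1"] by simp
      hence "f x = f (x - 1) * (exp r / (x - 1))"
        using x1 by (simp add: f_def right_diff_distrib exp_diff)
      also have "\<dots> \<le> f (x - 1) * 1"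
        using x1 nonneg[OF x1(2)] by (intro mult_left_mono) (auto simp: field_simps)
      also have "f (x - 1) \<le> C0" using Suc.prems x1 by (intro Suc.IH) auto
      finally show ?thesis by simp
    qed
  qed
  have "rGamma x \<le> (\<bar>C0\<bar> + 1) * exp (- r * x)" if "x \<ge> 1 / 2" for x
  proof -
    obtain n where "x \<le> real n" using real_arch_simple by blast
    hence "x \<le> N + 1 + real n" using exp_gt_zero[of r] unfolding N_def by linarith
    hence "f x \<le> C0" using that by (intro *[of x n]) auto
    hence "f x \<le> \<bar>C0\<bar> + 1" by linarith
    hence "f x * exp (- r * x) \<le> (\<bar>C0\<bar> + 1) * exp (- r * x)" by (intro mult_right_mono) auto
    thus ?thesis by (simp add: f_def mult.assoc flip: exp_add)
  qed
  thus ?thesis by (intro exI[of _ "\<bar>C0\<bar> + 1"]) auto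
qed

text \<open>Each step of the induction moves the half plane one unit to the left by 1/\<Gamma>(z) =
  z/\<Gamma>(z + 1). The factor z is paid for by half of \<epsilon> in the imaginary direction and
  by the extra unit in r + 1 in the real direction.\<close>

lemma norm_rGamma_exp_bound_aux:
  fixes r \<epsilon> :: real
  assumes "\<epsilon> > 0"
  shows "\<exists>C>0. \<forall>z. Re z \<ge> 1 / 2 - real m \<longrightarrow> norm (rGamma z) \<le> C * exp (- r * Re z + (pi / 2 + \<epsilon>) * \<bar>Im z\<bar>)"
  using assms
proof (induction m arbitrary: r \<epsilon>)
  case 0
  obtain C where C: "C > 0" "\<And>x. x \<ge> 1/2 \<Longrightarrow> rGamma x \<le> C * exp (- r * x)"
    using rGamma_exp_bounded[of r] by blast
  show ?case
  proof (intro exI[of _ C] conjI allI impI C(1))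
    fix z :: complex assume "Re z \<ge> 1 / 2 - real 0"
    hence z: "Re z \<ge> 1 / 2" by simp
    have "norm (rGamma z) \<le> rGamma (Re z) * exp (pi * \<bar>Im z\<bar> / 2)" by (rule norm_rGamma_le[OF z])
    also have "\<dots> \<le> (C * exp (- r * Re z)) * exp ((pi / 2 + \<epsilon>) * \<bar>Im z\<bar>)"
      using 0 C(1) by (intro mult_mono C(2) z) (auto simp: algebra_simps)
    finally show "norm (rGamma z) \<le> C * exp (- r * Re z + (pi / 2 + \<epsilon>) * \<bar>Im z\<bar>)"
      by (simp only: exp_add mult.assoc)
  qed
next
  case (Suc m)
  obtain C where C: "C > 0" "\<And>z. Re z \<ge> 1 / 2 - real m \<Longrightarrow> norm (rGamma z) \<le> C * exp (- (r + 1) * Re z + (pi / 2 + \<epsilon> / 2) * \<bar>Im z\<bar>)"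
    using Suc.IH[of "\<epsilon> / 2" "r + 1"] Suc.prems by auto
  define K where "K = C * (1 + 2 / \<epsilon>) * exp (2 * real m + 1 - r)"
  show ?case
  proof (intro exI[of _ K] conjI allI impI)
    show "K > 0" using C(1) Suc.prems by (auto simp: K_def intro!: mult_pos_pos add_pos_pos)
    fix z :: complex assume z: "Re z \<ge> 1 / 2 - real (Suc m)"
    \<comment> \<open>The shift 2 m + 2 is large enough for Re z + 2 m + 2 to dominate |Re z| on the
      enlarged half plane.\<close>
    have 1: "norm z \<le> exp (Re z + 2 * real m + 2) * ((1 + 2 / \<epsilon>) * exp (\<epsilon> / 2 * \<bar>Im z\<bar>))"
    proof -
      have e1: "exp (Re z + 2 * real m + 2) \<ge> 1 + (Re z + 2 * real m + 2)" by (rule exp_ge_add_one_self)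
      hence e2: "\<bar>Re z\<bar> \<le> exp (Re z + 2 * real m + 2)" "1 \<le> exp (Re z + 2 * real m + 2)" using z by auto
      have "\<epsilon> / 2 * \<bar>Im z\<bar> \<le> exp (\<epsilon> / 2 * \<bar>Im z\<bar>)" using exp_ge_add_one_self[of "\<epsilon> / 2 * \<bar>Im z\<bar>"] by linarith
      hence "\<bar>Im z\<bar> \<le> 2 / \<epsilon> * exp (\<epsilon> / 2 * \<bar>Im z\<bar>)" using Suc.prems by (simp add: field_simps)
      moreover have "1 \<le> exp (\<epsilon> / 2 * \<bar>Im z\<bar>)" using Suc.prems by simp
      ultimately have e3: "1 + \<bar>Im z\<bar> \<le> (1 + 2 / \<epsilon>) * exp (\<epsilon> / 2 * \<bar>Im z\<bar>)"
        unfolding distrib_right mult_1_left by linarith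
      have "norm z \<le> \<bar>Re z\<bar> + \<bar>Im z\<bar>" by (rule cmod_le)
      also have "\<dots> \<le> exp (Re z + 2 * real m + 2) * 1 + exp (Re z + 2 * real m + 2) * \<bar>Im z\<bar>"
        using e2 mult_right_mono[OF e2(2), of "\<bar>Im z\<bar>"] by (intro add_mono) auto
      also have "\<dots> = exp (Re z + 2 * real m + 2) * (1 + \<bar>Im z\<bar>)" by (simp add: algebra_simps)
      also have "\<dots> \<le> exp (Re z + 2 * real m + 2) * ((1 + 2 / \<epsilon>) * exp (\<epsilon> / 2 * \<bar>Im z\<bar>))"
        by (intro mult_left_mono e3) auto
      finally show ?thesis .
    qed
    have 2: "norm (rGamma (z + 1)) \<le> C * exp (- (r + 1) * (Re z + 1) + (pi / 2 + \<epsilon> / 2) * \<bar>Im z\<bar>)"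
      using C(2)[of "z + 1"] z by simp
    have "norm (rGamma z) = norm z * norm (rGamma (z + 1))"
      using rGamma_plus1[of z] by (metis norm_mult)
    also have "\<dots> \<le> (exp (Re z + 2 * real m + 2) * ((1 + 2 / \<epsilon>) * exp (\<epsilon> / 2 * \<bar>Im z\<bar>))) *
        (C * exp (- (r + 1) * (Re z + 1) + (pi / 2 + \<epsilon> / 2) * \<bar>Im z\<bar>))"
      using Suc.prems by (intro mult_mono 1 2) (auto intro!: mult_nonneg_nonneg)
    also have "\<dots> = C * (1 + 2 / \<epsilon>) * (exp (Re z + 2 * real m + 2) * exp (\<epsilon> / 2 * \<bar>Im z\<bar>) * exp (- (r + 1) * (Re z + 1) + (pi / 2 + \<epsilon> / 2) * \<bar>Im z\<bar>))"
      by (simp add: mult_ac)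
    also have "exp (Re z + 2 * real m + 2) * exp (\<epsilon> / 2 * \<bar>Im z\<bar>) * exp (- (r + 1) * (Re z + 1) + (pi / 2 + \<epsilon> / 2) * \<bar>Im z\<bar>)
        = exp (2 * real m + 1 - r) * exp (- r * Re z + (pi / 2 + \<epsilon>) * \<bar>Im z\<bar>)"
      unfolding exp_add[symmetric] by (rule arg_cong[where f = exp]) (simp add: algebra_simps)
    finally show "norm (rGamma z) \<le> K * exp (- r * Re z + (pi / 2 + \<epsilon>) * \<bar>Im z\<bar>)"
      by (simp add: K_def mult_ac)
  qed
qed

lemma norm_rGamma_exp_bound:
  fixes r \<epsilon> x0 :: real
  assumes "\<epsilon> > 0"
  obtains C where "C > 0" "\<And>z. Re z \<ge> x0 \<Longrightarrow> norm (rGamma z) \<le> C * exp (- r * Re z + (pi / 2 + \<epsilon>) * \<bar>Im z\<bar>)"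
proof -
  define m where "m = nat \<lceil>1 / 2 - x0\<rceil>"
  have "x0 \<ge> 1 / 2 - real m" unfolding m_def by linarith
  obtain C where C: "C > 0" "\<And>z. Re z \<ge> 1 / 2 - real m \<Longrightarrow> norm (rGamma z) \<le> C * exp (- r * Re z + (pi / 2 + \<epsilon>) * \<bar>Im z\<bar>)"
    using norm_rGamma_exp_bound_aux[OF assms, of m r] by blast
  show ?thesis
    by (rule that[OF C(1)], rule C(2)) (use \<open>x0 \<ge> 1 / 2 - real m\<close> in linarith)
qed

text \<open>Passing from 1/\<Gamma>(z - 2) to 1/\<Gamma>(z) gains the factor |z - 2||z - 1|, hence
  1/(1 + y^2) with y = Im z, without any loss \<epsilon> in the exponential rate. This is the form
  required at \<sigma> = 1/3, where no exponential margin is left.\<close>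

lemma norm_rGamma_quadratic_bound:
  fixes r :: real
  obtains C where "C > 0" "\<And>z. Re z \<ge> 5 / 2 \<Longrightarrow> norm (rGamma z) \<le> C * exp (- r * Re z + pi / 2 * \<bar>Im z\<bar>) / (1 + (Im z)\<^sup>2)"
proof -
  obtain C where C: "C > 0" "\<And>x. x \<ge> 1/2 \<Longrightarrow> rGamma x \<le> C * exp (- r * x)"
    using rGamma_exp_bounded[of r] by blast
  show ?thesis
  proof (rule that[of "4 * C * exp (2 * r)"])
    fix z :: complex assume z: "Re z \<ge> 5 / 2"
    have ge: "norm (z - 2) * norm (z - 1) \<ge> (1 + (Im z)\<^sup>2) / 4"
    proof -
      have b: "norm (z - of_real c) \<ge> sqrt ((1 + (Im z)\<^sup>2) / 4)" if "c \<le> 2" for c :: real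
      proof (rule real_le_lsqrt)
        have "(1 / 2)\<^sup>2 \<le> (Re z - c)\<^sup>2" using z that by (intro power_mono) auto
        hence "1 / 4 \<le> (Re z - c)\<^sup>2" by (simp add: power_divide)
        have gen: "(1 + Y) / 4 \<le> A + Y" if "1 / 4 \<le> A" "0 \<le> Y" for A Y :: real
          using that by (simp add: field_simps)
        have "(1 + (Im z)\<^sup>2) / 4 \<le> (Re z - c)\<^sup>2 + (Im z)\<^sup>2"
          by (rule gen[OF \<open>1 / 4 \<le> (Re z - c)\<^sup>2\<close> zero_le_power2])
        thus "(1 + (Im z)\<^sup>2) / 4 \<le> (norm (z - of_real c))\<^sup>2"
          by (simp add: cmod_power2)
      qed auto
      have "sqrt ((1 + (Im z)\<^sup>2) / 4) * sqrt ((1 + (Im z)\<^sup>2) / 4) \<le> norm (z - 2) * norm (z - 1)"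
        using b[of 2] b[of 1] by (intro mult_mono) auto
      thus ?thesis by simp
    qed
    have "rGamma (z - 2) = (z - 2) * rGamma (z - 1)" "rGamma (z - 1) = (z - 1) * rGamma z"
      using rGamma_plus1[of "z - 2"] rGamma_plus1[of "z - 1"] by (simp_all add: algebra_simps)
    hence eq: "norm (rGamma (z - 2)) = norm (z - 2) * norm (z - 1) * norm (rGamma z)"
      by (simp add: norm_mult)
    have "(1 + (Im z)\<^sup>2) / 4 * norm (rGamma z) \<le> norm (z - 2) * norm (z - 1) * norm (rGamma z)"
      by (intro mult_right_mono ge) auto
    also have "\<dots> = norm (rGamma (z - 2))" by (simp add: eq)
    also have "\<dots> \<le> rGamma (Re (z - 2)) * exp (pi * \<bar>Im (z - 2)\<bar> / 2)"
      using z by (intro norm_rGamma_le) auto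
    also have "\<dots> \<le> C * exp (- r * (Re z - 2)) * exp (pi * \<bar>Im z\<bar> / 2)"
      using C(2)[of "Re z - 2"] z by (auto intro!: mult_right_mono)
    also have "\<dots> = C * exp (2 * r) * exp (- r * Re z + pi / 2 * \<bar>Im z\<bar>)"
      by (simp add: exp_add[symmetric] algebra_simps)
    finally have "(1 + (Im z)\<^sup>2) * norm (rGamma z) \<le> 4 * C * exp (2 * r) * exp (- r * Re z + pi / 2 * \<bar>Im z\<bar>)"
      by simp
    moreover have "1 + (Im z)\<^sup>2 > 0" by (simp add: add_pos_nonneg)
    ultimately show "norm (rGamma z) \<le> 4 * C * exp (2 * r) * exp (- r * Re z + pi / 2 * \<bar>Im z\<bar>) / (1 + (Im z)\<^sup>2)"
      by (simp add: pos_le_divide_eq mult.commute)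
  qed (use C in auto)
qed

section \<open>Summation by contour integrals\<close>

text \<open>Exponential decay is weakened to 1/(1 + t^2) so that line integrals can be bounded by an
  arctangent.\<close>

lemma exp_neg_le_quadratic:
  fixes l t :: real
  assumes "l > 0" "t \<ge> 0"
  shows "exp (- l * t) \<le> (1 + 2 / l\<^sup>2) / (1 + t\<^sup>2)"
proof -
  have "(1 + t\<^sup>2) * exp (- l * t) \<le> 1 + 2 / l\<^sup>2"
  proof -
    have "exp (l * t) \<ge> (l * t)\<^sup>2 / 2"
    proof -
      have "l * t \<ge> 0" using assms by simp
      thus ?thesis using exp_lower_Taylor_quadratic[of "l * t"] by linarith
    qed
    hence "t\<^sup>2 \<le> 2 / l\<^sup>2 * exp (l * t)" using assms by (simp add: field_simps power_mult_distrib)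
    hence "t\<^sup>2 * exp (- l * t) \<le> 2 / l\<^sup>2 * exp (l * t) * exp (- l * t)" by (intro mult_right_mono) auto
    also have "\<dots> = 2 / l\<^sup>2" by (simp add: exp_minus)
    finally have 1: "t\<^sup>2 * exp (- l * t) \<le> 2 / l\<^sup>2" .
    have 2: "exp (- l * t) \<le> 1" using assms by simp
    have "(1 + t\<^sup>2) * exp (- l * t) = exp (- l * t) + t\<^sup>2 * exp (- l * t)" by (simp add: algebra_simps)
    thus ?thesis using 1 2 by linarith
  qed
  moreover have "1 + t\<^sup>2 > 0" by (simp add: add_pos_nonneg)
  ultimately show ?thesis by (simp add: pos_le_divide_eq mult.commute)
qed

text \<open>B/(1 + t^2) has the primitive B arctan t, and arctan stays below \<pi>/2 < 2. The bound
  is independent of the length T and so replaces the convergence of an integral over the whole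
  ray.\<close>

lemma contour_integral_arctan_bound:
  fixes f :: "complex \<Rightarrow> complex"
  assumes cont: "continuous_on (closed_segment a (a + of_real T * v)) f" and "T \<ge> 0" "B \<ge> 0"
    and le: "\<And>t. 0 \<le> t \<Longrightarrow> t \<le> T \<Longrightarrow> norm (f (a + of_real t * v)) \<le> B / (1 + t\<^sup>2)"
  shows "norm (contour_integral (linepath a (a + of_real T * v)) f) \<le> 2 * B * norm v"
proof -
  let ?b = "a + of_real T * v"
  have lp: "linepath a ?b x = a + of_real (T * x) * v" for x
    by (simp add: linepath_def scaleR_conv_of_real algebra_simps)
  have "f contour_integrable_on linepath a ?b"
    by (intro contour_integrable_continuous_linepath cont)
  hence hi: "((\<lambda>x. f (linepath a ?b x) * (?b - a)) has_integral contour_integral (linepath a ?b) f) {0..1}"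
    using has_contour_integral_integral has_contour_integral_linepath by blast
  define h where "h = (\<lambda>x. B * norm v * arctan (T * x))"
  have hh: "((\<lambda>x. B * norm v * (T / (1 + (T * x)\<^sup>2))) has_integral (h 1 - h 0)) {0..1}"
  proof (rule fundamental_theorem_of_calculus)
    fix x :: real
    have "(h has_field_derivative B * norm v * (inverse (1 + (T * x)\<^sup>2) * T)) (at x within {0..1})"
      unfolding h_def by (auto intro!: derivative_eq_intros)
    thus "(h has_vector_derivative B * norm v * (T / (1 + (T * x)\<^sup>2))) (at x within {0..1})"
      by (simp add: has_real_derivative_iff_has_vector_derivative divide_inverse mult_ac)
  qed simp
  have "norm (contour_integral (linepath a ?b) f) \<le> h 1 - h 0"
  proof (rule integral_norm_bound_integral[of "\<lambda>x. f (linepath a ?b x) * (?b - a)" "{0..1}" "\<lambda>x. B * norm v * (T / (1 + (T * x)\<^sup>2))",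
        unfolded integral_unique[OF hi] integral_unique[OF hh]])
    show "(\<lambda>x. f (linepath a ?b x) * (?b - a)) integrable_on {0..1}" using hi by blast
    show "(\<lambda>x. B * norm v * (T / (1 + (T * x)\<^sup>2))) integrable_on {0..1}" using hh by blast
    fix x :: real assume x: "x \<in> {0..1}"
    have "norm (f (a + of_real (T * x) * v)) \<le> B / (1 + (T * x)\<^sup>2)"
      using x \<open>T \<ge> 0\<close> by (intro le) (auto simp: mult_left_le)
    hence "norm (f (linepath a ?b x)) * (T * norm v) \<le> B / (1 + (T * x)\<^sup>2) * (T * norm v)"
      unfolding lp using \<open>T \<ge> 0\<close> by (intro mult_right_mono) auto
    thus "norm (f (linepath a ?b x) * (?b - a)) \<le> B * norm v * (T / (1 + (T * x)\<^sup>2))"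
      using \<open>T \<ge> 0\<close> by (simp add: norm_mult mult_ac)
  qed
  also have "h 1 - h 0 = B * norm v * arctan T" by (simp add: h_def)
  also have "\<dots> \<le> B * norm v * 2"
    using arctan_ubound[of T] pi_less_4 \<open>B \<ge> 0\<close> by (intro mult_left_mono) auto
  finally show ?thesis by (simp add: mult_ac)
qed

section \<open>Residue sums over rectangles\<close>

lemma contour_integral_rectpath:
  assumes cont: "continuous_on (path_image (rectpath a1 a3)) f" and le: "Re a1 \<le> Re a3" "Im a1 \<le> Im a3"
  defines "a2 \<equiv> Complex (Re a3) (Im a1)" and "a4 \<equiv> Complex (Re a1) (Im a3)"
  shows "contour_integral (rectpath a1 a3) f = contour_integral (linepath a1 a2) f + contour_integral (linepath a2 a3) f
    + contour_integral (linepath a3 a4) f + contour_integral (linepath a4 a1) f"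
proof -
  have rp: "rectpath a1 a3 = linepath a1 a2 +++ linepath a2 a3 +++ linepath a3 a4 +++ linepath a4 a1"
    by (simp add: rectpath_def a2_def a4_def Let_def)
  have "path_image (rectpath a1 a3) = closed_segment a1 a2 \<union> (closed_segment a2 a3 \<union> (closed_segment a3 a4 \<union> closed_segment a4 a1))"
    unfolding rp by (simp add: path_image_join)
  hence "f contour_integrable_on linepath a1 a2" "f contour_integrable_on linepath a2 a3"
    "f contour_integrable_on linepath a3 a4" "f contour_integrable_on linepath a4 a1"
    by (auto intro!: contour_integrable_continuous_linepath continuous_on_subset[OF cont])
  thus ?thesis unfolding rp by (simp add: contour_integrable_join)
qed

lemma rectangle_residues:
  assumes S: "open S" "convex S" "finite pts" and f: "f holomorphic_on S - pts"
    and le: "Re a1 < Re a3" "Im a1 < Im a3" and sub: "cbox a1 a3 \<subseteq> S"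
    and fr: "\<And>p. p \<in> pts \<Longrightarrow> p \<in> box a1 a3 \<or> p \<notin> cbox a1 a3"
  shows "contour_integral (rectpath a1 a3) f = 2 * of_real pi * \<i> * (\<Sum>p\<in>pts \<inter> box a1 a3. residue f p)"
proof -
  have pi: "path_image (rectpath a1 a3) \<subseteq> cbox a1 a3"
    using le by (intro path_image_rectpath_subset_cbox) auto
  moreover have "path_image (rectpath a1 a3) \<inter> box a1 a3 = {}"
    using le by (intro path_image_rectpath_inter_box) auto
  ultimately have img: "path_image (rectpath a1 a3) \<subseteq> S - pts"
    using sub fr by blast
  have "contour_integral (rectpath a1 a3) f = 2 * pi * \<i> * (\<Sum>p\<in>pts. winding_number (rectpath a1 a3) p * residue f p)"
  proof (rule Residue_theorem[OF S(1) convex_connected[OF S(2)] S(3) f])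
    show "\<forall>z. z \<notin> S \<longrightarrow> winding_number (rectpath a1 a3) z = 0"
      using le sub by (auto intro!: winding_number_rectpath_outside)
  qed (use img in auto)
  also have "(\<Sum>p\<in>pts. winding_number (rectpath a1 a3) p * residue f p) = (\<Sum>p\<in>pts \<inter> box a1 a3. residue f p)"
  proof (rule sum.mono_neutral_cong_right)
    show "\<forall>i\<in>pts - pts \<inter> box a1 a3. winding_number (rectpath a1 a3) i * residue f i = 0"
      using fr le by (auto intro!: winding_number_rectpath_outside)
    show "winding_number (rectpath a1 a3) x * residue f x = residue f x" if "x \<in> pts \<inter> box a1 a3" for x
      using that le winding_number_rectpath[of x a1 a3] by auto
  qed (use S in auto)
  finally show ?thesis by simp
qed

lemma residue_cot:
  assumes S: "open S" "of_int n \<in> S" and G: "G holomorphic_on S"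
  shows "residue (\<lambda>s. of_real pi * G s * cot (of_real pi * s)) (of_int n) = G (of_int n)"
proof -
  define S' where "S' = S \<inter> ball (of_int n) 1"
  have "sin (of_real pi * s) \<noteq> 0" if s: "s \<in> S' - {of_int n}" for s
  proof
    assume "sin (of_real pi * s) = 0"
    then obtain k :: int where "of_real pi * s = of_real (of_int k * pi)"
      by (auto simp: sin_eq_0)
    hence k: "s = of_int k" by (simp add: mult.commute)
    with s have "norm (of_int (n - k) :: complex) < 1" by (simp add: S'_def dist_norm)
    hence "\<bar>n - k\<bar> < 1" by (metis norm_of_int of_int_less_1_iff of_int_abs)
    thus False using s k by auto
  qed
  hence holo: "(\<lambda>s. of_real pi * G s * cot (of_real pi * s)) holomorphic_on (S' - {of_int n})"
    unfolding cot_def by (intro holomorphic_intros holomorphic_on_subset[OF G]) (auto simp: S'_def)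
  have "((\<lambda>w. sin (of_real pi * w)) has_field_derivative (of_real pi * cos (of_real pi * of_int n))) (at (of_int n :: complex))"
    by (auto intro!: derivative_eq_intros)
  moreover have sn: "sin (of_real pi * of_int n :: complex) = 0"
    by (subst sin_eq_0) (auto intro!: exI[of _ n])
  ultimately have l1: "((\<lambda>w. sin (of_real pi * w) / (w - of_int n)) \<longlongrightarrow> of_real pi * cos (of_real pi * of_int n)) (at (of_int n :: complex))"
    by (simp add: has_field_derivative_iff)
  have "(cos (of_real pi * of_int n :: complex))\<^sup>2 = 1"
    using sin_cos_squared_add[of "of_real pi * of_int n :: complex"] sn by simp
  hence c0: "cos (of_real pi * of_int n :: complex) \<noteq> 0" by auto
  have "(G \<longlongrightarrow> G (of_int n)) (at (of_int n))"
    using holomorphic_on_imp_continuous_on[OF G] S by (simp add: continuous_on_eq_continuous_at isCont_def)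
  moreover have "isCont (\<lambda>w. cos (of_real pi * w)) (of_int n :: complex)" by (intro continuous_intros)
  hence "((\<lambda>w. cos (of_real pi * w)) \<longlongrightarrow> cos (of_real pi * of_int n)) (at (of_int n :: complex))"
    by (simp add: isCont_def)
  ultimately have "((\<lambda>w. of_real pi * G w * cos (of_real pi * w) / (sin (of_real pi * w) / (w - of_int n))) \<longlongrightarrow>
      of_real pi * G (of_int n) * cos (of_real pi * of_int n) / (of_real pi * cos (of_real pi * of_int n))) (at (of_int n))"
    using c0 by (intro tendsto_intros l1) auto
  hence "((\<lambda>w. of_real pi * G w * cot (of_real pi * w) * (w - of_int n)) \<longlongrightarrow> G (of_int n)) (at (of_int n))"
    using c0 by (simp add: cot_def)
  thus ?thesis using S by (intro residue_simple'[OF _ _ holo]) (auto simp: S'_def)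
qed

lemma half_integer_strip:
  fixes m :: int and N :: nat
  assumes "of_int m - 1 < Re (of_int j :: complex)" "Re (of_int j :: complex) < of_int m + real N"
  shows "\<exists>k<N. j = m + int k"
proof -
  have "real_of_int m - 1 < real_of_int j" "real_of_int j < real_of_int m + real N"
    using assms by simp_all
  hence "m - 1 < j" "j < m + int N" by linarith+
  thus ?thesis by (intro exI[of _ "nat (j - m)"]) auto
qed

text \<open>In the strip m - 1 < Re s < m + N the zeros of sin(\<pi>s) are exactly the N integers
  from m to m + N - 1, and \<open>residue_cot\<close> makes each contribute its value of G. The
  vertical sides run midway between integers.\<close>

lemma rectangle_cot_sum:
  fixes m :: int and N :: nat
  assumes G: "G holomorphic_on {s. Re s > a'}" and a': "a' < of_int m - 1 / 2" and N: "N > 0" and Y: "Y > 0"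
  defines "a \<equiv> of_int m - 1 / 2" and "d \<equiv> of_int m - 1 / 2 + real N"
  shows "contour_integral (rectpath (Complex a (-Y)) (Complex d Y)) (\<lambda>s. of_real pi * G s * cot (of_real pi * s))
     = 2 * of_real pi * \<i> * (\<Sum>k<N. G (of_int (m + int k)))"
proof -
  define S where "S = {s. Re s > a'} \<inter> {s. Re s > of_int m - 1} \<inter> {s. Re s < of_int m + real N}"
  define pts where "pts = (\<lambda>k. complex_of_int (m + int k)) ` {..<N}"
  have inj: "inj_on (\<lambda>k. complex_of_int (m + int k)) {..<N}" by (auto simp: inj_on_def)
  have S: "open S" "convex S"
    unfolding S_def by (intro open_Int open_halfspace_Re_gt open_halfspace_Re_lt convex_Int convex_halfspace_Re_gt convex_halfspace_Re_lt)+
  have pS: "pts \<subseteq> S \<and> pts \<subseteq> box (Complex a (-Y)) (Complex d Y)"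
    using a' Y by (auto simp: pts_def S_def a_def d_def in_box_complex_iff)
  have nz: "sin (of_real pi * s) \<noteq> 0" if s: "s \<in> S - pts" for s
  proof
    assume "sin (of_real pi * s) = 0"
    then obtain k :: int where "of_real pi * s = of_real (of_int k * pi)"
      by (auto simp: sin_eq_0)
    hence k: "s = of_int k" by (simp add: mult.commute)
    with s half_integer_strip[of m k N] obtain i where "i < N" "k = m + int i" by (auto simp: S_def)
    thus False using s k by (auto simp: pts_def)
  qed
  have G': "G holomorphic_on S" by (rule holomorphic_on_subset[OF G]) (auto simp: S_def)
  have holo: "(\<lambda>s. of_real pi * G s * cot (of_real pi * s)) holomorphic_on S - pts"
    unfolding cot_def using nz by (intro holomorphic_intros holomorphic_on_subset[OF G']) auto
  have "contour_integral (rectpath (Complex a (-Y)) (Complex d Y)) (\<lambda>s. of_real pi * G s * cot (of_real pi * s))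
     = 2 * of_real pi * \<i> * (\<Sum>p\<in>pts \<inter> box (Complex a (-Y)) (Complex d Y). residue (\<lambda>s. of_real pi * G s * cot (of_real pi * s)) p)"
  proof (rule rectangle_residues[OF S _ holo])
    show "cbox (Complex a (-Y)) (Complex d Y) \<subseteq> S"
      using a' by (auto simp: S_def in_cbox_complex_iff a_def d_def)
  qed (use pS N Y in \<open>auto simp: pts_def a_def d_def\<close>)
  also have "pts \<inter> box (Complex a (-Y)) (Complex d Y) = pts" using pS by blast
  also have "(\<Sum>p\<in>pts. residue (\<lambda>s. of_real pi * G s * cot (of_real pi * s)) p) = (\<Sum>p\<in>pts. G p)"
  proof (rule sum.cong[OF refl])
    fix p assume p: "p \<in> pts"
    then obtain k where k: "p = of_int (m + int k)" by (auto simp: pts_def)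
    show "residue (\<lambda>s. of_real pi * G s * cot (of_real pi * s)) p = G p"
      unfolding k using p pS by (intro residue_cot[OF S(1) _ G']) (auto simp: k)
  qed
  also have "\<dots> = (\<Sum>k<N. G (of_int (m + int k)))"
    unfolding pts_def by (subst sum.reindex[OF inj]) simp
  finally show ?thesis .
qed

section \<open>Abel-Plana summation over a half plane\<close>

lemma half_cot_lower:
  assumes "exp (2 * pi * \<i> * s) \<noteq> 1"
  shows "cot (of_real pi * s) / (2 * \<i>) = 1 / 2 + 1 / (exp (2 * pi * \<i> * s) - 1)"
proof -
  define E where "E = exp (\<i> * (of_real pi * s))"
  have E0: "E \<noteq> 0" by (simp add: E_def)
  have E2: "exp (2 * pi * \<i> * s) = E * E" by (simp add: E_def exp_add[symmetric] algebra_simps)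
  have ne: "E * E - 1 \<noteq> 0" using assms E2 by simp
  have "cot (of_real pi * s) = \<i> * (E * E + 1) / (E * E - 1)"
    unfolding cot_def sin_exp_eq cos_exp_eq exp_minus E_def[symmetric]
    using E0 ne by (simp add: field_simps)
  show ?thesis unfolding E2 \<open>cot (of_real pi * s) = _\<close> using ne by (simp add: field_simps)
qed

lemma half_cot_upper:
  assumes "exp (2 * pi * \<i> * s) \<noteq> 1"
  shows "cot (of_real pi * s) / (2 * \<i>) = - 1 / 2 - 1 / (exp (- 2 * pi * \<i> * s) - 1)"
proof -
  define E where "E = exp (2 * pi * \<i> * s)"
  have E: "E \<noteq> 0" "E \<noteq> 1" using assms by (auto simp: E_def)
  have "exp (- 2 * pi * \<i> * s) = 1 / E" by (simp add: E_def exp_minus divide_inverse)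
  have "1 / 2 + 1 / (E - 1) = - 1 / 2 - 1 / (1 / E - 1)"
    using E by (simp add: field_simps)
  thus ?thesis unfolding half_cot_lower[OF assms] \<open>exp (- 2 * pi * \<i> * s) = 1 / E\<close> E_def .
qed

text \<open>Half way between integers exp(2\<pi>is) is a negative real number, so the denominators
  of the two kernels have modulus above 1 and the kernels can be bounded down to the real
  axis.\<close>

lemma half_integer_kernel:
  fixes s :: complex and m :: int
  assumes "Re s = of_int m - 1 / 2"
  shows "exp (2 * pi * \<i> * s) = - of_real (exp (- 2 * pi * Im s))" "exp (- 2 * pi * \<i> * s) = - of_real (exp (2 * pi * Im s))"
proof -
  have s: "s = of_int m - 1 / 2 + \<i> * of_real (Im s)"
    using assms by (simp add: complex_eq_iff)
  have p: "exp (2 * of_real pi * \<i> * of_int n) = 1" for n :: int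
    using exp_integer_2pi[of "of_int n"] by (simp add: mult_ac)
  have "exp (2 * pi * \<i> * s) = exp (2 * of_real pi * \<i> * of_int m + (- (\<i> * of_real pi) + of_real (- 2 * pi * Im s)))"
    by (subst s, rule arg_cong[where f = exp]) (simp add: algebra_simps)
  also have "\<dots> = - of_real (exp (- 2 * pi * Im s))"
    unfolding exp_add p by (simp add: exp_minus exp_of_real[symmetric])
  finally show "exp (2 * pi * \<i> * s) = - of_real (exp (- 2 * pi * Im s))" .
  hence "exp (- (2 * pi * \<i> * s)) = inverse (- of_real (exp (- 2 * pi * Im s)))"
    by (simp add: exp_minus)
  thus "exp (- 2 * pi * \<i> * s) = - of_real (exp (2 * pi * Im s))"
    by (simp add: exp_minus)
qed


lemma norm_kernel_half_integer:
  fixes s :: complex and m :: int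
  assumes "Re s = of_int m - 1 / 2"
  shows "norm (1 / (exp (2 * pi * \<i> * s) - 1)) \<le> exp (2 * pi * Im s)"
    and "norm (1 / (exp (- 2 * pi * \<i> * s) - 1)) \<le> exp (- 2 * pi * Im s)"
proof -
  have gen: "norm (1 / (- of_real (exp x) - 1 :: complex)) \<le> exp (- x)" for x
  proof -
    have "- of_real (exp x) - 1 = (- of_real (exp x + 1) :: complex)" by simp
    hence "norm (- of_real (exp x) - 1 :: complex) = exp x + 1"
      by (metis norm_minus_cancel norm_of_real abs_of_pos add_pos_pos exp_gt_zero zero_less_one)
    hence "norm (1 / (- of_real (exp x) - 1 :: complex)) = 1 / (exp x + 1)" by (simp add: norm_divide)
    also have "\<dots> \<le> 1 / exp x" by (intro divide_left_mono) (auto intro!: mult_pos_pos add_pos_pos)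
    finally show ?thesis by (simp add: exp_minus divide_inverse)
  qed
  show "norm (1 / (exp (2 * pi * \<i> * s) - 1)) \<le> exp (2 * pi * Im s)"
    using gen[of "- 2 * pi * Im s"] unfolding half_integer_kernel(1)[OF assms] by simp
  show "norm (1 / (exp (- 2 * pi * \<i> * s) - 1)) \<le> exp (- 2 * pi * Im s)"
    using gen[of "2 * pi * Im s"] unfolding half_integer_kernel(2)[OF assms] by simp
qed

lemma norm_kernel_far:
  fixes s :: complex
  shows "Im s \<le> -1 \<Longrightarrow> norm (1 / (exp (2 * pi * \<i> * s) - 1)) \<le> 2 * exp (2 * pi * Im s)"
    and "Im s \<ge> 1 \<Longrightarrow> norm (1 / (exp (- 2 * pi * \<i> * s) - 1)) \<le> 2 * exp (- 2 * pi * Im s)"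
proof -
  have gen: "norm (1 / (w - 1)) \<le> 2 / norm w" if "norm w \<ge> 2" for w :: complex
  proof -
    have "norm (w - 1) \<ge> norm w - 1" using norm_triangle_ineq2[of w 1] by simp
    hence "norm (w - 1) \<ge> norm w / 2" using that by linarith
    hence "1 / norm (w - 1) \<le> 1 / (norm w / 2)" using that by (intro divide_left_mono mult_pos_pos) auto
    thus ?thesis by (simp add: norm_divide)
  qed
  have e2: "exp x \<ge> 2" if "x \<ge> 1" for x :: real
    using exp_ge_add_one_self[of x] that by linarith
  show "norm (1 / (exp (2 * pi * \<i> * s) - 1)) \<le> 2 * exp (2 * pi * Im s)" if "Im s \<le> -1"
  proof -
    have n: "norm (exp (2 * pi * \<i> * s)) = exp (- 2 * pi * Im s)" by (simp add: norm_exp_eq_Re)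
    have "1 * 1 \<le> (2 * pi) * (- Im s)" using that pi_ge_two by (intro mult_mono) auto
    hence "- 2 * pi * Im s \<ge> 1" by simp
    from gen[of "exp (2 * pi * \<i> * s)", unfolded n, OF e2[OF this]] show ?thesis
      by (simp add: exp_minus divide_inverse)
  qed
  show "norm (1 / (exp (- 2 * pi * \<i> * s) - 1)) \<le> 2 * exp (- 2 * pi * Im s)" if "Im s \<ge> 1"
  proof -
    have n: "norm (exp (- 2 * pi * \<i> * s)) = exp (2 * pi * Im s)" by (simp add: norm_exp_eq_Re)
    have "1 * 1 \<le> (2 * pi) * Im s" using that pi_ge_two by (intro mult_mono) auto
    hence "2 * pi * Im s \<ge> 1" by simp
    from gen[of "exp (- 2 * pi * \<i> * s)", unfolded n, OF e2[OF this]] show ?thesis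
      by (simp add: exp_minus divide_inverse)
  qed
qed

text \<open>Abel--Plana summation over a half plane whose boundary passes between two integers: above the
  real axis \<open>\<pi> cot \<pi>s\<close> differs from \<open>-i\<pi>\<close>, below it from \<open>i\<pi>\<close>, by an exponentially small kernel.\<close>

lemma abel_plana_bound:
  fixes m :: int and N :: nat and G :: "complex \<Rightarrow> complex"
  defines "a \<equiv> real_of_int m - 1 / 2" and "d \<equiv> real_of_int m - 1 / 2 + real N"
  assumes \<Psi>: "\<And>s. Re s > a' \<Longrightarrow> (\<Psi> has_field_derivative G s) (at s)" and a': "a' < a"
    and \<theta>: "\<theta> < 2 * pi" and \<beta>: "\<beta>1 \<ge> 0" "\<beta>2 \<ge> 0" and N: "N > 0"
    and left: "\<And>s. Re s = a \<Longrightarrow> norm (G s) \<le> \<beta>1 * exp (\<theta> * \<bar>Im s\<bar>)"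
    and right: "\<And>s. Re s = d \<Longrightarrow> norm (G s) \<le> \<beta>2 * exp (\<theta> * \<bar>Im s\<bar>)"
    and mid: "\<And>s. a \<le> Re s \<Longrightarrow> Re s \<le> d \<Longrightarrow> norm (G s) \<le> B * exp (\<theta> * \<bar>Im s\<bar>)"
  shows "norm ((\<Sum>k<N. G (of_int (m + int k))) - (\<Psi> (of_real d) - \<Psi> (of_real a)))
           \<le> 4 * (1 + 2 / (2 * pi - \<theta>)\<^sup>2) * (\<beta>1 + \<beta>2)"
proof -
  define l where "l = 2 * pi - \<theta>"
  have l0: "l > 0" using \<theta> by (simp add: l_def)
  define C where "C = 1 + 2 / l\<^sup>2"
  define X where "X = (\<Sum>k<N. G (of_int (m + int k))) - (\<Psi> (of_real d) - \<Psi> (of_real a))"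
  have ad: "a < d" using N by (simp add: a_def d_def)
  have C0: "C \<ge> 0" by (simp add: C_def)
  have B0: "B \<ge> 0"
    using mid[of "of_real a"] ad by (simp) (meson norm_ge_zero order.trans)
  define S where "S = {s. Re s > a'}"
  have oS: "open S" "convex S" by (auto simp: S_def open_halfspace_Re_gt convex_halfspace_Re_gt)
  \<comment> \<open>G inherits holomorphy as the derivative of the given primitive.\<close>
  have hG: "G holomorphic_on S"
  proof -
    have "\<Psi> holomorphic_on S" unfolding holomorphic_on_open[OF oS(1)] using \<Psi> by (auto simp: S_def)
    from holomorphic_deriv[OF this oS(1)] show ?thesis
      by (rule holomorphic_transform) (use \<Psi> in \<open>auto simp: S_def intro: DERIV_imp_deriv\<close>)
  qed
  hence cG: "continuous_on S G" by (rule holomorphic_on_imp_continuous_on)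
  \<comment> \<open>\<open>Z\<close> is the half plane without the integers, on which both kernels
    are defined.\<close>
  define Z where "Z = {s \<in> S. exp (2 * pi * \<i> * s) \<noteq> 1}"
  define Km Kp where "Km = (\<lambda>s::complex. 1 / (exp (2 * pi * \<i> * s) - 1))" and "Kp = (\<lambda>s::complex. 1 / (exp (- 2 * pi * \<i> * s) - 1))"
  have Zp: "exp (- 2 * pi * \<i> * s) \<noteq> 1" if "s \<in> Z" for s
    using that by (auto simp: Z_def exp_minus inverse_eq_1_iff)
  define f where "f = (\<lambda>s. G s * (cot (of_real pi * s) / (2 * \<i>)))"
  have fm: "f s = 1 / 2 * G s + Km s * G s" if "s \<in> Z" for s
  proof -
    have e: "exp (2 * pi * \<i> * s) \<noteq> 1" using that by (simp add: Z_def)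
    show ?thesis unfolding f_def half_cot_lower[OF e] Km_def by (simp add: algebra_simps)
  qed
  have fp: "f s = - 1 / 2 * G s - Kp s * G s" if "s \<in> Z" for s
  proof -
    have e: "exp (2 * pi * \<i> * s) \<noteq> 1" using that by (simp add: Z_def)
    show ?thesis unfolding f_def half_cot_upper[OF e] Kp_def by (simp add: algebra_simps)
  qed
  have cGZ: "continuous_on Z G" using cG by (rule continuous_on_subset) (auto simp: Z_def)
  have cm: "continuous_on Z (\<lambda>s. Km s * G s)" unfolding Km_def
    by (intro continuous_intros cGZ) (auto simp: Z_def)
  have cp: "continuous_on Z (\<lambda>s. Kp s * G s)" unfolding Kp_def
    using Zp by (intro continuous_intros cGZ) auto
  have "continuous_on Z (\<lambda>s. 1 / 2 * G s + Km s * G s)"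
    by (intro continuous_intros cGZ cm)
  hence cf: "continuous_on Z f"
    by (rule continuous_on_eq) (use fm in auto)
  have segG: "(G has_contour_integral (\<Psi> q - \<Psi> p)) (linepath p q)" if "closed_segment p q \<subseteq> Z" for p q
  proof -
    have "(G has_contour_integral (\<Psi> (pathfinish (linepath p q)) - \<Psi> (pathstart (linepath p q)))) (linepath p q)"
      by (rule contour_integral_primitive[of S]) (use that \<Psi> in \<open>auto simp: S_def Z_def intro: has_field_derivative_at_within\<close>)
    thus ?thesis by simp
  qed
  \<comment> \<open>Below the real axis f is G/2 plus a kernel term, above it -G/2 minus one; the
    integrals of G/2 are evaluated by the primitive \<Psi>.\<close>
  have segm: "contour_integral (linepath p q) f = 1 / 2 * (\<Psi> q - \<Psi> p) + contour_integral (linepath p q) (\<lambda>s. Km s * G s)"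
    if pq: "closed_segment p q \<subseteq> Z" for p q
  proof -
    have "((\<lambda>s. Km s * G s) has_contour_integral contour_integral (linepath p q) (\<lambda>s. Km s * G s)) (linepath p q)"
      by (intro has_contour_integral_integral contour_integrable_continuous_linepath continuous_on_subset[OF cm] pq)
    from has_contour_integral_add[OF has_contour_integral_lmul[OF segG[OF pq], of "1/2"] this]
    have "(f has_contour_integral 1 / 2 * (\<Psi> q - \<Psi> p) + contour_integral (linepath p q) (\<lambda>s. Km s * G s)) (linepath p q)"
      by (rule has_contour_integral_eq) (use pq fm in auto)
    thus ?thesis by (rule contour_integral_unique)
  qed
  have segp: "contour_integral (linepath p q) f = - 1 / 2 * (\<Psi> q - \<Psi> p) - contour_integral (linepath p q) (\<lambda>s. Kp s * G s)"
    if pq: "closed_segment p q \<subseteq> Z" for p q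
  proof -
    have "((\<lambda>s. Kp s * G s) has_contour_integral contour_integral (linepath p q) (\<lambda>s. Kp s * G s)) (linepath p q)"
      by (intro has_contour_integral_integral contour_integrable_continuous_linepath continuous_on_subset[OF cp] pq)
    from has_contour_integral_diff[OF has_contour_integral_lmul[OF segG[OF pq], of "-1/2"] this]
    have "(f has_contour_integral - 1 / 2 * (\<Psi> q - \<Psi> p) - contour_integral (linepath p q) (\<lambda>s. Kp s * G s)) (linepath p q)"
      by (rule has_contour_integral_eq) (use pq fp in auto)
    thus ?thesis by (rule contour_integral_unique)
  qed
  have Zv: "s \<in> Z" if "Re s = a \<or> Re s = d" for s
  proof -
    have "exp (2 * pi * \<i> * s) = - of_real (exp (- 2 * pi * Im s))"
      using that half_integer_kernel(1)[of s m] half_integer_kernel(1)[of s "m + int N"] by (auto simp: a_def d_def)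
    moreover have "- of_real (exp (- 2 * pi * Im s)) \<noteq> (1::complex)"
    proof
      assume "- of_real (exp (- 2 * pi * Im s)) = (1::complex)"
      hence "Re (- of_real (exp (- 2 * pi * Im s)) :: complex) = 1" by simp
      thus False using exp_gt_zero[of "- 2 * pi * Im s"] by simp
    qed
    ultimately show ?thesis using that a' ad by (auto simp: Z_def S_def)
  qed
  have Zh: "s \<in> Z" if "a \<le> Re s" "Im s \<noteq> 0" for s
  proof -
    have "norm (exp (2 * pi * \<i> * s)) = exp (- 2 * pi * Im s)" by (simp add: norm_exp_eq_Re)
    hence "norm (exp (2 * pi * \<i> * s)) \<noteq> 1" using that by simp
    hence "exp (2 * pi * \<i> * s) \<noteq> 1" by (metis norm_one)
    thus ?thesis using that a' by (auto simp: Z_def S_def)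
  qed
  have XY: "norm X \<le> 4 * C * (\<beta>1 + \<beta>2) + 8 * B * real N * exp (- l * Y)" if Y: "Y \<ge> 1" for Y
  proof -
    define p1 p2 p3 p4 where "p1 = Complex a (-Y)" and "p2 = Complex d (-Y)" and "p3 = Complex d Y" and "p4 = Complex a Y"
    let ?a = "complex_of_real a" and ?d = "complex_of_real d"
    have vert: "Re s = Re p" if seg: "s \<in> closed_segment p q" "Re p = Re q" for s p q
    proof -
      obtain u where "s = (1 - u) *\<^sub>R p + u *\<^sub>R q" using seg(1) unfolding closed_segment_def by blast
      hence "Re s = (1 - u) * Re p + u * Re q" by simp
      thus ?thesis using seg(2) by (simp add: algebra_simps)
    qed
    have hor: "Im s = Im p \<and> min (Re p) (Re q) \<le> Re s \<and> Re s \<le> max (Re p) (Re q)" if s: "s \<in> closed_segment p q" "Im p = Im q" for s p q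
    proof -
      obtain u where u: "0 \<le> u" "u \<le> 1" and eq: "s = (1 - u) *\<^sub>R p + u *\<^sub>R q" using s(1) by (auto simp: closed_segment_def)
      have "Re s = (1 - u) *\<^sub>R Re p + u *\<^sub>R Re q" unfolding eq by simp
      hence "Re s \<in> closed_segment (Re p) (Re q)" using u unfolding closed_segment_def by blast
      moreover have "Im s = (1 - u) * Im p + u * Im q" unfolding eq by simp
      hence "Im s = Im p" using s(2) by (simp add: algebra_simps)
      ultimately show ?thesis by (auto simp: closed_segment_eq_real_ivl split: if_splits)
    qed
    have segs_h: "closed_segment p1 p2 \<subseteq> Z" "closed_segment p3 p4 \<subseteq> Z"
      using Y ad by (auto intro!: Zh dest!: hor simp: p1_def p2_def p3_def p4_def)
    have segs_v: "closed_segment p2 ?d \<subseteq> Z" "closed_segment ?d p3 \<subseteq> Z" "closed_segment p4 ?a \<subseteq> Z"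
       "closed_segment ?a p1 \<subseteq> Z" "closed_segment p2 p3 \<subseteq> Z" "closed_segment p4 p1 \<subseteq> Z"
      by (auto intro!: Zv dest!: vert simp: p1_def p2_def p3_def p4_def)
    note segs = segs_h(1) segs_v(1,2) segs_h(2) segs_v(3,4,5,6)
    have img: "path_image (rectpath p1 p3) \<subseteq> Z"
    proof -
      have "rectpath p1 p3 = linepath p1 p2 +++ linepath p2 p3 +++ linepath p3 p4 +++ linepath p4 p1"
        by (simp add: rectpath_def p1_def p2_def p3_def p4_def Let_def)
      thus ?thesis using segs by (simp add: path_image_join)
    qed
    have "contour_integral (rectpath p1 p3) (\<lambda>s. of_real pi * G s * cot (of_real pi * s)) = 2 * of_real pi * \<i> * (\<Sum>k<N. G (of_int (m + int k)))"
      unfolding p1_def p3_def a_def d_def using hG a' N Y by (intro rectangle_cot_sum[where a' = a']) (auto simp: S_def a_def)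
    moreover have "contour_integral (rectpath p1 p3) (\<lambda>s. 2 * of_real pi * \<i> * f s) = 2 * of_real pi * \<i> * contour_integral (rectpath p1 p3) f"
    proof (rule contour_integral_lmul)
      have "rectpath p1 p3 = linepath p1 p2 +++ linepath p2 p3 +++ linepath p3 p4 +++ linepath p4 p1"
        by (simp add: rectpath_def p1_def p2_def p3_def p4_def Let_def)
      thus "f contour_integrable_on rectpath p1 p3"
        using segs by (auto intro!: contour_integrable_joinI contour_integrable_continuous_linepath continuous_on_subset[OF cf])
    qed
    moreover have "(\<lambda>s. 2 * of_real pi * \<i> * f s) = (\<lambda>s. of_real pi * G s * cot (of_real pi * s))"
    proof
      fix s
      have "2 * of_real pi * \<i> * f s = of_real pi * G s * (2 * \<i> * (cot (of_real pi * s) / (2 * \<i>)))"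
        by (simp only: f_def mult_ac)
      also have "2 * \<i> * (cot (of_real pi * s) / (2 * \<i>)) = cot (of_real pi * s)" by simp
      finally show "2 * of_real pi * \<i> * f s = of_real pi * G s * cot (of_real pi * s)" .
    qed
    ultimately have "(\<Sum>k<N. G (of_int (m + int k))) = contour_integral (rectpath p1 p3) f" by simp
    also have "\<dots> = contour_integral (linepath p1 p2) f + contour_integral (linepath p2 p3) f + contour_integral (linepath p3 p4) f + contour_integral (linepath p4 p1) f"
    proof -
      have "continuous_on (path_image (rectpath p1 p3)) f" by (rule continuous_on_subset[OF cf img])
      from contour_integral_rectpath[OF this] show ?thesis using ad Y by (simp add: p1_def p2_def p3_def p4_def)
    qed
    also have "contour_integral (linepath p2 p3) f = contour_integral (linepath p2 ?d) f + contour_integral (linepath ?d p3) f"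
    proof (rule contour_integral_split_linepath[OF continuous_on_subset[OF cf segs(7)]])
      show "?d \<in> closed_segment p2 p3"
        unfolding closed_segment_def using Y by (auto intro!: exI[of _ "1/2"] simp: p2_def p3_def complex_eq_iff)
    qed
    also have "contour_integral (linepath p4 p1) f = contour_integral (linepath p4 ?a) f + contour_integral (linepath ?a p1) f"
    proof (rule contour_integral_split_linepath[OF continuous_on_subset[OF cf segs(8)]])
      show "?a \<in> closed_segment p4 p1"
        unfolding closed_segment_def using Y by (auto intro!: exI[of _ "1/2"] simp: p1_def p4_def complex_eq_iff)
    qed
    finally have sum: "(\<Sum>k<N. G (of_int (m + int k))) = contour_integral (linepath p1 p2) f +
        (contour_integral (linepath p2 ?d) f + contour_integral (linepath ?d p3) f) + contour_integral (linepath p3 p4) f +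
        (contour_integral (linepath p4 ?a) f + contour_integral (linepath ?a p1) f)" .
    \<comment> \<open>The contributions of \<Psi>/2 at the corners cancel. On the two vertical sides
      the sign changes at the real axis, so that \<Psi>(d) - \<Psi>(a) survives, and six kernel
      integrals remain.\<close>
    have gen: "1 / 2 * (q2 - q1) + i1 + (1 / 2 * (d' - q2) + i2 + (- 1 / 2 * (q3 - d') - i3)) + (- 1 / 2 * (q4 - q3) - i4)
       + (- 1 / 2 * (a' - q4) - i5 + (1 / 2 * (q1 - a') + i6)) - (d' - a') = i6 + i1 + i2 - i3 - i4 - i5"
      for q1 q2 q3 q4 d' a' i1 i2 i3 i4 i5 i6 :: complex
      by (simp add: field_simps)
    have X: "X = contour_integral (linepath ?a p1) (\<lambda>s. Km s * G s) + contour_integral (linepath p1 p2) (\<lambda>s. Km s * G s)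
        + contour_integral (linepath p2 ?d) (\<lambda>s. Km s * G s) - contour_integral (linepath ?d p3) (\<lambda>s. Kp s * G s)
        - contour_integral (linepath p3 p4) (\<lambda>s. Kp s * G s) - contour_integral (linepath p4 ?a) (\<lambda>s. Kp s * G s)"
      unfolding X_def sum segm[OF segs(1)] segm[OF segs(2)] segp[OF segs(3)] segp[OF segs(4)] segp[OF segs(5)] segm[OF segs(6)]
      by (rule gen)
    have decay: "exp (- 2 * pi * t) * (b * exp (\<theta> * t)) \<le> b * C / (1 + t\<^sup>2)" if "t \<ge> 0" "b \<ge> 0" for t b
    proof -
      have "exp (- 2 * pi * t) * (b * exp (\<theta> * t)) = b * exp (- l * t)"
        by (simp add: l_def exp_add[symmetric] algebra_simps)
      also have "\<dots> \<le> b * (C / (1 + t\<^sup>2))"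
        unfolding C_def using that l0 by (intro mult_left_mono exp_neg_le_quadratic) auto
      finally show ?thesis by simp
    qed
    have down: "norm (contour_integral (linepath (of_real c) (Complex c (-Y))) (\<lambda>s. Km s * G s)) \<le> 2 * (b * C)"
      if c: "c = of_int j - 1 / 2" "\<And>s. Re s = c \<Longrightarrow> norm (G s) \<le> b * exp (\<theta> * \<bar>Im s\<bar>)" "b \<ge> 0" "c = a \<or> c = d" for c b j
    proof -
      have e: "Complex c (-Y) = of_real c + of_real Y * (- \<i>)" by (simp add: complex_eq_iff)
      have "norm (contour_integral (linepath (of_real c) (of_real c + of_real Y * (- \<i>))) (\<lambda>s. Km s * G s)) \<le> 2 * (b * C) * norm (- \<i>)"
      proof (rule contour_integral_arctan_bound)
        show "continuous_on (closed_segment (of_real c) (of_real c + of_real Y * (- \<i>))) (\<lambda>s. Km s * G s)"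
          using c(4) by (intro continuous_on_subset[OF cm] subsetI Zv) (auto dest!: vert)
        fix t assume t: "0 \<le> t" "t \<le> Y"
        define s where "s = of_real c + of_real t * (- \<i>)"
        have s: "Re s = c" "Im s = - t" by (simp_all add: s_def)
        have "norm (Km s * G s) \<le> exp (2 * pi * Im s) * (b * exp (\<theta> * \<bar>Im s\<bar>))"
          unfolding norm_mult Km_def by (intro mult_mono norm_kernel_half_integer(1)[of s j] c(2)) (use s c(1) in auto)
        also have "\<dots> \<le> b * C / (1 + t\<^sup>2)" using decay[OF t(1) c(3)] s t by simp
        finally show "norm (Km (of_real c + of_real t * (- \<i>)) * G (of_real c + of_real t * (- \<i>))) \<le> b * C / (1 + t\<^sup>2)"
          unfolding s_def .
      qed (use Y c C0 in auto)
      thus ?thesis unfolding e by simp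
    qed
    have up: "norm (contour_integral (linepath (of_real c) (Complex c Y)) (\<lambda>s. Kp s * G s)) \<le> 2 * (b * C)"
      if c: "c = of_int j - 1 / 2" "\<And>s. Re s = c \<Longrightarrow> norm (G s) \<le> b * exp (\<theta> * \<bar>Im s\<bar>)" "b \<ge> 0" "c = a \<or> c = d" for c b j
    proof -
      have e: "Complex c Y = of_real c + of_real Y * \<i>" by (simp add: complex_eq_iff)
      have "norm (contour_integral (linepath (of_real c) (of_real c + of_real Y * \<i>)) (\<lambda>s. Kp s * G s)) \<le> 2 * (b * C) * norm \<i>"
      proof (rule contour_integral_arctan_bound)
        show "continuous_on (closed_segment (of_real c) (of_real c + of_real Y * \<i>)) (\<lambda>s. Kp s * G s)"
          using c(4) by (intro continuous_on_subset[OF cp] subsetI Zv) (auto dest!: vert)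
        fix t assume t: "0 \<le> t" "t \<le> Y"
        define s where "s = of_real c + of_real t * \<i>"
        have s: "Re s = c" "Im s = t" by (simp_all add: s_def)
        have "norm (Kp s * G s) \<le> exp (- 2 * pi * Im s) * (b * exp (\<theta> * \<bar>Im s\<bar>))"
          unfolding norm_mult Kp_def by (intro mult_mono norm_kernel_half_integer(2)[of s j] c(2)) (use s c(1) in auto)
        also have "\<dots> \<le> b * C / (1 + t\<^sup>2)" using decay[OF t(1) c(3)] s t by simp
        finally show "norm (Kp (of_real c + of_real t * \<i>) * G (of_real c + of_real t * \<i>)) \<le> b * C / (1 + t\<^sup>2)"
          unfolding s_def .
      qed (use Y c C0 in auto)
      thus ?thesis unfolding e by simp
    qed
    have rev: "norm (contour_integral (linepath q p) g) = norm (contour_integral (linepath p q) g)"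
      if "continuous_on Z g" "closed_segment p q \<subseteq> Z" for p q g
      using contour_integral_reverse_linepath[OF continuous_on_subset[OF that]] by simp
    have exps: "2 * exp (- 2 * pi * Y) * (B * exp (\<theta> * Y)) = 2 * B * exp (- l * Y)"
      by (simp add: l_def exp_add[symmetric] algebra_simps)
    have h1: "norm (contour_integral (linepath p1 p2) (\<lambda>s. Km s * G s)) \<le> 2 * B * exp (- l * Y) * norm (p2 - p1)"
    proof (rule contour_integral_bound_linepath)
      fix s assume "s \<in> closed_segment p1 p2"
      hence s: "Im s = - Y" "a \<le> Re s" "Re s \<le> d" using ad by (auto dest!: hor simp: p1_def p2_def)
      have "norm (Km s * G s) \<le> 2 * exp (2 * pi * Im s) * (B * exp (\<theta> * \<bar>Im s\<bar>))"
        unfolding norm_mult Km_def using s Y by (intro mult_mono norm_kernel_far(1) mid) auto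
      hence "norm (Km s * G s) \<le> 2 * exp (- 2 * pi * Y) * (B * exp (\<theta> * Y))" using s Y by simp
      thus "norm (Km s * G s) \<le> 2 * B * exp (- l * Y)" unfolding exps .
    qed (use B0 segs in \<open>auto intro!: contour_integrable_continuous_linepath continuous_on_subset[OF cm]\<close>)
    have h2: "norm (contour_integral (linepath p3 p4) (\<lambda>s. Kp s * G s)) \<le> 2 * B * exp (- l * Y) * norm (p4 - p3)"
    proof (rule contour_integral_bound_linepath)
      fix s assume "s \<in> closed_segment p3 p4"
      hence s: "Im s = Y" "a \<le> Re s" "Re s \<le> d" using ad by (auto dest!: hor simp: p3_def p4_def)
      have "norm (Kp s * G s) \<le> 2 * exp (- 2 * pi * Im s) * (B * exp (\<theta> * \<bar>Im s\<bar>))"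
        unfolding norm_mult Kp_def using s Y by (intro mult_mono norm_kernel_far(2) mid) auto
      hence "norm (Kp s * G s) \<le> 2 * exp (- 2 * pi * Y) * (B * exp (\<theta> * Y))" using s Y by simp
      thus "norm (Kp s * G s) \<le> 2 * B * exp (- l * Y)" unfolding exps .
    qed (use B0 segs in \<open>auto intro!: contour_integrable_continuous_linepath continuous_on_subset[OF cp]\<close>)
    have len: "norm (p2 - p1) = real N" "norm (p4 - p3) = real N"
      by (simp_all add: p1_def p2_def p3_def p4_def a_def d_def cmod_def)
    have v1: "norm (contour_integral (linepath ?a p1) (\<lambda>s. Km s * G s)) \<le> 2 * (\<beta>1 * C)"
      unfolding p1_def by (rule down[of a m]) (use left \<beta> in \<open>auto simp: a_def\<close>)
    have v2: "norm (contour_integral (linepath p2 ?d) (\<lambda>s. Km s * G s)) \<le> 2 * (\<beta>2 * C)"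
    proof -
      have "norm (contour_integral (linepath ?d p2) (\<lambda>s. Km s * G s)) \<le> 2 * (\<beta>2 * C)"
        unfolding p2_def by (rule down[of d "m + int N"]) (use right \<beta> in \<open>auto simp: d_def\<close>)
      thus ?thesis using rev[OF cm, of p2 ?d] segs(2) by simp
    qed
    have v3: "norm (contour_integral (linepath ?d p3) (\<lambda>s. Kp s * G s)) \<le> 2 * (\<beta>2 * C)"
      unfolding p3_def by (rule up[of d "m + int N"]) (use right \<beta> in \<open>auto simp: d_def\<close>)
    have v4: "norm (contour_integral (linepath p4 ?a) (\<lambda>s. Kp s * G s)) \<le> 2 * (\<beta>1 * C)"
    proof -
      have "norm (contour_integral (linepath ?a p4) (\<lambda>s. Kp s * G s)) \<le> 2 * (\<beta>1 * C)"
        unfolding p4_def by (rule up[of a m]) (use left \<beta> in \<open>auto simp: a_def\<close>)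
      thus ?thesis using rev[OF cp, of p4 ?a] segs(5) by simp
    qed
    have tri: "norm (x1 + x2 + x3 - x4 - x5 - x6) \<le> norm x1 + norm x2 + norm x3 + norm x4 + norm x5 + norm x6" for x1 x2 x3 x4 x5 x6 :: complex
    proof -
      have "norm (x1 + x2 + x3 - x4 - x5 - x6) \<le> norm (x1 + x2 + x3 - x4 - x5) + norm x6" by (rule norm_triangle_ineq4)
      also have "norm (x1 + x2 + x3 - x4 - x5) \<le> norm (x1 + x2 + x3 - x4) + norm x5" by (rule norm_triangle_ineq4)
      also have "norm (x1 + x2 + x3 - x4) \<le> norm (x1 + x2 + x3) + norm x4" by (rule norm_triangle_ineq4)
      also have "norm (x1 + x2 + x3) \<le> norm (x1 + x2) + norm x3" by (rule norm_triangle_ineq)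
      also have "norm (x1 + x2) \<le> norm x1 + norm x2" by (rule norm_triangle_ineq)
      finally show ?thesis by simp
    qed
    have "norm X \<le> 2 * (\<beta>1 * C) + 2 * B * exp (- l * Y) * real N + 2 * (\<beta>2 * C) + 2 * (\<beta>2 * C) + 2 * B * exp (- l * Y) * real N + 2 * (\<beta>1 * C)"
      unfolding X using tri[of "contour_integral (linepath ?a p1) (\<lambda>s. Km s * G s)" "contour_integral (linepath p1 p2) (\<lambda>s. Km s * G s)"
        "contour_integral (linepath p2 ?d) (\<lambda>s. Km s * G s)" "contour_integral (linepath ?d p3) (\<lambda>s. Kp s * G s)"
        "contour_integral (linepath p3 p4) (\<lambda>s. Kp s * G s)" "contour_integral (linepath p4 ?a) (\<lambda>s. Kp s * G s)"]
        v1 v2 v3 v4 h1[unfolded len] h2[unfolded len] by linarith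
    also have "\<dots> = 4 * C * (\<beta>1 + \<beta>2) + 4 * B * real N * exp (- l * Y)" by (simp add: algebra_simps)
    also have "\<dots> \<le> 4 * C * (\<beta>1 + \<beta>2) + 8 * B * real N * exp (- l * Y)" using B0 by (intro add_left_mono mult_right_mono) auto
    finally show ?thesis .
  qed
  \<comment> \<open>The bound holds for every height Y \<ge> 1, and the contribution of the
    horizontal sides vanishes as Y grows because 2\<pi> - \<theta> > 0.\<close>
  have "((\<lambda>Y. 4 * C * (\<beta>1 + \<beta>2) + 8 * B * real N * exp (- l * Y)) \<longlongrightarrow> 4 * C * (\<beta>1 + \<beta>2) + 8 * B * real N * 0) at_top"
  proof (intro tendsto_intros)
    have "filterlim (\<lambda>Y. l * Y) at_top at_top"
      using l0 by (intro filterlim_tendsto_pos_mult_at_top[OF tendsto_const _ filterlim_ident]) auto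
    hence "filterlim (\<lambda>Y. - (l * Y)) at_bot at_top" by (simp add: filterlim_uminus_at_bot)
    from filterlim_compose[OF exp_at_bot this] show "((\<lambda>Y. exp (- l * Y)) \<longlongrightarrow> 0) at_top" by simp
  qed
  moreover have "eventually (\<lambda>Y. norm X \<le> 4 * C * (\<beta>1 + \<beta>2) + 8 * B * real N * exp (- l * Y)) at_top"
    using eventually_ge_at_top[of 1] by eventually_elim (rule XY)
  ultimately have "norm X \<le> 4 * C * (\<beta>1 + \<beta>2) + 8 * B * real N * 0"
    by (intro tendsto_lowerbound[where F = at_top]) auto
  thus ?thesis unfolding X_def C_def l_def by simp
qed

section \<open>Mittag-Leffler sums\<close>

text \<open>Decay to the right beyond every exponential makes the sums converge at every scale exp(p
  s); the vertical rate \<theta> will have to stay below 2\<pi>, the decay rate of the Abel-Plana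
  kernels.\<close>

definition fast_decay :: "real \<Rightarrow> real \<Rightarrow> (complex \<Rightarrow> complex) \<Rightarrow> bool" where
  "fast_decay a \<theta> F \<longleftrightarrow> (\<forall>r. \<exists>C. \<forall>s. Re s \<ge> a \<longrightarrow> norm (F s) \<le> C * exp (- r * Re s + \<theta> * \<bar>Im s\<bar>))"

lemma fast_decayE:
  assumes "fast_decay a \<theta> F"
  obtains C where "C > 0" "\<And>s. Re s \<ge> a \<Longrightarrow> norm (F s) \<le> C * exp (- r * Re s + \<theta> * \<bar>Im s\<bar>)"
proof -
  obtain C where C: "\<And>s. Re s \<ge> a \<Longrightarrow> norm (F s) \<le> C * exp (- r * Re s + \<theta> * \<bar>Im s\<bar>)"
    using assms unfolding fast_decay_def by blast
  show ?thesis
  proof (rule that[of "\<bar>C\<bar> + 1"])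
    fix s assume "Re s \<ge> a"
    from C[OF this] have "norm (F s) \<le> C * exp (- r * Re s + \<theta> * \<bar>Im s\<bar>)" .
    also have "\<dots> \<le> (\<bar>C\<bar> + 1) * exp (- r * Re s + \<theta> * \<bar>Im s\<bar>)" by (intro mult_right_mono) auto
    finally show "norm (F s) \<le> (\<bar>C\<bar> + 1) * exp (- r * Re s + \<theta> * \<bar>Im s\<bar>)" .
  qed auto
qed

lemma fast_decay_summable:
  fixes m :: int
  assumes F: "fast_decay a \<theta> F" and a: "a \<le> of_int m"
  shows "summable (\<lambda>k. exp (of_real p * of_int (m + int k)) * F (of_int (m + int k)))"
proof -
  obtain C where C: "C > 0" "\<And>s. Re s \<ge> a \<Longrightarrow> norm (F s) \<le> C * exp (- (p + 1) * Re s + \<theta> * \<bar>Im s\<bar>)"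
    using fast_decayE[OF F, of "p + 1"] by blast
  show ?thesis
  proof (rule summable_comparison_test'[of _ 0])
    have "summable (\<lambda>k. C * exp (- of_int m) * exp (- 1) ^ k)"
      by (intro summable_mult summable_geometric) auto
    thus "summable (\<lambda>k. C * exp (- real_of_int m) * exp (- 1) ^ k)" .
    fix k :: nat
    define t where "t = real_of_int m + real k"
    have s: "Re (of_int (m + int k)) = t" "Im (of_int (m + int k)) = 0" by (simp_all add: t_def)
    have "norm (exp (of_real p * of_int (m + int k)) * F (of_int (m + int k))) = exp (p * t) * norm (F (of_int (m + int k)))"
      unfolding norm_mult norm_exp_eq_Re by (simp add: t_def)
    also have "\<dots> \<le> exp (p * t) * (C * exp (- (p + 1) * t))"
      using C(2)[of "of_int (m + int k)"] a unfolding s by (intro mult_left_mono) (auto simp: t_def)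
    also have "\<dots> = C * exp (- t)" by (simp add: exp_add[symmetric] algebra_simps)
    also have "exp (- t) = exp (- real_of_int m) * exp (- 1) ^ k"
      by (simp add: t_def exp_of_nat_mult[symmetric] exp_add[symmetric])
    finally show "norm (exp (of_real p * of_int (m + int k)) * F (of_int (m + int k))) \<le> C * exp (- real_of_int m) * exp (- 1) ^ k"
      by simp
  qed
qed

text \<open>The constant \<open>K\<close> is independent of the scale \<open>p\<close>, and only the vanishing part \<open>\<eta>\<close> depends on it.\<close>

lemma abel_plana_scaled:
  fixes m :: int and F :: "complex \<Rightarrow> complex"
  defines "a \<equiv> real_of_int m - 1 / 2"
  assumes F: "fast_decay a \<theta> F" and \<theta>: "\<theta> < 2 * pi" and a': "a' < a"
  shows "\<exists>K>0. \<forall>p \<Psi>. (\<forall>s. Re s > a' \<longrightarrow> (\<Psi> has_field_derivative exp (of_real p * s) * F s) (at s)) \<longrightarrow>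
     (\<exists>\<eta>. \<eta> \<longlonglongrightarrow> 0 \<and> (\<forall>N>0. norm ((\<Sum>k<N. exp (of_real p * of_int (m + int k)) * F (of_int (m + int k)))
          - (\<Psi> (of_real (a + real N)) - \<Psi> (of_real a))) \<le> K * exp (p * a) + \<eta> N))"
proof -
  \<comment> \<open>r = 0 gives a constant for the left line that does not depend on p. The choice r
    = p + 1 below governs the right line, whose contribution vanishes as N grows.\<close>
  obtain C0 where C0: "C0 > 0" "\<And>s. Re s \<ge> a \<Longrightarrow> norm (F s) \<le> C0 * exp (- 0 * Re s + \<theta> * \<bar>Im s\<bar>)"
    using fast_decayE[OF F, of 0] by blast
  define D where "D = 4 * (1 + 2 / (2 * pi - \<theta>)\<^sup>2)"
  have D0: "D > 0" by (auto simp: D_def intro!: add_pos_nonneg)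
  show ?thesis
  proof (intro exI[of _ "D * C0"] conjI allI impI)
    show "D * C0 > 0" using D0 C0 by simp
    fix p :: real and \<Psi> :: "complex \<Rightarrow> complex"
    assume \<Psi>: "\<forall>s. Re s > a' \<longrightarrow> (\<Psi> has_field_derivative exp (of_real p * s) * F s) (at s)"
    obtain C1 where C1: "C1 > 0" "\<And>s. Re s \<ge> a \<Longrightarrow> norm (F s) \<le> C1 * exp (- (p + 1) * Re s + \<theta> * \<bar>Im s\<bar>)"
      using fast_decayE[OF F, of "p + 1"] by blast
    define G where "G = (\<lambda>s. exp (of_real p * s) * F s)"
    have nG: "norm (G s) = exp (p * Re s) * norm (F s)" for s
      by (simp add: G_def norm_mult norm_exp_eq_Re)
    have G0: "norm (G s) \<le> C0 * exp (p * Re s) * exp (\<theta> * \<bar>Im s\<bar>)" if "Re s \<ge> a" for s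
    proof -
      have "norm (G s) \<le> exp (p * Re s) * (C0 * exp (\<theta> * \<bar>Im s\<bar>))"
        unfolding nG using C0(2)[OF that] by (intro mult_left_mono) auto
      thus ?thesis by (simp add: mult_ac)
    qed
    have G1: "norm (G s) \<le> C1 * exp (- Re s) * exp (\<theta> * \<bar>Im s\<bar>)" if "Re s \<ge> a" for s
    proof -
      have "norm (G s) \<le> exp (p * Re s) * (C1 * exp (- (p + 1) * Re s + \<theta> * \<bar>Im s\<bar>))"
        unfolding nG using C1(2)[OF that] by (intro mult_left_mono) auto
      also have "\<dots> = C1 * (exp (p * Re s) * exp (- (p + 1) * Re s + \<theta> * \<bar>Im s\<bar>))" by simp
      also have "exp (p * Re s) * exp (- (p + 1) * Re s + \<theta> * \<bar>Im s\<bar>) = exp (- Re s) * exp (\<theta> * \<bar>Im s\<bar>)"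
        unfolding exp_add[symmetric] by (rule arg_cong[where f = exp]) (simp add: algebra_simps)
      finally show ?thesis by simp
    qed
    define \<eta> where "\<eta> = (\<lambda>N::nat. D * C1 * exp (- (a + real N)))"
    have "\<eta> \<longlonglongrightarrow> D * C1 * 0"
      unfolding \<eta>_def
    proof (intro tendsto_intros)
      show "(\<lambda>N. exp (- (a + real N))) \<longlonglongrightarrow> 0" by real_asymp
    qed
    hence \<eta>0: "\<eta> \<longlonglongrightarrow> 0" by simp
    have "norm ((\<Sum>k<N. G (of_int (m + int k))) - (\<Psi> (of_real (a + real N)) - \<Psi> (of_real a))) \<le> D * C0 * exp (p * a) + \<eta> N" if N: "N > 0" for N
    proof -
      have "norm ((\<Sum>k<N. G (of_int (m + int k))) - (\<Psi> (of_real (a + real N)) - \<Psi> (of_real a)))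
        \<le> 4 * (1 + 2 / (2 * pi - \<theta>)\<^sup>2) * (C0 * exp (p * a) + C1 * exp (- (a + real N)))"
        unfolding a_def
      proof (rule abel_plana_bound[of a' \<Psi> G m \<theta> _ _ N "C0 * exp (\<bar>p\<bar> * (\<bar>a\<bar> + real N))"])
        show "norm (G s) \<le> C0 * exp (\<bar>p\<bar> * (\<bar>a\<bar> + real N)) * exp (\<theta> * \<bar>Im s\<bar>)"
          if "real_of_int m - 1 / 2 \<le> Re s" "Re s \<le> real_of_int m - 1 / 2 + real N" for s
        proof -
          have s: "a \<le> Re s" "\<bar>Re s\<bar> \<le> \<bar>a\<bar> + real N" using that by (auto simp: a_def)
          have "p * Re s \<le> \<bar>p\<bar> * \<bar>Re s\<bar>" by (metis abs_ge_self abs_mult)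
          also have "\<dots> \<le> \<bar>p\<bar> * (\<bar>a\<bar> + real N)" using s by (intro mult_left_mono) auto
          finally have "C0 * exp (p * Re s) * exp (\<theta> * \<bar>Im s\<bar>) \<le> C0 * exp (\<bar>p\<bar> * (\<bar>a\<bar> + real N)) * exp (\<theta> * \<bar>Im s\<bar>)"
            using C0(1) by (intro mult_right_mono mult_left_mono) auto
          thus ?thesis using G0[OF s(1)] by linarith
        qed
        show "norm (G s) \<le> C0 * exp (p * (real_of_int m - 1 / 2)) * exp (\<theta> * \<bar>Im s\<bar>)" if "Re s = real_of_int m - 1 / 2" for s
          using G0[of s] that by (simp add: a_def)
        show "norm (G s) \<le> C1 * exp (- (real_of_int m - 1 / 2 + real N)) * exp (\<theta> * \<bar>Im s\<bar>)" if "Re s = real_of_int m - 1 / 2 + real N" for s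
          using G1[of s] that by (simp add: a_def)
      qed (use \<Psi> a' \<theta> C0 C1 N in \<open>auto simp: a_def G_def\<close>)
      thus ?thesis unfolding D_def[symmetric] \<eta>_def by (simp add: algebra_simps)
    qed
    thus "\<exists>\<eta>. \<eta> \<longlonglongrightarrow> 0 \<and> (\<forall>N>0. norm ((\<Sum>k<N. exp (of_real p * of_int (m + int k)) * F (of_int (m + int k)))
          - (\<Psi> (of_real (a + real N)) - \<Psi> (of_real a))) \<le> D * C0 * exp (p * a) + \<eta> N)"
      using \<eta>0 unfolding G_def by blast
  qed
qed

text \<open>1/\<Gamma>(\<kappa>s + b) grows vertically with rate at most \<kappa>(\<pi>/2 + 1/2) and
  the exponential with rate at most \<kappa>\<pi>/2, together at most \<pi> + 1/2, which is below
  the limit 2\<pi> of the summation lemma.\<close>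

lemma fast_decay_rGamma:
  fixes \<kappa> b \<psi> a :: real
  assumes \<kappa>: "0 < \<kappa>" "\<kappa> \<le> 1" and \<psi>: "\<bar>\<psi>\<bar> \<le> pi / 2"
  shows "fast_decay a (pi + 1 / 2) (\<lambda>s. exp (\<i> * of_real \<psi> * of_real \<kappa> * s) * rGamma (of_real \<kappa> * s + of_real b))"
  unfolding fast_decay_def
proof
  fix r :: real
  obtain C where C: "C > 0" "\<And>z. Re z \<ge> \<kappa> * a + b \<Longrightarrow> norm (rGamma z) \<le> C * exp (- (r / \<kappa>) * Re z + (pi / 2 + 1 / 2) * \<bar>Im z\<bar>)"
    using norm_rGamma_exp_bound[of "1/2" "\<kappa> * a + b" "r / \<kappa>"] by auto
  show "\<exists>C. \<forall>s. Re s \<ge> a \<longrightarrow> norm (exp (\<i> * of_real \<psi> * of_real \<kappa> * s) * rGamma (of_real \<kappa> * s + of_real b)) \<le> C * exp (- r * Re s + (pi + 1 / 2) * \<bar>Im s\<bar>)"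
  proof (intro exI[of _ "C * exp (- (r / \<kappa>) * b)"] allI impI)
    fix s :: complex assume s: "Re s \<ge> a"
    have 1: "norm (rGamma (of_real \<kappa> * s + of_real b)) \<le> C * exp (- (r / \<kappa>) * (\<kappa> * Re s + b) + (pi / 2 + 1 / 2) * (\<kappa> * \<bar>Im s\<bar>))"
      using C(2)[of "of_real \<kappa> * s + of_real b"] s \<kappa> by (simp add: abs_mult)
    have 2: "norm (exp (\<i> * of_real \<psi> * of_real \<kappa> * s)) \<le> exp (pi / 2 * (\<kappa> * \<bar>Im s\<bar>))"
    proof -
      have "- (\<psi> * (\<kappa> * Im s)) \<le> \<bar>\<psi>\<bar> * (\<kappa> * \<bar>Im s\<bar>)"
        using \<kappa> abs_ge_minus_self[of "\<psi> * (\<kappa> * Im s)"] by (simp add: abs_mult)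
      also have "\<dots> \<le> pi / 2 * (\<kappa> * \<bar>Im s\<bar>)" using \<kappa> by (intro mult_right_mono \<psi>) auto
      finally show ?thesis by (simp add: norm_exp_eq_Re mult_ac)
    qed
    have "norm (exp (\<i> * of_real \<psi> * of_real \<kappa> * s) * rGamma (of_real \<kappa> * s + of_real b)) \<le>
        exp (pi / 2 * (\<kappa> * \<bar>Im s\<bar>)) * (C * exp (- (r / \<kappa>) * (\<kappa> * Re s + b) + (pi / 2 + 1 / 2) * (\<kappa> * \<bar>Im s\<bar>)))"
      unfolding norm_mult by (intro mult_mono 1 2) auto
    also have "\<dots> = C * exp (- (r / \<kappa>) * b) * exp (- r * Re s + (pi + 1 / 2) * (\<kappa> * \<bar>Im s\<bar>))"
    proof -
      have "- (r / \<kappa>) * (\<kappa> * Re s + b) = - r * Re s - (r / \<kappa>) * b" using \<kappa> by (simp add: field_simps)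
      thus ?thesis by (simp add: exp_add[symmetric] exp_diff[symmetric] algebra_simps)
    qed
    also have "\<dots> \<le> C * exp (- (r / \<kappa>) * b) * exp (- r * Re s + (pi + 1 / 2) * \<bar>Im s\<bar>)"
    proof -
      have "\<kappa> * \<bar>Im s\<bar> \<le> 1 * \<bar>Im s\<bar>" using \<kappa> by (intro mult_right_mono) auto
      hence "(pi + 1 / 2) * (\<kappa> * \<bar>Im s\<bar>) \<le> (pi + 1 / 2) * \<bar>Im s\<bar>" by (intro mult_left_mono) auto
      thus ?thesis using C(1) by (intro mult_left_mono) auto
    qed
    finally show "norm (exp (\<i> * of_real \<psi> * of_real \<kappa> * s) * rGamma (of_real \<kappa> * s + of_real b))
        \<le> C * exp (- (r / \<kappa>) * b) * exp (- r * Re s + (pi + 1 / 2) * \<bar>Im s\<bar>)" .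
  qed
qed

lemma primitive_diff_bound:
  fixes \<Psi> G :: "complex \<Rightarrow> complex"
  assumes "\<And>s. s \<in> closed_segment p q \<Longrightarrow> (\<Psi> has_field_derivative G s) (at s)"
    and "\<And>s. s \<in> closed_segment p q \<Longrightarrow> norm (G s) \<le> B"
  shows "norm (\<Psi> q - \<Psi> p) \<le> B * norm (q - p)"
  by (rule field_differentiable_bound[of "closed_segment p q" \<Psi> G])
     (use assms in \<open>auto intro: has_field_derivative_at_within\<close>)

text \<open>Terms with a negative index n vanish because 1/\<Gamma>(n + 1) does. The free start lets
  the sum begin as far left as the integral with which it is compared.\<close>

lemma exp_series_from_int:
  fixes u L :: complex and m :: int
  assumes "m \<le> 0"
  shows "(\<lambda>k. exp (of_int (m + int k) * L) * rGamma (of_int (m + int k) + 1)) sums exp (exp L)"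
proof -
  define n where "n = nat (- m)"
  have m: "m = - int n" using assms by (simp add: n_def)
  define f where "f = (\<lambda>k. exp (of_int (m + int k) * L) * rGamma (of_int (m + int k) + 1))"
  have z: "f k = 0" if "k < n" for k
  proof -
    have "of_int (m + int k) + (1 :: complex) = of_int (m + int k + 1)" by simp
    also have "rGamma \<dots> = (0 :: complex)" using that by (subst rGamma_of_int) (auto simp: m)
    finally show ?thesis by (simp add: f_def)
  qed
  have "f (k + n) = exp L ^ k /\<^sub>R fact k" for k
  proof -
    have e: "of_int (m + int (k + n)) = (of_nat k :: complex)" by (simp add: m)
    have "rGamma (of_nat k + 1 :: complex) = inverse (fact k)"
      using Gamma_fact[of k, where 'a = complex] by (simp add: rGamma_inverse_Gamma add.commute)
    thus ?thesis unfolding f_def e by (simp add: exp_of_nat_mult scaleR_conv_of_real of_real_inverse)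
  qed
  hence "(\<lambda>k. f (k + n)) sums exp (exp L)"
    using exp_converges[of "exp L"] by simp
  thus ?thesis unfolding f_def[symmetric] using sums_iff_shift[of f n "exp (exp L)"] z by simp
qed

text \<open>Both the Mittag-Leffler sum and the exponential series are compared with the integral of the same
  entire function \<open>v \<mapsto> e\<^bsup>vL\<^esup>/\<Gamma>(v + 1)\<close>, after the substitution \<open>v = \<kappa>s + b - 1\<close>.\<close>

lemma mittag_leffler_asymp:
  fixes \<kappa> b \<psi> :: real and m :: int
  assumes \<kappa>: "0 < \<kappa>" "\<kappa> \<le> 1" and \<psi>: "\<bar>\<psi>\<bar> \<le> pi / 2"
  defines "a \<equiv> real_of_int m - 1 / 2"
  shows "\<exists>K. \<forall>p\<ge>0. norm ((\<Sum>k. exp (of_real \<kappa> * of_int (m + int k) * (of_real p + \<i> * of_real \<psi>)) * rGamma (of_real \<kappa> * of_int (m + int k) + of_real b))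
      - exp (of_real (1 - b) * (of_real p + \<i> * of_real \<psi>) + exp (of_real p + \<i> * of_real \<psi>)) / of_real \<kappa>) \<le> K * exp (\<kappa> * a * p)"
proof -
  \<comment> \<open>\<open>y0\<close> is the image of the left end a under v = \<kappa>s + b - 1.
    The exponential series starts at an m' whose half-integer \<open>h\<close> lies below
    \<open>y0\<close>, so the two integrals differ on the left by the bounded segment from
    \<open>h\<close> to \<open>y0\<close>.\<close>
  define y0 where "y0 = \<kappa> * a + b - 1"
  define m' where "m' = min 0 \<lfloor>y0\<rfloor>"
  define h where "h = real_of_int m' - 1 / 2"
  have hy: "h < y0" unfolding h_def m'_def by linarith
  define F1 where "F1 = (\<lambda>s. exp (\<i> * of_real \<psi> * of_real \<kappa> * s) * rGamma (of_real \<kappa> * s + of_real b))"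
  define F2 where "F2 = (\<lambda>s. exp (\<i> * of_real \<psi> * of_real 1 * s) * rGamma (of_real 1 * s + of_real 1))"
  have d1: "fast_decay (real_of_int m - 1 / 2) (pi + 1 / 2) F1" unfolding F1_def by (rule fast_decay_rGamma[OF \<kappa> \<psi>])
  have d2: "fast_decay (real_of_int m' - 1 / 2) (pi + 1 / 2) F2" unfolding F2_def by (rule fast_decay_rGamma[OF _ _ \<psi>]) auto
  have th: "pi + 1 / 2 < 2 * pi" using pi_gt3 by simp
  obtain K1 where K1: "K1 > 0" "\<And>p \<Psi>. (\<And>s. (\<Psi> has_field_derivative exp (of_real p * s) * F1 s) (at s)) \<Longrightarrow>
     (\<exists>\<eta>. \<eta> \<longlonglongrightarrow> 0 \<and> (\<forall>N>0. norm ((\<Sum>k<N. exp (of_real p * of_int (m + int k)) * F1 (of_int (m + int k)))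
          - (\<Psi> (of_real (a + real N)) - \<Psi> (of_real a))) \<le> K1 * exp (p * a) + \<eta> N))"
    using abel_plana_scaled[OF d1 th, of "a - 1"] unfolding a_def by auto
  obtain K2 where K2: "K2 > 0" "\<And>p \<Psi>. (\<And>s. (\<Psi> has_field_derivative exp (of_real p * s) * F2 s) (at s)) \<Longrightarrow>
     (\<exists>\<eta>. \<eta> \<longlonglongrightarrow> 0 \<and> (\<forall>N>0. norm ((\<Sum>k<N. exp (of_real p * of_int (m' + int k)) * F2 (of_int (m' + int k)))
          - (\<Psi> (of_real (h + real N)) - \<Psi> (of_real h))) \<le> K2 * exp (p * h) + \<eta> N))"
    using abel_plana_scaled[OF d2 th, of "h - 1"] unfolding h_def by auto
  obtain C0 where C0: "C0 > 0" "\<And>s. Re s \<ge> h \<Longrightarrow> norm (F2 s) \<le> C0 * exp (- 0 * Re s + (pi + 1 / 2) * \<bar>Im s\<bar>)"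
    using fast_decayE[OF d2, of 0] unfolding h_def by blast
  define K where "K = K1 + (K2 + C0 * (y0 - h)) / \<kappa>"
  show ?thesis
  proof (intro exI[of _ K] allI impI)
    fix p :: real assume p: "p \<ge> 0"
    define L where "L = of_real p + \<i> * of_real \<psi>"
    define T where "T = (\<lambda>s. exp (of_real \<kappa> * s * L) * rGamma (of_real \<kappa> * s + of_real b))"
    define e where "e = (\<lambda>s. exp (s * L) * rGamma (s + 1))"
    \<comment> \<open>\<open>Z\<close> combines the Jacobian 1/\<kappa> with the factor exp((1 -
      b)L) that the substitution v = \<kappa>s + b - 1 leaves over.\<close>
    define Z where "Z = exp (of_real (1 - b) * L) / of_real \<kappa>"
    have T1: "T s = exp (of_real (\<kappa> * p) * s) * F1 s" for s
      by (simp add: T_def F1_def L_def exp_add[symmetric] algebra_simps)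
    have e2: "e s = exp (of_real p * s) * F2 s" for s
      by (simp add: e_def F2_def L_def exp_add[symmetric] algebra_simps)
    have "e holomorphic_on UNIV" unfolding e_def by (intro holomorphic_intros)
    from holomorphic_convex_primitive'[OF convex_UNIV open_UNIV this]
    obtain E where E: "\<And>s. (E has_field_derivative e s) (at s)" by auto
    define \<Psi> where "\<Psi> = (\<lambda>s. Z * E (of_real \<kappa> * s + of_real b - 1))"
    have \<Psi>: "(\<Psi> has_field_derivative T s) (at s)" for s
    proof -
      have "(\<Psi> has_field_derivative Z * (e (of_real \<kappa> * s + of_real b - 1) * of_real \<kappa>)) (at s)"
        unfolding \<Psi>_def by (auto intro!: derivative_eq_intros DERIV_chain'[OF _ E])
      also have "Z * (e (of_real \<kappa> * s + of_real b - 1) * of_real \<kappa>) = T s"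
        using \<kappa> unfolding Z_def e_def T_def by (simp add: exp_add[symmetric] algebra_simps)
      finally show ?thesis .
    qed
    have nZ: "norm Z = exp ((1 - b) * p) / \<kappa>"
      using \<kappa> by (simp add: Z_def L_def norm_divide norm_exp_eq_Re)
    obtain \<eta>1 where \<eta>1: "\<eta>1 \<longlonglongrightarrow> 0" "\<And>N. N > 0 \<Longrightarrow> norm ((\<Sum>k<N. T (of_int (m + int k))) - (\<Psi> (of_real (a + real N)) - \<Psi> (of_real a))) \<le> K1 * exp (\<kappa> * p * a) + \<eta>1 N"
      using K1(2)[of \<Psi> "\<kappa> * p"] \<Psi> unfolding T1 by blast
    obtain \<eta>2 where \<eta>2: "\<eta>2 \<longlonglongrightarrow> 0" "\<And>N. N > 0 \<Longrightarrow> norm ((\<Sum>k<N. e (of_int (m' + int k))) - (E (of_real (h + real N)) - E (of_real h))) \<le> K2 * exp (p * h) + \<eta>2 N"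
      using K2(2)[of E p] E unfolding e2 by blast
    \<comment> \<open>\<open>y N\<close> is the image of the right end a + N, and \<open>n N\<close>
      counts the unit steps from \<open>h\<close> that fit below it. The mismatch is at most one
      unit long and its contribution vanishes.\<close>
    define y where "y = (\<lambda>N::nat. \<kappa> * (a + real N) + b - 1)"
    define n where "n = (\<lambda>N::nat. nat \<lfloor>y N - h\<rfloor>)"
    have yN: "y N \<ge> y0" for N using \<kappa> by (simp add: y_def y0_def algebra_simps)
    have n: "h + real (n N) \<le> y N" "y N \<le> h + real (n N) + 1" for N
      using yN[of N] hy unfolding n_def by linarith+
    have y_lim: "filterlim y at_top sequentially"
    proof -
      have "filterlim (\<lambda>N. real N * \<kappa>) at_top sequentially"
        using \<kappa> by (intro filterlim_at_top_mult_tendsto_pos[OF tendsto_const _ filterlim_real_sequentially]) auto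
      from filterlim_tendsto_add_at_top[OF tendsto_const[of "\<kappa> * a + b - 1"] this]
      show ?thesis by (simp add: y_def algebra_simps)
    qed
    have n_lim: "filterlim n at_top sequentially"
    proof -
      have "filterlim (\<lambda>N. real (n N)) at_top sequentially"
      proof (rule filterlim_at_top_mono)
        show "filterlim (\<lambda>N. - (h + 1) + y N) at_top sequentially"
          by (rule filterlim_tendsto_add_at_top[OF tendsto_const y_lim])
        show "eventually (\<lambda>N. - (h + 1) + y N \<le> real (n N)) sequentially"
          using n(2) by (intro always_eventually allI) (simp add: algebra_simps)
      qed
      thus ?thesis by (simp add: filterlim_sequentially_iff_filterlim_real)
    qed
    obtain C1 where C1: "C1 > 0" "\<And>s. Re s \<ge> h \<Longrightarrow> norm (F2 s) \<le> C1 * exp (- (p + 1) * Re s + (pi + 1 / 2) * \<bar>Im s\<bar>)"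
      using fast_decayE[OF d2, of "p + 1"] unfolding h_def by blast
    have seg_real: "Im s = 0 \<and> min x x' \<le> Re s \<and> Re s \<le> max x x'" if s: "s \<in> closed_segment (of_real x) (of_real x')" for s x x'
    proof -
      obtain w where w: "0 \<le> w" "w \<le> 1" and eq: "s = (1 - w) *\<^sub>R of_real x + w *\<^sub>R of_real x'"
        using s unfolding closed_segment_def by blast
      have "Re s = (1 - w) *\<^sub>R x + w *\<^sub>R x'" unfolding eq by simp
      hence "Re s \<in> closed_segment x x'" using w unfolding closed_segment_def by blast
      moreover have "Im s = 0" unfolding eq by simp
      ultimately show ?thesis by (auto simp: closed_segment_eq_real_ivl split: if_splits)
    qed
    have Ey: "norm (E (of_real (y N)) - E (of_real (h + real (n N)))) \<le> C1 * exp (- (h + real (n N)))" for N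
    proof -
      have "norm (E (of_real (y N)) - E (of_real (h + real (n N)))) \<le> C1 * exp (- (h + real (n N))) * norm (of_real (y N) - of_real (h + real (n N)) :: complex)"
      proof (rule primitive_diff_bound[OF E])
        fix s assume "s \<in> closed_segment (complex_of_real (h + real (n N))) (of_real (y N))"
        from seg_real[OF this] have s: "Im s = 0" "h + real (n N) \<le> Re s" using n[of N] by auto
        have "norm (e s) = exp (p * Re s) * norm (F2 s)" by (simp add: e2 norm_mult norm_exp_eq_Re)
        also have "\<dots> \<le> exp (p * Re s) * (C1 * exp (- (p + 1) * Re s))"
          using C1(2)[of s] s by (intro mult_left_mono) auto
        also have "\<dots> = C1 * exp (- Re s)" by (simp add: exp_add[symmetric] algebra_simps)
        also have "\<dots> \<le> C1 * exp (- (h + real (n N)))" using s C1 by (intro mult_left_mono) auto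
        finally show "norm (e s) \<le> C1 * exp (- (h + real (n N)))" .
      qed
      also have "norm (of_real (y N) - of_real (h + real (n N)) :: complex) \<le> 1"
        using n[of N] by (simp only: of_real_diff[symmetric] norm_of_real)
      finally show ?thesis using C1 by (simp add: mult_left_le)
    qed
    \<comment> \<open>Here p \<ge> 0 enters: exp(p Re s) is largest at the right end
      \<open>y0\<close>, and |Z| exp(p y0) is of the same order exp(\<kappa>ap) as the error on the
      line Re s = a.\<close>
    have Eh: "norm (E (of_real y0) - E (of_real h)) \<le> C0 * (y0 - h) * exp (p * y0)"
    proof -
      have "norm (E (of_real y0) - E (of_real h)) \<le> exp (p * y0) * C0 * norm (of_real y0 - of_real h :: complex)"
      proof (rule primitive_diff_bound[OF E])
        fix s assume "s \<in> closed_segment (complex_of_real h) (of_real y0)"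
        from seg_real[OF this] have s: "Im s = 0" "h \<le> Re s" "Re s \<le> y0" using hy by auto
        have "norm (e s) = exp (p * Re s) * norm (F2 s)" by (simp add: e2 norm_mult norm_exp_eq_Re)
        also have "\<dots> \<le> exp (p * y0) * C0"
          using C0(2)[of s] C0(1) s p by (intro mult_mono) (auto intro: mult_left_mono)
        finally show "norm (e s) \<le> exp (p * y0) * C0" .
      qed
      also have "norm (of_real y0 - of_real h :: complex) = y0 - h"
        using hy by (simp only: of_real_diff[symmetric] norm_of_real)
      finally show ?thesis by (simp add: mult_ac)
    qed
    have bound: "norm ((\<Sum>k<N. T (of_int (m + int k))) - Z * (\<Sum>k<n N. e (of_int (m' + int k))))
        \<le> K1 * exp (\<kappa> * p * a) + \<eta>1 N + norm Z * (K2 * exp (p * h) + \<eta>2 (n N) + C1 * exp (- (h + real (n N))) + C0 * (y0 - h) * exp (p * y0))"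
      if N: "N > 0" "n N > 0" for N
    proof -
      define A1 where "A1 = (\<Sum>k<N. T (of_int (m + int k))) - (\<Psi> (of_real (a + real N)) - \<Psi> (of_real a))"
      define A2 where "A2 = (\<Sum>k<n N. e (of_int (m' + int k))) - (E (of_real (h + real (n N))) - E (of_real h))"
      define A3 where "A3 = E (of_real (y N)) - E (of_real (h + real (n N)))"
      define A4 where "A4 = E (of_real y0) - E (of_real h)"
      have P: "\<Psi> (of_real (a + real N)) - \<Psi> (of_real a) = Z * (E (of_real (y N)) - E (of_real y0))"
        by (simp add: \<Psi>_def y_def y0_def algebra_simps)
      have "(\<Sum>k<N. T (of_int (m + int k))) - Z * (\<Sum>k<n N. e (of_int (m' + int k))) = A1 + Z * (A3 - A2 - A4)"
        unfolding A1_def A2_def A3_def A4_def P by (simp add: algebra_simps)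
      also have "norm \<dots> \<le> norm A1 + norm Z * norm (A3 - A2 - A4)"
        by (metis norm_mult norm_triangle_ineq)
      also have "norm (A3 - A2 - A4) \<le> norm A2 + norm A3 + norm A4"
        using norm_triangle_ineq4[of "A3 - A2" A4] norm_triangle_ineq4[of A3 A2] by linarith
      also have "norm A1 \<le> K1 * exp (\<kappa> * p * a) + \<eta>1 N" unfolding A1_def by (rule \<eta>1(2)[OF N(1)])
      also have "norm A2 \<le> K2 * exp (p * h) + \<eta>2 (n N)" unfolding A2_def by (rule \<eta>2(2)[OF N(2)])
      also have "norm A3 \<le> C1 * exp (- (h + real (n N)))" unfolding A3_def by (rule Ey)
      also have "norm A4 \<le> C0 * (y0 - h) * exp (p * y0)" unfolding A4_def by (rule Eh)
      finally show ?thesis by (simp add: add_left_mono mult_left_mono)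
    qed
    have sT: "summable (\<lambda>k. T (of_int (m + int k)))"
      unfolding T1 by (rule fast_decay_summable[OF d1]) simp
    have "m' \<le> 0" by (simp add: m'_def)
    have "(\<lambda>k. e (of_int (m' + int k))) sums exp (exp L)"
      unfolding e_def by (rule exp_series_from_int[OF \<open>m' \<le> 0\<close>])
    hence lim_e: "(\<lambda>N. \<Sum>k<n N. e (of_int (m' + int k))) \<longlonglongrightarrow> exp (exp L)"
      unfolding sums_def by (rule filterlim_compose[OF _ n_lim])
    have "norm ((\<Sum>k. T (of_int (m + int k))) - Z * exp (exp L)) \<le>
       K1 * exp (\<kappa> * p * a) + 0 + norm Z * (K2 * exp (p * h) + 0 + C1 * 0 + C0 * (y0 - h) * exp (p * y0))"
    proof (rule tendsto_le[OF sequentially_bot])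
      show "(\<lambda>N. norm ((\<Sum>k<N. T (of_int (m + int k))) - Z * (\<Sum>k<n N. e (of_int (m' + int k))))) \<longlonglongrightarrow> norm ((\<Sum>k. T (of_int (m + int k))) - Z * exp (exp L))"
        by (intro tendsto_intros summable_LIMSEQ[OF sT] lim_e)
      show "(\<lambda>N. K1 * exp (\<kappa> * p * a) + \<eta>1 N + norm Z * (K2 * exp (p * h) + \<eta>2 (n N) + C1 * exp (- (h + real (n N))) + C0 * (y0 - h) * exp (p * y0)))
         \<longlonglongrightarrow> K1 * exp (\<kappa> * p * a) + 0 + norm Z * (K2 * exp (p * h) + 0 + C1 * 0 + C0 * (y0 - h) * exp (p * y0))"
      proof (intro tendsto_intros \<eta>1(1) filterlim_compose[OF \<eta>2(1) n_lim])
        have "(\<lambda>N. exp (- (h + real N))) \<longlonglongrightarrow> 0" by real_asymp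
        from filterlim_compose[OF this n_lim] show "(\<lambda>N. exp (- (h + real (n N)))) \<longlonglongrightarrow> 0" .
      qed
      have "eventually (\<lambda>N. n N > 0) sequentially" using eventually_compose_filterlim[OF eventually_gt_at_top[of 0] n_lim] .
      thus "eventually (\<lambda>N. norm ((\<Sum>k<N. T (of_int (m + int k))) - Z * (\<Sum>k<n N. e (of_int (m' + int k)))) \<le>
          K1 * exp (\<kappa> * p * a) + \<eta>1 N + norm Z * (K2 * exp (p * h) + \<eta>2 (n N) + C1 * exp (- (h + real (n N))) + C0 * (y0 - h) * exp (p * y0))) sequentially"
        using eventually_gt_at_top[of 0] by eventually_elim (rule bound)
    qed
    also have "\<dots> = K1 * exp (\<kappa> * p * a) + norm Z * (K2 * exp (p * h) + C0 * (y0 - h) * exp (p * y0))" by simp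
    also have "\<dots> \<le> K1 * exp (\<kappa> * p * a) + norm Z * (K2 * exp (p * y0) + C0 * (y0 - h) * exp (p * y0))"
      using K2(1) hy p by (intro add_left_mono mult_left_mono add_right_mono) (auto intro: mult_left_mono)
    also have "norm Z * (K2 * exp (p * y0) + C0 * (y0 - h) * exp (p * y0)) = (K2 + C0 * (y0 - h)) / \<kappa> * (exp ((1 - b) * p) * exp (p * y0))"
      unfolding nZ by (simp add: field_simps)
    also have "exp ((1 - b) * p) * exp (p * y0) = exp (\<kappa> * p * a)"
      unfolding exp_add[symmetric] by (rule arg_cong[where f = exp]) (simp add: y0_def algebra_simps)
    also have "K1 * exp (\<kappa> * p * a) + (K2 + C0 * (y0 - h)) / \<kappa> * exp (\<kappa> * p * a) = K * exp (\<kappa> * a * p)"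
      unfolding K_def by (simp add: algebra_simps)
    finally have "norm ((\<Sum>k. T (of_int (m + int k))) - Z * exp (exp L)) \<le> K * exp (\<kappa> * a * p)" .
    moreover have "Z * exp (exp L) = exp (of_real (1 - b) * L + exp L) / of_real \<kappa>" by (simp add: Z_def exp_add)
    ultimately show "norm ((\<Sum>k. exp (of_real \<kappa> * of_int (m + int k) * (of_real p + \<i> * of_real \<psi>)) * rGamma (of_real \<kappa> * of_int (m + int k) + of_real b))
      - exp (of_real (1 - b) * (of_real p + \<i> * of_real \<psi>) + exp (of_real p + \<i> * of_real \<psi>)) / of_real \<kappa>) \<le> K * exp (\<kappa> * a * p)"
      unfolding L_def[symmetric] T_def by simp
  qed
qed

section \<open>The exponential expansion\<close>

text \<open>At real arguments the imaginary part of the phase is the sine of the reflection formula, so the terms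
  of the series are the imaginary parts of \<open>struve_phase \<cdot> struve_ratio / \<pi>\<close>.\<close>

definition struve_phase :: "real \<Rightarrow> real \<Rightarrow> complex \<Rightarrow> complex" where
  "struve_phase \<sigma> \<nu> s = exp (\<i> * of_real pi * (of_real \<sigma> * s - of_real \<nu> - 1 / 2))"

definition struve_main :: "real \<Rightarrow> real \<Rightarrow> nat \<Rightarrow> complex \<Rightarrow> complex" where
  "struve_main \<sigma> \<nu> j s = of_real (struve_coeff \<sigma> \<nu> j) * (struve_prefactor \<sigma> \<nu> s *
     rGamma (of_real (struve_kappa \<sigma>) * s + of_real (1 - struve_theta \<nu>) + of_nat j))"

definition struve_rem :: "real \<Rightarrow> real \<Rightarrow> nat \<Rightarrow> complex \<Rightarrow> complex" where
  "struve_rem \<sigma> \<nu> M s = struve_ratio \<sigma> \<nu> s - (\<Sum>j<M. struve_main \<sigma> \<nu> j s)"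

text \<open>The coefficient of x^n of the series, continued from s = n to an entire
  function.\<close>

definition struve_term :: "real \<Rightarrow> real \<Rightarrow> complex \<Rightarrow> complex" where
  "struve_term \<sigma> \<nu> s = rGamma (s + 3 / 2) * rGamma (of_real \<nu> + 3 / 2 - of_real \<sigma> * s)"

text \<open>The logarithm of h \<kappa>^\<kappa>, the geometric rate in the prefactor.\<close>

definition struve_rate :: "real \<Rightarrow> real" where
  "struve_rate \<sigma> = \<sigma> * ln \<sigma> + (1 - \<sigma>) * ln (1 - \<sigma>)"

lemma struve_prefactor_exp:
  assumes "0 < \<sigma>" "\<sigma> < 1"
  shows "struve_prefactor \<sigma> \<nu> s = of_real (struve_kappa \<sigma> * struve_A0 \<sigma> \<nu>) * exp (of_real (struve_rate \<sigma>) * s)"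
proof -
  define c where "c = (- \<nu> - 1) * ln \<sigma> + (\<nu> + 2) * ln (1 - \<sigma>)"
  have 1: "struve_prefactor \<sigma> \<nu> s = of_real (sqrt (2 * pi)) * exp (of_real c) * exp (of_real (struve_rate \<sigma>) * s)" for s
    unfolding struve_prefactor_eq[OF assms] struve_rate_def c_def exp_add by (simp only: mult.commute[of s] mult.assoc)
  have pos: "struve_h \<sigma> * struve_kappa \<sigma> powr struve_kappa \<sigma> > 0"
    using assms by (simp add: struve_h_def struve_kappa_def)
  hence "complex_of_real (struve_h \<sigma> * struve_kappa \<sigma> powr struve_kappa \<sigma>) \<noteq> 0" by (metis of_real_eq_0_iff less_irrefl)
  \<comment> \<open>Evaluation at s = 0 identifies the constant factor with \<kappa> A_0.\<close>
  hence "struve_prefactor \<sigma> \<nu> 0 = of_real (struve_kappa \<sigma> * struve_A0 \<sigma> \<nu>)"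
    unfolding struve_prefactor_def by (simp only: powr_zero_eq_one) simp
  with 1[of 0] have "of_real (sqrt (2 * pi)) * exp (of_real c) = complex_of_real (struve_kappa \<sigma> * struve_A0 \<sigma> \<nu>)" by simp
  thus ?thesis unfolding 1[of s] by simp
qed

lemma struve_A0_pos: "0 < \<sigma> \<Longrightarrow> \<sigma> < 1 \<Longrightarrow> struve_kappa \<sigma> * struve_A0 \<sigma> \<nu> > 0"
  by (simp add: struve_kappa_def struve_A0_def)

lemma struve_rem_bound_pos:
  assumes \<sigma>: "0 < \<sigma>" "\<sigma> < 1" and M: "M \<ge> 1" and \<delta>: "\<delta> > 0"
  shows "\<exists>R C. \<forall>s. norm s \<ge> R \<and> \<bar>Arg s\<bar> \<le> pi - \<delta> \<longrightarrow>
     norm (struve_rem \<sigma> \<nu> M s) \<le> C * exp (struve_rate \<sigma> * Re s) *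
       norm (rGamma (of_real (struve_kappa \<sigma>) * s + of_real (1 - struve_theta \<nu>) + of_nat M))"
proof -
  from struve_coeff_spec(1)[OF \<sigma>, of \<nu>] M obtain \<rho> where \<rho>: "\<And>\<delta>. \<delta> > 0 \<Longrightarrow>
     (\<forall>\<^sub>F s in sector_at_infinity \<delta>.
           Gamma (of_real \<sigma> * s - of_real \<nu> - 1 / 2) * rGamma (s + 3 / 2) =
           of_real (struve_kappa \<sigma> * struve_A0 \<sigma> \<nu>) *
           of_real (struve_h \<sigma> * struve_kappa \<sigma> powr struve_kappa \<sigma>) powr s *
           ((\<Sum>j<M. of_real (struve_coeff \<sigma> \<nu> j) *
                rGamma (of_real (struve_kappa \<sigma>) * s + of_real (1 - struve_theta \<nu>) + of_nat j))
            + \<rho> s *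
                rGamma (of_real (struve_kappa \<sigma>) * s + of_real (1 - struve_theta \<nu>) + of_nat M)))
        \<and> \<rho> \<in> O[sector_at_infinity \<delta>](\<lambda>_. 1)"
    unfolding inverse_factorial_coeffs_def by blast
  from \<rho>[OF \<delta>] obtain C where C: "\<forall>\<^sub>F s in sector_at_infinity \<delta>. norm (\<rho> s) \<le> C * norm (1 :: complex)"
    by (elim conjE landau_o.bigE)
  have "\<forall>\<^sub>F s in sector_at_infinity \<delta>. norm (struve_rem \<sigma> \<nu> M s) \<le> (struve_kappa \<sigma> * struve_A0 \<sigma> \<nu> * C) * exp (struve_rate \<sigma> * Re s) *
       norm (rGamma (of_real (struve_kappa \<sigma>) * s + of_real (1 - struve_theta \<nu>) + of_nat M))"
    using C conjunct1[OF \<rho>[OF \<delta>]]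
  proof eventually_elim
    case (elim s)
    let ?g = "rGamma (of_real (struve_kappa \<sigma>) * s + of_real (1 - struve_theta \<nu>) + of_nat M)"
    have "struve_rem \<sigma> \<nu> M s = struve_prefactor \<sigma> \<nu> s * (\<rho> s * ?g)"
      using elim(2) unfolding struve_rem_def struve_ratio_def struve_main_def struve_prefactor_def[symmetric]
      by (simp add: distrib_left sum_distrib_left mult_ac)
    also have "norm \<dots> = struve_kappa \<sigma> * struve_A0 \<sigma> \<nu> * exp (struve_rate \<sigma> * Re s) * (norm (\<rho> s) * norm ?g)"
      unfolding struve_prefactor_exp[OF \<sigma>] norm_mult norm_of_real norm_exp_eq_Re
      using struve_A0_pos[OF \<sigma>, of \<nu>] by simp
    also have "\<dots> \<le> struve_kappa \<sigma> * struve_A0 \<sigma> \<nu> * exp (struve_rate \<sigma> * Re s) * (C * norm ?g)"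
      using elim(1) struve_A0_pos[OF \<sigma>, of \<nu>] by (intro mult_left_mono mult_right_mono) auto
    finally show ?case by (simp add: mult_ac)
  qed
  thus ?thesis unfolding eventually_sector_iff by blast
qed

text \<open>For M = 0, the case used when \<sigma> > 1/3, the remainder is the quotient itself: the
  remainder for M = 1 plus the leading term. Both are bounded by the zeroth inverse factorial, since
  |1/\<Gamma>(z + 1)| \<le> |1/\<Gamma>(z)| for |z| \<ge> 1.\<close>

lemma struve_rem_bound:
  assumes \<sigma>: "0 < \<sigma>" "\<sigma> < 1" and \<delta>: "\<delta> > 0"
  obtains R C where "R > 0" "C > 0" "\<And>s. norm s \<ge> R \<Longrightarrow> \<bar>Arg s\<bar> \<le> pi - \<delta> \<Longrightarrow>
     norm (struve_rem \<sigma> \<nu> M s) \<le> C * exp (struve_rate \<sigma> * Re s) *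
       norm (rGamma (of_real (struve_kappa \<sigma>) * s + of_real (1 - struve_theta \<nu> + real M)))"
proof -
  let ?\<kappa> = "struve_kappa \<sigma>" and ?\<beta> = "1 - struve_theta \<nu>"
  have k: "?\<kappa> > 0" using \<sigma> by (simp add: struve_kappa_def)
  have eq: "of_real ?\<kappa> * s + of_real ?\<beta> + of_nat M = of_real ?\<kappa> * s + complex_of_real (?\<beta> + real M)" for s M by simp
  have "\<exists>R C. \<forall>s. norm s \<ge> R \<and> \<bar>Arg s\<bar> \<le> pi - \<delta> \<longrightarrow>
     norm (struve_rem \<sigma> \<nu> M s) \<le> C * exp (struve_rate \<sigma> * Re s) *
       norm (rGamma (of_real ?\<kappa> * s + of_real (?\<beta> + real M)))"
  proof (cases "M \<ge> 1")
    case True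
    thus ?thesis using struve_rem_bound_pos[OF \<sigma> True \<delta>, of \<nu>] unfolding eq by blast
  next
    case False
    hence M: "M = 0" by simp
    obtain R C where RC: "\<And>s. norm s \<ge> R \<Longrightarrow> \<bar>Arg s\<bar> \<le> pi - \<delta> \<Longrightarrow>
     norm (struve_rem \<sigma> \<nu> 1 s) \<le> C * exp (struve_rate \<sigma> * Re s) *
       norm (rGamma (of_real ?\<kappa> * s + of_real ?\<beta> + of_nat 1))"
      using struve_rem_bound_pos[OF \<sigma> order_refl \<delta>, of \<nu>] by blast
    let ?R = "max R ((1 + \<bar>?\<beta>\<bar>) / ?\<kappa>)"
    have "norm (struve_rem \<sigma> \<nu> 0 s) \<le> (\<bar>C\<bar> + ?\<kappa> * struve_A0 \<sigma> \<nu>) * exp (struve_rate \<sigma> * Re s) * norm (rGamma (of_real ?\<kappa> * s + of_real ?\<beta>))"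
      if s: "norm s \<ge> ?R" "\<bar>Arg s\<bar> \<le> pi - \<delta>" for s
    proof -
      define z where "z = of_real ?\<kappa> * s + complex_of_real ?\<beta>"
      have "1 + \<bar>?\<beta>\<bar> \<le> ?\<kappa> * norm s" using s(1) k by (simp add: field_simps)
      hence z1: "norm z \<ge> 1"
        using norm_triangle_ineq2[of "of_real ?\<kappa> * s" "- complex_of_real ?\<beta>"] k
        by (simp add: z_def norm_mult del: of_real_diff)
      have "norm (rGamma z) = norm z * norm (rGamma (z + 1))" by (metis norm_mult rGamma_plus1)
      hence g: "norm (rGamma (z + 1)) \<le> norm (rGamma z)" using mult_right_mono[OF z1, of "norm (rGamma (z + 1))"] by simp
      have "struve_rem \<sigma> \<nu> 0 s = struve_rem \<sigma> \<nu> 1 s + struve_prefactor \<sigma> \<nu> s * rGamma z"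
        using struve_coeff_spec(2)[OF \<sigma>, of \<nu>] by (simp add: struve_rem_def struve_main_def z_def)
      also have "norm \<dots> \<le> norm (struve_rem \<sigma> \<nu> 1 s) + norm (struve_prefactor \<sigma> \<nu> s * rGamma z)" by (rule norm_triangle_ineq)
      also have "norm (struve_prefactor \<sigma> \<nu> s * rGamma z) = ?\<kappa> * struve_A0 \<sigma> \<nu> * exp (struve_rate \<sigma> * Re s) * norm (rGamma z)"
        unfolding struve_prefactor_exp[OF \<sigma>] norm_mult norm_of_real norm_exp_eq_Re
        using struve_A0_pos[OF \<sigma>, of \<nu>] by simp
      also have "norm (struve_rem \<sigma> \<nu> 1 s) \<le> C * exp (struve_rate \<sigma> * Re s) * norm (rGamma (z + 1))"
        using RC[of s] s by (simp add: z_def)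
      also have "\<dots> \<le> \<bar>C\<bar> * exp (struve_rate \<sigma> * Re s) * norm (rGamma z)"
        using g by (intro mult_mono mult_right_mono) auto
      finally show ?thesis by (simp add: z_def algebra_simps)
    qed
    thus ?thesis unfolding M by (intro exI[of _ ?R] exI[of _ "\<bar>C\<bar> + ?\<kappa> * struve_A0 \<sigma> \<nu>"]) auto
  qed
  then obtain R C where RC: "\<And>s. norm s \<ge> R \<Longrightarrow> \<bar>Arg s\<bar> \<le> pi - \<delta> \<Longrightarrow>
     norm (struve_rem \<sigma> \<nu> M s) \<le> C * exp (struve_rate \<sigma> * Re s) *
       norm (rGamma (of_real ?\<kappa> * s + of_real (?\<beta> + real M)))" by blast
  show ?thesis
  proof (rule that[of "\<bar>R\<bar> + 1" "\<bar>C\<bar> + 1"])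
    fix s assume s: "norm s \<ge> \<bar>R\<bar> + 1" "\<bar>Arg s\<bar> \<le> pi - \<delta>"
    have "norm (struve_rem \<sigma> \<nu> M s) \<le> C * exp (struve_rate \<sigma> * Re s) *
       norm (rGamma (of_real ?\<kappa> * s + of_real (?\<beta> + real M)))" using s by (intro RC) auto
    also have "\<dots> \<le> (\<bar>C\<bar> + 1) * exp (struve_rate \<sigma> * Re s) *
       norm (rGamma (of_real ?\<kappa> * s + of_real (?\<beta> + real M)))" by (intro mult_right_mono) auto
    finally show "norm (struve_rem \<sigma> \<nu> M s) \<le> (\<bar>C\<bar> + 1) * exp (struve_rate \<sigma> * Re s) *
       norm (rGamma (of_real ?\<kappa> * s + of_real (?\<beta> + real M)))" .
  qed auto
qed

lemma struve_term_eq: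
  assumes "of_real \<sigma> * s - of_real \<nu> - 1 / 2 \<notin> \<int>\<^sub>\<le>\<^sub>0"
  shows "struve_term \<sigma> \<nu> s = struve_ratio \<sigma> \<nu> s * (sin (of_real pi * (of_real \<sigma> * s - of_real \<nu> - 1 / 2)) / of_real pi)"
proof -
  define w where "w = of_real \<sigma> * s - of_real \<nu> - (1 / 2 :: complex)"
  have "rGamma w * rGamma (1 - w) = sin (of_real pi * w) / of_real pi" by (rule rGamma_reflection_complex)
  moreover have "1 - w = of_real \<nu> + 3 / 2 - of_real \<sigma> * s" by (simp add: w_def)
  moreover have "Gamma w * rGamma w = 1"
    using assms by (simp add: w_def[symmetric] rGamma_inverse_Gamma Gamma_eq_zero_iff)
  ultimately have "rGamma (of_real \<nu> + 3 / 2 - of_real \<sigma> * s) = Gamma w * (sin (of_real pi * w) / of_real pi)"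
    by (metis (no_types, lifting) mult.assoc mult_1)
  thus ?thesis unfolding struve_term_def struve_ratio_def w_def[symmetric] by (simp add: mult_ac)
qed

lemma struve_X_pos: "0 < \<sigma> \<Longrightarrow> \<sigma> < 1 \<Longrightarrow> x > 0 \<Longrightarrow> struve_X \<sigma> x > 0"
  by (simp add: struve_X_def struve_kappa_def struve_h_def)

text \<open>X is the scale for which (h \<kappa>^\<kappa> x)^s = exp(\<kappa>s ln X), so prefactor
  and power of x merge into one exponential.\<close>

lemma ln_struve_X:
  assumes "0 < \<sigma>" "\<sigma> < 1" "x > 0"
  shows "struve_kappa \<sigma> * ln (struve_X \<sigma> x) = struve_rate \<sigma> + ln x"
proof -
  define k where "k = 1 - \<sigma>"
  have k: "k > 0" using assms by (simp add: k_def)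
  have hx: "\<sigma> powr \<sigma> * x > 0" using assms by simp
  have "ln (struve_X \<sigma> x) = ln k + ln ((\<sigma> powr \<sigma> * x) powr (1 / k))"
    unfolding struve_X_def struve_kappa_def struve_h_def k_def[symmetric]
    using k hx by (intro ln_mult_pos) auto
  also have "ln ((\<sigma> powr \<sigma> * x) powr (1 / k)) = (\<sigma> * ln \<sigma> + ln x) / k"
    using assms by (simp add: ln_powr ln_mult_pos)
  finally show ?thesis using k
    unfolding struve_kappa_def struve_rate_def k_def[symmetric] by (simp add: field_simps)
qed

section \<open>From complex exponentials to the sine form of the expansion\<close>

lemma minus_one_powi_sin:
  "(- 1 :: real) powi (int j - 1) * sin (y - pi * (real j + 1)) = sin y"
proof -
  have "sin (y - pi * (real j + 1)) = - ((-1) ^ j * sin y)"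
  proof (induction j)
    case (Suc j)
    have "sin (y - pi * (real (Suc j) + 1)) = sin ((y - pi * (real j + 1)) - pi)" by (simp add: algebra_simps)
    also have "\<dots> = - sin (y - pi * (real j + 1))" by simp
    finally show ?case unfolding Suc by simp
  qed simp
  moreover have "(- 1 :: real) powi (int j - 1) = - ((- 1) ^ j)"
    by (simp add: power_int_diff)
  ultimately show ?thesis by (simp add: power_mult_distrib[symmetric] flip: mult.assoc)
qed

text \<open>With u = e^L the term u^(\<vartheta> - j) e^u has modulus X^(\<vartheta> - j) exp(X cos
  \<psi>) and phase X sin \<psi> + (\<vartheta> - j)\<psi>. Since \<pi>/\<kappa> = \<psi> + \<pi>,
  the constant phase -\<pi>(\<nu> + 1/2) replaces \<psi> by \<pi>/\<kappa> up to the multiple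
  \<pi>(j + 1), which is the origin of the sign (-1)^(j - 1).\<close>

lemma struve_E_trunc_eq:
  assumes \<sigma>: "0 < \<sigma>" "\<sigma> < 1" and x: "x > 0"
  defines "L \<equiv> of_real (ln (struve_X \<sigma> x)) + \<i> * of_real (pi * \<sigma> / struve_kappa \<sigma>)"
  shows "struve_E_trunc \<sigma> \<nu> M x = 1 / pi * Im (\<Sum>j<M. of_real (struve_A0 \<sigma> \<nu> * struve_coeff \<sigma> \<nu> j) * exp (- \<i> * of_real (pi * (\<nu> + 1 / 2)))
     * exp (of_real (struve_theta \<nu> - real j) * L + exp L))"
proof -
  define \<psi> where "\<psi> = pi * \<sigma> / struve_kappa \<sigma>"
  define X where "X = struve_X \<sigma> x"
  define \<theta> where "\<theta> = struve_theta \<nu>"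
  define k where "k = struve_kappa \<sigma>"
  have k: "k > 0" using \<sigma> by (simp add: k_def struve_kappa_def)
  have X0: "X > 0" using struve_X_pos[OF \<sigma> x] by (simp add: X_def)
  have expL: "exp L = Complex (X * cos \<psi>) (X * sin \<psi>)"
    using X0 unfolding L_def X_def[symmetric] \<psi>_def[symmetric]
    by (simp add: complex_eq_iff Re_exp Im_exp)
  have tm: "Im (exp (- \<i> * of_real (pi * (\<nu> + 1 / 2))) * exp (of_real (\<theta> - real j) * L + exp L)) =
      X powr \<theta> * exp (X * cos \<psi>) * ((- 1) powi (int j - 1) * X powi (- int j) * sin (X * sin \<psi> + pi / k * (\<theta> - real j)))" for j
  proof -
    have "exp (- \<i> * of_real (pi * (\<nu> + 1 / 2))) * exp (of_real (\<theta> - real j) * L + exp L) =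
       exp (- \<i> * of_real (pi * (\<nu> + 1 / 2)) + (of_real (\<theta> - real j) * L + exp L))" by (simp only: exp_add)
    also have "Im \<dots> = exp ((\<theta> - real j) * ln X + X * cos \<psi>) * sin ((\<theta> - real j) * \<psi> + X * sin \<psi> - pi * (\<nu> + 1 / 2))"
      unfolding Im_exp expL by (simp add: L_def X_def[symmetric] \<psi>_def[symmetric] algebra_simps)
    also have "exp ((\<theta> - real j) * ln X + X * cos \<psi>) = X powr \<theta> * X powi (- int j) * exp (X * cos \<psi>)"
    proof -
      have "X powi (- int j) = X powr (- real j)" using X0 by (simp add: powr_real_of_int'[symmetric])
      thus ?thesis using X0 by (simp add: powr_def exp_add[symmetric] algebra_simps)
    qed
    also have "sin ((\<theta> - real j) * \<psi> + X * sin \<psi> - pi * (\<nu> + 1 / 2)) =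
        (- 1) powi (int j - 1) * sin (X * sin \<psi> + pi / k * (\<theta> - real j))"
    proof -
      have "pi / k = \<psi> + pi" using k unfolding \<psi>_def k_def[symmetric]
        by (simp add: field_simps) (simp add: k_def struve_kappa_def algebra_simps)
      hence e: "X * sin \<psi> + pi / k * (\<theta> - real j) = ((\<theta> - real j) * \<psi> + X * sin \<psi> - pi * (\<nu> + 1 / 2)) - pi * (real j + 1)"
        by (simp add: \<theta>_def struve_theta_def algebra_simps)
      show ?thesis unfolding e by (rule minus_one_powi_sin[symmetric])
    qed
    finally show ?thesis by (simp add: mult_ac)
  qed
  have "Im (\<Sum>j<M. of_real (struve_A0 \<sigma> \<nu> * struve_coeff \<sigma> \<nu> j) * exp (- \<i> * of_real (pi * (\<nu> + 1 / 2))) * exp (of_real (\<theta> - real j) * L + exp L))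
     = (\<Sum>j<M. struve_A0 \<sigma> \<nu> * struve_coeff \<sigma> \<nu> j * Im (exp (- \<i> * of_real (pi * (\<nu> + 1 / 2))) * exp (of_real (\<theta> - real j) * L + exp L)))"
  proof -
    have "Im (of_real r * z) = r * Im z" for r z by simp
    thus ?thesis unfolding Im_sum mult.assoc by (intro sum.cong refl) (simp only: mult.assoc)
  qed
  thus ?thesis
    unfolding tm struve_E_trunc_def Let_def X_def[symmetric] \<theta>_def[symmetric] k_def[symmetric] \<psi>_def[symmetric, folded k_def]
    by (simp add: sum_distrib_left mult_ac)
qed

text \<open>\<open>mittag_leffler_asymp\<close> with p = ln X and b = 1 - \<vartheta> + j. The bound
  \<sigma> \<le> 1/3 amounts to \<psi> \<le> \<pi>/2, X \<ge> 1 to p \<ge> 0, and the \<kappa> in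
  the prefactor \<kappa> A_0 cancels the 1/\<kappa> of the Mittag-Leffler asymptotics.\<close>

lemma struve_main_sum:
  fixes m :: int
  assumes \<sigma>: "0 < \<sigma>" "\<sigma> \<le> 1 / 3"
  defines "a \<equiv> real_of_int m - 1 / 2" and "\<psi> \<equiv> pi * \<sigma> / struve_kappa \<sigma>"
  shows "\<exists>K. \<forall>x>0. struve_X \<sigma> x \<ge> 1 \<longrightarrow>
    summable (\<lambda>k. struve_phase \<sigma> \<nu> (of_int (m + int k)) * struve_main \<sigma> \<nu> j (of_int (m + int k)) * exp (of_real (ln x) * of_int (m + int k))) \<and>
    norm ((\<Sum>k. struve_phase \<sigma> \<nu> (of_int (m + int k)) * struve_main \<sigma> \<nu> j (of_int (m + int k)) * exp (of_real (ln x) * of_int (m + int k)))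
      - of_real (struve_A0 \<sigma> \<nu> * struve_coeff \<sigma> \<nu> j) * exp (- \<i> * of_real (pi * (\<nu> + 1 / 2)))
       * exp (of_real (struve_theta \<nu> - real j) * (of_real (ln (struve_X \<sigma> x)) + \<i> * of_real \<psi>) + exp (of_real (ln (struve_X \<sigma> x)) + \<i> * of_real \<psi>))) \<le> K * exp (a * ln x)"
proof -
  have \<sigma>1: "\<sigma> < 1" using \<sigma> by simp
  define k where "k = struve_kappa \<sigma>"
  have k: "0 < k" "k \<le> 1" "k \<ge> 2 / 3" using \<sigma> by (auto simp: k_def struve_kappa_def)
  define b where "b = 1 - struve_theta \<nu> + real j"
  have \<psi>: "\<bar>\<psi>\<bar> \<le> pi / 2"
  proof -
    have "pi * \<sigma> \<le> pi / 2 * k" using \<sigma> k mult_left_mono[of \<sigma> "k / 2" pi] by simp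
    thus ?thesis using k \<sigma> by (simp add: \<psi>_def k_def[symmetric] field_simps)
  qed
  obtain K where K: "\<And>p. p \<ge> 0 \<Longrightarrow> norm ((\<Sum>i. exp (of_real k * of_int (m + int i) * (of_real p + \<i> * of_real \<psi>)) * rGamma (of_real k * of_int (m + int i) + of_real b))
      - exp (of_real (1 - b) * (of_real p + \<i> * of_real \<psi>) + exp (of_real p + \<i> * of_real \<psi>)) / of_real k) \<le> K * exp (k * a * p)"
    using mittag_leffler_asymp[OF k(1,2) \<psi>, of m b] unfolding a_def by blast
  define c where "c = of_real (k * struve_A0 \<sigma> \<nu> * struve_coeff \<sigma> \<nu> j) * exp (- \<i> * of_real (pi * (\<nu> + 1 / 2)))"
  show ?thesis
  proof (intro exI[of _ "norm c * K * exp (struve_rate \<sigma> * a)"] allI impI)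
    fix x :: real assume x: "x > 0" "struve_X \<sigma> x \<ge> 1"
    define p where "p = ln (struve_X \<sigma> x)"
    have p: "p \<ge> 0" using x by (simp add: p_def)
    have kp: "k * p = struve_rate \<sigma> + ln x" using ln_struve_X[OF \<sigma>(1) \<sigma>1 x(1)] by (simp add: k_def p_def)
    have kpsi: "k * \<psi> = pi * \<sigma>" using k by (simp add: \<psi>_def k_def[symmetric])
    define f where "f = (\<lambda>i. exp (of_real k * of_int (m + int i) * (of_real p + \<i> * of_real \<psi>)) * rGamma (of_real k * of_int (m + int i) + of_real b))"
    have eq: "struve_phase \<sigma> \<nu> s * struve_main \<sigma> \<nu> j s * exp (of_real (ln x) * s) = c * (exp (of_real k * s * (of_real p + \<i> * of_real \<psi>)) * rGamma (of_real k * s + of_real b))" for s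
    proof -
      have "of_real k * s * (of_real p + \<i> * of_real \<psi>) = s * of_real (k * p) + \<i> * s * of_real (k * \<psi>)" by (simp add: algebra_simps)
      also have "\<dots> = s * of_real (struve_rate \<sigma>) + s * of_real (ln x) + \<i> * s * of_real (pi * \<sigma>)" unfolding kp kpsi by (simp add: algebra_simps)
      finally have e: "exp (of_real k * s * (of_real p + \<i> * of_real \<psi>)) = exp (of_real (struve_rate \<sigma>) * s) * exp (of_real (ln x) * s) * exp (\<i> * s * of_real (pi * \<sigma>))"
        by (simp add: exp_add mult_ac)
      have ph: "struve_phase \<sigma> \<nu> s = exp (\<i> * s * of_real (pi * \<sigma>)) * exp (- \<i> * of_real (pi * (\<nu> + 1 / 2)))"
        unfolding struve_phase_def exp_add[symmetric] by (rule arg_cong[where f = exp]) (simp add: algebra_simps)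
      have g: "of_real k * s + of_real (1 - struve_theta \<nu>) + of_nat j = of_real k * s + complex_of_real b" by (simp add: b_def)
      show ?thesis unfolding e ph struve_main_def struve_prefactor_exp[OF \<sigma>(1) \<sigma>1] k_def[symmetric] g c_def
        by (simp add: mult_ac)
    qed
    have fi: "exp (of_real k * of_int (m + int i) * (of_real p + \<i> * of_real \<psi>)) * rGamma (of_real k * of_int (m + int i) + of_real b) = f i" for i
      by (simp only: f_def)
    have sf: "summable f"
    proof -
      have "f = (\<lambda>i. exp (of_real (k * p) * of_int (m + int i)) * (exp (\<i> * of_real \<psi> * of_real k * of_int (m + int i)) * rGamma (of_real k * of_int (m + int i) + of_real b)))"
        unfolding f_def by (rule ext) (simp add: exp_add[symmetric] algebra_simps)
      thus ?thesis using fast_decay_summable[OF fast_decay_rGamma[OF k(1,2) \<psi>, of a b], of m "k * p"] by (simp add: a_def)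
    qed
    have sums: "(\<Sum>i. c * f i) = c * (\<Sum>i. f i)" by (rule suminf_mult[OF sf])
    have "norm ((\<Sum>i. c * f i) - c * (exp (of_real (1 - b) * (of_real p + \<i> * of_real \<psi>) + exp (of_real p + \<i> * of_real \<psi>)) / of_real k)) \<le> norm c * (K * exp (k * a * p))"
      unfolding sums right_diff_distrib[symmetric] norm_mult using K[OF p] unfolding f_def by (intro mult_left_mono) auto
    also have "exp (k * a * p) = exp (struve_rate \<sigma> * a) * exp (a * ln x)"
    proof -
      have "k * a * p = a * (k * p)" by simp
      thus ?thesis unfolding kp by (simp add: exp_add[symmetric] algebra_simps)
    qed
    also have "c * (exp (of_real (1 - b) * (of_real p + \<i> * of_real \<psi>) + exp (of_real p + \<i> * of_real \<psi>)) / of_real k) =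
       of_real (struve_A0 \<sigma> \<nu> * struve_coeff \<sigma> \<nu> j) * exp (- \<i> * of_real (pi * (\<nu> + 1 / 2)))
       * exp (of_real (struve_theta \<nu> - real j) * (of_real p + \<i> * of_real \<psi>) + exp (of_real p + \<i> * of_real \<psi>))"
      using k by (simp add: c_def b_def)
    finally show "summable (\<lambda>k. struve_phase \<sigma> \<nu> (of_int (m + int k)) * struve_main \<sigma> \<nu> j (of_int (m + int k)) * exp (of_real (ln x) * of_int (m + int k))) \<and>
    norm ((\<Sum>k. struve_phase \<sigma> \<nu> (of_int (m + int k)) * struve_main \<sigma> \<nu> j (of_int (m + int k)) * exp (of_real (ln x) * of_int (m + int k)))
      - of_real (struve_A0 \<sigma> \<nu> * struve_coeff \<sigma> \<nu> j) * exp (- \<i> * of_real (pi * (\<nu> + 1 / 2)))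
       * exp (of_real (struve_theta \<nu> - real j) * (of_real (ln (struve_X \<sigma> x)) + \<i> * of_real \<psi>) + exp (of_real (ln (struve_X \<sigma> x)) + \<i> * of_real \<psi>))) \<le> norm c * K * exp (struve_rate \<sigma> * a) * exp (a * ln x)"
      unfolding p_def[symmetric] eq fi using sf by (simp add: mult.assoc summable_mult)
  qed
qed

section \<open>The ray through the saddle point\<close>

text \<open>Lets powers of X = e^p be absorbed into a fraction of the exponent c X once p is
  large.\<close>

lemma linear_le_exp:
  fixes q c :: real
  assumes "c > 0" "p \<ge> 2 * \<bar>q\<bar> / c" "p \<ge> 0"
  shows "q * p \<le> c * exp p"
proof -
  have "2 * \<bar>q\<bar> \<le> p * c" using assms(1,2) by (simp add: pos_divide_le_eq)
  hence "\<bar>q\<bar> * p \<le> (p * c / 2) * p" using assms(3) by (intro mult_right_mono) auto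
  moreover have "exp p \<ge> p\<^sup>2 / 2"
    using exp_lower_Taylor_quadratic[OF assms(3)] assms(3) by linarith
  hence "c * (p\<^sup>2 / 2) \<le> c * exp p" using assms(1) by (intro mult_left_mono) auto
  moreover have "q * p \<le> \<bar>q\<bar> * p" using assms(3) by (intro mult_right_mono) auto
  ultimately show ?thesis by (simp add: power2_eq_square mult_ac)
qed

text \<open>In terms of y = e^p/r both bounds come from ln y \<le> y - 1, with equality at r = e^p.
  Half way below the maximum a fixed proportion is saved: ln y \<le> y/2 - 1 + ln 2 and ln 2 \<le>
  25/36 give the factor 7/8 for y \<ge> 2.\<close>

lemma entropy_bound:
  fixes r p :: real
  assumes "r > 0"
  shows "r * (1 + p - ln r) \<le> exp p"
    and "r \<le> exp p / 2 \<Longrightarrow> r * (1 + p - ln r) \<le> 7 / 8 * exp p"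
proof -
  define y where "y = exp p / r"
  have y0: "y > 0" using assms by (simp add: y_def)
  have lny: "ln y = p - ln r" using assms by (simp add: y_def ln_div)
  have ry: "r * y = exp p" using assms by (simp add: y_def)
  have "ln y \<le> y - 1" using y0 by (rule ln_le_minus_one)
  hence "r * (1 + ln y) \<le> r * y" using assms by (intro mult_left_mono) auto
  thus "r * (1 + p - ln r) \<le> exp p" unfolding lny ry by (simp add: algebra_simps)
  assume "r \<le> exp p / 2"
  hence "y \<ge> 2" using assms by (simp add: y_def field_simps)
  have "ln (y / 2) \<le> y / 2 - 1" using y0 by (intro ln_le_minus_one) auto
  hence "ln y \<le> y / 2 - 1 + ln 2" using y0 by (simp add: ln_div)
  moreover have "ln (2::real) \<le> 25 / 36" by (rule ln2_le_25_over_36)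
  ultimately have "1 + ln y \<le> 7 / 8 * y" using \<open>y \<ge> 2\<close> by linarith
  hence "r * (1 + ln y) \<le> r * (7 / 8 * y)" using assms by (intro mult_left_mono) auto
  also have "\<dots> = 7 / 8 * exp p" using ry by simp
  finally show "r * (1 + p - ln r) \<le> 7 / 8 * exp p" unfolding lny by (simp add: algebra_simps)
qed

text \<open>On the ray through the saddle point \<open>u = e\<^bsup>L\<^esup>\<close> the modulus of the integrand is governed by
  \<open>cos \<psi> \<cdot> r(1 + ln(X/r))\<close>, which is at most \<open>X cos \<psi>\<close>.\<close>

lemma saddle_ray_bound:
  fixes \<kappa> a b \<psi> :: real
  assumes \<kappa>: "\<kappa> > 0" and \<psi>: "0 \<le> \<psi>" "\<psi> < pi / 2" and B0: "\<kappa> * a + b - 1 / 2 \<ge> 0"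
  shows "\<exists>K p0. \<forall>p\<ge>p0. \<forall>t\<ge>0. norm (exp (of_real \<kappa> * (of_real a + of_real t * exp (\<i> * of_real \<psi>)) * (of_real p + \<i> * of_real \<psi>))
       * rGamma (of_real \<kappa> * (of_real a + of_real t * exp (\<i> * of_real \<psi>)) + of_real b))
     \<le> K * exp ((5 / 2 - b) * p + exp p * cos \<psi>) / (1 + t\<^sup>2)"
proof -
  define c where "c = cos \<psi>"
  have c: "c > 0" "c \<le> 1" using \<psi> by (auto simp: c_def intro!: cos_gt_zero_pi)
  define b' where "b' = \<kappa> * a + b"
  define B where "B = b' - 1 / 2"
  have B: "B \<ge> 0" using B0 by (simp add: B_def b'_def)
  have "stirling_analytic b' 0 \<in> O[at 0](\<lambda>w. w ^ (0 + 3))" using stirling_analytic_0[of b'] by simp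
  from Gamma_stirling[OF this, of "pi / 2"] obtain R0 B1 where R0: "R0 > 0" and st: "\<And>s. \<bar>Arg s\<bar> \<le> pi - pi / 2 \<Longrightarrow> norm s \<ge> R0 \<Longrightarrow>
       \<exists>\<epsilon>. norm \<epsilon> \<le> B1 / norm s ^ (0 + 1) \<and> Gamma (s + of_real b') = of_real (sqrt (2 * pi)) * exp (stirling_exponent b' s + poly 0 (1 / s) + \<epsilon>)"
    by auto
  \<comment> \<open>For radii below \<open>R\<close> compactness bounds 1/\<Gamma>; from
    \<open>R\<close> on Stirling's formula is available.\<close>
  define R where "R = max R0 1"
  define E where "E = exp (\<bar>B1\<bar>)"
  have R1: "R \<ge> 1" by (simp add: R_def)
  have "compact (rGamma ` cball (of_real b' :: complex) R)"
    by (intro compact_continuous_image continuous_intros) auto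
  from compact_imp_bounded[OF this] obtain C1 where C1: "C1 > 0" "\<And>w. w \<in> cball (of_real b' :: complex) R \<Longrightarrow> norm (rGamma w) \<le> C1"
    unfolding bounded_pos by blast
  define v where "v = exp (\<i> * of_real \<psi>)"
  have v: "Re v = c" "Im v = sin \<psi>" "norm v = 1" by (auto simp: v_def c_def Re_exp Im_exp)
  define l where "l = 2 * \<kappa> * c"
  have l0: "l > 0" using \<kappa> c by (simp add: l_def)
  \<comment> \<open>The summands belong, in this order, to the ranges r \<le> X/2, X/2 < r \<le> e^3
    X and r > e^3 X with r \<ge> R, and to the range r < R, where r = \<kappa>t.\<close>
  define K where "K = E * (1 + 1 / \<kappa>\<^sup>2) + E * exp (B * ln 2) * (1 + exp 6 / \<kappa>\<^sup>2) + E * (1 + 2 / l\<^sup>2) + C1 * exp (R * pi) * (1 + (R / \<kappa>)\<^sup>2)"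
  define p0 where "p0 = max 0 (max (2 * \<bar>B\<bar> / (c / 8)) (2 * \<bar>R + B\<bar> / c))"
  have Kp: "E * (1 + 1 / \<kappa>\<^sup>2) \<le> K" "E * exp (B * ln 2) * (1 + exp 6 / \<kappa>\<^sup>2) \<le> K" "E * (1 + 2 / l\<^sup>2) \<le> K" "C1 * exp (R * pi) * (1 + (R / \<kappa>)\<^sup>2) \<le> K"
  proof -
    have "0 \<le> E * (1 + 1 / \<kappa>\<^sup>2)" "0 \<le> E * exp (B * ln 2) * (1 + exp 6 / \<kappa>\<^sup>2)" "0 \<le> E * (1 + 2 / l\<^sup>2)" "0 \<le> C1 * exp (R * pi) * (1 + (R / \<kappa>)\<^sup>2)"
      using C1 by (auto simp: E_def intro!: mult_nonneg_nonneg add_nonneg_nonneg)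
    thus "E * (1 + 1 / \<kappa>\<^sup>2) \<le> K" "E * exp (B * ln 2) * (1 + exp 6 / \<kappa>\<^sup>2) \<le> K" "E * (1 + 2 / l\<^sup>2) \<le> K" "C1 * exp (R * pi) * (1 + (R / \<kappa>)\<^sup>2) \<le> K"
      unfolding K_def by linarith+
  qed
  show ?thesis
  proof (rule exI[of _ K], rule exI[of _ p0], intro allI impI)
    fix p t :: real assume p: "p \<ge> p0" and t: "t \<ge> 0"
    have p0: "p \<ge> 0" using p by (simp add: p0_def)
    have pB: "B * p \<le> c / 8 * exp p" using c p by (intro linear_le_exp) (auto simp: p0_def)
    have pR: "(R + B) * p \<le> c * exp p" using c p by (intro linear_le_exp) (auto simp: p0_def)
    define X where "X = exp p"
    have X: "X \<ge> 1" "X > 0" using p0 by (auto simp: X_def)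
    define r where "r = \<kappa> * t"
    have r0: "r \<ge> 0" using \<kappa> t by (simp add: r_def)
    have tr: "t = r / \<kappa>" using \<kappa> by (simp add: r_def)
    define z where "z = of_real r * v"
    have z: "norm z = r" using r0 by (simp add: z_def norm_mult v)
    have arg: "of_real \<kappa> * (of_real a + of_real t * v) + of_real b = z + of_real b'"
      by (simp add: z_def r_def b'_def algebra_simps)
    have nexp: "norm (exp (of_real \<kappa> * (of_real a + of_real t * v) * (of_real p + \<i> * of_real \<psi>))) = exp (\<kappa> * a * p + r * c * p - r * sin \<psi> * \<psi>)"
      unfolding norm_exp_eq_Re by (simp add: v r_def algebra_simps)
    define Goal where "Goal = K * exp ((5 / 2 - b) * p + exp p * cos \<psi>) / (1 + t\<^sup>2)"
    have t1: "1 + t\<^sup>2 > 0" by (simp add: add_pos_nonneg)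
    \<comment> \<open>With B = \<kappa>a + b - 1/2 the target exponent (5/2 - b)p is \<kappa>ap - Bp
      + 2p; the spare X^2 = e^(2p) pays for the factor 1 + t^2.\<close>
    have exps: "exp ((5 / 2 - b) * p + exp p * cos \<psi>) = exp (\<kappa> * a * p) * exp (- B * p) * X\<^sup>2 * exp (c * X)"
      unfolding X_def exp_double[symmetric] exp_add[symmetric] by (rule arg_cong[where f = exp]) (simp add: B_def b'_def c_def algebra_simps)
    have goalI: "\<alpha> \<le> Goal" if "\<alpha> * (1 + t\<^sup>2) \<le> K * (exp (\<kappa> * a * p) * exp (- B * p) * X\<^sup>2 * exp (c * X))" for \<alpha>
      using that t1 unfolding Goal_def exps by (simp add: pos_le_divide_eq)
    show "norm (exp (of_real \<kappa> * (of_real a + of_real t * exp (\<i> * of_real \<psi>)) * (of_real p + \<i> * of_real \<psi>))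
       * rGamma (of_real \<kappa> * (of_real a + of_real t * exp (\<i> * of_real \<psi>)) + of_real b)) \<le> K * exp ((5 / 2 - b) * p + exp p * cos \<psi>) / (1 + t\<^sup>2)"
      unfolding v_def[symmetric] arg norm_mult nexp Goal_def[symmetric]
    proof (cases "r < R")
      case True
      have g: "norm (rGamma (z + of_real b')) \<le> C1"
        using z True by (intro C1(2)) (simp add: dist_norm)
      have "\<kappa> * a * p + r * c * p - r * sin \<psi> * \<psi> \<le> \<kappa> * a * p + R * p + R * pi"
      proof -
        have "r * c * p \<le> R * 1 * p" using True r0 c p0 by (intro mult_right_mono mult_mono) auto
        moreover have "- (r * sin \<psi> * \<psi>) \<le> 0" using r0 \<psi> by (auto intro!: mult_nonneg_nonneg sin_ge_zero)
        moreover have "R * pi \<ge> 0" using R1 by simp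
        ultimately show ?thesis by linarith
      qed
      also have "\<dots> \<le> \<kappa> * a * p + (- B * p) + c * X + R * pi"
        using pR by (simp add: X_def algebra_simps)
      finally have e: "exp (\<kappa> * a * p + r * c * p - r * sin \<psi> * \<psi>) \<le> exp (\<kappa> * a * p + (- B * p) + c * X + R * pi)" by simp
      have "exp (\<kappa> * a * p + r * c * p - r * sin \<psi> * \<psi>) * norm (rGamma (z + of_real b')) * (1 + t\<^sup>2)
          \<le> exp (\<kappa> * a * p + (- B * p) + c * X + R * pi) * C1 * (1 + (R / \<kappa>)\<^sup>2)"
        using True r0 \<kappa> C1 by (intro mult_mono e g add_left_mono power_mono) (auto simp: tr divide_right_mono)
      also have "\<dots> = (C1 * exp (R * pi) * (1 + (R / \<kappa>)\<^sup>2)) * (exp (\<kappa> * a * p) * exp (- B * p) * 1 * exp (c * X))"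
        unfolding exp_add by simp
      also have "\<dots> \<le> K * (exp (\<kappa> * a * p) * exp (- B * p) * X\<^sup>2 * exp (c * X))"
      proof (intro mult_mono Kp(4) order_refl)
        show "1 \<le> X\<^sup>2" using X by simp
        show "0 \<le> K" using Kp(4) C1 by (smt (verit) exp_gt_zero mult_pos_pos zero_le_power2)
      qed auto
      finally show "exp (\<kappa> * a * p + r * c * p - r * sin \<psi> * \<psi>) * norm (rGamma (z + of_real b')) \<le> Goal" by (rule goalI)
    next
      case False
      hence rR: "r \<ge> R" "r \<ge> 1" "r > 0" using R1 by auto
      have argz: "Arg z = \<psi>"
        unfolding z_def using rR \<psi> pi_gt_zero by (subst Arg_times_of_real) (auto simp: v_def intro!: Arg_unique[of 1])
      have Lnz: "Ln z = of_real (ln r) + \<i> * of_real \<psi>"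
        using rR z argz by (subst Ln_Arg) auto
      obtain \<epsilon> where \<epsilon>: "norm \<epsilon> \<le> B1 / norm z ^ (0 + 1)" "Gamma (z + of_real b') = of_real (sqrt (2 * pi)) * exp (stirling_exponent b' z + poly 0 (1 / z) + \<epsilon>)"
        using st[of z] argz \<psi> z rR by (auto simp: R_def)
      have se: "Re (stirling_exponent b' z) = (r * c + B) * ln r - r * sin \<psi> * \<psi> - r * c"
        unfolding stirling_exponent_def Lnz by (simp add: z_def v B_def algebra_simps)
      have "norm (rGamma (z + of_real b')) = exp (- (Re (stirling_exponent b' z) + Re \<epsilon>)) / sqrt (2 * pi)"
        unfolding rGamma_inverse_Gamma \<epsilon>(2) by (simp add: norm_inverse norm_mult norm_exp_eq_Re divide_inverse exp_minus[symmetric] algebra_simps)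
      also have "\<dots> \<le> exp (- Re (stirling_exponent b' z) + \<bar>B1\<bar>) / 1"
      proof (intro frac_le)
        have "B1 / norm z \<le> \<bar>B1\<bar> / 1" using z rR by (intro frac_le) auto
        hence "norm \<epsilon> \<le> \<bar>B1\<bar>" using \<epsilon>(1) by simp
        hence "- Re \<epsilon> \<le> \<bar>B1\<bar>" using abs_Re_le_cmod[of \<epsilon>] by linarith
        thus "exp (- (Re (stirling_exponent b' z) + Re \<epsilon>)) \<le> exp (- Re (stirling_exponent b' z) + \<bar>B1\<bar>)" by simp
        have "1 \<le> 2 * pi" using pi_gt3 by simp
        thus "1 \<le> sqrt (2 * pi)" by (rule real_sqrt_ge_one)
      qed auto
      also have "exp (- Re (stirling_exponent b' z) + \<bar>B1\<bar>) / 1 = E * exp (- Re (stirling_exponent b' z))"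
        by (simp only: E_def exp_add div_by_1 mult.commute)
      finally have g: "norm (rGamma (z + of_real b')) \<le> E * exp (- Re (stirling_exponent b' z))" .
      have main: "exp (\<kappa> * a * p + r * c * p - r * sin \<psi> * \<psi>) * norm (rGamma (z + of_real b'))
          \<le> E * (exp (\<kappa> * a * p) * exp (c * (r * (1 + p - ln r))) * exp (- B * ln r))"
      proof -
        have "exp (\<kappa> * a * p + r * c * p - r * sin \<psi> * \<psi>) * norm (rGamma (z + of_real b'))
          \<le> exp (\<kappa> * a * p + r * c * p - r * sin \<psi> * \<psi>) * (E * exp (- Re (stirling_exponent b' z)))"
          by (intro mult_left_mono g) auto
        also have "\<dots> = E * (exp (\<kappa> * a * p + r * c * p - r * sin \<psi> * \<psi>) * exp (- Re (stirling_exponent b' z)))" by simp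
        \<comment> \<open>The angular parts r \<psi> sin \<psi> cancel because the ray has the
          direction of the saddle point.\<close>
        also have "exp (\<kappa> * a * p + r * c * p - r * sin \<psi> * \<psi>) * exp (- Re (stirling_exponent b' z))
           = exp (\<kappa> * a * p) * exp (c * (r * (1 + p - ln r))) * exp (- B * ln r)"
          unfolding se exp_add[symmetric] by (rule arg_cong[where f = exp]) (simp add: algebra_simps)
        finally show ?thesis .
      qed
      have E0: "E > 0" by (simp add: E_def)
      have K0: "K \<ge> 0" using Kp(3) E0 by (smt (verit) mult_pos_pos zero_le_divide_iff zero_le_power2)
      have lnr: "ln r \<ge> 0" using rR by simp
      have "(exp (\<kappa> * a * p) * exp (c * (r * (1 + p - ln r))) * exp (- B * ln r)) * (E * (1 + t\<^sup>2)) \<le> K * (exp (\<kappa> * a * p) * exp (- B * p) * X\<^sup>2 * exp (c * X))"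
      proof -
        \<comment> \<open>A factor X^(-B) has to be produced. For r \<le> X/2 it comes from the room
          in the exponent, otherwise from r^(-B). For r > e^3 X the exponent decays linearly in t
          and this supplies 1/(1 + t^2).\<close>
        consider "r \<le> X / 2" | "X / 2 < r" "r \<le> exp 3 * X" | "r > exp 3 * X" by linarith
        thus ?thesis
        proof cases
          case 1
          have "c * (r * (1 + p - ln r)) \<le> c * (7 / 8 * X)"
            using entropy_bound(2)[OF rR(3), of p] 1 c by (intro mult_left_mono) (auto simp: X_def)
          also have "\<dots> \<le> c * X + (- B * p)" using pB by (simp add: X_def algebra_simps)
          finally have e1: "exp (c * (r * (1 + p - ln r))) \<le> exp (- B * p) * exp (c * X)"
            by (simp add: exp_add[symmetric] add.commute)
          have e2: "exp (- B * ln r) \<le> 1" using B lnr by simp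
          have e3: "1 + t\<^sup>2 \<le> (1 + 1 / \<kappa>\<^sup>2) * X\<^sup>2"
          proof -
            have "r\<^sup>2 \<le> X\<^sup>2" using 1 r0 X by (intro power_mono) auto
            hence "t\<^sup>2 \<le> 1 / \<kappa>\<^sup>2 * X\<^sup>2" unfolding tr power_divide by (simp add: divide_right_mono)
            moreover have "1 \<le> X\<^sup>2" using X by simp
            ultimately show ?thesis by (simp add: distrib_right)
          qed
          have "(exp (\<kappa> * a * p) * exp (c * (r * (1 + p - ln r))) * exp (- B * ln r)) * (E * (1 + t\<^sup>2))
            \<le> (exp (\<kappa> * a * p) * (exp (- B * p) * exp (c * X)) * 1) * (E * ((1 + 1 / \<kappa>\<^sup>2) * X\<^sup>2))"
            using E0 t1 by (intro mult_mono e1 e2 e3 order_refl mult_left_mono) (auto intro!: mult_nonneg_nonneg)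
          also have "\<dots> = (E * (1 + 1 / \<kappa>\<^sup>2)) * (exp (\<kappa> * a * p) * exp (- B * p) * X\<^sup>2 * exp (c * X))" by simp
          also have "\<dots> \<le> K * (exp (\<kappa> * a * p) * exp (- B * p) * X\<^sup>2 * exp (c * X))" by (intro mult_right_mono Kp(1)) auto
          finally show ?thesis .
        next
          case 2
          have e1: "exp (c * (r * (1 + p - ln r))) \<le> exp (c * X)"
            using entropy_bound(1)[OF rR(3), of p] c by (auto simp: X_def intro!: mult_left_mono)
          have e2: "exp (- B * ln r) \<le> exp (B * ln 2) * exp (- B * p)"
          proof -
            have "ln (X / 2) \<le> ln r" using 2 X rR by (subst ln_le_cancel_iff) auto
            hence "p - ln 2 \<le> ln r" using X by (simp add: ln_div X_def)
            hence "B * (p - ln 2) \<le> B * ln r" using B by (intro mult_left_mono) auto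
            thus ?thesis by (simp add: exp_add[symmetric] algebra_simps)
          qed
          have e3: "1 + t\<^sup>2 \<le> (1 + exp 6 / \<kappa>\<^sup>2) * X\<^sup>2"
          proof -
            have "r\<^sup>2 \<le> (exp 3 * X)\<^sup>2" using 2 r0 by (intro power_mono) auto
            also have "\<dots> = exp 6 * X\<^sup>2" by (simp add: power_mult_distrib flip: exp_double)
            finally have "t\<^sup>2 \<le> exp 6 / \<kappa>\<^sup>2 * X\<^sup>2" unfolding tr power_divide by (simp add: divide_right_mono)
            moreover have "1 \<le> X\<^sup>2" using X by simp
            ultimately show ?thesis by (simp add: distrib_right)
          qed
          have "(exp (\<kappa> * a * p) * exp (c * (r * (1 + p - ln r))) * exp (- B * ln r)) * (E * (1 + t\<^sup>2))
            \<le> (exp (\<kappa> * a * p) * exp (c * X) * (exp (B * ln 2) * exp (- B * p))) * (E * ((1 + exp 6 / \<kappa>\<^sup>2) * X\<^sup>2))"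
            using E0 t1 by (intro mult_mono e1 e2 e3 order_refl mult_left_mono) (auto intro!: mult_nonneg_nonneg)
          also have "\<dots> = (E * exp (B * ln 2) * (1 + exp 6 / \<kappa>\<^sup>2)) * (exp (\<kappa> * a * p) * exp (- B * p) * X\<^sup>2 * exp (c * X))" by simp
          also have "\<dots> \<le> K * (exp (\<kappa> * a * p) * exp (- B * p) * X\<^sup>2 * exp (c * X))" by (intro mult_right_mono Kp(2)) auto
          finally show ?thesis .
        next
          case 3
          have "ln (exp 3 * X) \<le> ln r" using 3 X rR by (subst ln_le_cancel_iff) auto
          hence lr: "3 + p \<le> ln r" using X by (simp add: ln_mult_pos X_def)
          have "r * (1 + p - ln r) \<le> r * (- 2)" using lr rR by (intro mult_left_mono) auto
          hence "c * (r * (1 + p - ln r)) \<le> c * (r * (- 2))" using c by (intro mult_left_mono[of _ "r * (- 2)"]) auto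
          hence "exp (c * (r * (1 + p - ln r))) \<le> exp (- l * t)" by (simp add: l_def r_def mult_ac)
          also have "\<dots> \<le> (1 + 2 / l\<^sup>2) / (1 + t\<^sup>2)" by (rule exp_neg_le_quadratic[OF l0 t])
          finally have e1: "exp (c * (r * (1 + p - ln r))) \<le> (1 + 2 / l\<^sup>2) / (1 + t\<^sup>2)" .
          have "B * p \<le> B * ln r" using B lr by (intro mult_left_mono) auto
          hence e2: "exp (- B * ln r) \<le> exp (- B * p)" by simp
          have "(exp (\<kappa> * a * p) * exp (c * (r * (1 + p - ln r))) * exp (- B * ln r)) * (E * (1 + t\<^sup>2))
            \<le> (exp (\<kappa> * a * p) * ((1 + 2 / l\<^sup>2) / (1 + t\<^sup>2)) * exp (- B * p)) * (E * (1 + t\<^sup>2))"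
            using E0 t1 by (intro mult_mono e1 e2 order_refl) (auto intro!: mult_nonneg_nonneg divide_nonneg_pos add_nonneg_nonneg)
          also have "\<dots> = (E * (1 + 2 / l\<^sup>2)) * (exp (\<kappa> * a * p) * exp (- B * p) * 1 * 1)"
            using t1 by simp
          also have "\<dots> \<le> K * (exp (\<kappa> * a * p) * exp (- B * p) * X\<^sup>2 * exp (c * X))"
            using X c K0 by (intro mult_mono Kp(3) order_refl) auto
          finally show ?thesis .
        qed
      qed
      moreover have "exp (\<kappa> * a * p + r * c * p - r * sin \<psi> * \<psi>) * norm (rGamma (z + of_real b')) * (1 + t\<^sup>2)
          \<le> (exp (\<kappa> * a * p) * exp (c * (r * (1 + p - ln r))) * exp (- B * ln r)) * (E * (1 + t\<^sup>2))"
        using mult_right_mono[OF main, of "1 + t\<^sup>2"] t1 by (simp add: mult_ac)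
      ultimately show "exp (\<kappa> * a * p + r * c * p - r * sin \<psi> * \<psi>) * norm (rGamma (z + of_real b')) \<le> Goal"
        by (intro goalI) linarith
    qed
  qed
qed

section \<open>The remainder sum for \<sigma> < 1/3\<close>

lemma holomorphic_struve_rem:
  assumes "\<And>s. s \<in> A \<Longrightarrow> of_real \<sigma> * s - of_real \<nu> - 1 / 2 \<notin> \<int>\<^sub>\<le>\<^sub>0"
  shows "struve_rem \<sigma> \<nu> M holomorphic_on A"
proof -
  have "struve_prefactor \<sigma> \<nu> holomorphic_on A"
    unfolding struve_prefactor_def by (intro holomorphic_intros)
  moreover have "struve_ratio \<sigma> \<nu> holomorphic_on A"
    unfolding struve_ratio_def using assms by (intro holomorphic_intros) auto
  ultimately show ?thesis
    unfolding struve_rem_def[abs_def] struve_main_def by (intro holomorphic_intros)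
qed

text \<open>The possible poles are real, the rightmost one at (\<nu> + 1/2)/\<sigma>.\<close>

lemma holomorphic_struve_rem_halfplane:
  assumes "\<sigma> > 0" "(\<nu> + 1 / 2) / \<sigma> \<le> c"
  shows "struve_rem \<sigma> \<nu> M holomorphic_on {s. Re s > c}"
proof (rule holomorphic_struve_rem, rule notI)
  fix s assume s: "s \<in> {s. Re s > c}" and "of_real \<sigma> * s - of_real \<nu> - 1 / 2 \<in> \<int>\<^sub>\<le>\<^sub>0"
  then obtain n where n: "of_real \<sigma> * s - of_real \<nu> - 1 / 2 = - of_nat n" by (auto elim: nonpos_Ints_cases')
  hence "Re (of_real \<sigma> * s - of_real \<nu> - 1 / 2) = - real n" by simp
  hence "\<sigma> * Re s \<le> \<nu> + 1 / 2" by simp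
  moreover have "(\<nu> + 1 / 2) / \<sigma> < Re s" using s assms(2) by simp
  hence "\<nu> + 1 / 2 < \<sigma> * Re s" using assms(1) by (simp add: pos_divide_less_eq mult.commute)
  ultimately show False by linarith
qed

lemma norm_struve_phase: "norm (struve_phase \<sigma> \<nu> s) = exp (- pi * \<sigma> * Im s)"
  unfolding struve_phase_def norm_exp_eq_Re by simp

lemma holomorphic_struve_phase: "struve_phase \<sigma> \<nu> holomorphic_on A"
  unfolding struve_phase_def[abs_def] by (intro holomorphic_intros)

lemma fast_decay_scale:
  assumes F: "fast_decay a \<theta> F" and le: "\<And>s. Re s \<ge> a \<Longrightarrow> norm (G s) \<le> C * exp (q * Re s) * norm (F s)" and C: "C \<ge> 0"
  shows "fast_decay a \<theta> G"
  unfolding fast_decay_def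
proof
  fix r
  obtain C' where C': "C' > 0" "\<And>s. Re s \<ge> a \<Longrightarrow> norm (F s) \<le> C' * exp (- (r + q) * Re s + \<theta> * \<bar>Im s\<bar>)"
    using fast_decayE[OF F, of "r + q"] by blast
  show "\<exists>C. \<forall>s. Re s \<ge> a \<longrightarrow> norm (G s) \<le> C * exp (- r * Re s + \<theta> * \<bar>Im s\<bar>)"
  proof (intro exI[of _ "C * C'"] allI impI)
    fix s assume s: "Re s \<ge> a"
    have "norm (G s) \<le> C * exp (q * Re s) * (C' * exp (- (r + q) * Re s + \<theta> * \<bar>Im s\<bar>))"
      by (rule order.trans[OF le[OF s]]) (use C C'(2)[OF s] in \<open>auto intro!: mult_left_mono\<close>)
    also have "\<dots> = C * C' * (exp (q * Re s) * exp (- (r + q) * Re s + \<theta> * \<bar>Im s\<bar>))" by simp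
    also have "exp (q * Re s) * exp (- (r + q) * Re s + \<theta> * \<bar>Im s\<bar>) = exp (- r * Re s + \<theta> * \<bar>Im s\<bar>)"
      unfolding exp_add[symmetric] by (rule arg_cong[where f = exp]) (simp add: algebra_simps)
    finally show "norm (G s) \<le> C * C' * exp (- r * Re s + \<theta> * \<bar>Im s\<bar>)" .
  qed
qed

text \<open>Two terms more than M are split off because \<open>saddle_ray_bound\<close> loses X^2:
  with b = 3 - \<vartheta> + M its exponent 5/2 - b is \<vartheta> - M - 1/2, just below the
  required \<vartheta> - M. The sum starts to the right of all poles, which leaves out finitely many
  terms of the series.\<close>

lemma struve_rem_sum_below_third:
  fixes M :: nat
  assumes \<sigma>: "0 < \<sigma>" "\<sigma> < 1 / 3"
  defines "\<psi> \<equiv> pi * \<sigma> / struve_kappa \<sigma>"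
  shows "\<exists>m::int. m \<ge> 0 \<and> of_int m > (\<nu> + 1 / 2) / \<sigma> \<and> (\<exists>K x0. \<forall>x\<ge>x0.
    summable (\<lambda>k. struve_phase \<sigma> \<nu> (of_int (m + int k)) * struve_rem \<sigma> \<nu> (M + 2) (of_int (m + int k)) * exp (of_real (ln x) * of_int (m + int k))) \<and>
    norm (\<Sum>k. struve_phase \<sigma> \<nu> (of_int (m + int k)) * struve_rem \<sigma> \<nu> (M + 2) (of_int (m + int k)) * exp (of_real (ln x) * of_int (m + int k)))
      \<le> K * (exp ((real_of_int m - 1 / 2) * ln x) + struve_X \<sigma> x powr (struve_theta \<nu> - real M) * exp (struve_X \<sigma> x * cos \<psi>)))"
proof -
  have \<sigma>1: "\<sigma> < 1" using \<sigma> by simp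
  define \<kappa> where "\<kappa> = struve_kappa \<sigma>"
  have \<kappa>: "0 < \<kappa>" "\<kappa> \<le> 1" "\<kappa> > 2 / 3" using \<sigma> by (auto simp: \<kappa>_def struve_kappa_def)
  have \<psi>: "0 \<le> \<psi>" "\<psi> < pi / 2"
  proof -
    have "pi * \<sigma> < pi / 2 * \<kappa>" using \<sigma> \<kappa> mult_strict_left_mono[of \<sigma> "\<kappa> / 2" pi] by simp
    thus "\<psi> < pi / 2" "0 \<le> \<psi>" using \<kappa> \<sigma> by (simp_all add: \<psi>_def \<kappa>_def[symmetric] field_simps)
  qed
  have kpsi: "\<kappa> * \<psi> = pi * \<sigma>" using \<kappa> by (simp add: \<psi>_def \<kappa>_def[symmetric])
  define b where "b = 1 - struve_theta \<nu> + real (M + 2)"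
  obtain R C where R: "R > 0" and C: "C > 0" and rem: "\<And>s. norm s \<ge> R \<Longrightarrow> \<bar>Arg s\<bar> \<le> pi - pi / 2 \<Longrightarrow>
     norm (struve_rem \<sigma> \<nu> (M + 2) s) \<le> C * exp (struve_rate \<sigma> * Re s) * norm (rGamma (of_real \<kappa> * s + of_real b))"
    using struve_rem_bound[OF \<sigma>(1) \<sigma>1, of "pi / 2" \<nu> "M + 2"] unfolding \<kappa>_def b_def by (metis pi_half_gt_zero)
  \<comment> \<open>The line Re s = a must lie beyond the radius of the remainder bound, beyond the
    poles, and far enough right for \<kappa>a + b \<ge> 1/2.\<close>
  define m where "m = \<lceil>max R (max ((\<nu> + 1 / 2) / \<sigma>) ((1 / 2 - b) / \<kappa>))\<rceil> + 2"
  define a where "a = real_of_int m - 1 / 2"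
  have a: "a \<ge> R + 1" "a \<ge> (\<nu> + 1 / 2) / \<sigma> + 1" "a \<ge> (1 / 2 - b) / \<kappa>"
    unfolding a_def m_def by linarith+
  have B: "\<kappa> * a + b - 1 / 2 \<ge> 0" using a(3) \<kappa> by (simp add: pos_divide_le_eq algebra_simps)
  define F where "F = (\<lambda>s. struve_phase \<sigma> \<nu> s * struve_rem \<sigma> \<nu> (M + 2) s)"
  define H where "H = (\<lambda>s. exp (\<i> * of_real \<psi> * of_real \<kappa> * s) * rGamma (of_real \<kappa> * s + of_real b))"
  have nph: "norm (struve_phase \<sigma> \<nu> s) = norm (exp (\<i> * of_real \<psi> * of_real \<kappa> * s))" for s
    using kpsi by (simp add: norm_struve_phase norm_exp_eq_Re) (simp add: mult_ac)
  have FH: "norm (F s) \<le> C * exp (struve_rate \<sigma> * Re s) * norm (H s)" if "Re s \<ge> a" for s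
  proof -
    have "norm s \<ge> R" using that a(1) complex_Re_le_cmod[of s] by linarith
    moreover have "\<bar>Arg s\<bar> \<le> pi - pi / 2" using that a R Arg_Re_nonneg[of s] by simp
    ultimately have "norm (struve_rem \<sigma> \<nu> (M + 2) s) \<le> C * exp (struve_rate \<sigma> * Re s) * norm (rGamma (of_real \<kappa> * s + of_real b))"
      by (rule rem)
    hence "norm (struve_phase \<sigma> \<nu> s) * norm (struve_rem \<sigma> \<nu> (M + 2) s) \<le> norm (struve_phase \<sigma> \<nu> s) * (C * exp (struve_rate \<sigma> * Re s) * norm (rGamma (of_real \<kappa> * s + of_real b)))"
      by (intro mult_left_mono) auto
    thus ?thesis unfolding F_def H_def norm_mult nph by (simp add: mult_ac)
  qed
  have fdF: "fast_decay a (pi + 1 / 2) F"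
    by (rule fast_decay_scale[OF _ FH]) (use C \<psi> \<kappa> in \<open>auto simp: H_def intro!: fast_decay_rGamma\<close>)
  have th: "pi + 1 / 2 < 2 * pi" using pi_gt3 by simp
  have holF: "F holomorphic_on {s. Re s > a - 1}"
    unfolding F_def using \<sigma> a by (intro holomorphic_intros holomorphic_struve_phase holomorphic_struve_rem_halfplane) auto
  obtain K1 where K1: "K1 > 0" "\<And>p \<Psi>. (\<And>s. Re s > a - 1 \<Longrightarrow> (\<Psi> has_field_derivative exp (of_real p * s) * F s) (at s)) \<Longrightarrow>
     (\<exists>\<eta>. \<eta> \<longlonglongrightarrow> 0 \<and> (\<forall>N>0. norm ((\<Sum>k<N. exp (of_real p * of_int (m + int k)) * F (of_int (m + int k)))
          - (\<Psi> (of_real (a + real N)) - \<Psi> (of_real a))) \<le> K1 * exp (p * a) + \<eta> N))"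
    using abel_plana_scaled[OF fdF[unfolded a_def] th, of "a - 1"] unfolding a_def by auto
  obtain K2 p0 where K2: "\<And>p t. p \<ge> p0 \<Longrightarrow> t \<ge> 0 \<Longrightarrow> norm (exp (of_real \<kappa> * (of_real a + of_real t * exp (\<i> * of_real \<psi>)) * (of_real p + \<i> * of_real \<psi>))
       * rGamma (of_real \<kappa> * (of_real a + of_real t * exp (\<i> * of_real \<psi>)) + of_real b))
     \<le> K2 * exp ((5 / 2 - b) * p + exp p * cos \<psi>) / (1 + t\<^sup>2)"
    using saddle_ray_bound[OF \<kappa>(1) \<psi> B] by blast
  \<comment> \<open>From \<open>x0\<close> on, p = ln X is nonnegative and at least p0.\<close>
  define x0 where "x0 = exp (\<kappa> * max p0 0 - struve_rate \<sigma>) + 1"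
  define K where "K = K1 + 2 * (C * \<bar>K2\<bar>)"
  have main: "summable (\<lambda>k. struve_phase \<sigma> \<nu> (of_int (m + int k)) * struve_rem \<sigma> \<nu> (M + 2) (of_int (m + int k)) * exp (of_real (ln x) * of_int (m + int k))) \<and>
    norm (\<Sum>k. struve_phase \<sigma> \<nu> (of_int (m + int k)) * struve_rem \<sigma> \<nu> (M + 2) (of_int (m + int k)) * exp (of_real (ln x) * of_int (m + int k)))
      \<le> K * (exp ((real_of_int m - 1 / 2) * ln x) + struve_X \<sigma> x powr (struve_theta \<nu> - real M) * exp (struve_X \<sigma> x * cos \<psi>))"
    if x: "x \<ge> x0" for x
  proof -
    have xpos: "x > 0" using x exp_gt_zero[of "\<kappa> * max p0 0 - struve_rate \<sigma>"] unfolding x0_def by linarith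
    define X where "X = struve_X \<sigma> x"
    define p where "p = ln X"
    have X0: "X > 0" using struve_X_pos[OF \<sigma>(1) \<sigma>1 xpos] by (simp add: X_def)
    have kp: "\<kappa> * p = struve_rate \<sigma> + ln x" using ln_struve_X[OF \<sigma>(1) \<sigma>1 xpos] by (simp add: \<kappa>_def p_def X_def)
    have "exp (\<kappa> * max p0 0 - struve_rate \<sigma>) \<le> x" using x by (simp add: x0_def)
    hence "\<kappa> * max p0 0 - struve_rate \<sigma> \<le> ln x" using xpos by (simp add: ln_ge_iff)
    hence "\<kappa> * max p0 0 \<le> \<kappa> * p" unfolding kp by simp
    hence p: "p \<ge> p0" "p \<ge> 0" using \<kappa> by auto
    have expp: "exp p = X" using X0 by (simp add: p_def)
    define G where "G = (\<lambda>s. exp (of_real (ln x) * s) * F s)"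
    have Gb: "norm (G s) \<le> C * norm (exp (of_real \<kappa> * s * (of_real p + \<i> * of_real \<psi>)) * rGamma (of_real \<kappa> * s + of_real b))" if "Re s \<ge> a" for s
    proof -
      have "norm (G s) \<le> exp (ln x * Re s) * (C * exp (struve_rate \<sigma> * Re s) * norm (H s))"
        unfolding G_def norm_mult norm_exp_eq_Re using FH[OF that] by (intro mult_mono) auto
      also have "\<dots> = C * (exp ((struve_rate \<sigma> + ln x) * Re s) * norm (H s))" by (simp add: exp_add algebra_simps)
      also have "exp ((struve_rate \<sigma> + ln x) * Re s) = norm (exp (of_real (\<kappa> * p) * s))" unfolding kp norm_exp_eq_Re by simp
      also have "norm (exp (of_real (\<kappa> * p) * s)) * norm (H s) = norm (exp (of_real \<kappa> * s * (of_real p + \<i> * of_real \<psi>)) * rGamma (of_real \<kappa> * s + of_real b))"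
        unfolding H_def norm_mult[symmetric] by (rule arg_cong[where f = norm]) (simp add: exp_add[symmetric] algebra_simps)
      finally show ?thesis .
    qed
    have holG: "G holomorphic_on {s. Re s > a - 1}" unfolding G_def by (intro holomorphic_intros holF)
    have oS: "open {s. Re s > a - 1}" "convex {s. Re s > a - 1}" by (auto simp: open_halfspace_Re_gt convex_halfspace_Re_gt)
    from holomorphic_convex_primitive'[OF oS(2,1) holG] obtain \<Psi> where \<Psi>': "\<And>s. s \<in> {s. Re s > a - 1} \<Longrightarrow> (\<Psi> has_field_derivative G s) (at s within {s. Re s > a - 1})" by auto
    have \<Psi>: "(\<Psi> has_field_derivative G s) (at s)" if "Re s > a - 1" for s
      using \<Psi>'[of s] that at_within_open[OF _ oS(1), of s] by simp
    obtain \<eta> where \<eta>: "\<eta> \<longlonglongrightarrow> 0" "\<And>N. N > 0 \<Longrightarrow> norm ((\<Sum>k<N. G (of_int (m + int k))) - (\<Psi> (of_real (a + real N)) - \<Psi> (of_real a))) \<le> K1 * exp (ln x * a) + \<eta> N"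
      using K1(2)[of \<Psi> "ln x"] \<Psi> unfolding G_def by blast
    define v where "v = exp (\<i> * of_real \<psi>)"
    have c: "cos \<psi> > 0" using \<psi> by (intro cos_gt_zero_pi) auto
    have s0: "sin \<psi> \<ge> 0" using \<psi> by (intro sin_ge_zero) auto
    have v: "Re v = cos \<psi>" "Im v = sin \<psi>" "norm v = 1" by (auto simp: v_def Re_exp Im_exp)
    define W where "W = X powr (struve_theta \<nu> - real M) * exp (X * cos \<psi>)"
    have Wle: "exp ((5 / 2 - b) * p + exp p * cos \<psi>) \<le> W"
    proof -
      have "(5 / 2 - b) * p \<le> (struve_theta \<nu> - real M) * p" using p(2) by (intro mult_right_mono) (auto simp: b_def)
      hence "exp ((5 / 2 - b) * p + exp p * cos \<psi>) \<le> exp ((struve_theta \<nu> - real M) * p + exp p * cos \<psi>)" by simp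
      also have "\<dots> = W" using X0 unfolding expp by (simp add: W_def powr_def p_def exp_add)
      finally show ?thesis .
    qed
    have W0: "W \<ge> 0" by (simp add: W_def)
    \<comment> \<open>The ray meets the line Re s = a + N at height N tan \<psi>, so the integral
      from a to a + N is one along the ray up to a vertical piece.\<close>
    define th where "th = tan \<psi>"
    have th0: "th \<ge> 0" using c s0 by (simp add: th_def tan_def)
    \<comment> \<open>The additional decay (\<pi> + 1/2) tan \<psi> outweighs the vertical growth on
      a segment whose height is proportional to N.\<close>
    obtain C3 where C3: "C3 > 0" "\<And>s. Re s \<ge> a \<Longrightarrow> norm (F s) \<le> C3 * exp (- (ln x + (pi + 1 / 2) * th + 1) * Re s + (pi + 1 / 2) * \<bar>Im s\<bar>)"
      using fast_decayE[OF fdF, of "ln x + (pi + 1 / 2) * th + 1"] by blast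
    define D where "D = C3 * exp (\<bar>(pi + 1 / 2) * th\<bar> * \<bar>a\<bar>) * exp (- a)"
    have ray: "norm (\<Psi> (of_real a + of_real T * v) - \<Psi> (of_real a)) \<le> 2 * (C * \<bar>K2\<bar> * W)" if T: "T \<ge> 0" for T
    proof -
      have seg: "closed_segment (of_real a) (of_real a + of_real T * v) \<subseteq> {s. Re s > a - 1}"
      proof (rule closed_segment_subset)
        show "of_real a + of_real T * v \<in> {s. Re s > a - 1}" using mult_nonneg_nonneg[OF T less_imp_le[OF c]] v by simp
      qed (use oS in auto)
      have "(G has_contour_integral (\<Psi> (pathfinish (linepath (of_real a) (of_real a + of_real T * v))) - \<Psi> (pathstart (linepath (of_real a) (of_real a + of_real T * v)))))
         (linepath (of_real a) (of_real a + of_real T * v))"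
        by (rule contour_integral_primitive[OF \<Psi>']) (use seg in auto)
      hence "contour_integral (linepath (of_real a) (of_real a + of_real T * v)) G = \<Psi> (of_real a + of_real T * v) - \<Psi> (of_real a)"
        by (simp add: contour_integral_unique)
      moreover have "norm (contour_integral (linepath (of_real a) (of_real a + of_real T * v)) G) \<le> 2 * (C * \<bar>K2\<bar> * W) * norm v"
      proof (rule contour_integral_arctan_bound)
        show "continuous_on (closed_segment (of_real a) (of_real a + of_real T * v)) G"
          using holomorphic_on_imp_continuous_on[OF holG] seg by (rule continuous_on_subset)
        fix t assume t: "0 \<le> t" "t \<le> T"
        have "Re (of_real a + of_real t * v) \<ge> a" using t c v by simp
        from Gb[OF this] have "norm (G (of_real a + of_real t * v)) \<le> C * (K2 * exp ((5 / 2 - b) * p + exp p * cos \<psi>) / (1 + t\<^sup>2))"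
          using mult_left_mono[OF K2[OF p(1) t(1)], of C] C unfolding v_def[symmetric] by (elim order.trans) simp
        also have "\<dots> \<le> C * (\<bar>K2\<bar> * W / (1 + t\<^sup>2))"
          using C W0 Wle by (intro mult_left_mono divide_right_mono mult_mono) auto
        finally show "norm (G (of_real a + of_real t * v)) \<le> C * \<bar>K2\<bar> * W / (1 + t\<^sup>2)" by simp
      qed (use T C W0 in auto)
      ultimately show ?thesis by (simp add: v)
    qed
    have vert: "norm (\<Psi> (of_real (a + real N) + of_real (real N * th) * \<i>) - \<Psi> (of_real (a + real N))) \<le> D * exp (- real N) * (real N * th)" for N
    proof -
      let ?q = "complex_of_real (a + real N)" and ?z = "of_real (a + real N) + of_real (real N * th) * \<i>"
      have seg: "Re s = a + real N \<and> 0 \<le> Im s \<and> Im s \<le> real N * th" if s: "s \<in> closed_segment ?q ?z" for s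
      proof -
        obtain u where u: "0 \<le> u" "u \<le> 1" "s = (1 - u) *\<^sub>R ?q + u *\<^sub>R ?z" using s unfolding closed_segment_def by blast
        have "Re s = a + real N" "Im s = u * (real N * th)" unfolding u(3) by (simp_all add: algebra_simps)
        moreover have "u * (real N * th) \<le> 1 * (real N * th)" using u th0 by (intro mult_right_mono) auto
        ultimately show ?thesis using u th0 by simp
      qed
      have "norm (\<Psi> ?z - \<Psi> ?q) \<le> D * exp (- real N) * norm (?z - ?q)"
      proof (rule primitive_diff_bound[of _ _ _ G])
        fix s assume "s \<in> closed_segment ?q ?z"
        note s = seg[OF this]
        show "(\<Psi> has_field_derivative G s) (at s)" using s by (intro \<Psi>) auto
        have "norm (G s) \<le> exp (ln x * Re s) * (C3 * exp (- (ln x + (pi + 1 / 2) * th + 1) * Re s + (pi + 1 / 2) * \<bar>Im s\<bar>))"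
          unfolding G_def norm_mult norm_exp_eq_Re using C3(2)[of s] s by (intro mult_mono) auto
        also have "\<dots> = C3 * (exp (ln x * Re s) * exp (- (ln x + (pi + 1 / 2) * th + 1) * Re s + (pi + 1 / 2) * \<bar>Im s\<bar>))" by simp
        also have "exp (ln x * Re s) * exp (- (ln x + (pi + 1 / 2) * th + 1) * Re s + (pi + 1 / 2) * \<bar>Im s\<bar>)
            = exp (- ((pi + 1 / 2) * th + 1) * Re s + (pi + 1 / 2) * \<bar>Im s\<bar>)"
          unfolding exp_add[symmetric] by (rule arg_cong[where f = exp]) (simp add: algebra_simps)
        also have "\<dots> \<le> exp (\<bar>(pi + 1 / 2) * th\<bar> * \<bar>a\<bar> + (- a) + (- real N))"
        proof -
          define q where "q = (pi + 1 / 2) * th"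
          have "(pi + 1 / 2) * \<bar>Im s\<bar> \<le> (pi + 1 / 2) * (real N * th)" using s by (intro mult_left_mono) auto
          hence "(pi + 1 / 2) * \<bar>Im s\<bar> \<le> q * real N" by (simp add: q_def mult_ac)
          moreover have "- (q * a) \<le> \<bar>q\<bar> * \<bar>a\<bar>"
            using abs_ge_minus_self[of "q * a"] by (simp add: abs_mult)
          moreover have "- (q + 1) * Re s = - (q * a) - q * real N - a - real N" using s by (simp add: algebra_simps)
          ultimately show ?thesis unfolding q_def[symmetric] exp_le_cancel_iff by linarith
        qed
        also have "C3 * exp (\<bar>(pi + 1 / 2) * th\<bar> * \<bar>a\<bar> + (- a) + (- real N)) = D * exp (- real N)"
          by (simp only: D_def exp_add mult.assoc)
        finally show "norm (G s) \<le> D * exp (- real N)" using C3(1) by simp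
      qed
      moreover have "norm (?z - ?q) = real N * th" using th0 by (simp add: norm_mult)
      ultimately show ?thesis by simp
    qed
    have bound: "norm (\<Sum>k<N. G (of_int (m + int k))) \<le> K1 * exp (ln x * a) + \<eta> N + (2 * (C * \<bar>K2\<bar> * W) + D * th * (real N * exp (- real N)))" if N: "N > 0" for N
    proof -
      have z: "of_real a + of_real (real N / cos \<psi>) * v = of_real (a + real N) + of_real (real N * th) * \<i>"
        using c v by (simp add: complex_eq_iff th_def tan_def)
      have r: "norm (\<Psi> (of_real (a + real N) + of_real (real N * th) * \<i>) - \<Psi> (of_real a)) \<le> 2 * (C * \<bar>K2\<bar> * W)"
        using ray[of "real N / cos \<psi>"] c unfolding z by simp
      have tri: "norm A \<le> norm (A - (B' - C')) + norm (Z - C') + norm (Z - B')" for A B' C' Z :: complex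
      proof -
        have "A = (A - (B' - C')) + (Z - C') - (Z - B')" by simp
        hence "norm A \<le> norm ((A - (B' - C')) + (Z - C')) + norm (Z - B')" by (metis norm_triangle_ineq4)
        also have "norm ((A - (B' - C')) + (Z - C')) \<le> norm (A - (B' - C')) + norm (Z - C')" by (rule norm_triangle_ineq)
        finally show ?thesis by simp
      qed
      show ?thesis
        using tri[of "\<Sum>k<N. G (of_int (m + int k))" "\<Psi> (of_real (a + real N))" "\<Psi> (of_real a)" "\<Psi> (of_real (a + real N) + of_real (real N * th) * \<i>)"]
          \<eta>(2)[OF N] r vert[of N] by (simp add: mult_ac)
    qed
    have sG: "summable (\<lambda>k. G (of_int (m + int k)))"
      unfolding G_def by (rule fast_decay_summable[OF fdF]) (simp add: a_def)
    have "norm (\<Sum>k. G (of_int (m + int k))) \<le> K1 * exp (ln x * a) + 0 + (2 * (C * \<bar>K2\<bar> * W) + D * th * 0)"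
    proof (rule tendsto_le[OF sequentially_bot])
      show "(\<lambda>N. norm (\<Sum>k<N. G (of_int (m + int k)))) \<longlonglongrightarrow> norm (\<Sum>k. G (of_int (m + int k)))"
        by (intro tendsto_norm summable_LIMSEQ sG)
      have "(\<lambda>N. real N * exp (- real N)) \<longlonglongrightarrow> 0" by real_asymp
      thus "(\<lambda>N. K1 * exp (ln x * a) + \<eta> N + (2 * (C * \<bar>K2\<bar> * W) + D * th * (real N * exp (- real N)))) \<longlonglongrightarrow> K1 * exp (ln x * a) + 0 + (2 * (C * \<bar>K2\<bar> * W) + D * th * 0)"
        by (intro tendsto_intros \<eta>(1))
      show "eventually (\<lambda>N. norm (\<Sum>k<N. G (of_int (m + int k))) \<le> K1 * exp (ln x * a) + \<eta> N + (2 * (C * \<bar>K2\<bar> * W) + D * th * (real N * exp (- real N)))) sequentially"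
        using eventually_gt_at_top[of 0] by eventually_elim (rule bound)
    qed
    also have "\<dots> = K1 * exp (a * ln x) + 2 * (C * \<bar>K2\<bar>) * W" by (simp add: mult_ac)
    also have "\<dots> \<le> K * (exp (a * ln x) + W)"
    proof -
      have "2 * (C * \<bar>K2\<bar>) \<ge> 0" using C by simp
      hence "0 \<le> 2 * (C * \<bar>K2\<bar>) * exp (a * ln x)" "0 \<le> K1 * W" using K1(1) W0 by auto
      thus ?thesis unfolding K_def by (simp add: algebra_simps)
    qed
    finally have "norm (\<Sum>k. G (of_int (m + int k))) \<le> K * (exp (a * ln x) + W)" .
    moreover have "G s = struve_phase \<sigma> \<nu> s * struve_rem \<sigma> \<nu> (M + 2) s * exp (of_real (ln x) * s)" for s
      by (simp add: G_def F_def)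
    ultimately show ?thesis using sG unfolding a_def W_def X_def by simp
  qed
  have "real_of_int m > (\<nu> + 1 / 2) / \<sigma>" using a(2) unfolding a_def by linarith
  moreover have "real_of_int m \<ge> 0" using a(1) R unfolding a_def by linarith
  ultimately show ?thesis using main by auto
qed

section \<open>Residues at the poles\<close>

text \<open>|sin(\<pi>s)|^2 is (cosh(2\<pi> Im s) - cos(2\<pi> Re s))/2. Half way between integers
  the cosine is -1, and for |Im s| \<ge> 1 it is small against the hyperbolic term.\<close>

lemma norm_sin_pi_ge:
  fixes s :: complex
  assumes "\<bar>Im s\<bar> \<ge> 1 \<or> (\<exists>m::int. Re s = of_int m - 1 / 2)"
  shows "norm (sin (of_real pi * s)) \<ge> exp (pi * \<bar>Im s\<bar>) / 4"
proof (rule power2_le_imp_le)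
  define y where "y = \<bar>Im s\<bar>"
  have sq: "(norm (sin (of_real pi * s)))\<^sup>2 = (exp (2 * pi * y) + exp (- (2 * pi * y)) - 2 * cos (2 * (pi * Re s))) / 4"
    unfolding norm_sin_squared y_def by (cases "Im s \<ge> 0") (simp_all add: exp_minus mult_ac)
  have "exp (2 * pi * y) / 4 \<le> exp (2 * pi * y) + exp (- (2 * pi * y)) - 2 * cos (2 * (pi * Re s))"
  proof (cases "y \<ge> 1")
    case True
    have "1 * 1 \<le> pi * y" using True pi_gt3 by (intro mult_mono) auto
    hence "1 + (2 * pi * y) + (2 * pi * y)\<^sup>2 / 2 \<ge> 5" 
      using power_mono[of 2 "2 * pi * y" 2] by simp
    hence "exp (2 * pi * y) \<ge> 5"
      using exp_lower_Taylor_quadratic[of "2 * pi * y"] \<open>1 * 1 \<le> pi * y\<close> by simp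
    moreover have "cos (2 * (pi * Re s)) \<le> 1" by simp
    moreover have "exp (- (2 * pi * y)) > 0" by simp
    ultimately show ?thesis by linarith
  next
    case False
    then obtain m :: int where m: "Re s = of_int m - 1 / 2" using assms by (auto simp: y_def)
    have "cos (2 * (pi * Re s)) = cos (2 * pi * of_int m - pi)" unfolding m by (simp add: algebra_simps)
    also have "\<dots> = - 1"
      using cos_int_2pin[of m] sin_int_2pin[of m] by (simp add: cos_diff)
    finally have "cos (2 * (pi * Re s)) = - 1" .
    moreover have "exp (2 * pi * y) > 0" "exp (- (2 * pi * y)) > 0" by auto
    ultimately show ?thesis by linarith
  qed
  moreover have "(exp (pi * \<bar>Im s\<bar>) / 4)\<^sup>2 = exp (2 * pi * y) / 4 / 4"
    by (simp add: power_divide y_def flip: exp_double)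
  ultimately show "(exp (pi * \<bar>Im s\<bar>) / 4)\<^sup>2 \<le> (norm (sin (of_real pi * s)))\<^sup>2" unfolding sq by simp
qed auto

text \<open>The combination \<open>sin w cot \<pi>s - cos w\<close> is small both far from the real axis and on the lines half
  way between the integers; the growth \<open>e\<^bsup>\<pi>\<sigma>|Im s|\<^esup>\<close> of its two parts cancels.\<close>

lemma norm_sin_cot_kernel:
  fixes s :: complex and \<sigma> \<nu> :: real
  assumes \<sigma>: "\<sigma> < 1" and s: "\<bar>Im s\<bar> \<ge> 1 \<or> (\<exists>m::int. Re s = of_int m - 1 / 2)"
  defines "w \<equiv> of_real pi * (of_real \<sigma> * s - of_real \<nu> - 1 / 2)"
  shows "norm (sin w * cot (of_real pi * s) - cos w) \<le> 4 * exp (- (pi * \<sigma> * \<bar>Im s\<bar>))"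
proof -
  have ge: "norm (sin (of_real pi * s)) \<ge> exp (pi * \<bar>Im s\<bar>) / 4" by (rule norm_sin_pi_ge[OF s])
  have "exp (pi * \<bar>Im s\<bar>) / 4 > 0" by simp
  with ge have pos: "norm (sin (of_real pi * s)) > 0" by linarith
  have "Im (w - of_real pi * s) = - (pi * (1 - \<sigma>) * Im s)" by (simp add: w_def algebra_simps)
  hence "\<bar>Im (w - of_real pi * s)\<bar> = pi * (1 - \<sigma>) * \<bar>Im s\<bar>" using \<sigma> by (simp add: abs_mult)
  hence num: "norm (sin (w - of_real pi * s)) \<le> exp (pi * (1 - \<sigma>) * \<bar>Im s\<bar>)"
    using norm_sin_le_exp[of "w - of_real pi * s"] by simp
  from pos have "sin (of_real pi * s) \<noteq> 0" by auto
  \<comment> \<open>The combination is a single sine quotient: the numerator grows with rate \<pi>(1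
    - \<sigma>), the denominator with rate \<pi>.\<close>
  hence "sin w * cot (of_real pi * s) - cos w = sin (w - of_real pi * s) / sin (of_real pi * s)"
    by (simp add: cot_def sin_diff field_simps)
  also have "norm \<dots> = norm (sin (w - of_real pi * s)) / norm (sin (of_real pi * s))" by (rule norm_divide)
  also have "\<dots> \<le> exp (pi * (1 - \<sigma>) * \<bar>Im s\<bar>) / (exp (pi * \<bar>Im s\<bar>) / 4)"
    by (rule frac_le[OF _ num _ ge]) simp_all
  also have "\<dots> = 4 * (exp (pi * (1 - \<sigma>) * \<bar>Im s\<bar>) * exp (- (pi * \<bar>Im s\<bar>)))"
  proof -
    have "x / (y / 4) = 4 * (x * inverse y)" for x y :: real by (simp add: field_simps)
    thus ?thesis unfolding exp_minus .
  qed
  also have "exp (pi * (1 - \<sigma>) * \<bar>Im s\<bar>) * exp (- (pi * \<bar>Im s\<bar>)) = exp (- (pi * \<sigma> * \<bar>Im s\<bar>))"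
    unfolding exp_add[symmetric] by (rule arg_cong[where f = exp]) (simp add: algebra_simps)
  finally show ?thesis .
qed

text \<open>The rate \<pi>\<kappa>/2 of 1/\<Gamma>(\<kappa>s) is compared with \<pi>\<sigma>. For
  \<sigma> > 1/3 the margin leaves an exponential factor, which is weakened to 1/(1 + y^2) with y =
  Im s. For \<sigma> = 1/3 the rates agree and the quadratic bound takes over; it asks for arguments
  to the right of 5/2, hence for a large M. The radius R is fixed before r, so one disc contains
  everything that has to be treated separately.\<close>

lemma struve_rem_decay:
  assumes \<sigma>: "1 / 3 \<le> \<sigma>" "\<sigma> < 1" and M: "\<sigma> = 1 / 3 \<Longrightarrow> struve_kappa \<sigma> * a + (1 - struve_theta \<nu> + real M) \<ge> 5 / 2"
  shows "\<exists>R. \<forall>r. \<exists>C>0. \<forall>s. Re s \<ge> a \<and> norm s \<ge> R \<longrightarrow>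
     norm (struve_rem \<sigma> \<nu> M s) \<le> C * exp (- r * Re s + pi * \<sigma> * \<bar>Im s\<bar>) / (1 + (Im s)\<^sup>2)"
proof -
  have \<sigma>0: "\<sigma> > 0" using \<sigma> by linarith
  define \<kappa> where "\<kappa> = struve_kappa \<sigma>"
  have \<kappa>: "0 < \<kappa>" "\<kappa> \<le> 1" using \<sigma> by (auto simp: \<kappa>_def struve_kappa_def)
  define b where "b = 1 - struve_theta \<nu> + real M"
  have pos: "1 + t\<^sup>2 > 0" for t :: real by (simp add: add_pos_nonneg)
  have g: "\<exists>C>0. \<forall>s. Re s \<ge> a \<longrightarrow> norm (rGamma (of_real \<kappa> * s + of_real b)) \<le> C * exp (- r * Re s + pi * \<sigma> * \<bar>Im s\<bar>) / (1 + (Im s)\<^sup>2)" for r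
  proof (cases "\<sigma> = 1 / 3")
    case True
    obtain C where C: "C > 0" "\<And>z. Re z \<ge> 5 / 2 \<Longrightarrow> norm (rGamma z) \<le> C * exp (- (r / \<kappa>) * Re z + pi / 2 * \<bar>Im z\<bar>) / (1 + (Im z)\<^sup>2)"
      using norm_rGamma_quadratic_bound by blast
    show ?thesis
    proof (intro exI[of _ "C * exp (- (r / \<kappa> * b)) / \<kappa>\<^sup>2"] conjI allI impI)
      fix s assume s: "Re s \<ge> a"
      have "\<kappa> * a \<le> \<kappa> * Re s" using s \<kappa> by simp
      hence "Re (of_real \<kappa> * s + of_real b) \<ge> 5 / 2" using M[OF True] by (simp add: b_def \<kappa>_def)
      from C(2)[OF this] have "norm (rGamma (of_real \<kappa> * s + of_real b)) \<le> C * exp (- (r / \<kappa>) * (\<kappa> * Re s + b) + pi / 2 * \<bar>\<kappa> * Im s\<bar>) / (1 + (\<kappa> * Im s)\<^sup>2)"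
        by simp
      also have "- (r / \<kappa>) * (\<kappa> * Re s + b) + pi / 2 * \<bar>\<kappa> * Im s\<bar> = - (r / \<kappa> * b) + (- r * Re s + pi * \<sigma> * \<bar>Im s\<bar>)"
      proof -
        have k: "\<kappa> = 2 / 3" using True by (simp add: \<kappa>_def struve_kappa_def)
        show ?thesis unfolding k True by (simp add: abs_mult field_simps)
      qed
      also have "C * exp (- (r / \<kappa> * b) + (- r * Re s + pi * \<sigma> * \<bar>Im s\<bar>)) / (1 + (\<kappa> * Im s)\<^sup>2)
         \<le> C * exp (- (r / \<kappa> * b) + (- r * Re s + pi * \<sigma> * \<bar>Im s\<bar>)) / (\<kappa>\<^sup>2 * (1 + (Im s)\<^sup>2))"
      proof (intro divide_left_mono mult_pos_pos mult_nonneg_nonneg pos)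
        have "\<kappa>\<^sup>2 \<le> 1" using \<kappa> by (simp add: power_le_one)
        thus "\<kappa>\<^sup>2 * (1 + (Im s)\<^sup>2) \<le> 1 + (\<kappa> * Im s)\<^sup>2" by (simp add: power_mult_distrib algebra_simps)
      qed (use C \<kappa> in auto)
      also have "\<dots> = C * exp (- (r / \<kappa> * b)) / \<kappa>\<^sup>2 * exp (- r * Re s + pi * \<sigma> * \<bar>Im s\<bar>) / (1 + (Im s)\<^sup>2)"
        unfolding exp_add by simp
      finally show "norm (rGamma (of_real \<kappa> * s + of_real b)) \<le> C * exp (- (r / \<kappa> * b)) / \<kappa>\<^sup>2 * exp (- r * Re s + pi * \<sigma> * \<bar>Im s\<bar>) / (1 + (Im s)\<^sup>2)" .
    qed (use C \<kappa> in auto)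
  next
    case False
    define e where "e = pi * \<sigma> / \<kappa> - pi / 2"
    have "pi * \<kappa> / 2 < pi * \<sigma>" using False \<sigma> by (simp add: \<kappa>_def struve_kappa_def)
    hence e: "e > 0" using \<kappa> by (simp add: e_def pos_less_divide_eq mult.commute)
    obtain C where C: "C > 0" "\<And>z. Re z \<ge> \<kappa> * a + b \<Longrightarrow> norm (rGamma z) \<le> C * exp (- (r / \<kappa>) * Re z + (pi / 2 + e / 2) * \<bar>Im z\<bar>)"
      using norm_rGamma_exp_bound[of "e / 2" "\<kappa> * a + b" "r / \<kappa>"] e by auto
    define l where "l = \<kappa> * e / 2"
    have l: "l > 0" using \<kappa> e by (simp add: l_def)
    show ?thesis
    proof (intro exI[of _ "C * exp (- (r / \<kappa> * b)) * (1 + 2 / l\<^sup>2)"] conjI allI impI)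
      fix s assume s: "Re s \<ge> a"
      have "\<kappa> * a \<le> \<kappa> * Re s" using s \<kappa> by simp
      hence "Re (of_real \<kappa> * s + of_real b) \<ge> \<kappa> * a + b" by simp
      from C(2)[OF this] have "norm (rGamma (of_real \<kappa> * s + of_real b)) \<le> C * exp (- (r / \<kappa>) * (\<kappa> * Re s + b) + (pi / 2 + e / 2) * \<bar>\<kappa> * Im s\<bar>)"
        by simp
      also have "- (r / \<kappa>) * (\<kappa> * Re s + b) + (pi / 2 + e / 2) * \<bar>\<kappa> * Im s\<bar> = - (r / \<kappa> * b) + (- r * Re s + pi * \<sigma> * \<bar>Im s\<bar>) + - l * \<bar>Im s\<bar>"
        using \<kappa> by (simp add: abs_mult l_def e_def field_simps)
      also have "C * exp (- (r / \<kappa> * b) + (- r * Re s + pi * \<sigma> * \<bar>Im s\<bar>) + - l * \<bar>Im s\<bar>)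
         = C * exp (- (r / \<kappa> * b)) * exp (- r * Re s + pi * \<sigma> * \<bar>Im s\<bar>) * exp (- l * \<bar>Im s\<bar>)" unfolding exp_add by simp
      also have "\<dots> \<le> C * exp (- (r / \<kappa> * b)) * exp (- r * Re s + pi * \<sigma> * \<bar>Im s\<bar>) * ((1 + 2 / l\<^sup>2) / (1 + (Im s)\<^sup>2))"
        using exp_neg_le_quadratic[OF l, of "\<bar>Im s\<bar>"] C by (intro mult_left_mono) auto
      finally show "norm (rGamma (of_real \<kappa> * s + of_real b)) \<le> C * exp (- (r / \<kappa> * b)) * (1 + 2 / l\<^sup>2) * exp (- r * Re s + pi * \<sigma> * \<bar>Im s\<bar>) / (1 + (Im s)\<^sup>2)"
        by (simp add: mult_ac)
    qed (use C in \<open>auto intro!: mult_pos_pos add_pos_nonneg\<close>)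
  qed
  obtain R C where R: "R > 0" and C: "C > 0" and rem: "\<And>s. norm s \<ge> R \<Longrightarrow> \<bar>Arg s\<bar> \<le> pi - pi / 4 \<Longrightarrow>
     norm (struve_rem \<sigma> \<nu> M s) \<le> C * exp (struve_rate \<sigma> * Re s) * norm (rGamma (of_real \<kappa> * s + of_real b))"
    using struve_rem_bound[OF \<sigma>0 \<sigma>(2), of "pi / 4" \<nu> M] unfolding \<kappa>_def b_def by (metis pi_gt_zero divide_pos_pos zero_less_numeral)
  \<comment> \<open>For large |s| a half plane Re s \<ge> a with a negative lies in a sector only
    slightly wider than the right half plane, in particular in |Arg s| \<le> 3\<pi>/4.\<close>
  have arg: "\<bar>Arg s\<bar> \<le> pi - pi / 4" if s: "Re s \<ge> a" "norm s \<ge> 2 * \<bar>a\<bar> + 1" for s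
  proof (rule ccontr)
    assume "\<not> ?thesis"
    hence A: "\<bar>Arg s\<bar> > pi - pi / 4" "\<bar>Arg s\<bar> \<le> pi" using Arg_bounded[of s] by auto
    have "cos \<bar>Arg s\<bar> \<le> cos (pi - pi / 4)" using A by (intro cos_monotone_0_pi_le) auto
    also have "cos (pi - pi / 4) = - (sqrt 2 / 2)" unfolding cos_pi_minus cos_45 ..
    also have "\<dots> \<le> - (1 / 2)" by (simp add: real_le_rsqrt)
    finally have c: "cos (Arg s) \<le> - (1 / 2)" by simp
    have "Re s = norm s * cos (Arg s)" using s(2) by (subst cos_Arg) auto
    also have "\<dots> \<le> norm s * (- (1 / 2))" using c by (intro mult_left_mono) auto
    finally show False using s by linarith
  qed
  show ?thesis
  proof (rule exI[of _ "R + (2 * \<bar>a\<bar> + 1)"], rule allI)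
    fix r
    obtain C' where C': "C' > 0" "\<And>s. Re s \<ge> a \<Longrightarrow> norm (rGamma (of_real \<kappa> * s + of_real b)) \<le> C' * exp (- (r + struve_rate \<sigma>) * Re s + pi * \<sigma> * \<bar>Im s\<bar>) / (1 + (Im s)\<^sup>2)"
      using g[of "r + struve_rate \<sigma>"] by blast
    show "\<exists>C>0. \<forall>s. Re s \<ge> a \<and> norm s \<ge> R + (2 * \<bar>a\<bar> + 1) \<longrightarrow>
     norm (struve_rem \<sigma> \<nu> M s) \<le> C * exp (- r * Re s + pi * \<sigma> * \<bar>Im s\<bar>) / (1 + (Im s)\<^sup>2)"
    proof (intro exI[of _ "C * C'"] conjI allI impI)
      fix s assume s: "Re s \<ge> a \<and> norm s \<ge> R + (2 * \<bar>a\<bar> + 1)"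
      have "norm (struve_rem \<sigma> \<nu> M s) \<le> C * exp (struve_rate \<sigma> * Re s) * norm (rGamma (of_real \<kappa> * s + of_real b))"
        using s R by (intro rem arg) auto
      also have "\<dots> \<le> C * exp (struve_rate \<sigma> * Re s) * (C' * exp (- (r + struve_rate \<sigma>) * Re s + pi * \<sigma> * \<bar>Im s\<bar>) / (1 + (Im s)\<^sup>2))"
        using s C by (intro mult_left_mono C') auto
      also have "\<dots> = C * C' * (exp (struve_rate \<sigma> * Re s) * exp (- (r + struve_rate \<sigma>) * Re s + pi * \<sigma> * \<bar>Im s\<bar>)) / (1 + (Im s)\<^sup>2)" by simp
      also have "exp (struve_rate \<sigma> * Re s) * exp (- (r + struve_rate \<sigma>) * Re s + pi * \<sigma> * \<bar>Im s\<bar>) = exp (- r * Re s + pi * \<sigma> * \<bar>Im s\<bar>)"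
        unfolding exp_add[symmetric] by (rule arg_cong[where f = exp]) (simp add: algebra_simps)
      finally show "norm (struve_rem \<sigma> \<nu> M s) \<le> C * C' * exp (- r * Re s + pi * \<sigma> * \<bar>Im s\<bar>) / (1 + (Im s)\<^sup>2)" .
    qed (use C C' in auto)
  qed
qed

text \<open>The singularity comes from the factor \<Gamma> of the quotient, with residue (-1)^k/k!
  in its own argument and 1/\<sigma> times that in s. The sign is cancelled by cos(-\<pi>k), and the
  subtracted main terms are entire.\<close>

lemma residue_struve_pole:
  fixes k :: nat and \<sigma> \<nu> :: real
  assumes \<sigma>: "\<sigma> > 0"
  defines "q \<equiv> - struve_k \<sigma> \<nu> k"
  shows "residue (\<lambda>s. exp (of_real p * s) * cos (of_real pi * (of_real \<sigma> * s - of_real \<nu> - 1 / 2)) * struve_rem \<sigma> \<nu> M s) (of_real q)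
    = of_real (1 / \<sigma> * (exp (p * q) / fact k * rGamma (3 / 2 - struve_k \<sigma> \<nu> k)))"
proof -
  define w where "w = (\<lambda>s. of_real \<sigma> * s - of_real \<nu> - (1 / 2 :: complex))"
  have wq: "w (of_real q) = - of_nat k"
  proof -
    have "\<sigma> * q - \<nu> - 1 / 2 = - real k" using \<sigma> by (simp add: q_def struve_k_def)
    hence "complex_of_real (\<sigma> * q - \<nu> - 1 / 2) = - of_nat k" by simp
    thus ?thesis by (simp add: w_def)
  qed
  have wk: "w s + of_nat k = of_real \<sigma> * (s - of_real q)" for s
  proof -
    have "w s - w (of_real q) = of_real \<sigma> * (s - of_real q)" by (simp add: w_def algebra_simps)
    thus ?thesis unfolding wq by simp
  qed
  define h where "h = (\<lambda>s. exp (of_real p * s) * cos (of_real pi * w s) * rGamma (s + 3 / 2))"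
  define g where "g = (\<lambda>s. exp (of_real p * s) * cos (of_real pi * w s) * (\<Sum>j<M. struve_main \<sigma> \<nu> j s))"
  define f where "f = (\<lambda>s. exp (of_real p * s) * cos (of_real pi * w s) * struve_rem \<sigma> \<nu> M s)"
  have f: "f s = h s * Gamma (w s) - g s" for s
    by (simp add: f_def h_def g_def struve_rem_def struve_ratio_def w_def algebra_simps)
  have np: "w s \<notin> \<int>\<^sub>\<le>\<^sub>0" if s: "s \<in> ball (of_real q) (1 / \<sigma>) - {of_real q}" for s
  proof
    assume "w s \<in> \<int>\<^sub>\<le>\<^sub>0"
    then obtain n where n: "w s = - of_nat n" by (auto elim: nonpos_Ints_cases')
    have "of_real \<sigma> * (s - of_real q) = of_int (int k - int n)" using wk[of s] n by simp
    hence "\<sigma> * norm (s - of_real q) = \<bar>of_int (int k - int n)\<bar>"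
      using \<sigma> by (metis abs_of_pos norm_mult norm_of_int norm_of_real)
    moreover have "norm (s - of_real q) < 1 / \<sigma>" using s by (simp add: dist_norm norm_minus_commute)
    hence "\<sigma> * norm (s - of_real q) < 1" using \<sigma> by (simp add: pos_less_divide_eq mult.commute)
    ultimately have "\<bar>int k - int n\<bar> < 1" by linarith
    hence "of_real \<sigma> * (s - of_real q) = 0" using \<open>of_real \<sigma> * (s - of_real q) = of_int (int k - int n)\<close> by simp
    thus False using s \<sigma> by simp
  qed
  have pre: "struve_prefactor \<sigma> \<nu> holomorphic_on A" for A
    unfolding struve_prefactor_def by (intro holomorphic_intros)
  have hg: "g holomorphic_on UNIV" "h holomorphic_on UNIV" unfolding g_def h_def w_def struve_main_def
    by (intro holomorphic_intros pre)+
  have holo: "f holomorphic_on ball (of_real q) (1 / \<sigma>) - {of_real q}"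
    unfolding f_def using np unfolding w_def by (intro holomorphic_intros holomorphic_struve_rem) auto
  have "((\<lambda>s. Gamma (w s) * (w s + of_nat k)) \<longlongrightarrow> (- 1) ^ k / fact k) (at (of_real q))"
  proof (rule filterlim_compose[OF Gamma_residues])
    show "filterlim w (at (- of_nat k)) (at (of_real q))"
    proof (rule filterlim_atI)
      have "isCont w (of_real q)" unfolding w_def by (intro continuous_intros)
      thus "(w \<longlongrightarrow> - of_nat k) (at (of_real q))" unfolding isCont_def wq .
      have "w s \<noteq> - of_nat k" if "s \<noteq> of_real q" for s
        using wk[of s] that \<sigma> by (auto simp: add_eq_0_iff2)
      thus "\<forall>\<^sub>F s in at (of_real q). w s \<noteq> - of_nat k" by (auto simp: eventually_at_filter)
    qed
  qed
  moreover have "isCont h (of_real q)" "isCont g (of_real q)"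
    using hg[THEN holomorphic_on_imp_continuous_on] by (simp_all add: continuous_on_eq_continuous_at)
  hence "(h \<longlongrightarrow> h (of_real q)) (at (of_real q))" "(g \<longlongrightarrow> g (of_real q)) (at (of_real q))" by (simp_all add: isCont_def)
  moreover have "((\<lambda>s. s - of_real q) \<longlongrightarrow> of_real q - of_real q) (at (of_real q :: complex))" by (intro tendsto_intros)
  ultimately have "((\<lambda>s. h s * (Gamma (w s) * (w s + of_nat k)) / of_real \<sigma> - g s * (s - of_real q)) \<longlongrightarrow>
       h (of_real q) * ((- 1) ^ k / fact k) / of_real \<sigma> - g (of_real q) * (of_real q - of_real q)) (at (of_real q))"
    using \<sigma> by (intro tendsto_intros) auto
  moreover have "h s * (Gamma (w s) * (w s + of_nat k)) / of_real \<sigma> - g s * (s - of_real q) = f s * (s - of_real q)" for s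
    unfolding wk f using \<sigma> by (simp add: field_simps)
  ultimately have "((\<lambda>s. f s * (s - of_real q)) \<longlongrightarrow> h (of_real q) * ((- 1) ^ k / fact k) / of_real \<sigma>) (at (of_real q))" by simp
  hence "residue f (of_real q) = h (of_real q) * ((- 1) ^ k / fact k) / of_real \<sigma>"
    using \<sigma> by (intro residue_simple'[OF _ _ holo]) auto
  also have "h (of_real q) = of_real (exp (p * q)) * (- 1) ^ k * of_real (rGamma (3 / 2 - struve_k \<sigma> \<nu> k))"
  proof -
    have "cos (of_real pi * w (of_real q)) = cos (of_real (pi * real k))" unfolding wq by simp
    also have "\<dots> = of_real (cos (pi * real k))" by (rule cos_of_real)
    also have "\<dots> = (- 1) ^ k" by (simp add: mult.commute)
    finally have "cos (of_real pi * w (of_real q)) = (- 1) ^ k" .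
    moreover have "rGamma (of_real q + 3 / 2 :: complex) = of_real (rGamma (3 / 2 - struve_k \<sigma> \<nu> k))"
      by (simp add: q_def algebra_simps flip: rGamma_complex_of_real)
    ultimately show ?thesis unfolding h_def by (simp flip: exp_of_real)
  qed
  also have "of_real (exp (p * q)) * (- 1) ^ k * of_real (rGamma (3 / 2 - struve_k \<sigma> \<nu> k)) * ((- 1) ^ k / fact k) / of_real \<sigma>
     = (of_real (1 / \<sigma> * (exp (p * q) / fact k * rGamma (3 / 2 - struve_k \<sigma> \<nu> k))) :: complex)"
  proof -
    have e: "A * u * B * (u / f) / t = 1 / t * (A / f * B)" if "u * u = 1" for A u B f t :: complex
    proof -
      have "A * u * B * (u / f) / t = (u * u) * (1 / t * (A / f * B))" by (simp add: mult_ac)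
      thus ?thesis using that by simp
    qed
    have "(- 1) ^ k * (- 1) ^ k = (1 :: complex)" by (simp flip: power_mult_distrib)
    from e[OF this] show ?thesis by simp
  qed
  finally show ?thesis unfolding f_def w_def .
qed

lemma vertical_integral_bound:
  assumes cont: "continuous_on (closed_segment (Complex c (- Y)) (Complex c Y)) f" and Y: "Y \<ge> 0" and B: "B \<ge> 0"
    and le: "\<And>y. norm (f (Complex c y)) \<le> B / (1 + y\<^sup>2)"
  shows "norm (contour_integral (linepath (Complex c (- Y)) (Complex c Y)) f) \<le> 4 * B"
proof -
  have mid: "of_real c \<in> closed_segment (Complex c (- Y)) (Complex c Y)"
    unfolding closed_segment_def by (intro CollectI exI[of _ "1 / 2"]) (simp add: complex_eq_iff)
  have sub: "closed_segment (of_real c) (Complex c Y) \<subseteq> closed_segment (Complex c (- Y)) (Complex c Y)"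
    "closed_segment (of_real c) (Complex c (- Y)) \<subseteq> closed_segment (Complex c (- Y)) (Complex c Y)"
    using mid by (simp_all add: subset_closed_segment)
  have e: "Complex c Y = of_real c + of_real Y * \<i>" "Complex c (- Y) = of_real c + of_real Y * (- \<i>)"
    by (simp_all add: complex_eq_iff)
  have "norm (contour_integral (linepath (of_real c) (of_real c + of_real Y * \<i>)) f) \<le> 2 * B * norm \<i>"
    by (rule contour_integral_arctan_bound)
      (use continuous_on_subset[OF cont sub(1)] le Y B in \<open>simp_all add: e Complex_eq mult.commute\<close>)
  hence up: "norm (contour_integral (linepath (of_real c) (Complex c Y)) f) \<le> 2 * B" unfolding e by simp
  have "norm (contour_integral (linepath (of_real c) (of_real c + of_real Y * (- \<i>))) f) \<le> 2 * B * norm (- \<i>)"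
  proof (rule contour_integral_arctan_bound)
    fix t :: real
    have "of_real c + of_real t * (- \<i>) = Complex c (- t)" by (simp add: complex_eq_iff)
    thus "norm (f (of_real c + of_real t * (- \<i>))) \<le> B / (1 + t\<^sup>2)" using le[of "- t"] by simp
  qed (use continuous_on_subset[OF cont sub(2)] Y B in \<open>simp_all add: e\<close>)
  hence down: "norm (contour_integral (linepath (of_real c) (Complex c (- Y))) f) \<le> 2 * B" unfolding e by simp
  have "contour_integral (linepath (Complex c (- Y)) (Complex c Y)) f =
     contour_integral (linepath (Complex c (- Y)) (of_real c)) f + contour_integral (linepath (of_real c) (Complex c Y)) f"
    by (rule contour_integral_split_linepath[OF cont mid])
  also have "contour_integral (linepath (Complex c (- Y)) (of_real c)) f = - contour_integral (linepath (of_real c) (Complex c (- Y))) f"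
    by (rule contour_integral_reverse_linepath) (use continuous_on_subset[OF cont sub(2)] in \<open>simp add: closed_segment_commute\<close>)
  finally show ?thesis
    using up down norm_triangle_ineq[of "- contour_integral (linepath (of_real c) (Complex c (- Y))) f" "contour_integral (linepath (of_real c) (Complex c Y)) f"]
    by simp
qed

text \<open>\<open>G\<close> is sin \<phi>/\<pi> times the remainder R, written so as to be entire:
  where R has a pole the sine vanishes. The two parts of the kernel therefore have their residues
  separately, G cot(\<pi>s) at the integers and R cos \<phi> at the points -k_s, even if such a
  point is itself an integer. What remains in the limit is the left line Re s = a, whose bound exp(p
  a) is uniform in p.\<close>

lemma struve_residue_sum:
  fixes m :: int and \<sigma> \<nu> :: real and M P :: nat
  defines "a \<equiv> real_of_int m - 1 / 2"
  assumes \<sigma>: "1 / 3 \<le> \<sigma>" "\<sigma> < 1" and M: "\<sigma> = 1 / 3 \<Longrightarrow> struve_kappa \<sigma> * a + (1 - struve_theta \<nu> + real M) \<ge> 5 / 2"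
    and P: "\<And>k. k < P \<Longrightarrow> - struve_k \<sigma> \<nu> k > a" "\<And>k. k \<ge> P \<Longrightarrow> - struve_k \<sigma> \<nu> k < a"
  defines "G \<equiv> \<lambda>s. struve_term \<sigma> \<nu> s - sin (of_real pi * (of_real \<sigma> * s - of_real \<nu> - 1 / 2)) / of_real pi * (\<Sum>j<M. struve_main \<sigma> \<nu> j s)"
  shows "\<exists>K. \<forall>p. summable (\<lambda>k. exp (of_real p * of_int (m + int k)) * G (of_int (m + int k))) \<and>
    norm ((\<Sum>k. exp (of_real p * of_int (m + int k)) * G (of_int (m + int k)))
      - of_real (1 / \<sigma> * (\<Sum>k<P. exp (p * (- struve_k \<sigma> \<nu> k)) / fact k * rGamma (3 / 2 - struve_k \<sigma> \<nu> k)))) \<le> K * exp (p * a)"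
proof -
  have \<sigma>0: "\<sigma> > 0" using \<sigma> by linarith
  define q where "q = (\<lambda>k. - struve_k \<sigma> \<nu> k)"
  define w where "w = (\<lambda>s. of_real \<sigma> * s - of_real \<nu> - (1 / 2 :: complex))"
  define R where "R = struve_rem \<sigma> \<nu> M"
  define T where "T = (\<lambda>k p. 1 / \<sigma> * (exp (p * q k) / fact k * rGamma (3 / 2 - struve_k \<sigma> \<nu> k)))"
  have poles: "\<exists>k. s = of_real (q k)" if "w s \<in> \<int>\<^sub>\<le>\<^sub>0" for s
  proof -
    from that obtain k where "w s = - of_nat k" by (auto elim: nonpos_Ints_cases')
    hence "of_real \<sigma> * s = of_real (\<nu> + 1 / 2 - real k)" by (simp add: w_def algebra_simps)
    also have "\<nu> + 1 / 2 - real k = \<sigma> * q k" using \<sigma>0 by (simp add: q_def struve_k_def)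
    finally have "of_real \<sigma> * s = of_real \<sigma> * of_real (q k)" by simp
    hence "s = of_real (q k)" using \<sigma>0 by simp
    thus ?thesis by blast
  qed
  have holR: "R holomorphic_on A" if "\<And>k. of_real (q k) \<notin> A" for A
    unfolding R_def using poles that unfolding w_def by (intro holomorphic_struve_rem) blast
  have pre: "struve_prefactor \<sigma> \<nu> holomorphic_on A" for A
    unfolding struve_prefactor_def by (intro holomorphic_intros)
  have holG: "G holomorphic_on A" for A
    unfolding G_def struve_term_def struve_main_def by (intro holomorphic_intros pre) auto
  have GR: "G s = sin (of_real pi * w s) / of_real pi * R s" if "\<And>k. s \<noteq> of_real (q k)" for s
  proof -
    have "w s \<notin> \<int>\<^sub>\<le>\<^sub>0" using poles that by blast
    define v where "v = sin (of_real pi * w s) / of_real pi"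
    have "struve_term \<sigma> \<nu> s = struve_ratio \<sigma> \<nu> s * v"
      unfolding v_def w_def by (rule struve_term_eq) (rule \<open>w s \<notin> \<int>\<^sub>\<le>\<^sub>0\<close>[unfolded w_def])
    moreover have "G s = struve_term \<sigma> \<nu> s - v * (\<Sum>j<M. struve_main \<sigma> \<nu> j s)" by (simp only: G_def v_def w_def)
    ultimately show ?thesis unfolding v_def[symmetric] by (simp add: R_def struve_rem_def algebra_simps)
  qed
  obtain R0 where R0: "\<And>r. \<exists>C>0. \<forall>s. Re s \<ge> a \<and> norm s \<ge> R0 \<longrightarrow> norm (R s) \<le> C * exp (- r * Re s + pi * \<sigma> * \<bar>Im s\<bar>) / (1 + (Im s)\<^sup>2)"
    using struve_rem_decay[OF \<sigma> M] unfolding R_def by auto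
  have pos: "1 + t\<^sup>2 > 0" for t :: real by (simp add: add_pos_nonneg)
  have qa: "q k \<noteq> a" for k using P[of k] unfolding q_def by (cases "k < P") auto
  have qle: "q k \<le> q 0" for k using \<sigma>0 by (simp add: q_def struve_k_def divide_right_mono diff_right_mono)
  \<comment> \<open>The decay bound covers the part |s| \<ge> R0 of the left line. The rest is
    compact and free of poles, because no q_k equals a.\<close>
  obtain C1 where C1: "C1 > 0" "\<And>s. Re s = a \<Longrightarrow> norm (R s) \<le> C1 * exp (pi * \<sigma> * \<bar>Im s\<bar>) / (1 + (Im s)\<^sup>2)"
  proof -
    obtain C where C: "C > 0" "\<And>s. Re s \<ge> a \<Longrightarrow> norm s \<ge> R0 \<Longrightarrow> norm (R s) \<le> C * exp (- 0 * Re s + pi * \<sigma> * \<bar>Im s\<bar>) / (1 + (Im s)\<^sup>2)"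
      using R0[of 0] by blast
    have "R holomorphic_on - range (\<lambda>k. of_real (q k))" by (rule holR) auto
    moreover have "of_real (q k) \<notin> {s. Re s = a}" for k using qa[of k] by simp
    hence "cball 0 R0 \<inter> {s. Re s = a} \<subseteq> - range (\<lambda>k. of_real (q k))" by blast
    ultimately have "continuous_on (cball 0 R0 \<inter> {s. Re s = a}) R"
      using continuous_on_subset[OF holomorphic_on_imp_continuous_on] by blast
    moreover have "compact (cball 0 R0 \<inter> {s. Re s = a})" by (intro compact_Int_closed closed_Collect_eq continuous_intros) auto
    ultimately have "compact (R ` (cball 0 R0 \<inter> {s. Re s = a}))" by (rule compact_continuous_image)
    from compact_imp_bounded[OF this] obtain D where D: "D > 0" "\<And>s. norm s \<le> R0 \<Longrightarrow> Re s = a \<Longrightarrow> norm (R s) \<le> D"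
      unfolding bounded_pos by auto
    show ?thesis
    proof (rule that[of "C + D * (1 + R0\<^sup>2)"])
      show "C + D * (1 + R0\<^sup>2) > 0" using C D pos by (auto intro!: add_pos_pos)
      fix s assume s: "Re s = a"
      show "norm (R s) \<le> (C + D * (1 + R0\<^sup>2)) * exp (pi * \<sigma> * \<bar>Im s\<bar>) / (1 + (Im s)\<^sup>2)"
      proof (cases "norm s \<ge> R0")
        case True
        hence "norm (R s) \<le> C * exp (pi * \<sigma> * \<bar>Im s\<bar>) / (1 + (Im s)\<^sup>2)" using C(2)[of s] s by simp
        also have "\<dots> \<le> (C + D * (1 + R0\<^sup>2)) * exp (pi * \<sigma> * \<bar>Im s\<bar>) / (1 + (Im s)\<^sup>2)"
          using D pos less_imp_le[OF pos] by (intro divide_right_mono mult_right_mono) auto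
        finally show ?thesis .
      next
        case False
        have "\<bar>Im s\<bar> \<le> R0" using False abs_Im_le_cmod[of s] by linarith
        hence "(Im s)\<^sup>2 \<le> R0\<^sup>2" by (metis abs_ge_zero power2_abs power_mono)
        hence "norm (R s) * (1 + (Im s)\<^sup>2) \<le> D * (1 + R0\<^sup>2)"
          using D False s less_imp_le[OF pos] by (intro mult_mono) auto
        also have "\<dots> \<le> (C + D * (1 + R0\<^sup>2)) * 1" using C by simp
        also have "\<dots> \<le> (C + D * (1 + R0\<^sup>2)) * exp (pi * \<sigma> * \<bar>Im s\<bar>)"
          using C D pos \<sigma>0 less_imp_le[OF pos] by (intro mult_left_mono) (auto intro!: add_nonneg_nonneg mult_nonneg_nonneg)
        finally show ?thesis using pos by (simp add: pos_le_divide_eq)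
      qed
    qed
  qed
  show ?thesis
  proof (intro exI[of _ "4 * C1"] allI conjI)
    fix p :: real
    define g where "g = (\<lambda>k. exp (of_real p * of_int (m + int k)) * G (of_int (m + int k)))"
    \<comment> \<open>r = p + 1 makes the right line vanish as N grows. This constant may depend on
      p, in contrast to \<open>C1\<close>.\<close>
    obtain C2 where C2: "C2 > 0" "\<And>s. Re s \<ge> a \<Longrightarrow> norm s \<ge> R0 \<Longrightarrow> norm (R s) \<le> C2 * exp (- (p + 1) * Re s + pi * \<sigma> * \<bar>Im s\<bar>) / (1 + (Im s)\<^sup>2)"
      using R0[of "p + 1"] by blast
    define N0 where "N0 = nat \<lceil>max (R0 - a) (q 0 - a)\<rceil> + 1"
    have N0: "a + real N > R0" "a + real N > q 0" if "N \<ge> N0" for N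
      using that unfolding N0_def by linarith+
    have sum_g: "summable g"
    proof (rule summable_comparison_test'[of _ N0])
      have "summable (\<lambda>k. C2 / pi * exp (- of_int m) * exp (- 1) ^ k)"
        by (intro summable_mult summable_geometric) auto
      thus "summable (\<lambda>k. C2 / pi * exp (- real_of_int m) * exp (- 1) ^ k)" .
      fix k assume k: "k \<ge> N0"
      define t where "t = real_of_int m + real k"
      define s where "s = complex_of_int (m + int k)"
      have st: "s = of_real t" by (simp add: s_def t_def)
      have t: "t \<ge> a" "t > R0" "t > q 0" using N0[OF k] unfolding t_def a_def by linarith+
      have nq: "s \<noteq> of_real (q j)" for j using t qle[of j] unfolding st by (metis of_real_eq_iff not_le)
      have "norm (sin (of_real pi * w s)) \<le> 1"
      proof -
        have "of_real pi * w s = of_real (pi * (\<sigma> * t - \<nu> - 1 / 2))" unfolding st w_def by simp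
        thus ?thesis by (simp only: sin_of_real norm_of_real abs_sin_le_one)
      qed
      hence "norm (sin (of_real pi * w s)) / pi * norm (R s) \<le> 1 / pi * (C2 * exp (- (p + 1) * Re s + pi * \<sigma> * \<bar>Im s\<bar>) / (1 + (Im s)\<^sup>2))"
        using t C2(2)[of s] abs_Re_le_cmod[of s] st by (intro mult_mono divide_right_mono) auto
      hence "norm (G s) \<le> C2 / pi * exp (- (p + 1) * t)" unfolding GR[OF nq] by (simp add: st norm_mult norm_divide)
      hence "norm (exp (of_real p * s)) * norm (G s) \<le> exp (p * t) * (C2 / pi * exp (- (p + 1) * t))"
        by (intro mult_mono) (auto simp: norm_exp_eq_Re st)
      also have "\<dots> = C2 / pi * exp (- t)" by (simp add: exp_add[symmetric] algebra_simps)
      also have "exp (- t) = exp (- real_of_int m) * exp (- 1) ^ k"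
        by (simp add: t_def exp_of_nat_mult[symmetric] exp_add[symmetric])
      finally show "norm (g k) \<le> C2 / pi * exp (- real_of_int m) * exp (- 1) ^ k"
        by (simp add: g_def s_def norm_mult)
    qed
    define f1 where "f1 = (\<lambda>s. exp (of_real p * s) * G s)"
    define f2 where "f2 = (\<lambda>s. exp (of_real p * s) * cos (of_real pi * w s) * R s)"
    define f where "f = (\<lambda>s. of_real pi * f1 s * cot (of_real pi * s) - f2 s)"
    have fb: "norm (f s) \<le> 4 * (exp (p * Re s) * exp (- (pi * \<sigma> * \<bar>Im s\<bar>)) * norm (R s))"
      if "\<And>k. s \<noteq> of_real (q k)" "\<bar>Im s\<bar> \<ge> 1 \<or> (\<exists>m::int. Re s = of_int m - 1 / 2)" for s
    proof -
      have "f s = exp (of_real p * s) * (sin (of_real pi * w s) * cot (of_real pi * s) - cos (of_real pi * w s)) * R s"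
        unfolding f_def f1_def f2_def GR[OF that(1)] by (simp add: algebra_simps)
      also have "norm \<dots> \<le> exp (p * Re s) * (4 * exp (- (pi * \<sigma> * \<bar>Im s\<bar>))) * norm (R s)"
        unfolding norm_mult w_def by (intro mult_mono norm_sin_cot_kernel[OF \<sigma>(2) that(2)]) (auto simp: norm_exp_eq_Re)
      finally show ?thesis by (simp add: mult_ac)
    qed
    define S where "S = (\<Sum>k<P. T k p)"
    have main: "2 * pi * norm ((\<Sum>k<N. g k) - of_real S) \<le> 16 * C1 * exp (p * a) + 16 * C2 * exp (- (a + real N))" if N: "N \<ge> N0" for N
    proof -
      define d where "d = a + real N"
      have N1: "N > 0" using N by (simp add: N0_def)
      have d: "d > a" "d > R0" "d > q 0" using N0[OF N] N1 by (auto simp: d_def)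
      define D where "D = 8 * exp (\<bar>p\<bar> * (\<bar>a\<bar> + \<bar>d\<bar>)) * C2 * exp (\<bar>p + 1\<bar> * (\<bar>a\<bar> + \<bar>d\<bar>)) * real N"
      have bound: "2 * pi * norm ((\<Sum>k<N. g k) - of_real S) \<le> 16 * C1 * exp (p * a) + 16 * C2 * exp (- d) + D / (1 + Y\<^sup>2)"
        if Y: "Y \<ge> max 1 R0" for Y
      proof -
        have Y1: "Y \<ge> 1" "Y \<ge> R0" "Y > 0" using Y by auto
        define z1 where "z1 = Complex a (- Y)"
        define z3 where "z3 = Complex d Y"
        have I1: "contour_integral (rectpath z1 z3) (\<lambda>s. of_real pi * f1 s * cot (of_real pi * s)) = 2 * of_real pi * \<i> * (\<Sum>k<N. g k)"
        proof -
          have "f1 holomorphic_on {s. Re s > a - 1}" unfolding f1_def by (intro holomorphic_intros holG)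
          from rectangle_cot_sum[OF this, of m N Y] show ?thesis
            using N1 Y1 by (simp add: z1_def z3_def a_def d_def f1_def g_def)
        qed
        define pts where "pts = (\<lambda>k. complex_of_real (q k)) ` {..<P}"
        \<comment> \<open>\<open>a'\<close> is left of a and not left of the first excluded pole, so
          the half plane Re s > a' contains exactly the poles with k < P.\<close>
        define a' where "a' = max (q P) (a - 1)"
        have a': "a' < a" using P(2)[of P] by (simp add: a'_def q_def)
        have qP: "q k \<le> a'" if "k \<ge> P" for k
          using that \<sigma>0 by (simp add: a'_def q_def struve_k_def divide_right_mono diff_right_mono le_max_iff_disj)
        have qin: "a < q k" "q k < d" if "k < P" for k using P(1)[OF that] qle[of k] d by (auto simp: q_def)
        have box: "pts \<inter> box z1 z3 = pts" using qin Y1 by (auto simp: pts_def z1_def z3_def in_box_complex_iff)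
        have inj: "inj_on (\<lambda>k. complex_of_real (q k)) {..<P}" using \<sigma>0 by (auto simp: inj_on_def q_def struve_k_def)
        have holf2: "f2 holomorphic_on {s. Re s > a'} - pts"
          unfolding f2_def w_def
        proof (intro holomorphic_intros holR)
          fix k show "of_real (q k) \<notin> {s. Re s > a'} - pts"
            using qP[of k] by (cases "k < P") (auto simp: pts_def)
        qed
        have cb: "cbox z1 z3 \<subseteq> {s. Re s > a'}" using a' by (auto simp: z1_def z3_def in_cbox_complex_iff)
        have I2: "contour_integral (rectpath z1 z3) f2 = 2 * of_real pi * \<i> * of_real S"
        proof -
          have "contour_integral (rectpath z1 z3) f2 = 2 * of_real pi * \<i> * (\<Sum>s\<in>pts \<inter> box z1 z3. residue f2 s)"
          proof (rule rectangle_residues[OF _ _ _ holf2])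
            show "open {s. Re s > a'}" "convex {s. Re s > a'}" by (auto simp: open_halfspace_Re_gt convex_halfspace_Re_gt)
            show "s \<in> box z1 z3 \<or> s \<notin> cbox z1 z3" if "s \<in> pts" for s using that box by blast
          qed (use cb d Y1 in \<open>auto simp: pts_def z1_def z3_def\<close>)
          also have "(\<Sum>s\<in>pts \<inter> box z1 z3. residue f2 s) = (\<Sum>k<P. residue f2 (of_real (q k)))"
            unfolding box unfolding pts_def by (subst sum.reindex[OF inj]) simp
          also have "\<dots> = of_real S"
            unfolding S_def T_def f2_def w_def R_def q_def of_real_sum
            by (intro sum.cong refl residue_struve_pole[OF \<sigma>0])
          finally show ?thesis .
        qed
        have img: "path_image (rectpath z1 z3) \<subseteq> cbox z1 z3" "path_image (rectpath z1 z3) \<inter> box z1 z3 = {}"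
          using path_image_rectpath_subset_cbox[of z1 z3] path_image_rectpath_inter_box[of z1 z3] d Y1
          by (simp_all add: z1_def z3_def)
        have nq: "s \<noteq> of_real (q k)" if s: "s \<in> path_image (rectpath z1 z3)" for s k
        proof
          assume "s = of_real (q k)"
          show False
          proof (cases "k < P")
            case True
            hence "s \<in> pts" unfolding pts_def \<open>s = of_real (q k)\<close> by blast
            thus False using s img(2) box by blast
          next
            case False
            hence "Re s \<le> a'" using qP[of k] \<open>s = of_real (q k)\<close> by simp
            moreover have "s \<in> {s. Re s > a'}" using s img(1) cb by blast
            ultimately show False by simp
          qed
        qed
        have edge: "\<bar>Im s\<bar> = Y \<or> Re s = a \<or> Re s = d" if "s \<in> path_image (rectpath z1 z3)" for s
          using that d Y1 by (auto simp: z1_def z3_def path_image_rectpath)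
        have half: "\<exists>m::int. a = of_int m - 1 / 2" "\<exists>m::int. d = of_int m - 1 / 2"
          unfolding a_def d_def by (rule exI[of _ m], simp) (rule exI[of _ "m + int N"], simp)
        have good: "\<bar>Im s\<bar> \<ge> 1 \<or> (\<exists>m::int. Re s = of_int m - 1 / 2)" if "s \<in> path_image (rectpath z1 z3)" for s
          using edge[OF that] half Y1 by auto
        have sn: "sin (of_real pi * s) \<noteq> 0" if "s \<in> path_image (rectpath z1 z3)" for s
          using norm_sin_pi_ge[OF good[OF that]] by (smt (verit) divide_pos_pos exp_gt_zero norm_zero)
        have c1: "continuous_on (path_image (rectpath z1 z3)) (\<lambda>s. of_real pi * f1 s * cot (of_real pi * s))"
          unfolding cot_def f1_def using sn by (intro continuous_intros holomorphic_on_imp_continuous_on[OF holG]) auto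
        have c2: "continuous_on (path_image (rectpath z1 z3)) f2"
          by (rule continuous_on_subset[OF holomorphic_on_imp_continuous_on[OF holf2]]) (use img cb box in blast)
        have cf: "continuous_on (path_image (rectpath z1 z3)) f" unfolding f_def by (intro continuous_intros c1 c2)
        define z2 where "z2 = Complex d (- Y)"
        define z4 where "z4 = Complex a Y"
        have rp: "rectpath z1 z3 = linepath z1 z2 +++ linepath z2 z3 +++ linepath z3 z4 +++ linepath z4 z1"
          by (simp add: rectpath_def z1_def z2_def z3_def z4_def Let_def)
        have "path_image (rectpath z1 z3) = closed_segment z1 z2 \<union> (closed_segment z2 z3 \<union> (closed_segment z3 z4 \<union> closed_segment z4 z1))"
          unfolding rp by (simp add: path_image_join)
        hence segs: "closed_segment z1 z2 \<subseteq> path_image (rectpath z1 z3)" "closed_segment z2 z3 \<subseteq> path_image (rectpath z1 z3)"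
          "closed_segment z3 z4 \<subseteq> path_image (rectpath z1 z3)" "closed_segment z4 z1 \<subseteq> path_image (rectpath z1 z3)" by auto
        have ci: "h contour_integrable_on rectpath z1 z3" if "continuous_on (path_image (rectpath z1 z3)) h" for h
          unfolding rp using continuous_on_subset[OF that segs(1)] continuous_on_subset[OF that segs(2)]
            continuous_on_subset[OF that segs(3)] continuous_on_subset[OF that segs(4)]
          by (simp add: contour_integrable_continuous_linepath contour_integrable_joinI)
        have I: "contour_integral (rectpath z1 z3) f = 2 * of_real pi * \<i> * ((\<Sum>k<N. g k) - of_real S)"
        proof -
          have "contour_integral (rectpath z1 z3) f = contour_integral (rectpath z1 z3) (\<lambda>s. of_real pi * f1 s * cot (of_real pi * s)) - contour_integral (rectpath z1 z3) f2"
            unfolding f_def by (intro contour_integral_diff ci c1 c2)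
          thus ?thesis unfolding I1 I2 by (simp add: algebra_simps)
        qed
        have split: "contour_integral (rectpath z1 z3) f = contour_integral (linepath z1 z2) f + contour_integral (linepath z2 z3) f
            + contour_integral (linepath z3 z4) f + contour_integral (linepath z4 z1) f"
          using contour_integral_rectpath[OF cf] d Y1 by (simp add: z1_def z2_def z3_def z4_def)
        have vert: "norm (f (Complex c y)) \<le> 4 * (exp (p * c) * C) / (1 + y\<^sup>2)"
          if c: "norm (R (Complex c y)) \<le> C * exp (pi * \<sigma> * \<bar>y\<bar>) / (1 + y\<^sup>2)" "c = a \<or> c = d" for c y C
        proof -
          have nq': "Complex c y \<noteq> of_real (q k)" for k
            using c(2) qa[of k] qle[of k] d by (auto simp: complex_eq_iff)
          have "norm (f (Complex c y)) \<le> 4 * (exp (p * c) * exp (- (pi * \<sigma> * \<bar>y\<bar>)) * norm (R (Complex c y)))"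
            using fb[of "Complex c y"] nq' half c(2) by auto
          also have "\<dots> \<le> 4 * (exp (p * c) * exp (- (pi * \<sigma> * \<bar>y\<bar>)) * (C * exp (pi * \<sigma> * \<bar>y\<bar>) / (1 + y\<^sup>2)))"
            by (intro mult_left_mono c) auto
          also have "\<dots> = 4 * (exp (p * c) * C) / (1 + y\<^sup>2) * (exp (- (pi * \<sigma> * \<bar>y\<bar>)) * exp (pi * \<sigma> * \<bar>y\<bar>))" by simp
          also have "exp (- (pi * \<sigma> * \<bar>y\<bar>)) * exp (pi * \<sigma> * \<bar>y\<bar>) = 1" by (simp flip: exp_add)
          finally show ?thesis by simp
        qed
        have left: "norm (contour_integral (linepath z1 z4) f) \<le> 4 * (4 * (exp (p * a) * C1))"
          unfolding z1_def z4_def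
        proof (rule vertical_integral_bound)
          show "continuous_on (closed_segment (Complex a (- Y)) (Complex a Y)) f"
            using continuous_on_subset[OF cf segs(4)] by (simp add: z1_def z4_def closed_segment_commute)
          show "norm (f (Complex a y)) \<le> 4 * (exp (p * a) * C1) / (1 + y\<^sup>2)" for y
            using C1(2)[of "Complex a y"] by (intro vert) auto
        qed (use C1 Y1 in auto)
        have right: "norm (contour_integral (linepath z2 z3) f) \<le> 4 * (4 * (exp (p * d) * (C2 * exp (- (p + 1) * d))))"
          unfolding z2_def z3_def
        proof (rule vertical_integral_bound)
          show "continuous_on (closed_segment (Complex d (- Y)) (Complex d Y)) f"
            using continuous_on_subset[OF cf segs(2)] by (simp add: z2_def z3_def)
          show "norm (f (Complex d y)) \<le> 4 * (exp (p * d) * (C2 * exp (- (p + 1) * d))) / (1 + y\<^sup>2)" for y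
          proof (rule vert)
            have "norm (Complex d y) \<ge> R0" using d abs_Re_le_cmod[of "Complex d y"] by simp
            from C2(2)[OF _ this] show "norm (R (Complex d y)) \<le> C2 * exp (- (p + 1) * d) * exp (pi * \<sigma> * \<bar>y\<bar>) / (1 + y\<^sup>2)"
              using d unfolding exp_add by simp
          qed auto
        qed (use C2 Y1 in auto)
        define E where "E = 4 * (exp (\<bar>p\<bar> * (\<bar>a\<bar> + \<bar>d\<bar>)) * (C2 * exp (\<bar>p + 1\<bar> * (\<bar>a\<bar> + \<bar>d\<bar>)))) / (1 + Y\<^sup>2)"
        have fh: "norm (f s) \<le> E" if s: "a \<le> Re s" "Re s \<le> d" "\<bar>Im s\<bar> = Y" for s
        proof -
          have ab: "r * Re s \<le> \<bar>r\<bar> * (\<bar>a\<bar> + \<bar>d\<bar>)" for r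
          proof -
            have "r * Re s \<le> \<bar>r\<bar> * \<bar>Re s\<bar>" by (metis abs_ge_self abs_mult)
            also have "\<dots> \<le> \<bar>r\<bar> * (\<bar>a\<bar> + \<bar>d\<bar>)" using s by (intro mult_left_mono) auto
            finally show ?thesis .
          qed
          have "Im s \<noteq> 0" using s Y1 by auto
          hence nq': "s \<noteq> of_real (q k)" for k by auto
          have "norm s \<ge> R0" using s Y1 abs_Im_le_cmod[of s] by linarith
          note b = C2(2)[OF s(1) this]
          have "norm (f s) \<le> 4 * (exp (p * Re s) * exp (- (pi * \<sigma> * \<bar>Im s\<bar>)) * norm (R s))"
            using s Y1 nq' by (intro fb) auto
          also have "\<dots> \<le> 4 * (exp (p * Re s) * exp (- (pi * \<sigma> * \<bar>Im s\<bar>)) * (C2 * exp (- (p + 1) * Re s + pi * \<sigma> * \<bar>Im s\<bar>) / (1 + (Im s)\<^sup>2)))"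
            by (intro mult_left_mono b) auto
          also have "\<dots> = 4 * (exp (p * Re s) * (C2 * exp (- (p + 1) * Re s))) / (1 + Y\<^sup>2) * (exp (- (pi * \<sigma> * \<bar>Im s\<bar>)) * exp (pi * \<sigma> * \<bar>Im s\<bar>))"
            unfolding exp_add using s by (simp flip: s(3))
          also have "exp (- (pi * \<sigma> * \<bar>Im s\<bar>)) * exp (pi * \<sigma> * \<bar>Im s\<bar>) = 1" by (simp flip: exp_add)
          also have "4 * (exp (p * Re s) * (C2 * exp (- (p + 1) * Re s))) / (1 + Y\<^sup>2) * 1 \<le> E"
            unfolding E_def mult_1_right using C2 ab[of p] ab[of "- (p + 1)", unfolded abs_minus_cancel] less_imp_le[OF pos]
            by (intro divide_right_mono mult_left_mono mult_mono) auto
          finally show ?thesis .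
        qed
        have E0: "E \<ge> 0" using C2 less_imp_le[OF pos] by (auto simp: E_def)
        have hor: "a \<le> Re s \<and> Re s \<le> d \<and> \<bar>Im s\<bar> = Y" if "s \<in> closed_segment z1 z2 \<or> s \<in> closed_segment z3 z4" for s
        proof -
          have "s \<in> cbox z1 z3" using that segs img by blast
          moreover have "Im s = - Y \<or> Im s = Y"
            using that by (auto simp: z1_def z2_def z3_def z4_def closed_segment_same_Im)
          ultimately show ?thesis using Y1 by (auto simp: z1_def z3_def in_cbox_complex_iff)
        qed
        have len: "norm (z2 - z1) = real N" "norm (z4 - z3) = real N"
          by (simp_all add: z1_def z2_def z3_def z4_def d_def cmod_def)
        have h1: "norm (contour_integral (linepath z1 z2) f) \<le> E * norm (z2 - z1)"
          by (rule contour_integral_bound_linepath[OF _ E0]) (use hor fh continuous_on_subset[OF cf segs(1)] in \<open>auto intro!: contour_integrable_continuous_linepath\<close>)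
        have h2: "norm (contour_integral (linepath z3 z4) f) \<le> E * norm (z4 - z3)"
          by (rule contour_integral_bound_linepath[OF _ E0]) (use hor fh continuous_on_subset[OF cf segs(3)] in \<open>auto intro!: contour_integrable_continuous_linepath\<close>)
        have left': "norm (contour_integral (linepath z4 z1) f) \<le> 4 * (4 * (exp (p * a) * C1))"
          using left contour_integral_reverse_linepath[OF continuous_on_subset[OF cf segs(4)]] by simp
        have "norm (contour_integral (rectpath z1 z3) f) \<le> E * real N + 4 * (4 * (exp (p * d) * (C2 * exp (- (p + 1) * d)))) + E * real N + 4 * (4 * (exp (p * a) * C1))"
          unfolding split using h1 h2 len left' right norm_triangle_ineq[of "contour_integral (linepath z1 z2) f + contour_integral (linepath z2 z3) f
            + contour_integral (linepath z3 z4) f" "contour_integral (linepath z4 z1) f"]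
            norm_triangle_ineq[of "contour_integral (linepath z1 z2) f + contour_integral (linepath z2 z3) f" "contour_integral (linepath z3 z4) f"]
            norm_triangle_ineq[of "contour_integral (linepath z1 z2) f" "contour_integral (linepath z2 z3) f"] by simp
        also have "exp (p * d) * (C2 * exp (- (p + 1) * d)) = C2 * exp (- d)" by (simp add: exp_add[symmetric] algebra_simps)
        also have "E * real N + 4 * (4 * (C2 * exp (- d))) + E * real N + 4 * (4 * (exp (p * a) * C1)) = 16 * C1 * exp (p * a) + 16 * C2 * exp (- d) + D / (1 + Y\<^sup>2)"
          by (simp add: E_def D_def)
        finally show ?thesis unfolding I by (simp add: norm_mult)
      qed
      \<comment> \<open>The height goes to infinity for fixed N; on the horizontal sides the factor
        1/(1 + Y^2) suffices, since their length is N.\<close>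
      have "((\<lambda>Y. 16 * C1 * exp (p * a) + 16 * C2 * exp (- d) + D / (1 + Y\<^sup>2)) \<longlongrightarrow> 16 * C1 * exp (p * a) + 16 * C2 * exp (- d) + 0) at_top"
      proof (intro tendsto_intros)
        show "((\<lambda>Y. D / (1 + Y\<^sup>2)) \<longlongrightarrow> 0) at_top" by real_asymp
      qed
      moreover have "eventually (\<lambda>Y. 2 * pi * norm ((\<Sum>k<N. g k) - of_real S) \<le> 16 * C1 * exp (p * a) + 16 * C2 * exp (- d) + D / (1 + Y\<^sup>2)) at_top"
        using eventually_ge_at_top[of "max 1 R0"] by eventually_elim (rule bound)
      ultimately have "2 * pi * norm ((\<Sum>k<N. g k) - of_real S) \<le> 16 * C1 * exp (p * a) + 16 * C2 * exp (- d) + 0"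
        by (intro tendsto_lowerbound[where F = at_top]) auto
      thus ?thesis by (simp add: d_def)
    qed
    have "2 * pi * norm ((\<Sum>k. g k) - of_real S) \<le> 16 * C1 * exp (p * a) + 16 * C2 * 0"
    proof (rule tendsto_le[OF sequentially_bot])
      show "(\<lambda>N. 2 * pi * norm ((\<Sum>k<N. g k) - of_real S)) \<longlonglongrightarrow> 2 * pi * norm ((\<Sum>k. g k) - of_real S)"
        by (intro tendsto_intros summable_LIMSEQ sum_g)
      have "(\<lambda>N. exp (- (a + real N))) \<longlonglongrightarrow> 0" by real_asymp
      thus "(\<lambda>N. 16 * C1 * exp (p * a) + 16 * C2 * exp (- (a + real N))) \<longlonglongrightarrow> 16 * C1 * exp (p * a) + 16 * C2 * 0"
        by (intro tendsto_intros)
      show "\<forall>\<^sub>F N in sequentially. 2 * pi * norm ((\<Sum>k<N. g k) - of_real S) \<le> 16 * C1 * exp (p * a) + 16 * C2 * exp (- (a + real N))"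
        using eventually_ge_at_top[of N0] by eventually_elim (rule main)
    qed
    moreover have "4 * norm ((\<Sum>k. g k) - of_real S) \<le> 2 * pi * norm ((\<Sum>k. g k) - of_real S)"
      using pi_gt3 by (intro mult_right_mono) auto
    ultimately have "norm ((\<Sum>k. g k) - of_real S) \<le> 4 * C1 * exp (p * a)" by simp
    moreover have "S = 1 / \<sigma> * (\<Sum>k<P. exp (p * (- struve_k \<sigma> \<nu> k)) / fact k * rGamma (3 / 2 - struve_k \<sigma> \<nu> k))"
      by (simp add: S_def T_def q_def sum_distrib_left)
    ultimately show "norm ((\<Sum>k. exp (of_real p * of_int (m + int k)) * G (of_int (m + int k)))
      - of_real (1 / \<sigma> * (\<Sum>k<P. exp (p * (- struve_k \<sigma> \<nu> k)) / fact k * rGamma (3 / 2 - struve_k \<sigma> \<nu> k)))) \<le> 4 * C1 * exp (p * a)"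
      unfolding g_def by simp
    show "summable (\<lambda>k. exp (of_real p * of_int (m + int k)) * G (of_int (m + int k)))" using sum_g unfolding g_def .
  qed
qed

section \<open>The compound expansion\<close>

definition struve_series :: "real \<Rightarrow> real \<Rightarrow> real \<Rightarrow> real" where
  "struve_series \<sigma> \<nu> x = (\<Sum>n. x ^ n * rGamma (real n + 3 / 2) * rGamma (\<nu> + 3 / 2 - \<sigma> * real n))"

text \<open>The index is an integer because the terms with n < 0 are, up to sign, those of the first
  algebraic series.\<close>

definition struve_real_term :: "real \<Rightarrow> real \<Rightarrow> real \<Rightarrow> int \<Rightarrow> real" where
  "struve_real_term \<sigma> \<nu> x n = x powi n * rGamma (of_int n + 3 / 2) * rGamma (\<nu> + 3 / 2 - \<sigma> * of_int n)"

lemma struve_series_altdef: "struve_series \<sigma> \<nu> x = (\<Sum>n. struve_real_term \<sigma> \<nu> x (int n))"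
  by (simp add: struve_series_def struve_real_term_def)

lemma exp_ln_of_int:
  assumes "x > 0"
  shows "exp (of_real (ln x) * of_int n) = complex_of_real (x powi n)"
proof -
  have "x powi n = exp (ln x * of_int n)" using assms by (simp add: powr_real_of_int'[symmetric] powr_def mult.commute)
  thus ?thesis by (simp add: exp_of_real[symmetric])
qed

lemma struve_real_term_complex:
  assumes "x > 0"
  shows "of_real (struve_real_term \<sigma> \<nu> x n) = exp (of_real (ln x) * of_int n) * struve_term \<sigma> \<nu> (of_int n)"
proof -
  have "rGamma (of_int n + 3 / 2) = complex_of_real (rGamma (of_int n + 3 / 2))"
    "rGamma (of_real \<nu> + 3 / 2 - of_real \<sigma> * of_int n) = complex_of_real (rGamma (\<nu> + 3 / 2 - \<sigma> * of_int n))"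
    by (simp_all flip: rGamma_complex_of_real)
  thus ?thesis unfolding exp_ln_of_int[OF assms] struve_term_def struve_real_term_def by simp
qed

lemma real_struve_main: "struve_main \<sigma> \<nu> j (of_int n) \<in> \<real>" if "0 < \<sigma>" "\<sigma> < 1"
proof -
  have "rGamma (of_real (struve_kappa \<sigma>) * of_int n + of_real (1 - struve_theta \<nu>) + of_nat j) = complex_of_real (rGamma (struve_kappa \<sigma> * of_int n + (1 - struve_theta \<nu>) + real j))"
    by (simp flip: rGamma_complex_of_real)
  moreover have "exp (of_real (struve_rate \<sigma>) * of_int n) = complex_of_real (exp (struve_rate \<sigma> * of_int n))"
    by (simp flip: exp_of_real)
  ultimately show ?thesis unfolding struve_main_def struve_prefactor_exp[OF that] by (simp only:) (intro Reals_mult Reals_of_real)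
qed

lemma real_struve_ratio: "struve_ratio \<sigma> \<nu> (of_int n) \<in> \<real>"
proof -
  have "Gamma (of_real \<sigma> * of_int n - of_real \<nu> - 1 / 2) = complex_of_real (Gamma (\<sigma> * of_int n - \<nu> - 1 / 2))"
    "rGamma (of_int n + 3 / 2) = complex_of_real (rGamma (of_int n + 3 / 2))"
    by (simp_all flip: Gamma_complex_of_real rGamma_complex_of_real)
  thus ?thesis unfolding struve_ratio_def by (simp only:) (intro Reals_mult Reals_of_real)
qed

lemma struve_phase_Im:
  assumes "r \<in> \<real>" "x > 0"
  shows "exp (of_real (ln x) * of_int n) * (sin (of_real pi * (of_real \<sigma> * of_int n - of_real \<nu> - 1 / 2)) / of_real pi * r)
    = of_real (1 / pi * Im (struve_phase \<sigma> \<nu> (of_int n) * r * exp (of_real (ln x) * of_int n)))"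
proof -
  obtain r' where r: "r = of_real r'" using assms(1) by (auto elim: Reals_cases)
  define w where "w = pi * (\<sigma> * of_int n - \<nu> - 1 / 2)"
  have "struve_phase \<sigma> \<nu> (of_int n) = exp (\<i> * of_real w)"
    unfolding struve_phase_def w_def by (rule arg_cong[where f = exp]) simp
  hence "Im (struve_phase \<sigma> \<nu> (of_int n)) = sin w" by (simp add: Im_exp)
  moreover have "sin (of_real pi * (of_real \<sigma> * of_int n - of_real \<nu> - 1 / 2)) = complex_of_real (sin w)"
    by (simp add: w_def flip: sin_of_real)
  moreover define y where "y = x powi n"
  ultimately show ?thesis unfolding exp_ln_of_int[OF assms(2)] r y_def[symmetric] by simp
qed

text \<open>At n = -k - 1 the factor 1/\<Gamma>(n + 3/2) is 1/\<Gamma>(1/2 - k), which reflection at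
  1/2 + k turns into (-1)^k \<Gamma>(k + 1/2)/\<pi>.\<close>

lemma struve_H_first_term:
  assumes "x > 0"
  shows "1 / pi * ((- x) powi (- int k - 1) * Gamma (real k + 1 / 2) * rGamma (\<nu> + 3 / 2 + \<sigma> * (real k + 1)))
    = - struve_real_term \<sigma> \<nu> x (- int k - 1)"
proof -
  have "rGamma (1 / 2 + of_nat k) * rGamma (1 - (1 / 2 + of_nat k)) = sin (of_real pi * (1 / 2 + of_nat k)) / complex_of_real pi"
    by (rule rGamma_reflection_complex)
  hence "complex_of_real (rGamma (1 / 2 + real k) * rGamma (1 - (1 / 2 + real k))) = complex_of_real (sin (pi * (1 / 2 + real k)) / pi)"
    by (simp flip: rGamma_complex_of_real sin_of_real)
  hence refl: "rGamma (1 / 2 + real k) * rGamma (1 - (1 / 2 + real k)) = sin (pi * (1 / 2 + real k)) / pi"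
    by (simp only: of_real_eq_iff)
  have "sin (pi * (1 / 2 + real k)) = cos (pi * real k)"
    by (simp add: distrib_left sin_add)
  also have "\<dots> = (- 1) ^ k" by (simp add: mult.commute)
  finally have s: "sin (pi * (1 / 2 + real k)) = (- 1) ^ k" .
  have g: "rGamma (1 / 2 + real k) = 1 / Gamma (real k + 1 / 2)" by (simp add: rGamma_inverse_Gamma inverse_eq_divide add.commute)
  have "Gamma (real k + 1 / 2) > 0" by (intro Gamma_real_pos) (simp add: add_nonneg_pos)
  hence "Gamma (real k + 1 / 2) \<noteq> 0" by (rule less_imp_neq[THEN not_sym])
  hence "rGamma (1 / 2 - real k) = Gamma (real k + 1 / 2) * (1 / Gamma (real k + 1 / 2) * rGamma (1 - (1 / 2 + real k)))"
    by (simp only: mult.assoc[symmetric] times_divide_eq_right mult_1_right divide_self) simp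
  also have "\<dots> = (- 1) ^ k / pi * Gamma (real k + 1 / 2)" using refl unfolding s g by (simp only: mult.commute)
  finally have r: "rGamma (1 / 2 - real k) = (- 1) ^ k / pi * Gamma (real k + 1 / 2)" .
  have "(- x) powi (- int k - 1) = (- 1) powi (- int k - 1) * x powi (- int k - 1)"
    using power_int_mult_distrib[of "-1" x "- int k - 1"] by simp
  also have "(- 1 :: real) powi (- int k - 1) = - ((- 1) ^ k)"
    by (simp add: power_int_diff power_int_minus flip: power_inverse)
  finally have "(- x) powi (- int k - 1) = - ((- 1) ^ k) * x powi (- int k - 1)" .
  moreover have "of_int (- int k - 1) + 3 / 2 = 1 / 2 - real k" "\<nu> + 3 / 2 - \<sigma> * of_int (- int k - 1) = \<nu> + 3 / 2 + \<sigma> * (real k + 1)"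
    by (simp_all add: algebra_simps)
  ultimately show ?thesis unfolding struve_real_term_def by (simp only: r) simp
qed

text \<open>Starting the sum at m \<le> 0 adds the terms with indices from m to -1, which are minus
  the first -m terms of the first algebraic series.\<close>

lemma struve_series_shift:
  assumes x: "x > 0" and m: "m \<le> 0" and sum: "summable (\<lambda>k. struve_real_term \<sigma> \<nu> x (m + int k))"
  shows "struve_series \<sigma> \<nu> x - struve_H_trunc \<sigma> \<nu> (nat (- m)) P x
    = (\<Sum>k. struve_real_term \<sigma> \<nu> x (m + int k)) - 1 / \<sigma> * (\<Sum>k<P. x powr (- struve_k \<sigma> \<nu> k) / fact k * rGamma (3 / 2 - struve_k \<sigma> \<nu> k))"
proof -
  define K where "K = nat (- m)"
  have K: "m = - int K" using m by (simp add: K_def)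
  have "(\<Sum>k. struve_real_term \<sigma> \<nu> x (m + int k)) = struve_series \<sigma> \<nu> x + (\<Sum>i<K. struve_real_term \<sigma> \<nu> x (m + int i))"
    using suminf_split_initial_segment[OF sum, of K] by (simp add: K struve_series_altdef)
  also have "(\<Sum>i<K. struve_real_term \<sigma> \<nu> x (m + int i)) = (\<Sum>i<K. struve_real_term \<sigma> \<nu> x (- int i - 1))"
  proof -
    have "(\<Sum>i<K. struve_real_term \<sigma> \<nu> x (m + int i)) = (\<Sum>i<K. struve_real_term \<sigma> \<nu> x (- int (K - Suc i) - 1))"
      by (intro sum.cong refl arg_cong[where f = "struve_real_term \<sigma> \<nu> x"]) (simp add: K of_nat_diff)
    also have "\<dots> = (\<Sum>i<K. struve_real_term \<sigma> \<nu> x (- int i - 1))" by (rule sum.nat_diff_reindex)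
    finally show ?thesis .
  qed
  finally have "(\<Sum>k. struve_real_term \<sigma> \<nu> x (m + int k)) = struve_series \<sigma> \<nu> x + (\<Sum>i<K. struve_real_term \<sigma> \<nu> x (- int i - 1))" .
  moreover have "1 / pi * (\<Sum>k<K. (- x) powi (- int k - 1) * Gamma (real k + 1 / 2) * rGamma (\<nu> + 3 / 2 + \<sigma> * (real k + 1))) = - (\<Sum>i<K. struve_real_term \<sigma> \<nu> x (- int i - 1))"
    unfolding sum_distrib_left struve_H_first_term[OF x] by (simp add: sum_negf)
  ultimately show ?thesis unfolding struve_H_trunc_def K_def[symmetric] by simp
qed

text \<open>Imaginary parts divided by \<pi> turn the Mittag-Leffler limits of the M main terms into
  the truncated exponential expansion, with an error of order x^(m - 1/2).\<close>

lemma struve_main_sum_E: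
  fixes m :: int and M :: nat and \<sigma> \<nu> :: real
  assumes \<sigma>: "0 < \<sigma>" "\<sigma> \<le> 1 / 3"
  defines "f \<equiv> \<lambda>x k. struve_phase \<sigma> \<nu> (of_int (m + int k)) * (\<Sum>j<M. struve_main \<sigma> \<nu> j (of_int (m + int k))) * exp (of_real (ln x) * of_int (m + int k))"
  shows "\<exists>K. \<forall>x>0. struve_X \<sigma> x \<ge> 1 \<longrightarrow> summable (f x) \<and>
    \<bar>1 / pi * Im (\<Sum>k. f x k) - struve_E_trunc \<sigma> \<nu> M x\<bar> \<le> K * exp ((real_of_int m - 1 / 2) * ln x)"
proof -
  define u where "u = (\<lambda>j x k. struve_phase \<sigma> \<nu> (of_int (m + int k)) * struve_main \<sigma> \<nu> j (of_int (m + int k)) * exp (of_real (ln x) * of_int (m + int k)))"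
  define e where "e = (\<lambda>j x. of_real (struve_A0 \<sigma> \<nu> * struve_coeff \<sigma> \<nu> j) * exp (- \<i> * of_real (pi * (\<nu> + 1 / 2)))
       * exp (of_real (struve_theta \<nu> - real j) * (of_real (ln (struve_X \<sigma> x)) + \<i> * of_real (pi * \<sigma> / struve_kappa \<sigma>)) + exp (of_real (ln (struve_X \<sigma> x)) + \<i> * of_real (pi * \<sigma> / struve_kappa \<sigma>))))"
  have "\<exists>K. \<forall>x>0. struve_X \<sigma> x \<ge> 1 \<longrightarrow> summable (u j x) \<and> norm ((\<Sum>k. u j x k) - e j x) \<le> K * exp ((real_of_int m - 1 / 2) * ln x)" for j
    using struve_main_sum[OF \<sigma>, of \<nu> m j] unfolding u_def e_def .
  then obtain K where K: "\<And>j x. x > 0 \<Longrightarrow> struve_X \<sigma> x \<ge> 1 \<Longrightarrow> summable (u j x)"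
    "\<And>j x. x > 0 \<Longrightarrow> struve_X \<sigma> x \<ge> 1 \<Longrightarrow> norm ((\<Sum>k. u j x k) - e j x) \<le> K j * exp ((real_of_int m - 1 / 2) * ln x)"
    by metis
  show ?thesis
  proof (intro exI[of _ "\<Sum>j<M. K j"] allI impI conjI)
    fix x :: real assume x: "x > 0" "struve_X \<sigma> x \<ge> 1"
    have f: "f x = (\<lambda>k. \<Sum>j<M. u j x k)" by (rule ext) (simp add: f_def u_def sum_distrib_left sum_distrib_right)
    show "summable (f x)" unfolding f using K(1)[OF x] by (intro summable_sum)
    have sf: "(\<Sum>k. f x k) = (\<Sum>j<M. \<Sum>k. u j x k)" unfolding f by (rule suminf_sum) (rule K(1)[OF x])
    have E: "struve_E_trunc \<sigma> \<nu> M x = 1 / pi * Im (\<Sum>j<M. e j x)"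
      unfolding e_def using \<sigma> x by (intro struve_E_trunc_eq) auto
    have "1 / pi * Im (\<Sum>k. f x k) - struve_E_trunc \<sigma> \<nu> M x = 1 / pi * Im (\<Sum>j<M. (\<Sum>k. u j x k) - e j x)"
      unfolding sf E sum_subtractf by (simp add: right_diff_distrib)
    also have "\<bar>\<dots>\<bar> \<le> 1 * norm (\<Sum>j<M. (\<Sum>k. u j x k) - e j x)"
      unfolding abs_mult using pi_gt3 by (intro mult_mono abs_Im_le_cmod) auto
    also have "\<dots> \<le> (\<Sum>j<M. K j * exp ((real_of_int m - 1 / 2) * ln x))"
      unfolding mult_1 by (intro sum_norm_le K(2)[OF x])
    finally show "\<bar>1 / pi * Im (\<Sum>k. f x k) - struve_E_trunc \<sigma> \<nu> M x\<bar> \<le> (\<Sum>j<M. K j) * exp ((real_of_int m - 1 / 2) * ln x)"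
      by (simp add: sum_distrib_right)
  qed
qed

section \<open>The series in the three ranges of \<sigma>\<close>

lemma complex_suminf_of_real:
  assumes "summable (\<lambda>k. complex_of_real (f k))"
  shows "summable f" "(\<Sum>k. complex_of_real (f k)) = of_real (\<Sum>k. f k)"
proof -
  show s: "summable f" using assms by (simp add: summable_complex_of_real)
  show "(\<Sum>k. complex_of_real (f k)) = of_real (\<Sum>k. f k)" by (rule suminf_of_real[OF s, symmetric])
qed

lemma Im_summable:
  assumes "summable f"
  shows "summable (\<lambda>k. Im (f k))" "(\<Sum>k. Im (f k)) = Im (\<Sum>k. f k)"
  using sums_Im[OF summable_sums[OF assms]] by (auto simp: sums_iff)

text \<open>With M = 0 nothing is subtracted, and the function G of
  \<open>struve_residue_sum\<close> is \<open>struve_term\<close> itself.\<close>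

lemma struve_series_above_third:
  fixes m :: int
  assumes \<sigma>: "1 / 3 < \<sigma>" "\<sigma> < 1" and m: "m \<le> 0"
    and P: "\<And>k. k < P \<Longrightarrow> - struve_k \<sigma> \<nu> k > real_of_int m - 1 / 2" "\<And>k. k \<ge> P \<Longrightarrow> - struve_k \<sigma> \<nu> k < real_of_int m - 1 / 2"
  shows "\<exists>C. \<forall>x>0. \<bar>struve_series \<sigma> \<nu> x - struve_H_trunc \<sigma> \<nu> (nat (- m)) P x\<bar> \<le> C * exp (ln x * (real_of_int m - 1 / 2))"
proof -
  have M: "\<sigma> = 1 / 3 \<Longrightarrow> struve_kappa \<sigma> * (real_of_int m - 1 / 2) + (1 - struve_theta \<nu> + real 0) \<ge> 5 / 2" using \<sigma>(1) by linarith
  from struve_residue_sum[OF less_imp_le[OF \<sigma>(1)] \<sigma>(2) M P, unfolded lessThan_0 sum.empty mult_zero_right diff_zero]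
  obtain C where C: "\<forall>p. summable (\<lambda>k. exp (of_real p * of_int (m + int k)) * struve_term \<sigma> \<nu> (of_int (m + int k))) \<and>
    norm ((\<Sum>k. exp (of_real p * of_int (m + int k)) * struve_term \<sigma> \<nu> (of_int (m + int k)))
      - of_real (1 / \<sigma> * (\<Sum>k<P. exp (p * (- struve_k \<sigma> \<nu> k)) / fact k * rGamma (3 / 2 - struve_k \<sigma> \<nu> k)))) \<le> C * exp (p * (real_of_int m - 1 / 2))" ..
  note C = conjunct1[OF spec[OF C]] conjunct2[OF spec[OF C]]
  show ?thesis
  proof (intro exI[of _ C] allI impI)
    fix x :: real assume x: "x > 0"
    note s = complex_suminf_of_real[of "\<lambda>k. struve_real_term \<sigma> \<nu> x (m + int k)", unfolded struve_real_term_complex[OF x], OF C(1)]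
    have e: "complex_of_real (struve_series \<sigma> \<nu> x - struve_H_trunc \<sigma> \<nu> (nat (- m)) P x) =
       (\<Sum>k. exp (of_real (ln x) * of_int (m + int k)) * struve_term \<sigma> \<nu> (of_int (m + int k)))
      - of_real (1 / \<sigma> * (\<Sum>k<P. exp (ln x * (- struve_k \<sigma> \<nu> k)) / fact k * rGamma (3 / 2 - struve_k \<sigma> \<nu> k)))"
      unfolding struve_series_shift[OF x m s(1)] s(2) of_real_diff using x by (simp add: powr_def mult.commute)
    have "\<bar>struve_series \<sigma> \<nu> x - struve_H_trunc \<sigma> \<nu> (nat (- m)) P x\<bar> = norm (complex_of_real (struve_series \<sigma> \<nu> x - struve_H_trunc \<sigma> \<nu> (nat (- m)) P x))"
      by (simp only: norm_of_real)
    also have "\<dots> \<le> C * exp (ln x * (real_of_int m - 1 / 2))" unfolding e by (rule C(2))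
    finally show "\<bar>struve_series \<sigma> \<nu> x - struve_H_trunc \<sigma> \<nu> (nat (- m)) P x\<bar> \<le> C * exp (ln x * (real_of_int m - 1 / 2))" .
  qed
qed

text \<open>The series is the sum over G, evaluated by residues, plus the imaginary parts of the
  main terms, evaluated by \<open>struve_main_sum_E\<close>, which includes the limiting case \<psi>
  = \<pi>/2.\<close>

lemma struve_series_third:
  fixes m :: int
  assumes \<sigma>: "\<sigma> = 1 / 3" and m: "m \<le> 0" and M: "struve_kappa \<sigma> * (real_of_int m - 1 / 2) + (1 - struve_theta \<nu> + real M) \<ge> 5 / 2"
    and P: "\<And>k. k < P \<Longrightarrow> - struve_k \<sigma> \<nu> k > real_of_int m - 1 / 2" "\<And>k. k \<ge> P \<Longrightarrow> - struve_k \<sigma> \<nu> k < real_of_int m - 1 / 2"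
  shows "\<exists>C. \<forall>x>0. struve_X \<sigma> x \<ge> 1 \<longrightarrow>
    \<bar>struve_series \<sigma> \<nu> x - (struve_E_trunc \<sigma> \<nu> M x + struve_H_trunc \<sigma> \<nu> (nat (- m)) P x)\<bar> \<le> C * exp (ln x * (real_of_int m - 1 / 2))"
proof -
  have \<sigma>': "0 < \<sigma>" "\<sigma> < 1" "1 / 3 \<le> \<sigma>" "\<sigma> \<le> 1 / 3" using \<sigma> by auto
  define main where "main = (\<lambda>s. \<Sum>j<M. struve_main \<sigma> \<nu> j s)"
  define G where "G = (\<lambda>s. struve_term \<sigma> \<nu> s - sin (of_real pi * (of_real \<sigma> * s - of_real \<nu> - 1 / 2)) / of_real pi * main s)"
  define S where "S = (\<lambda>p. 1 / \<sigma> * (\<Sum>k<P. exp (p * (- struve_k \<sigma> \<nu> k)) / fact k * rGamma (3 / 2 - struve_k \<sigma> \<nu> k)))"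
  have ex: "\<exists>C. \<forall>p. summable (\<lambda>k. exp (of_real p * of_int (m + int k)) * G (of_int (m + int k))) \<and>
    norm ((\<Sum>k. exp (of_real p * of_int (m + int k)) * G (of_int (m + int k))) - of_real (S p)) \<le> C * exp (p * (real_of_int m - 1 / 2))"
    unfolding G_def main_def S_def by (rule struve_residue_sum[OF \<sigma>'(3,2) M P])
  obtain C where C: "\<forall>p. summable (\<lambda>k. exp (of_real p * of_int (m + int k)) * G (of_int (m + int k))) \<and>
    norm ((\<Sum>k. exp (of_real p * of_int (m + int k)) * G (of_int (m + int k))) - of_real (S p)) \<le> C * exp (p * (real_of_int m - 1 / 2))"
    by (rule exE[OF ex])
  note C = conjunct1[OF spec[OF C]] conjunct2[OF spec[OF C]]
  define f where "f = (\<lambda>x k. struve_phase \<sigma> \<nu> (of_int (m + int k)) * main (of_int (m + int k)) * exp (of_real (ln x) * of_int (m + int k)))"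
  have exK: "\<exists>K. \<forall>x>0. struve_X \<sigma> x \<ge> 1 \<longrightarrow> summable (f x) \<and>
    \<bar>1 / pi * Im (\<Sum>k. f x k) - struve_E_trunc \<sigma> \<nu> M x\<bar> \<le> K * exp ((real_of_int m - 1 / 2) * ln x)"
    unfolding f_def main_def by (rule struve_main_sum_E[OF \<sigma>'(1,4)])
  obtain K where K: "\<forall>x>0. struve_X \<sigma> x \<ge> 1 \<longrightarrow> summable (f x) \<and>
    \<bar>1 / pi * Im (\<Sum>k. f x k) - struve_E_trunc \<sigma> \<nu> M x\<bar> \<le> K * exp ((real_of_int m - 1 / 2) * ln x)"
    by (rule exE[OF exK])
  note K = conjunct1[OF K[rule_format]] conjunct2[OF K[rule_format]]
  show ?thesis
  proof (intro exI[of _ "C + K"] allI impI)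
    fix x :: real assume x: "x > 0" "struve_X \<sigma> x \<ge> 1"
    define g where "g = (\<lambda>k. exp (of_real (ln x) * of_int (m + int k)) * G (of_int (m + int k)))"
    define h where "h = (\<lambda>k. 1 / pi * Im (f x k))"
    have mr: "main (of_int n) \<in> \<real>" for n unfolding main_def using real_struve_main[OF \<sigma>'(1,2)] by (intro sum_in_Reals) auto
    have t: "complex_of_real (struve_real_term \<sigma> \<nu> x (m + int k)) = g k + of_real (h k)" for k
    proof -
      have "of_real (h k) = exp (of_real (ln x) * of_int (m + int k)) * (sin (of_real pi * (of_real \<sigma> * of_int (m + int k) - of_real \<nu> - 1 / 2)) / of_real pi * main (of_int (m + int k)))"
        unfolding h_def f_def by (rule struve_phase_Im[OF mr x(1), symmetric])
      thus ?thesis unfolding struve_real_term_complex[OF x(1)] g_def G_def by (simp only: right_diff_distrib diff_add_cancel)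
    qed
    have sh: "summable h" "(\<Sum>k. h k) = 1 / pi * Im (\<Sum>k. f x k)"
      using Im_summable[OF K(1)[OF x]] unfolding h_def by (simp_all add: summable_mult suminf_mult del: times_divide_eq_left mult_1)
    have sg: "summable g" using C(1)[of "ln x"] by (simp add: g_def)
    have sh': "summable (\<lambda>k. complex_of_real (h k))" using sh by (simp add: summable_complex_of_real)
    have st: "summable (\<lambda>k. complex_of_real (struve_real_term \<sigma> \<nu> x (m + int k)))"
      "(\<Sum>k. complex_of_real (struve_real_term \<sigma> \<nu> x (m + int k))) = (\<Sum>k. g k) + of_real (\<Sum>k. h k)"
      unfolding t suminf_of_real[OF sh(1)] by (intro summable_add sg sh') (intro suminf_add[symmetric] sg sh')
    note s = complex_suminf_of_real[OF st(1)]
    have "of_real (struve_series \<sigma> \<nu> x - struve_H_trunc \<sigma> \<nu> (nat (- m)) P x) = of_real (\<Sum>k. struve_real_term \<sigma> \<nu> x (m + int k)) - complex_of_real (S (ln x))"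
      unfolding struve_series_shift[OF x(1) m s(1)] S_def using x by (simp add: powr_def mult.commute)
    also have "\<dots> = ((\<Sum>k. g k) - of_real (S (ln x))) + of_real (1 / pi * Im (\<Sum>k. f x k))"
      unfolding s(2)[symmetric] st(2) sh(2) by simp
    finally have "of_real (struve_series \<sigma> \<nu> x - (struve_E_trunc \<sigma> \<nu> M x + struve_H_trunc \<sigma> \<nu> (nat (- m)) P x))
      = ((\<Sum>k. g k) - of_real (S (ln x))) + complex_of_real (1 / pi * Im (\<Sum>k. f x k) - struve_E_trunc \<sigma> \<nu> M x)"
      by (simp add: algebra_simps)
    hence "\<bar>struve_series \<sigma> \<nu> x - (struve_E_trunc \<sigma> \<nu> M x + struve_H_trunc \<sigma> \<nu> (nat (- m)) P x)\<bar>
       = norm (((\<Sum>k. g k) - of_real (S (ln x))) + complex_of_real (1 / pi * Im (\<Sum>k. f x k) - struve_E_trunc \<sigma> \<nu> M x))"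
      by (metis norm_of_real)
    also have "\<dots> \<le> norm ((\<Sum>k. g k) - of_real (S (ln x))) + norm (complex_of_real (1 / pi * Im (\<Sum>k. f x k) - struve_E_trunc \<sigma> \<nu> M x))"
      by (rule norm_triangle_ineq)
    also have "\<dots> \<le> C * exp (ln x * (real_of_int m - 1 / 2)) + K * exp ((real_of_int m - 1 / 2) * ln x)"
      unfolding norm_of_real g_def by (intro add_mono C(2) K(2) x)
    finally show "\<bar>struve_series \<sigma> \<nu> x - (struve_E_trunc \<sigma> \<nu> M x + struve_H_trunc \<sigma> \<nu> (nat (- m)) P x)\<bar> \<le> (C + K) * exp (ln x * (real_of_int m - 1 / 2))"
      by (simp add: algebra_simps)
  qed
qed

text \<open>The terms below m are kept in the statement. Being finitely many powers of x, they are
  absorbed later by the growing exponential error term.\<close>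

lemma struve_series_below_third:
  assumes \<sigma>: "0 < \<sigma>" "\<sigma> < 1 / 3"
  shows "\<exists>(m::nat) C x0. \<forall>x\<ge>x0. \<bar>struve_series \<sigma> \<nu> x - struve_E_trunc \<sigma> \<nu> (M + 2) x - (\<Sum>n<m. struve_real_term \<sigma> \<nu> x (int n))\<bar>
    \<le> C * (exp (ln x * (real m - 1 / 2)) + struve_X \<sigma> x powr (struve_theta \<nu> - real M) * exp (struve_X \<sigma> x * cos (pi * \<sigma> / struve_kappa \<sigma>)))"
proof -
  have \<sigma>': "\<sigma> < 1" "\<sigma> \<le> 1 / 3" using \<sigma> by auto
  define W where "W = (\<lambda>x. struve_X \<sigma> x powr (struve_theta \<nu> - real M) * exp (struve_X \<sigma> x * cos (pi * \<sigma> / struve_kappa \<sigma>)))"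
  define r where "r = (\<lambda>m0 x k. struve_phase \<sigma> \<nu> (of_int (m0 + int k)) * struve_rem \<sigma> \<nu> (M + 2) (of_int (m0 + int k)) * exp (of_real (ln x) * of_int (m0 + int k)))"
  have ex: "\<exists>m::int. m \<ge> 0 \<and> of_int m > (\<nu> + 1 / 2) / \<sigma> \<and> (\<exists>K x0. \<forall>x\<ge>x0. summable (r m x) \<and>
      norm (\<Sum>k. r m x k) \<le> K * (exp ((real_of_int m - 1 / 2) * ln x) + W x))"
    unfolding r_def W_def by (rule struve_rem_sum_below_third[OF \<sigma>])
  obtain m0 :: int and C x0 where m0: "m0 \<ge> 0" "of_int m0 > (\<nu> + 1 / 2) / \<sigma>" and
    C: "\<forall>x\<ge>x0. summable (r m0 x) \<and> norm (\<Sum>k. r m0 x k) \<le> C * (exp ((real_of_int m0 - 1 / 2) * ln x) + W x)"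
    using ex by (elim exE conjE) (rule that)
  note C = conjunct1[OF C[rule_format]] conjunct2[OF C[rule_format]]
  define m where "m = nat m0"
  have m: "m0 = int m" using m0 by (simp add: m_def)
  define main where "main = (\<lambda>s. \<Sum>j<M + 2. struve_main \<sigma> \<nu> j s)"
  define f where "f = (\<lambda>x k. struve_phase \<sigma> \<nu> (of_int (m0 + int k)) * main (of_int (m0 + int k)) * exp (of_real (ln x) * of_int (m0 + int k)))"
  have exK: "\<exists>K. \<forall>x>0. struve_X \<sigma> x \<ge> 1 \<longrightarrow> summable (f x) \<and>
    \<bar>1 / pi * Im (\<Sum>k. f x k) - struve_E_trunc \<sigma> \<nu> (M + 2) x\<bar> \<le> K * exp ((real_of_int m0 - 1 / 2) * ln x)"
    unfolding f_def main_def by (rule struve_main_sum_E[OF \<sigma>(1) \<sigma>'(2)])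
  obtain K where K: "\<forall>x>0. struve_X \<sigma> x \<ge> 1 \<longrightarrow> summable (f x) \<and>
    \<bar>1 / pi * Im (\<Sum>k. f x k) - struve_E_trunc \<sigma> \<nu> (M + 2) x\<bar> \<le> K * exp ((real_of_int m0 - 1 / 2) * ln x)"
    by (rule exE[OF exK])
  note K = conjunct1[OF K[rule_format]] conjunct2[OF K[rule_format]]
  have X1: "struve_X \<sigma> x \<ge> 1" if "x \<ge> exp (- struve_rate \<sigma>)" for x
  proof -
    have x: "x > 0" using that exp_gt_zero[of "- struve_rate \<sigma>"] by linarith
    hence "- struve_rate \<sigma> \<le> ln x" using that by (simp add: ln_ge_iff)
    hence "struve_kappa \<sigma> * ln (struve_X \<sigma> x) \<ge> 0" unfolding ln_struve_X[OF \<sigma>(1) \<sigma>'(1) x] by simp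
    hence "ln (struve_X \<sigma> x) \<ge> 0" using \<sigma>' by (simp add: struve_kappa_def zero_le_mult_iff)
    thus ?thesis using struve_X_pos[OF \<sigma>(1) \<sigma>'(1) x] by simp
  qed
  show ?thesis
  proof (rule exI[of _ m], rule exI[of _ "C + \<bar>K\<bar>"], rule exI[of _ "max x0 (exp (- struve_rate \<sigma>))"], intro allI impI)
    fix x :: real assume x': "x \<ge> max x0 (exp (- struve_rate \<sigma>))"
    have x: "x \<ge> x0" "struve_X \<sigma> x \<ge> 1" using x' X1 by auto
    have x0: "x > 0" using x' exp_gt_zero[of "- struve_rate \<sigma>"] by linarith
    have t: "struve_real_term \<sigma> \<nu> x (m0 + int k) = 1 / pi * Im (r m0 x k) + 1 / pi * Im (f x k)" for k
    proof -
      define n where "n = m0 + int k"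
      have "(\<nu> + 1 / 2) / \<sigma> < of_int n" using m0 by (simp add: n_def)
      hence nu: "\<nu> + 1 / 2 < \<sigma> * of_int n" using \<sigma> by (simp add: pos_divide_less_eq mult.commute)
      have "of_real \<sigma> * of_int n - of_real \<nu> - 1 / 2 \<notin> (\<int>\<^sub>\<le>\<^sub>0 :: complex set)"
      proof
        assume "of_real \<sigma> * of_int n - of_real \<nu> - 1 / 2 \<in> (\<int>\<^sub>\<le>\<^sub>0 :: complex set)"
        then obtain i where "of_real \<sigma> * of_int n - of_real \<nu> - 1 / 2 = - complex_of_nat i" by (auto elim: nonpos_Ints_cases')
        hence "Re (of_real \<sigma> * of_int n - of_real \<nu> - 1 / 2) = - real i" by simp
        thus False using nu by simp
      qed
      from struve_term_eq[OF this] have "complex_of_real (struve_real_term \<sigma> \<nu> x n) = exp (of_real (ln x) * of_int n) * (sin (of_real pi * (of_real \<sigma> * of_int n - of_real \<nu> - 1 / 2)) / of_real pi * struve_ratio \<sigma> \<nu> (of_int n))"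
        unfolding struve_real_term_complex[OF x0] by simp
      also have "\<dots> = of_real (1 / pi * Im (struve_phase \<sigma> \<nu> (of_int n) * struve_ratio \<sigma> \<nu> (of_int n) * exp (of_real (ln x) * of_int n)))"
        by (rule struve_phase_Im[OF real_struve_ratio x0])
      finally have "struve_real_term \<sigma> \<nu> x n = 1 / pi * Im (struve_phase \<sigma> \<nu> (of_int n) * struve_ratio \<sigma> \<nu> (of_int n) * exp (of_real (ln x) * of_int n))"
        by (simp only: of_real_eq_iff)
      also have "struve_phase \<sigma> \<nu> (of_int n) * struve_ratio \<sigma> \<nu> (of_int n) * exp (of_real (ln x) * of_int n) = r m0 x k + f x k"
        unfolding r_def f_def n_def[symmetric] struve_rem_def main_def by (simp add: algebra_simps)
      finally show ?thesis by (simp add: n_def distrib_left)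
    qed
    have sr: "summable (r m0 x)" by (rule C(1)[OF x(1)])
    have sf: "summable (f x)" by (rule K(1)[OF x0 x(2)])
    have st: "(\<lambda>k. struve_real_term \<sigma> \<nu> x (m0 + int k)) sums (1 / pi * Im (\<Sum>k. r m0 x k) + 1 / pi * Im (\<Sum>k. f x k))"
      unfolding t by (intro sums_add sums_mult sums_Im summable_sums sr sf)
    hence st': "(\<lambda>k. struve_real_term \<sigma> \<nu> x (int (k + m))) sums (1 / pi * Im (\<Sum>k. r m0 x k) + 1 / pi * Im (\<Sum>k. f x k))"
      by (simp add: m add.commute)
    have "struve_series \<sigma> \<nu> x = 1 / pi * Im (\<Sum>k. r m0 x k) + 1 / pi * Im (\<Sum>k. f x k) + (\<Sum>n<m. struve_real_term \<sigma> \<nu> x (int n))"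
      unfolding struve_series_altdef using st' by (subst (asm) sums_iff_shift) (simp add: sums_iff)
    hence "\<bar>struve_series \<sigma> \<nu> x - struve_E_trunc \<sigma> \<nu> (M + 2) x - (\<Sum>n<m. struve_real_term \<sigma> \<nu> x (int n))\<bar>
       = \<bar>1 / pi * Im (\<Sum>k. r m0 x k) + (1 / pi * Im (\<Sum>k. f x k) - struve_E_trunc \<sigma> \<nu> (M + 2) x)\<bar>" by simp
    also have "\<dots> \<le> \<bar>1 / pi * Im (\<Sum>k. r m0 x k)\<bar> + \<bar>1 / pi * Im (\<Sum>k. f x k) - struve_E_trunc \<sigma> \<nu> (M + 2) x\<bar>" by (rule abs_triangle_ineq)
    also have "\<bar>1 / pi * Im (\<Sum>k. r m0 x k)\<bar> \<le> 1 * norm (\<Sum>k. r m0 x k)"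
      unfolding abs_mult using pi_gt3 by (intro mult_mono abs_Im_le_cmod) auto
    also have "1 * norm (\<Sum>k. r m0 x k) \<le> C * (exp ((real_of_int m0 - 1 / 2) * ln x) + W x)" using C(2)[OF x(1)] by simp
    also have "\<bar>1 / pi * Im (\<Sum>k. f x k) - struve_E_trunc \<sigma> \<nu> (M + 2) x\<bar> \<le> K * exp ((real_of_int m0 - 1 / 2) * ln x)" by (rule K(2)[OF x0 x(2)])
    also have "K * exp ((real_of_int m0 - 1 / 2) * ln x) \<le> \<bar>K\<bar> * (exp ((real_of_int m0 - 1 / 2) * ln x) + W x)"
      by (intro mult_mono) (auto simp: W_def)
    finally show "\<bar>struve_series \<sigma> \<nu> x - struve_E_trunc \<sigma> \<nu> (M + 2) x - (\<Sum>n<m. struve_real_term \<sigma> \<nu> x (int n))\<bar>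
      \<le> (C + \<bar>K\<bar>) * (exp (ln x * (real m - 1 / 2)) + struve_X \<sigma> x powr (struve_theta \<nu> - real M) * exp (struve_X \<sigma> x * cos (pi * \<sigma> / struve_kappa \<sigma>)))"
      by (simp add: W_def m algebra_simps)
  qed
qed

text \<open>The poles have spacing \<open>1/\<sigma> > 1\<close>, so one of two consecutive half-integers is not a pole.\<close>

lemma struve_half_integer_between_poles:
  fixes A :: real
  assumes \<sigma>: "0 < \<sigma>" "\<sigma> < 1"
  obtains m :: int and P :: nat where "m \<le> 0" "real_of_int m - 1 / 2 \<le> A"
    "\<And>k. k < P \<Longrightarrow> - struve_k \<sigma> \<nu> k > real_of_int m - 1 / 2" "\<And>k. k \<ge> P \<Longrightarrow> - struve_k \<sigma> \<nu> k < real_of_int m - 1 / 2"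
proof -
  define q where "q = (\<lambda>k. - struve_k \<sigma> \<nu> k)"
  have q: "q i - q j = (real j - real i) / \<sigma>" for i j
    using \<sigma> by (simp add: q_def struve_k_def field_simps)
  have sep: "1 < \<bar>q i - q j\<bar>" if "i \<noteq> j" for i j
  proof -
    have "1 \<le> \<bar>real j - real i\<bar>" using that by linarith
    hence "1 / \<sigma> \<le> \<bar>q i - q j\<bar>" using \<sigma> unfolding q abs_divide by (intro divide_mono) auto
    moreover have "1 < 1 / \<sigma>" using \<sigma> by simp
    ultimately show ?thesis by linarith
  qed
  define m0 where "m0 = min 0 \<lfloor>A\<rfloor>"
  have m0: "m0 \<le> 0" "real_of_int m0 \<le> A" unfolding m0_def by linarith+
  obtain m where m: "m \<le> m0" "\<And>k. q k \<noteq> real_of_int m - 1 / 2"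
  proof (cases "\<forall>k. q k \<noteq> real_of_int m0 - 1 / 2")
    case True thus ?thesis using that[of m0] by blast
  next
    case False
    then obtain i where i: "q i = real_of_int m0 - 1 / 2" by blast
    show ?thesis
    proof (rule that[of "m0 - 1"])
      fix k show "q k \<noteq> real_of_int (m0 - 1) - 1 / 2" using sep[of i k] i by (cases "i = k") auto
    qed simp
  qed
  define a where "a = real_of_int m - 1 / 2"
  obtain n :: nat where "real n > q 0 - a" using reals_Archimedean2 by blast
  moreover have "real n \<le> real n / \<sigma>" using \<sigma> by (simp add: pos_le_divide_eq mult_left_le)
  moreover have "q 0 - q n = real n / \<sigma>" by (simp add: q)
  ultimately have ex: "q n < a" by linarith
  define P where "P = (LEAST n. q n < a)"
  have P: "q P < a" unfolding P_def using ex by (rule LeastI)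
  show ?thesis
  proof (rule that[of m P])
    show "- struve_k \<sigma> \<nu> k > real_of_int m - 1 / 2" if "k < P" for k
      using not_less_Least[of k "\<lambda>n. q n < a"] that m(2)[of k] by (auto simp: P_def q_def a_def)
    show "- struve_k \<sigma> \<nu> k < real_of_int m - 1 / 2" if "k \<ge> P" for k
    proof -
      have "q P - q k \<ge> 0" unfolding q using that \<sigma> by simp
      thus ?thesis using P by (simp add: q_def a_def)
    qed
  qed (use m m0 in auto)
qed

section \<open>Comparison of the scales x and X\<close>

lemma bigo_nonneg_mono:
  fixes f :: "real \<Rightarrow> real"
  assumes "f \<in> O[F](g)" "eventually (\<lambda>x. \<bar>g x\<bar> \<le> h x) F"
  shows "f \<in> O[F](h)"
proof (rule landau_o.big_trans[OF assms(1)])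
  show "g \<in> O[F](h)"
    by (rule bigoI[of _ 1]) (use assms(2) in eventually_elim, auto)
qed

lemma bigo_eventually_eq:
  fixes f f' g g' :: "real \<Rightarrow> real"
  assumes "f \<in> O[F](g)" "eventually (\<lambda>x. f x = f' x) F" "eventually (\<lambda>x. g x = g' x) F"
  shows "f' \<in> O[F](g')"
  using iffD1[OF landau_o.big.in_cong[OF assms(2)] assms(1)] unfolding landau_o.big.cong[OF assms(3)] .

lemma bigo_cmult:
  fixes f g :: "real \<Rightarrow> real"
  shows "f \<in> O[F](g) \<Longrightarrow> (\<lambda>x. c * f x) \<in> O[F](g)"
  by (cases "c = 0") auto

lemma filterlim_struve_X:
  assumes "0 < \<sigma>" "\<sigma> < 1"
  shows "filterlim (struve_X \<sigma>) at_top at_top"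
proof -
  define k where "k = struve_kappa \<sigma>"
  have k: "k > 0" using assms by (simp add: k_def struve_kappa_def)
  have "filterlim (\<lambda>x. (struve_rate \<sigma> + ln x) * (1 / k)) at_top at_top"
    using k by (intro filterlim_at_top_mult_tendsto_pos[OF tendsto_const]
      filterlim_tendsto_add_at_top[OF tendsto_const ln_at_top]) auto
  from filterlim_compose[OF exp_at_top this]
  have X: "filterlim (\<lambda>x. exp ((struve_rate \<sigma> + ln x) * (1 / k))) at_top at_top" .
  have ev: "\<forall>\<^sub>F x in at_top. exp ((struve_rate \<sigma> + ln x) * (1 / k)) = struve_X \<sigma> x"
    using eventually_gt_at_top[of 0]
  proof eventually_elim
    case (elim x)
    have "(struve_rate \<sigma> + ln x) * (1 / k) = ln (struve_X \<sigma> x)"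
      using k ln_struve_X[OF assms elim] by (simp add: k_def field_simps)
    thus ?case using struve_X_pos[OF assms elim] by simp
  qed
  show ?thesis by (rule iffD1[OF filterlim_cong[OF refl refl ev] X])
qed

lemma powr_eq_struve_X_powr:
  assumes "0 < \<sigma>" "\<sigma> < 1" "x > 0"
  shows "x powr q = exp (- q * struve_rate \<sigma>) * struve_X \<sigma> x powr (struve_kappa \<sigma> * q)"
proof -
  have "q * ln x = - q * struve_rate \<sigma> + q * (struve_kappa \<sigma> * ln (struve_X \<sigma> x))"
    unfolding ln_struve_X[OF assms] by (simp add: algebra_simps)
  thus ?thesis using assms(3) struve_X_pos[OF assms] by (simp add: powr_def exp_add[symmetric] mult_ac)
qed

lemma powr_le_exp_linear:
  fixes c p :: real
  assumes c: "c > 0"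
  shows "\<exists>K. \<forall>y\<ge>1. y powr p \<le> K * exp (y * c)"
proof -
  \<comment> \<open>This choice gives |p| e \<le> c, so |p| ln y stays below c y up to a
    constant.\<close>
  define e where "e = c / (\<bar>p\<bar> + 1)"
  have e: "e > 0" using c by (simp add: e_def add_nonneg_pos)
  have pe: "\<bar>p\<bar> * e \<le> c" using c by (simp add: e_def pos_divide_le_eq add_nonneg_pos algebra_simps)
  define K where "K = \<bar>p\<bar> * (- 1 - ln e)"
  show ?thesis
  proof (intro exI[of _ "exp K"] allI impI)
    fix y :: real assume y: "y \<ge> 1"
    have "ln (e * y) \<le> e * y - 1" using e y by (intro ln_le_minus_one) auto
    hence "ln y \<le> e * y + (- 1 - ln e)" using e y by (simp add: ln_mult_pos)
    hence "\<bar>p\<bar> * ln y \<le> \<bar>p\<bar> * (e * y + (- 1 - ln e))" by (intro mult_left_mono) auto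
    also have "\<dots> = \<bar>p\<bar> * e * y + K" by (simp add: K_def algebra_simps)
    also have "\<dots> \<le> c * y + K" using pe y by (intro add_right_mono mult_right_mono) auto
    finally have "\<bar>p\<bar> * ln y \<le> K + y * c" by (simp add: mult.commute)
    moreover have "p * ln y \<le> \<bar>p\<bar> * ln y" using y by (intro mult_right_mono) auto
    ultimately have "exp (p * ln y) \<le> exp (K + y * c)" by simp
    thus "y powr p \<le> exp K * exp (y * c)" using y by (simp add: powr_def exp_add)
  qed
qed

text \<open>Applied with c = cos \<psi> for \<sigma> < 1/3, where every power of x, and hence the
  whole algebraic part, is below the exponential error term.\<close>

lemma powr_bigo_struve_exp:
  assumes \<sigma>: "0 < \<sigma>" "\<sigma> < 1" and c: "c > 0"
  shows "(\<lambda>x. x powr q) \<in> O[at_top](\<lambda>x. struve_X \<sigma> x powr r * exp (struve_X \<sigma> x * c))"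
proof -
  define b where "b = struve_kappa \<sigma> * q"
  define e where "e = exp (- q * struve_rate \<sigma>)"
  obtain K where K: "\<And>y. y \<ge> 1 \<Longrightarrow> y powr (b - r) \<le> K * exp (y * c)"
    using powr_le_exp_linear[OF c, of "b - r"] by blast
  have "(\<lambda>y::real. y powr b) \<in> O[at_top](\<lambda>y. y powr r * exp (y * c))"
  proof (rule bigoI[of _ K], rule eventually_mono[OF eventually_ge_at_top[of 1]])
    fix y :: real assume y: "y \<ge> 1"
    have "y powr b = y powr r * y powr (b - r)" by (simp flip: powr_add)
    also have "\<dots> \<le> y powr r * (K * exp (y * c))" by (intro mult_left_mono K y) auto
    finally show "norm (y powr b) \<le> K * norm (y powr r * exp (y * c))" by (simp add: mult_ac)
  qed
  hence "(\<lambda>y::real. e * y powr b) \<in> O[at_top](\<lambda>y. y powr r * exp (y * c))" by simp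
  from landau_o.big.compose[OF this filterlim_struve_X[OF \<sigma>]]
  have "(\<lambda>x. e * struve_X \<sigma> x powr b) \<in> O[at_top](\<lambda>x. struve_X \<sigma> x powr r * exp (struve_X \<sigma> x * c))" .
  moreover have "\<forall>\<^sub>F x in at_top. e * struve_X \<sigma> x powr b = x powr q"
    by (rule eventually_mono[OF eventually_gt_at_top[of 0]], unfold e_def b_def, rule powr_eq_struve_X_powr[OF \<sigma>, symmetric])
  ultimately show ?thesis by (rule bigo_eventually_eq) simp
qed

text \<open>The counterpart for 1/3 < \<sigma> < 1/2, where cos \<psi> is negative and the
  exponential part is below every power of x.\<close>

lemma struve_exp_bigo_powr:
  assumes \<sigma>: "0 < \<sigma>" "\<sigma> < 1" and c: "c < 0"
  shows "(\<lambda>x. struve_X \<sigma> x powr r * exp (struve_X \<sigma> x * c)) \<in> O[at_top](\<lambda>x. x powr q)"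
proof -
  define b where "b = struve_kappa \<sigma> * q"
  define e where "e = exp (- q * struve_rate \<sigma>)"
  have e: "e > 0" by (simp add: e_def)
  obtain K where K: "\<And>y. y \<ge> 1 \<Longrightarrow> y powr (r - b) \<le> K * exp (y * (- c))"
    using powr_le_exp_linear[of "- c" "r - b"] c by auto
  have "(\<lambda>y::real. y powr r * exp (y * c)) \<in> O[at_top](\<lambda>y. y powr b)"
  proof (rule bigoI[of _ K], rule eventually_mono[OF eventually_ge_at_top[of 1]])
    fix y :: real assume y: "y \<ge> 1"
    have "y powr r * exp (y * c) = y powr b * y powr (r - b) * exp (y * c)" by (simp flip: powr_add)
    also have "\<dots> \<le> y powr b * (K * exp (y * (- c))) * exp (y * c)" by (intro mult_left_mono mult_right_mono K y) auto
    also have "\<dots> = K * y powr b" by (simp add: exp_minus)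
    finally show "norm (y powr r * exp (y * c)) \<le> K * norm (y powr b)" by simp
  qed
  hence "(\<lambda>y::real. y powr r * exp (y * c)) \<in> O[at_top](\<lambda>y. e * y powr b)" using e by simp
  from landau_o.big.compose[OF this filterlim_struve_X[OF \<sigma>]]
  have A: "(\<lambda>x. struve_X \<sigma> x powr r * exp (struve_X \<sigma> x * c)) \<in> O[at_top](\<lambda>x. e * struve_X \<sigma> x powr b)" .
  have ev: "\<forall>\<^sub>F x in at_top. e * struve_X \<sigma> x powr b = x powr q"
    by (rule eventually_mono[OF eventually_gt_at_top[of 0]], unfold e_def b_def, rule powr_eq_struve_X_powr[OF \<sigma>, symmetric])
  show ?thesis by (rule bigo_eventually_eq[OF A _ ev]) simp
qed

text \<open>The oscillation is discarded, as sines are at most 1 in modulus, and for X \<ge> 1 each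
  term from index M on is at most a constant times X^(-M).\<close>

lemma struve_E_trunc_diff_bigo:
  assumes \<sigma>: "0 < \<sigma>" "\<sigma> < 1" and M: "M \<le> M'"
  shows "(\<lambda>x. struve_E_trunc \<sigma> \<nu> M' x - struve_E_trunc \<sigma> \<nu> M x) \<in> O[at_top](\<lambda>x. struve_X \<sigma> x powr (struve_theta \<nu> - real M)
     * exp (struve_X \<sigma> x * cos (pi * \<sigma> / struve_kappa \<sigma>)))"
proof -
  define t where "t = (\<lambda>x j. (- 1) powi (int j - 1) * struve_coeff \<sigma> \<nu> j * struve_X \<sigma> x powi (- int j) *
               sin (struve_X \<sigma> x * sin (pi * \<sigma> / struve_kappa \<sigma>) + pi / struve_kappa \<sigma> * (struve_theta \<nu> - real j)))"
  define w where "w = (\<lambda>x. struve_X \<sigma> x powr struve_theta \<nu> * exp (struve_X \<sigma> x * cos (pi * \<sigma> / struve_kappa \<sigma>)))"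
  define C where "C = struve_A0 \<sigma> \<nu> / pi"
  have E: "struve_E_trunc \<sigma> \<nu> M x = C * w x * (\<Sum>j<M. t x j)" for M x
    by (simp add: struve_E_trunc_def Let_def t_def w_def C_def)
  have "(\<Sum>j<M'. t x j) - (\<Sum>j<M. t x j) = (\<Sum>j=M..<M'. t x j)" for x
    using sum_diff_nat_ivl[of 0 M M' "t x"] M by (simp add: lessThan_atLeast0)
  hence diff: "struve_E_trunc \<sigma> \<nu> M' x - struve_E_trunc \<sigma> \<nu> M x = C * w x * (\<Sum>j=M..<M'. t x j)" for x
    unfolding E right_diff_distrib[symmetric] by simp
  have ev: "\<forall>\<^sub>F x in at_top. struve_X \<sigma> x \<ge> 1"
    using filterlim_struve_X[OF \<sigma>] by (simp add: filterlim_at_top)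
  show ?thesis
  proof (rule bigoI[of _ "\<bar>C\<bar> * (\<Sum>j=M..<M'. \<bar>struve_coeff \<sigma> \<nu> j\<bar>)"], use ev in eventually_elim)
    fix x assume X: "struve_X \<sigma> x \<ge> 1"
    have tj: "\<bar>t x j\<bar> \<le> \<bar>struve_coeff \<sigma> \<nu> j\<bar> * struve_X \<sigma> x powr (- real M)" if "j \<ge> M" for j
    proof -
      have "struve_X \<sigma> x powi (- int j) \<le> struve_X \<sigma> x powi (- int M)"
        using X that by (intro power_int_increasing) auto
      also have "\<dots> = struve_X \<sigma> x powr (- real M)" using X by (simp add: powr_real_of_int'[symmetric])
      finally have le: "struve_X \<sigma> x powi (- int j) \<le> struve_X \<sigma> x powr (- real M)" .
      have "\<bar>t x j\<bar> = \<bar>struve_coeff \<sigma> \<nu> j\<bar> * struve_X \<sigma> x powi (- int j) *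
               \<bar>sin (struve_X \<sigma> x * sin (pi * \<sigma> / struve_kappa \<sigma>) + pi / struve_kappa \<sigma> * (struve_theta \<nu> - real j))\<bar>"
        using X by (simp add: t_def abs_mult power_int_abs[symmetric])
      also have "\<dots> \<le> \<bar>struve_coeff \<sigma> \<nu> j\<bar> * struve_X \<sigma> x powr (- real M) * 1"
        using X by (intro mult_mono mult_left_mono le) (auto simp: zero_le_power_int)
      finally show ?thesis by simp
    qed
    have "\<bar>\<Sum>j=M..<M'. t x j\<bar> \<le> (\<Sum>j=M..<M'. \<bar>struve_coeff \<sigma> \<nu> j\<bar> * struve_X \<sigma> x powr (- real M))"
      by (intro order.trans[OF sum_abs] sum_mono tj) auto
    also have "\<dots> = (\<Sum>j=M..<M'. \<bar>struve_coeff \<sigma> \<nu> j\<bar>) * struve_X \<sigma> x powr (- real M)" by (simp add: sum_distrib_right)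
    finally have le: "\<bar>\<Sum>j=M..<M'. t x j\<bar> \<le> (\<Sum>j=M..<M'. \<bar>struve_coeff \<sigma> \<nu> j\<bar>) * struve_X \<sigma> x powr (- real M)" .
    have "norm (struve_E_trunc \<sigma> \<nu> M' x - struve_E_trunc \<sigma> \<nu> M x) = \<bar>C\<bar> * w x * \<bar>\<Sum>j=M..<M'. t x j\<bar>"
      unfolding diff by (simp add: abs_mult w_def)
    also have "\<dots> \<le> \<bar>C\<bar> * w x * ((\<Sum>j=M..<M'. \<bar>struve_coeff \<sigma> \<nu> j\<bar>) * struve_X \<sigma> x powr (- real M))"
      using le by (intro mult_left_mono) (auto simp: w_def)
    also have "\<dots> = \<bar>C\<bar> * (\<Sum>j=M..<M'. \<bar>struve_coeff \<sigma> \<nu> j\<bar>) * (w x * struve_X \<sigma> x powr (- real M))" by (simp only: mult_ac)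
    also have "w x * struve_X \<sigma> x powr (- real M) = norm (struve_X \<sigma> x powr (struve_theta \<nu> - real M) * exp (struve_X \<sigma> x * cos (pi * \<sigma> / struve_kappa \<sigma>)))"
      by (simp add: w_def powr_diff powr_minus divide_inverse)
    finally show "norm (struve_E_trunc \<sigma> \<nu> M' x - struve_E_trunc \<sigma> \<nu> M x) \<le> \<bar>C\<bar> * (\<Sum>j=M..<M'. \<bar>struve_coeff \<sigma> \<nu> j\<bar>) *
       norm (struve_X \<sigma> x powr (struve_theta \<nu> - real M) * exp (struve_X \<sigma> x * cos (pi * \<sigma> / struve_kappa \<sigma>)))" .
  qed
qed

lemma struve_H_term_bigo:
  "(\<lambda>x. (- x) powi (- int k - 1) * c1 * c2) \<in> O[at_top](\<lambda>x::real. x powi (- int k - 1))"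
  by (rule bigoI[of _ "\<bar>c1 * c2\<bar>"], rule eventually_mono[OF eventually_gt_at_top[of 0]])
     (simp add: abs_mult power_int_abs)

lemma powi_bigo_mono: "i \<le> j \<Longrightarrow> (\<lambda>x::real. x powi i) \<in> O[at_top](\<lambda>x. x powi j)"
  by (rule bigoI[of _ 1], rule eventually_mono[OF eventually_ge_at_top[of 1]])
     (auto simp: zero_le_power_int intro!: power_int_increasing)

lemma powr_bigo_mono: "p \<le> q \<Longrightarrow> (\<lambda>x::real. x powr p) \<in> O[at_top](\<lambda>x. x powr q)"
  by (rule bigoI[of _ 1], rule eventually_mono[OF eventually_ge_at_top[of 1]])
     (auto intro!: powr_mono)

text \<open>Allows an estimate to be proved for truncations longer than requested, as the surplus
  terms are of the size of the claimed error.\<close>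

lemma struve_H_trunc_diff_bigo:
  assumes \<sigma>: "0 < \<sigma>" and K: "K \<le> K0" "K' \<le> P"
  shows "(\<lambda>x. struve_H_trunc \<sigma> \<nu> K0 P x - struve_H_trunc \<sigma> \<nu> K K' x) \<in> O[at_top](\<lambda>x. x powi (- int K - 1) + x powr (- (real K' - \<nu> - 1 / 2) / \<sigma>))"
    (is "_ \<in> O[at_top](\<lambda>x. ?A x + ?B x)")
proof -
  define f where "f = (\<lambda>k x. (- x) powi (- int k - 1) * Gamma (real k + 1 / 2) * rGamma (\<nu> + 3 / 2 + \<sigma> * (real k + 1)))"
  define g where "g = (\<lambda>k x. x powr (- struve_k \<sigma> \<nu> k) / fact k * rGamma (3 / 2 - struve_k \<sigma> \<nu> k))"
  have s: "(\<Sum>j<M'. t j) - (\<Sum>j<M. t j) = (\<Sum>j=M..<M'. t j)" if "M \<le> M'" for t :: "nat \<Rightarrow> real" and M M'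
    using sum_diff_nat_ivl[of 0 M M' t] that by (simp add: lessThan_atLeast0)
  have diff: "struve_H_trunc \<sigma> \<nu> K0 P x - struve_H_trunc \<sigma> \<nu> K K' x = 1 / pi * (\<Sum>k=K..<K0. f k x) + 1 / \<sigma> * (\<Sum>k=K'..<P. g k x)" for x
    unfolding s[OF K(1), symmetric] s[OF K(2), symmetric] struve_H_trunc_def f_def g_def by (simp add: right_diff_distrib)
  have AB: "\<forall>\<^sub>F x in at_top. \<bar>?A x\<bar> \<le> ?A x + ?B x" "\<forall>\<^sub>F x in at_top. \<bar>?B x\<bar> \<le> ?A x + ?B x"
    using eventually_gt_at_top[of 0] by (eventually_elim, simp add: zero_le_power_int)+
  have "f k \<in> O[at_top](\<lambda>x. ?A x + ?B x)" if "k \<in> {K..<K0}" for k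
  proof -
    have "f k \<in> O[at_top](\<lambda>x. x powi (- int k - 1))" unfolding f_def by (rule struve_H_term_bigo)
    also have "(\<lambda>x. x powi (- int k - 1)) \<in> O[at_top](?A)" using that by (intro powi_bigo_mono) auto
    finally show ?thesis by (rule bigo_nonneg_mono[OF _ AB(1)])
  qed
  hence 1: "(\<lambda>x. 1 / pi * (\<Sum>k=K..<K0. f k x)) \<in> O[at_top](\<lambda>x. ?A x + ?B x)"
    by (intro bigo_cmult big_sum_in_bigo) auto
  have "g k \<in> O[at_top](\<lambda>x. ?A x + ?B x)" if "k \<in> {K'..<P}" for k
  proof -
    have "g k = (\<lambda>x. (1 / fact k * rGamma (3 / 2 - struve_k \<sigma> \<nu> k)) * x powr (- struve_k \<sigma> \<nu> k))" by (simp add: g_def mult.commute)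
    also have "\<dots> \<in> O[at_top](\<lambda>x. x powr (- struve_k \<sigma> \<nu> k))" by simp
    also have "(\<lambda>x. x powr (- struve_k \<sigma> \<nu> k)) \<in> O[at_top](?B)"
    proof (rule powr_bigo_mono)
      have "struve_k \<sigma> \<nu> K' \<le> struve_k \<sigma> \<nu> k"
        unfolding struve_k_def using that \<sigma> by (intro divide_right_mono) auto
      moreover have "- (real K' - \<nu> - 1 / 2) / \<sigma> = - struve_k \<sigma> \<nu> K'"
        unfolding struve_k_def by (rule minus_divide_left[symmetric])
      ultimately show "- struve_k \<sigma> \<nu> k \<le> - (real K' - \<nu> - 1 / 2) / \<sigma>" by linarith
    qed
    finally show ?thesis by (rule bigo_nonneg_mono[OF _ AB(2)])
  qed
  hence 2: "(\<lambda>x. 1 / \<sigma> * (\<Sum>k=K'..<P. g k x)) \<in> O[at_top](\<lambda>x. ?A x + ?B x)"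
    using \<sigma> by (intro bigo_cmult big_sum_in_bigo) auto
  show ?thesis unfolding diff by (rule sum_in_bigo(1)[OF 1 2])
qed

section \<open>The compound error bound in the variable x\<close>

lemma exp_ln_bigo_powi:
  assumes "a \<le> - real K - 1"
  shows "(\<lambda>x. exp (ln x * a)) \<in> O[at_top](\<lambda>x. x powi (- int K - 1))"
proof -
  have "(\<lambda>x. x powr a) \<in> O[at_top](\<lambda>x. x powr (- real K - 1))" using assms by (intro powr_bigo_mono) simp
  moreover have "\<forall>\<^sub>F x::real in at_top. x powr a = exp (ln x * a)" "\<forall>\<^sub>F x::real in at_top. x powr (- real K - 1) = x powi (- int K - 1)"
    using eventually_gt_at_top[of 0] by (eventually_elim, simp add: powr_def mult.commute powr_real_of_int'[symmetric])+
  ultimately show ?thesis by (rule bigo_eventually_eq)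
qed

text \<open>The line a = m - 1/2 is put so far left that x^a is below x^(-K - 1) and that at least K
  terms of the first and K' terms of the second algebraic series are collected; the surplus terms
  are then dropped.\<close>

lemma struve_series_asymp_above_third:
  assumes \<sigma>: "1 / 3 < \<sigma>" "\<sigma> < 1"
  shows "(\<lambda>x. struve_series \<sigma> \<nu> x - struve_H_trunc \<sigma> \<nu> K K' x) \<in> O[at_top](\<lambda>x. x powi (- int K - 1) + x powr (- (real K' - \<nu> - 1 / 2) / \<sigma>))"
    (is "_ \<in> O[at_top](\<lambda>x. ?A x + ?B x)")
proof -
  have \<sigma>0: "\<sigma> > 0" using \<sigma> by linarith
  obtain m :: int and P :: nat where m: "m \<le> 0" "real_of_int m - 1 / 2 \<le> min (- real K - 1) (- struve_k \<sigma> \<nu> K')"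
    and P: "\<And>k. k < P \<Longrightarrow> - struve_k \<sigma> \<nu> k > real_of_int m - 1 / 2" "\<And>k. k \<ge> P \<Longrightarrow> - struve_k \<sigma> \<nu> k < real_of_int m - 1 / 2"
    using struve_half_integer_between_poles[OF \<sigma>0 \<sigma>(2)] by blast
  have K: "K \<le> nat (- m)" "K' \<le> P" using m P(2)[of K'] by (force, linarith)
  have "\<exists>C. \<forall>x>0. \<bar>struve_series \<sigma> \<nu> x - struve_H_trunc \<sigma> \<nu> (nat (- m)) P x\<bar> \<le> C * exp (ln x * (real_of_int m - 1 / 2))"
    by (rule struve_series_above_third[OF \<sigma> m(1)]) (erule P)+
  then obtain C where C: "\<forall>x>0. \<bar>struve_series \<sigma> \<nu> x - struve_H_trunc \<sigma> \<nu> (nat (- m)) P x\<bar> \<le> C * exp (ln x * (real_of_int m - 1 / 2))"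
    by (elim exE) (rule that)
  have A: "\<forall>\<^sub>F x in at_top. \<bar>?A x\<bar> \<le> ?A x + ?B x"
    using eventually_gt_at_top[of 0] by (eventually_elim, simp add: zero_le_power_int)
  have "(\<lambda>x. struve_series \<sigma> \<nu> x - struve_H_trunc \<sigma> \<nu> (nat (- m)) P x) \<in> O[at_top](\<lambda>x. exp (ln x * (real_of_int m - 1 / 2)))"
    by (rule bigoI[of _ C], rule eventually_mono[OF eventually_gt_at_top[of 0]]) (use C in auto)
  also have "(\<lambda>x. exp (ln x * (real_of_int m - 1 / 2))) \<in> O[at_top](?A)" using m by (intro exp_ln_bigo_powi) auto
  finally have "(\<lambda>x. struve_series \<sigma> \<nu> x - struve_H_trunc \<sigma> \<nu> (nat (- m)) P x) \<in> O[at_top](\<lambda>x. ?A x + ?B x)"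
    by (rule bigo_nonneg_mono[OF _ A])
  from sum_in_bigo(1)[OF this struve_H_trunc_diff_bigo[OF \<sigma>0 K, of \<nu>]] show ?thesis by simp
qed

text \<open>For \<sigma> < 1/3 the exponential error term absorbs everything algebraic. At \<sigma>
  = 1/3 the cosine vanishes, so that term is only a power of X and both parts have to be kept. For
  \<sigma> > 1/3 the exponential expansion is inserted as a negligible quantity.\<close>

lemma struve_series_asymp_below_half:
  assumes \<sigma>: "0 < \<sigma>" "\<sigma> < 1 / 2"
  defines "c \<equiv> cos (pi * \<sigma> / struve_kappa \<sigma>)"
  shows "(\<lambda>x. struve_series \<sigma> \<nu> x - (struve_E_trunc \<sigma> \<nu> M x + struve_H_trunc \<sigma> \<nu> K K' x)) \<in>
     O[at_top](\<lambda>x. struve_X \<sigma> x powr (struve_theta \<nu> - real M) * exp (struve_X \<sigma> x * c) + x powi (- int K - 1) + x powr (- (real K' - \<nu> - 1 / 2) / \<sigma>))"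
    (is "_ \<in> O[at_top](\<lambda>x. ?W x + ?A x + ?B x)")
proof -
  have \<sigma>1: "\<sigma> < 1" using \<sigma> by simp
  have k: "struve_kappa \<sigma> > 0" "struve_kappa \<sigma> \<le> 1" using \<sigma> by (auto simp: struve_kappa_def)
  have mono: "\<forall>\<^sub>F x in at_top. \<bar>?A x\<bar> \<le> ?W x + ?A x + ?B x" "\<forall>\<^sub>F x in at_top. \<bar>?W x\<bar> \<le> ?W x + ?A x + ?B x"
    "\<forall>\<^sub>F x in at_top. \<bar>?A x + ?B x\<bar> \<le> ?W x + ?A x + ?B x"
    using eventually_gt_at_top[of 0] by (eventually_elim, simp add: zero_le_power_int)+
  consider "\<sigma> < 1 / 3" | "\<sigma> = 1 / 3" | "\<sigma> > 1 / 3" by linarith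
  thus ?thesis
  proof cases
    case 1
    have c: "c > 0"
    proof -
      have "pi * \<sigma> < pi / 2 * struve_kappa \<sigma>" using 1 mult_strict_left_mono[of \<sigma> "struve_kappa \<sigma> / 2" pi] by (simp add: struve_kappa_def)
      hence "pi * \<sigma> / struve_kappa \<sigma> < pi / 2" using k by (simp add: pos_divide_less_eq)
      moreover have "pi * \<sigma> / struve_kappa \<sigma> > 0" using k \<sigma> by simp
      ultimately show ?thesis unfolding c_def by (intro cos_gt_zero_pi) auto
    qed
    note pw = powr_bigo_struve_exp[OF \<sigma>(1) \<sigma>1 c]
    have pi: "(\<lambda>x. x powi n) \<in> O[at_top](?W)" for n
    proof -
      have "\<forall>\<^sub>F x::real in at_top. x powr (of_int n) = x powi n"
        using eventually_gt_at_top[of 0] by eventually_elim (simp add: powr_real_of_int')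
      from bigo_eventually_eq[OF pw[of "of_int n" "struve_theta \<nu> - real M"] this] show ?thesis by simp
    qed
    from struve_series_below_third[OF \<sigma>(1) 1, of \<nu> M, folded c_def]
    obtain m :: nat and C x0 where C: "\<forall>x\<ge>x0. \<bar>struve_series \<sigma> \<nu> x - struve_E_trunc \<sigma> \<nu> (M + 2) x - (\<Sum>n<m. struve_real_term \<sigma> \<nu> x (int n))\<bar>
    \<le> C * (exp (ln x * (real m - 1 / 2)) + ?W x)"
      by (elim exE) (rule that)
    have "(\<lambda>x. struve_series \<sigma> \<nu> x - struve_E_trunc \<sigma> \<nu> (M + 2) x - (\<Sum>n<m. struve_real_term \<sigma> \<nu> x (int n))) \<in> O[at_top](\<lambda>x. exp (ln x * (real m - 1 / 2)) + ?W x)"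
      by (rule bigoI[of _ C], rule eventually_mono[OF eventually_ge_at_top[of x0]]) (use C in auto)
    also have "(\<lambda>x. exp (ln x * (real m - 1 / 2)) + ?W x) \<in> O[at_top](?W)"
    proof (rule sum_in_bigo(1))
      have "\<forall>\<^sub>F x::real in at_top. x powr (real m - 1 / 2) = exp (ln x * (real m - 1 / 2))"
        using eventually_gt_at_top[of 0] by eventually_elim (simp add: powr_def mult.commute)
      from bigo_eventually_eq[OF pw[of "real m - 1 / 2" "struve_theta \<nu> - real M"] this]
      show "(\<lambda>x. exp (ln x * (real m - 1 / 2))) \<in> O[at_top](?W)" by simp
    qed simp
    finally have 1: "(\<lambda>x. struve_series \<sigma> \<nu> x - struve_E_trunc \<sigma> \<nu> (M + 2) x - (\<Sum>n<m. struve_real_term \<sigma> \<nu> x (int n))) \<in> O[at_top](?W)" .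
    have 2: "(\<lambda>x. \<Sum>n<m. struve_real_term \<sigma> \<nu> x (int n)) \<in> O[at_top](?W)"
    proof (rule big_sum_in_bigo)
      fix n
      have "(\<lambda>x. struve_real_term \<sigma> \<nu> x (int n)) = (\<lambda>x. (rGamma (of_int (int n) + 3 / 2) * rGamma (\<nu> + 3 / 2 - \<sigma> * of_int (int n))) * x powi int n)"
        by (simp add: struve_real_term_def mult_ac)
      also have "\<dots> \<in> O[at_top](?W)" by (intro bigo_cmult pi)
      finally show "(\<lambda>x. struve_real_term \<sigma> \<nu> x (int n)) \<in> O[at_top](?W)" .
    qed
    have 3: "(\<lambda>x. struve_E_trunc \<sigma> \<nu> (M + 2) x - struve_E_trunc \<sigma> \<nu> M x) \<in> O[at_top](?W)"
      unfolding c_def by (rule struve_E_trunc_diff_bigo[OF \<sigma>(1) \<sigma>1]) simp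
    have 4: "(\<lambda>x. struve_H_trunc \<sigma> \<nu> K K' x) \<in> O[at_top](?W)"
    proof -
      have "(\<lambda>x. struve_H_trunc \<sigma> \<nu> K K' x - struve_H_trunc \<sigma> \<nu> 0 0 x) \<in> O[at_top](\<lambda>x. x powi (- int 0 - 1) + x powr (- (real 0 - \<nu> - 1 / 2) / \<sigma>))"
        by (rule struve_H_trunc_diff_bigo[OF \<sigma>(1)]) auto
      also have "(\<lambda>x. x powi (- int 0 - 1) + x powr (- (real 0 - \<nu> - 1 / 2) / \<sigma>)) \<in> O[at_top](?W)"
        by (intro sum_in_bigo pi pw)
      finally show ?thesis by (simp add: struve_H_trunc_def)
    qed
    from sum_in_bigo(2)[OF sum_in_bigo(1)[OF sum_in_bigo(1)[OF 1 2] 3] 4]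
    have "(\<lambda>x. struve_series \<sigma> \<nu> x - (struve_E_trunc \<sigma> \<nu> M x + struve_H_trunc \<sigma> \<nu> K K' x)) \<in> O[at_top](?W)"
      by (simp add: algebra_simps)
    thus ?thesis by (rule bigo_nonneg_mono[OF _ mono(2)])
  next
    case 2
    obtain m :: int and P :: nat where m: "m \<le> 0" "real_of_int m - 1 / 2 \<le> min (- real K - 1) (- struve_k \<sigma> \<nu> K')"
      and P: "\<And>k. k < P \<Longrightarrow> - struve_k \<sigma> \<nu> k > real_of_int m - 1 / 2" "\<And>k. k \<ge> P \<Longrightarrow> - struve_k \<sigma> \<nu> k < real_of_int m - 1 / 2"
      using struve_half_integer_between_poles[OF \<sigma>(1) \<sigma>1] by blast
    have K: "K \<le> nat (- m)" "K' \<le> P" using m P(2)[of K'] by (force, linarith)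
    \<comment> \<open>The additional terms secure the condition \<kappa>a + 1 - \<vartheta> + M'
      \<ge> 5/2 with a = m - 1/2; \<open>struve_E_trunc_diff_bigo\<close> drops them again.\<close>
    define M' where "M' = M + nat \<lceil>5 / 2 - struve_kappa \<sigma> * (real_of_int m - 1 / 2) - (1 - struve_theta \<nu>)\<rceil>"
    have M': "M \<le> M'" "struve_kappa \<sigma> * (real_of_int m - 1 / 2) + (1 - struve_theta \<nu> + real M') \<ge> 5 / 2"
      unfolding M'_def by (simp, linarith)
    have "\<exists>C. \<forall>x>0. struve_X \<sigma> x \<ge> 1 \<longrightarrow>
       \<bar>struve_series \<sigma> \<nu> x - (struve_E_trunc \<sigma> \<nu> M' x + struve_H_trunc \<sigma> \<nu> (nat (- m)) P x)\<bar> \<le> C * exp (ln x * (real_of_int m - 1 / 2))"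
      by (rule struve_series_third[OF 2 m(1) M'(2)]) (erule P)+
    then obtain C where C: "\<forall>x>0. struve_X \<sigma> x \<ge> 1 \<longrightarrow>
       \<bar>struve_series \<sigma> \<nu> x - (struve_E_trunc \<sigma> \<nu> M' x + struve_H_trunc \<sigma> \<nu> (nat (- m)) P x)\<bar> \<le> C * exp (ln x * (real_of_int m - 1 / 2))"
      by (elim exE) (rule that)
    have evX: "\<forall>\<^sub>F x in at_top. struve_X \<sigma> x \<ge> 1"
      using filterlim_struve_X[OF \<sigma>(1) \<sigma>1] by (simp add: filterlim_at_top)
    have "(\<lambda>x. struve_series \<sigma> \<nu> x - (struve_E_trunc \<sigma> \<nu> M' x + struve_H_trunc \<sigma> \<nu> (nat (- m)) P x)) \<in> O[at_top](\<lambda>x. exp (ln x * (real_of_int m - 1 / 2)))"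
      by (rule bigoI[of _ C], rule eventually_mono[OF eventually_conj[OF eventually_gt_at_top[of 0] evX]]) (use C in auto)
    also have "(\<lambda>x. exp (ln x * (real_of_int m - 1 / 2))) \<in> O[at_top](?A)" using m by (intro exp_ln_bigo_powi) auto
    finally have 1: "(\<lambda>x. struve_series \<sigma> \<nu> x - (struve_E_trunc \<sigma> \<nu> M' x + struve_H_trunc \<sigma> \<nu> (nat (- m)) P x)) \<in> O[at_top](\<lambda>x. ?W x + ?A x + ?B x)"
      by (rule bigo_nonneg_mono[OF _ mono(1)])
    have 2: "(\<lambda>x. struve_E_trunc \<sigma> \<nu> M' x - struve_E_trunc \<sigma> \<nu> M x) \<in> O[at_top](\<lambda>x. ?W x + ?A x + ?B x)"
      by (rule bigo_nonneg_mono[OF struve_E_trunc_diff_bigo[OF \<sigma>(1) \<sigma>1 M'(1)] mono(2)[unfolded c_def], folded c_def])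
    have 3: "(\<lambda>x. struve_H_trunc \<sigma> \<nu> (nat (- m)) P x - struve_H_trunc \<sigma> \<nu> K K' x) \<in> O[at_top](\<lambda>x. ?W x + ?A x + ?B x)"
      by (rule bigo_nonneg_mono[OF struve_H_trunc_diff_bigo[OF \<sigma>(1) K] mono(3)])
    from sum_in_bigo(1)[OF sum_in_bigo(1)[OF 1 2] 3] show ?thesis by (simp add: algebra_simps)
  next
    case 3
    have c: "c < 0"
    proof -
      have "pi * \<sigma> > pi / 2 * struve_kappa \<sigma>" using 3 mult_strict_left_mono[of "struve_kappa \<sigma> / 2" \<sigma> pi] by (simp add: struve_kappa_def)
      hence "pi * \<sigma> / struve_kappa \<sigma> > pi / 2" using k by (simp add: pos_less_divide_eq)
      moreover have "pi * \<sigma> / struve_kappa \<sigma> < pi" using k \<sigma> by (simp add: pos_divide_less_eq struve_kappa_def)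
      ultimately show ?thesis unfolding c_def using cos_monotone_0_pi[of "pi / 2" "pi * \<sigma> / struve_kappa \<sigma>"] by simp
    qed
    have 1: "(\<lambda>x. struve_series \<sigma> \<nu> x - struve_H_trunc \<sigma> \<nu> K K' x) \<in> O[at_top](\<lambda>x. ?W x + ?A x + ?B x)"
      by (rule bigo_nonneg_mono[OF struve_series_asymp_above_third[OF 3 \<sigma>1] mono(3)])
    have "(\<lambda>x. struve_E_trunc \<sigma> \<nu> M x - struve_E_trunc \<sigma> \<nu> 0 x) \<in> O[at_top](\<lambda>x. struve_X \<sigma> x powr (struve_theta \<nu> - real 0) * exp (struve_X \<sigma> x * c))"
      unfolding c_def by (rule struve_E_trunc_diff_bigo[OF \<sigma>(1) \<sigma>1]) simp
    also have "(\<lambda>x. struve_X \<sigma> x powr (struve_theta \<nu> - real 0) * exp (struve_X \<sigma> x * c)) \<in> O[at_top](\<lambda>x. x powr (of_int (- int K - 1)))"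
      by (rule struve_exp_bigo_powr[OF \<sigma>(1) \<sigma>1 c])
    finally have "(\<lambda>x. struve_E_trunc \<sigma> \<nu> M x) \<in> O[at_top](\<lambda>x. x powr (of_int (- int K - 1)))"
      by (simp add: struve_E_trunc_def Let_def)
    moreover have "\<forall>\<^sub>F x::real in at_top. \<bar>x powr (of_int (- int K - 1))\<bar> \<le> ?W x + ?A x + ?B x"
      using mono(1) eventually_gt_at_top[of 0]
    proof eventually_elim
      case (elim x)
      have "x powr (of_int (- int K - 1)) = x powi (- int K - 1)" using elim(2) by (intro powr_real_of_int') auto
      thus ?case using elim(1) by simp
    qed
    ultimately have 2: "(\<lambda>x. struve_E_trunc \<sigma> \<nu> M x) \<in> O[at_top](\<lambda>x. ?W x + ?A x + ?B x)" by (rule bigo_nonneg_mono)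
    from sum_in_bigo(2)[OF 1 2] show ?thesis by (simp add: algebra_simps)
  qed
qed

lemma gen_struve_eq_struve_series:
  assumes "z > 0"
  shows "(z / 2) powr (- \<nu> - 1) * gen_struve \<nu> (- \<sigma>) z = struve_series \<sigma> \<nu> (z\<^sup>2 / 4)"
proof -
  have p: "(z / 2) powr (- \<nu> - 1) * (z / 2) powr (\<nu> + 1) = 1" using assms by (simp flip: powr_add)
  have q: "(z / 2) ^ (2 * n) = (z\<^sup>2 / 4) ^ n" for n by (simp add: power_mult power_divide)
  have r: "- \<sigma> * real n + \<nu> + 3 / 2 = \<nu> + 3 / 2 - \<sigma> * real n" for n by simp
  show ?thesis
    unfolding gen_struve_def struve_series_def q r mult.assoc[symmetric] p by simp
qed

lemma struve_bigo_transfer: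
  assumes "(\<lambda>x. struve_series \<sigma> \<nu> x - f x) \<in> O[at_top](g)"
  shows "(\<lambda>z. (z / 2) powr (- \<nu> - 1) * gen_struve \<nu> (- \<sigma>) z - f (z\<^sup>2 / 4)) \<in> O[at_top](\<lambda>z. g (z\<^sup>2 / 4))"
proof -
  have "filterlim (\<lambda>z::real. z\<^sup>2 / 4) at_top at_top" by real_asymp
  from landau_o.big.compose[OF assms this]
  have "(\<lambda>z. struve_series \<sigma> \<nu> (z\<^sup>2 / 4) - f (z\<^sup>2 / 4)) \<in> O[at_top](\<lambda>z. g (z\<^sup>2 / 4))" .
  moreover have "\<forall>\<^sub>F z in at_top. struve_series \<sigma> \<nu> (z\<^sup>2 / 4) - f (z\<^sup>2 / 4) = (z / 2) powr (- \<nu> - 1) * gen_struve \<nu> (- \<sigma>) z - f (z\<^sup>2 / 4)"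
    using eventually_gt_at_top[of 0] by eventually_elim (simp add: gen_struve_eq_struve_series)
  ultimately show ?thesis by (rule bigo_eventually_eq) simp
qed

theorem theorem4:
  fixes \<nu> \<sigma> :: real
  assumes "0 < \<sigma>" and "\<sigma> < 1"
  shows "(\<sigma> < 1 / 2 \<longrightarrow>
            (\<forall>M\<ge>1. \<forall>K\<ge>1. \<forall>K'\<ge>1.
               (\<lambda>z. (z / 2) powr (- \<nu> - 1) * gen_struve \<nu> (- \<sigma>) z
                    - (struve_E_trunc \<sigma> \<nu> M (z^2 / 4) + struve_H_trunc \<sigma> \<nu> K K' (z^2 / 4)))
               \<in> O[at_top](\<lambda>z. struve_X \<sigma> (z^2 / 4) powr (struve_theta \<nu> - real M)
                                * exp (struve_X \<sigma> (z^2 / 4) * cos (pi * \<sigma> / struve_kappa \<sigma>))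
                              + (z^2 / 4) powi (- int K - 1)
                              + (z^2 / 4) powr (- (real K' - \<nu> - 1 / 2) / \<sigma>))))
       \<and> (1 / 2 < \<sigma> \<longrightarrow>
            (\<forall>K\<ge>1. \<forall>K'\<ge>1.
               (\<lambda>z. (z / 2) powr (- \<nu> - 1) * gen_struve \<nu> (- \<sigma>) z
                    - struve_H_trunc \<sigma> \<nu> K K' (z^2 / 4))
               \<in> O[at_top](\<lambda>z. (z^2 / 4) powi (- int K - 1)
                              + (z^2 / 4) powr (- (real K' - \<nu> - 1 / 2) / \<sigma>))))
       \<and> struve_coeff \<sigma> \<nu> 0 = 1
       \<and> struve_coeff \<sigma> \<nu> 1 = struve_c1 (- \<sigma>) \<nu>
       \<and> struve_coeff \<sigma> \<nu> 2 = struve_c2 (- \<sigma>) \<nu>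
       \<and> struve_coeff \<sigma> \<nu> 3 = struve_c3 (- \<sigma>) \<nu>"
proof (intro conjI impI allI)
  fix M K K' :: nat
  assume half: "\<sigma> < 1 / 2"
  show "(\<lambda>z. (z / 2) powr (- \<nu> - 1) * gen_struve \<nu> (- \<sigma>) z
                    - (struve_E_trunc \<sigma> \<nu> M (z^2 / 4) + struve_H_trunc \<sigma> \<nu> K K' (z^2 / 4)))
               \<in> O[at_top](\<lambda>z. struve_X \<sigma> (z^2 / 4) powr (struve_theta \<nu> - real M)
                                * exp (struve_X \<sigma> (z^2 / 4) * cos (pi * \<sigma> / struve_kappa \<sigma>))
                              + (z^2 / 4) powi (- int K - 1)
                              + (z^2 / 4) powr (- (real K' - \<nu> - 1 / 2) / \<sigma>))"
    by (rule struve_bigo_transfer[OF struve_series_asymp_below_half[OF assms(1) half]])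
next
  fix K K' :: nat
  assume "1 / 2 < \<sigma>"
  hence "1 / 3 < \<sigma>" by simp
  thus "(\<lambda>z. (z / 2) powr (- \<nu> - 1) * gen_struve \<nu> (- \<sigma>) z
                    - struve_H_trunc \<sigma> \<nu> K K' (z^2 / 4))
               \<in> O[at_top](\<lambda>z. (z^2 / 4) powi (- int K - 1)
                              + (z^2 / 4) powr (- (real K' - \<nu> - 1 / 2) / \<sigma>))"
    using assms(2) by (intro struve_bigo_transfer struve_series_asymp_above_third)
qed (use struve_coeff_spec[OF assms, of \<nu>] in simp_all)

end
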